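(* Let $s\ge 3$ and $u_0\in H^s$. For $B,b>0$ let $T_{max}^{B,b}$ be the maximal existence time of the solution $u^{B,b}$ of $$\partial_t u+u\,\partial_x u+\int_{\mathbf R}B e^{-b|x-\xi|}u_\xi(t,\xi)\,d\xi=0,\qquad u(0,x)=u_0(x).$$ Then $$\lim_{B\to 0\ \mathrm{or}\ b\to 0}T_{max}^{B,b}=-\frac{1}{\inf_{x\in\mathbf R}u_0'(x)},$$ i.e. the limit holds as $B\to0^+$ with $b>0$ fixed, and also as $b\to 0^+$ with $B>0$ fixed. (For $u_0\equiv 0$ the right-hand side is read as $+\infty$.)
   Context: The equation is posed for real-valued $u(t,x)$, $t>0$, $x\in\mathbf R$. $H^s=H^s(\mathbf R)$ is the Sobolev space with norm $\|f\|_{H^s}=\|(1+|\xi|^2)^{s/2}\widehat f\,\|_{L^2}$. For $u_0\in H^s$, $s>3/2$, the solution is the unique $u\in C([0,T_{max});H^s)\cap C^1([0,T_{max});H^{s-1})$ defined up to its maximal existence time $T_{max}\in(0,\infty]$. *)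

theory Defs
  imports "HOL-Analysis.Analysis"
begin

definition L2 :: "(real \<Rightarrow> 'a::real_normed_vector) \<Rightarrow> bool" where
  "L2 f \<longleftrightarrow> f \<in> borel_measurable lborel \<and> integrable lborel (\<lambda>x. (norm (f x))\<^sup>2)"

definition L2_norm :: "(real \<Rightarrow> 'a::real_normed_vector) \<Rightarrow> real" where
  "L2_norm f = sqrt (LINT x|lborel. (norm (f x))\<^sup>2)"

definition truncated_fourier :: "(real \<Rightarrow> real) \<Rightarrow> real \<Rightarrow> real \<Rightarrow> complex" where
  "truncated_fourier f R \<xi> =
     complex_of_real (1 / sqrt (2 * pi)) *
     (LINT x:{-R..R}|lborel. complex_of_real (f x) * cis (- (x * \<xi>)))"

(* The Plancherel transform of f in L^2 is the limit in L^2, as R tends to infinity, of the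
   truncated Fourier integrals. The nonnegative integral is used because the Bochner integral
   would silently be 0 for a non-integrable difference. *)
definition is_fourier_transform :: "(real \<Rightarrow> real) \<Rightarrow> (real \<Rightarrow> complex) \<Rightarrow> bool" where
  "is_fourier_transform f g \<longleftrightarrow> L2 g \<and>
     ((\<lambda>R. \<integral>\<^sup>+\<xi>. ennreal ((cmod (truncated_fourier f R \<xi> - g \<xi>))\<^sup>2) \<partial>lborel) \<longlongrightarrow> 0) at_top"

(* The transform is determined only up to null sets; every use below is insensitive to them. *)
definition fourier :: "(real \<Rightarrow> real) \<Rightarrow> real \<Rightarrow> complex" where
  "fourier f = (SOME g. is_fourier_transform f g)"

definition bessel_weighted :: "real \<Rightarrow> (real \<Rightarrow> real) \<Rightarrow> real \<Rightarrow> complex" where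
  "bessel_weighted s f \<xi> = complex_of_real ((1 + \<xi>\<^sup>2) powr (s / 2)) * fourier f \<xi>"

(* The real-valued elements of H^s(R), for s > 1/2 only: by the Sobolev embedding each
   almost-everywhere class then contains exactly one continuous function, and that
   representative is the one used, so that functions may be evaluated and differentiated
   pointwise. *)
definition sobolev :: "real \<Rightarrow> (real \<Rightarrow> real) set" where
  "sobolev s = {f. continuous_on UNIV f \<and> L2 f \<and> L2 (bessel_weighted s f)}"

definition sobolev_norm :: "real \<Rightarrow> (real \<Rightarrow> real) \<Rightarrow> real" where
  "sobolev_norm s f = L2_norm (bessel_weighted s f)"

definition time_interval :: "ereal \<Rightarrow> real set" where
  "time_interval T = {t. 0 \<le> t \<and> ereal t < T}"

(* Membership of w in C(I; H^s), the first argument of w being time. *)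
definition continuous_into_sobolev :: "real \<Rightarrow> real set \<Rightarrow> (real \<Rightarrow> real \<Rightarrow> real) \<Rightarrow> bool" where
  "continuous_into_sobolev s I w \<longleftrightarrow>
     (\<forall>t\<in>I. w t \<in> sobolev s) \<and>
     (\<forall>t\<in>I. ((\<lambda>\<tau>. sobolev_norm s (\<lambda>x. w \<tau> x - w t x)) \<longlongrightarrow> 0) (at t within I))"

(* v is the derivative of t |-> u t in the norm of H^s (one-sided at an endpoint of I). *)
definition has_sobolev_time_derivative ::
  "real \<Rightarrow> real set \<Rightarrow> (real \<Rightarrow> real \<Rightarrow> real) \<Rightarrow> (real \<Rightarrow> real \<Rightarrow> real) \<Rightarrow> bool" where
  "has_sobolev_time_derivative s I u v \<longleftrightarrow>
     (\<forall>t\<in>I. ((\<lambda>\<tau>. sobolev_norm s (\<lambda>x. (u \<tau> x - u t x) / (\<tau> - t) - v t x)) \<longlongrightarrow> 0)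
        (at t within I))"

(* u lies in C([0,T); H^s) and in C^1([0,T); H^(s-1)), with time derivative ut, and solves
   the initial value problem on [0,T). *)
definition is_solution ::
  "real \<Rightarrow> real \<Rightarrow> real \<Rightarrow> (real \<Rightarrow> real) \<Rightarrow> ereal \<Rightarrow> (real \<Rightarrow> real \<Rightarrow> real) \<Rightarrow> bool" where
  "is_solution s B b u0 T u \<longleftrightarrow>
     continuous_into_sobolev s (time_interval T) u \<and>
     (\<exists>ut. continuous_into_sobolev (s - 1) (time_interval T) ut \<and>
        has_sobolev_time_derivative (s - 1) (time_interval T) u ut \<and>
        (\<forall>t x. 0 < t \<and> ereal t < T \<longrightarrow>
           ut t x + u t x * deriv (u t) x
             + (LINT \<xi>|lborel. B * exp (- b * \<bar>x - \<xi>\<bar>) * deriv (u t) \<xi>) = 0)) \<and>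
     (\<forall>x. u 0 x = u0 x)"

definition max_existence_time :: "real \<Rightarrow> real \<Rightarrow> real \<Rightarrow> (real \<Rightarrow> real) \<Rightarrow> ereal" where
  "max_existence_time s B b u0 = Sup {T. 0 < T \<and> (\<exists>u. is_solution s B b u0 T u)}"

(* -1 / inf u0', read as infinity for the zero datum. For nonzero u0 in H^s with s > 3/2 the
   infimum is finite and negative. *)
definition burgers_breaking_time :: "(real \<Rightarrow> real) \<Rightarrow> ereal" where
  "burgers_breaking_time u0 =
     (if \<forall>x. u0 x = 0 then \<infinity> else ereal (- 1 / (INF x. deriv u0 x)))"

end

theory Submission
  imports Defs "HOL-Probability.Probability"
begin

text \<open>On the Fourier side the equation reads \<open>g' = - i m g - N(g)\<close> with the bounded real multiplier
\<open>m(x) = 2 b B x / (b^2 + x^2)\<close> and the Burgers nonlinearity \<open>N(g) = (i x / 2) (g * g)\<close>.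

Lower bound: for \<open>T\<close> before the Burgers breaking time, the Burgers solution \<open>w\<close> is explicit along straight
characteristics, and it solves the full equation up to the error \<open>i m w\<close>, which is small in \<open>L^2\<close> when \<open>B\<close>
or \<open>b\<close> is small. By \<open>L^2\<close> stability a Galerkin approximation stays close to \<open>w\<close> as long as the
\<open>L^1\<close> norm \<open>M\<close> of \<open>x g\<close> is bounded. The symmetrized trilinear form bounds all weighted energies in terms of \<open>M\<close>, so
interpolation between \<open>L^2\<close> closeness and the \<open>H^2\<close> bound improves the bound on \<open>M\<close>; a continuity argument keeps it
on all of \<open>[0,T]\<close>, uniformly in the truncation, and the Galerkin limit is a solution in \<open>H^s\<close>.

Upper bound: the \<open>L^2\<close> norm is conserved and \<open>m\<close> has \<open>L^2\<close> norm of order \<open>B sqrt b\<close>, so along a characteristic the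
velocity changes by at most a multiple of \<open>B sqrt b\<close>. Two characteristics whose straight counterparts cross before
time \<open>T\<close> would therefore cross as well, which a solution that is regular up to \<open>T\<close> does not allow.\<close>

text \<open>The multiplier has |m| <= B with equality at x = b, so for b -> 0 it does not become
  small as an operator on L^2. What becomes small is its L^2 norm, which suffices for the upper
  bound, and its values away from frequency 0. For the lower bound the term m w must be small
  uniformly in time. This comes from |w(t,x)| <= |a(x)| + C |x| with a the transform of the datum:
  the time derivative of w carries a factor x, which compensates for m near frequency 0.

  The nonlinearity loses one derivative, so the equation is not an ODE in H^s, and energy
  inequalities are first proved for truncations. There the symmetrized form costs only M, which
  dominates sup |u_x|; M is controlled by comparison with the Burgers solution, whose explicit
  formula gives bounds in H^2. The assumption s >= 3 makes u0'' continuous, as that formula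
  requires.

  Transforms are treated as functions defined at every frequency, and time derivatives are taken
  frequency by frequency; Fubini turns them into statements about norms.\<close>

abbreviation L1 :: "(real => 'a::{banach, second_countable_topology}) => bool" where "L1 \<equiv> integrable lborel"
abbreviation lint :: "(real => 'a::{banach, second_countable_topology}) => 'a" (binder "Lint " 10) where "lint f \<equiv> integral\<^sup>L lborel f"
abbreviation moment :: "(real => complex) => real" where "moment g \<equiv> Lint x. \<bar>x\<bar> * cmod (g x)"
abbreviation "cor \<equiv> complex_of_real"
abbreviation "Borel \<equiv> borel_measurable borel"
abbreviation "borel2 \<equiv> borel \<Otimes>\<^sub>M borel"
abbreviation "lborel2 \<equiv> lborel \<Otimes>\<^sub>M (lborel :: real measure)"
abbreviation "Borel2 \<equiv> borel_measurable borel2"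

lemmas int_bound = Bochner_Integration.integrable_bound and int_cong = Bochner_Integration.integral_cong
  and int_add = Bochner_Integration.integrable_add and int_diff = Bochner_Integration.integrable_diff
  and lint_add = Bochner_Integration.integral_add and lint_diff = Bochner_Integration.integral_diff


section \<open>Square-integrable functions\<close>

lemma Cauchy_Schwarz_integral:
 fixes f g :: "'a => real"
 assumes [measurable]: "f : borel_measurable M" "g : borel_measurable M"
  and f: "integrable M (%x. (f x)^2)" and g: "integrable M (%x. (g x)^2)"
 shows "integrable M (%x. f x * g x)"
  and "(LINT x|M. f x * g x)^2 <= (LINT x|M. (f x)^2) * (LINT x|M. (g x)^2)"
proof -
 show i: "integrable M (%x. f x * g x)"
 proof (rule int_bound)
  show "integrable M (%x. (f x)^2 + (g x)^2)" using f g by simp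
  show "AE x in M. norm (f x * g x) <= norm ((f x)^2 + (g x)^2)"
  proof (rule AE_I2)
   fix x
   have "2 * (\<bar>f x\<bar> * \<bar>g x\<bar>) <= \<bar>f x\<bar>^2 + \<bar>g x\<bar>^2"
    using sum_squares_bound[of "\<bar>f x\<bar>" "\<bar>g x\<bar>"] by simp
   thus "norm (f x * g x) <= norm ((f x)^2 + (g x)^2)"
    by (simp add: abs_mult) (smt (verit) mult_nonneg_nonneg abs_ge_zero)
  qed
 qed simp
 define F where "F = (LINT x|M. (f x)^2)"
 define G where "G = (LINT x|M. (g x)^2)"
 define P where "P = (LINT x|M. f x * g x)"
 \<comment> \<open>The square of \<open>f - c * g\<close> has nonnegative integral for every real
   \<open>c\<close>. The choice \<open>c = P / G\<close> gives the inequality; if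
   \<open>G = 0\<close>, the choice \<open>c = (F + 1) / (2 * P)\<close> would make the integral
   \<open>-1\<close> unless \<open>P = 0\<close>.\<close>
 have q: "0 <= F - 2 * c * P + c^2 * G" for c
 proof -
  have "0 <= (LINT x|M. (f x - c * g x)^2)" by simp
  also have "(%x. (f x - c * g x)^2) = (%x. (f x)^2 - 2 * c * (f x * g x) + c^2 * (g x)^2)"
   by (auto simp: power2_eq_square algebra_simps)
  also have "(LINT x|M. (f x)^2 - 2 * c * (f x * g x) + c^2 * (g x)^2) = F - 2 * c * P + c^2 * G"
   using f g i by (simp add: F_def G_def P_def)
  finally show ?thesis .
 qed
 have G0: "G \<ge> 0" by (simp add: G_def)
 show "(LINT x|M. f x * g x)^2 <= (LINT x|M. (f x)^2) * (LINT x|M. (g x)^2)"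
  unfolding F_def[symmetric] G_def[symmetric] P_def[symmetric]
 proof (cases "G = 0")
  case True
  have "P = 0"
  proof (rule ccontr)
   assume "P ~= 0"
   thus False using q[of "(F + 1) / (2 * P)"] True by (simp add: field_simps)
  qed
  thus "P^2 <= F * G" using True by simp
 next
  case False
  thus "P^2 <= F * G" using q[of "P / G"] G0
   by (simp add: field_simps power2_eq_square)
 qed
qed

lemma norm_add_sq_le: "(norm (a + b))^2 <= 2 * (norm a)^2 + 2 * (norm b)^2"
 for a b :: "'a::real_normed_vector"
proof -
 have "(norm (a + b))^2 <= (norm a + norm b)^2"
  by (intro power_mono norm_triangle_ineq) simp
 also have "... <= 2 * (norm a)^2 + 2 * (norm b)^2"
  using sum_squares_bound[of "norm a" "norm b"] by (simp add: power2_sum)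
 finally show ?thesis .
qed

lemma norm_diff_sq_le: "(norm (a - b))^2 <= 2 * (norm a)^2 + 2 * (norm b)^2"
 for a b :: "'a::real_normed_vector"
 using norm_add_sq_le[of a "-b"] by simp

lemma L2_measurable[measurable_dest]: "L2 f ==> f : Borel"
 by (simp add: L2_def)

lemma L2_integrable: "L2 f ==> L1 (%x. (norm (f x))^2)"
 by (simp add: L2_def)

lemma L2I: "f : Borel ==> L1 (%x. (norm (f x))^2) ==> L2 f"
 by (simp add: L2_def)

lemma L2_norm_sq: "(L2_norm f)^2 = (Lint x. (norm (f x))^2)"
 by (simp add: L2_norm_def)

lemma L2_bound:
 fixes f :: "real => 'a::{real_normed_vector, second_countable_topology}"
  and g :: "real => 'b::{real_normed_vector, second_countable_topology}"
 assumes "L2 f" "g : Borel" "!!x. norm (g x) <= C * norm (f x)"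
 shows "L2 g"
proof (rule L2I)
 show "L1 (%x. (norm (g x))^2)"
 proof (rule int_bound)
  show "L1 (%x. C^2 * (norm (f x))^2)" using L2_integrable[OF assms(1)] by simp
  show "AE x in lborel. norm ((norm (g x))^2) <= norm (C^2 * (norm (f x))^2)"
  proof (rule AE_I2)
   fix x
   have "(norm (g x))^2 <= (C * norm (f x))^2" by (intro power_mono assms) simp
   thus "norm ((norm (g x))^2) <= norm (C^2 * (norm (f x))^2)" by (simp add: power_mult_distrib)
  qed
 qed (use assms in measurable)
qed fact

lemma L2_add:
 fixes f :: "real => 'a::{real_normed_vector, second_countable_topology}"
 assumes "L2 f" "L2 g" shows "L2 (%x. f x + g x)"
proof (rule L2I)
 note [measurable] = L2_measurable[OF assms(1)] L2_measurable[OF assms(2)]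
 show "(%x. f x + g x) : Borel" by measurable
 show "L1 (%x. (norm (f x + g x))^2)"
 proof (rule int_bound)
  show "L1 (%x. 2 * (norm (f x))^2 + 2 * (norm (g x))^2)"
   using L2_integrable[OF assms(1)] L2_integrable[OF assms(2)] by simp
  show "AE x in lborel. norm ((norm (f x + g x))^2) <= norm (2 * (norm (f x))^2 + 2 * (norm (g x))^2)"
   using norm_add_sq_le[of "f _" "g _"] by (intro AE_I2) simp
 qed measurable
qed

lemma L2_cmult: "L2 f ==> L2 (%x. c * f x)" for f :: "real => 'a::{real_normed_field, second_countable_topology}"
 by (rule L2_bound[where C="norm c" and f=f]) (auto simp: norm_mult)

lemma L2_uminus: "L2 f ==> L2 (%x. - f x)" for f :: "real => 'a::{real_normed_vector, second_countable_topology}"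
 by (rule L2_bound[where C=1 and f=f]) auto

lemma L2_diff:
 fixes f :: "real => 'a::{real_normed_vector, second_countable_topology}"
 shows "L2 f ==> L2 g ==> L2 (%x. f x - g x)"
 using L2_add[of f "%x. - g x"] L2_uminus[of g] by simp

lemma L2_norm_nonneg[simp]: "0 <= L2_norm f"
 by (simp add: L2_norm_def)

lemma L2_Cauchy_Schwarz:
 fixes f :: "real => 'a::{real_normed_vector, second_countable_topology}"
  and g :: "real => 'b::{real_normed_vector, second_countable_topology}"
 assumes "L2 f" "L2 g"
 shows "L1 (%x. norm (f x) * norm (g x))"
  and "(Lint x. norm (f x) * norm (g x)) <= L2_norm f * L2_norm g"
proof -
 note [measurable] = L2_measurable[OF assms(1)] L2_measurable[OF assms(2)]
 note CS = Cauchy_Schwarz_integral[of "%x. norm (f x)" lborel "%x. norm (g x)"]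
 show "L1 (%x. norm (f x) * norm (g x))"
  by (intro CS L2_integrable assms) measurable
 have "(Lint x. norm (f x) * norm (g x))^2 <= (L2_norm f * L2_norm g)^2"
  unfolding power_mult_distrib L2_norm_sq
  by (intro CS L2_integrable assms) measurable
 thus "(Lint x. norm (f x) * norm (g x)) <= L2_norm f * L2_norm g"
  by (rule power2_le_imp_le) simp
qed

lemma L2_norm_mono:
 fixes f :: "real => 'a::{real_normed_vector, second_countable_topology}"
  and g :: "real => 'b::{real_normed_vector, second_countable_topology}"
 assumes "L2 f" "!!x. norm (g x) <= norm (f x)"
 shows "L2_norm g <= L2_norm f"
 unfolding L2_norm_def
 by (intro real_sqrt_le_mono integral_mono_AE' L2_integrable assms AE_I2 power_mono) auto

lemma L2_norm_cong_AE:
 assumes [measurable]: "f : Borel" "g : Borel" and "AE x in lborel. f x = g x"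
 shows "L2_norm f = L2_norm g"
 unfolding L2_norm_def by (intro arg_cong[of _ _ sqrt] integral_cong_AE) (use assms in auto)

lemma L2_cong_AE:
 fixes f g :: "real => 'a::{real_normed_vector, second_countable_topology}"
 assumes "L2 f" and [measurable]: "g : Borel" and "AE x in lborel. f x = g x"
 shows "L2 g"
proof (rule L2I)
 note [measurable] = L2_measurable[OF assms(1)]
 show "L1 (%x. (norm (g x))^2)"
  by (rule Bochner_Integration.integrable_cong_AE_imp[OF L2_integrable[OF assms(1)]])
   (use assms(3) in auto)
qed fact

lemma L2_norm_triangle:
 fixes f :: "real => 'a::{real_normed_vector, second_countable_topology}"
 assumes "L2 f" "L2 g" shows "L2_norm (%x. f x + g x) <= L2_norm f + L2_norm g"
proof (rule power2_le_imp_le)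
 note i = L2_Cauchy_Schwarz[OF assms] L2_integrable[OF assms(1)] L2_integrable[OF assms(2)]
 have "(L2_norm (%x. f x + g x))^2 <= (Lint x. (norm (f x))^2 + 2 * (norm (f x) * norm (g x)) + (norm (g x))^2)"
  unfolding L2_norm_sq
 proof (rule integral_mono)
  show "L1 (%x. (norm (f x + g x))^2)" by (intro L2_integrable L2_add assms)
  show "L1 (%x. (norm (f x))^2 + 2 * (norm (f x) * norm (g x)) + (norm (g x))^2)"
   using i by simp
  fix x have "(norm (f x + g x))^2 <= (norm (f x) + norm (g x))^2"
   by (intro power_mono norm_triangle_ineq) simp
  thus "(norm (f x + g x))^2 <= (norm (f x))^2 + 2 * (norm (f x) * norm (g x)) + (norm (g x))^2"
   by (simp add: power2_sum)
 qed
 also have "... = (L2_norm f)^2 + 2 * (Lint x. norm (f x) * norm (g x)) + (L2_norm g)^2"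
  using i by (simp add: L2_norm_sq)
 also have "... <= (L2_norm f + L2_norm g)^2" using i(2) by (simp add: power2_sum)
 finally show "(L2_norm (%x. f x + g x))^2 <= (L2_norm f + L2_norm g)^2" .
qed simp

lemma L2_norm_cmult: "L2_norm (%x. c * f x) = norm c * L2_norm f" for f :: "real => 'a::{real_normed_field, second_countable_topology}"
 unfolding L2_norm_def by (simp add: norm_mult power_mult_distrib real_sqrt_mult)

lemma L2_norm_uminus: "L2_norm (%x. - f x) = L2_norm f"
 unfolding L2_norm_def by simp

lemma L2_norm_minus_commute: "L2_norm (%x. f x - g x) = L2_norm (%x. g x - f x)"
 unfolding L2_norm_def by (simp add: norm_minus_commute)

lemma nn_integral_sq_eq: "L2 f ==> (\<integral>\<^sup>+x. ennreal ((norm (f x))^2) \<partial>lborel) = ennreal ((L2_norm f)^2)"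
 unfolding L2_norm_sq by (intro nn_integral_eq_integral L2_integrable) auto

lemma L2_of_nn_integral_le:
 fixes f :: "real => 'a::{real_normed_vector, second_countable_topology}"
 assumes [measurable]: "f : Borel"
  and le: "(\<integral>\<^sup>+x. ennreal ((norm (f x))^2) \<partial>lborel) <= ennreal c" and c: "0 <= c"
 shows "L2 f" "(L2_norm f)^2 <= c"
proof -
 have i: "L1 (%x. (norm (f x))^2)"
  using le by (intro integrableI_bounded) (auto simp: le_less_trans[OF _ ennreal_less_top])
 thus L: "L2 f" by (intro L2I) auto
 show "(L2_norm f)^2 <= c" using le nn_integral_sq_eq[OF L] c by simp
qed

text \<open>Fatou's lemma for the squared norms. It carries bounds to limits that converge only
  pointwise: Gaussian regularizations, rapid L^2 sequences and Galerkin approximations.\<close>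

lemma L2_Fatou:
 fixes f :: "nat => real => 'a::{real_normed_vector, second_countable_topology}"
 assumes L: "!!n. L2 (f n)" and [measurable]: "g : Borel"
  and lim: "AE x in lborel. (%n. f n x) \<longlonglongrightarrow> g x"
  and b: "!!n. (L2_norm (f n))^2 <= c"
 shows "L2 g" "(L2_norm g)^2 <= c"
proof -
 note [measurable] = L2_measurable[OF L]
 have c: "0 <= c" using b[of 0] by (rule order_trans[rotated]) simp
 have "(\<integral>\<^sup>+x. ennreal ((norm (g x))^2) \<partial>lborel) = (\<integral>\<^sup>+x. liminf (%n. ennreal ((norm (f n x))^2)) \<partial>lborel)"
 proof (rule nn_integral_cong_AE)
  show "AE x in lborel. ennreal ((norm (g x))^2) = liminf (%n. ennreal ((norm (f n x))^2))"
   using lim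
  proof eventually_elim
   fix x assume "(%n. f n x) \<longlonglongrightarrow> g x"
   hence "(%n. ennreal ((norm (f n x))^2)) \<longlonglongrightarrow> ennreal ((norm (g x))^2)"
    by (intro tendsto_ennrealI tendsto_intros)
   thus "ennreal ((norm (g x))^2) = liminf (%n. ennreal ((norm (f n x))^2))"
    by (rule lim_imp_Liminf[symmetric, rotated]) simp
  qed
 qed
 also have "... <= liminf (%n. \<integral>\<^sup>+x. ennreal ((norm (f n x))^2) \<partial>lborel)"
  by (intro nn_integral_liminf) measurable
 also have "... <= ennreal c"
  by (rule Liminf_le) (auto simp: nn_integral_sq_eq[OF L] intro!: always_eventually ennreal_leI b)
 finally have le: "(\<integral>\<^sup>+x. ennreal ((norm (g x))^2) \<partial>lborel) <= ennreal c" .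
 show "L2 g" "(L2_norm g)^2 <= c" using L2_of_nn_integral_le[OF _ le c] by auto
qed

lemma Riesz_Fischer_rapid:
 fixes f :: "nat => real => complex"
 assumes L: "!!n. L2 (f n)" and cauchy: "!!n. L2_norm (%x. f (Suc n) x - f n x) <= (1/2)^n"
 obtains g where "L2 g" "AE x in lborel. (%n. f n x) \<longlonglongrightarrow> g x"
  "!!n. L2_norm (%x. f n x - g x) <= 2 * (1/2)^n"
proof -
 note [measurable] = L2_measurable[OF L]
 have Ld: "L2 (%x. f (Suc n) x - f n x)" for n by (intro L2_diff L)
 \<comment> \<open>The weight \<open>2^n\<close> is the slack between \<open>(1/2)^n\<close> and its
   square: the weighted sum of squares is still finite, so for almost every \<open>x\<close> the
   increments are at most a multiple of \<open>(sqrt (1/2))^n\<close> and hence summable.\<close>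
 let ?d = "%n x. 2^n * (norm (f (Suc n) x - f n x))^2"
 have "(\<integral>\<^sup>+x. (\<Sum>n. ennreal (?d n x)) \<partial>lborel) = (\<Sum>n. \<integral>\<^sup>+x. ennreal (?d n x) \<partial>lborel)"
  by (intro nn_integral_suminf) measurable
 also have "... = (\<Sum>n. ennreal (2^n * (L2_norm (%x. f (Suc n) x - f n x))^2))"
  by (intro arg_cong[of _ _ suminf] ext)
   (simp add: ennreal_mult' nn_integral_cmult nn_integral_sq_eq[OF Ld])
 also have "... <= (\<Sum>n. ennreal ((1/2)^n))"
 proof (intro suminf_le ennreal_leI)
  fix n
  have "(L2_norm (%x. f (Suc n) x - f n x))^2 <= ((1/2)^n)^2"
   by (intro power_mono cauchy) simp
  hence "2^n * (L2_norm (%x. f (Suc n) x - f n x))^2 <= 2^n * ((1/2)^n)^2"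
   by (intro mult_left_mono) auto
  also have "... = (2 * (1/2))^n * (1/2::real)^n"
   unfolding power_mult_distrib by (simp add: power2_eq_square)
  finally show "2^n * (L2_norm (%x. f (Suc n) x - f n x))^2 <= (1/2)^n" by simp
 qed auto
 also have "... = ennreal (\<Sum>n. (1/2)^n)"
  by (intro suminf_ennreal2 summable_geometric) auto
 also have "... < \<infinity>" by simp
 finally have "AE x in lborel. (\<Sum>n. ennreal (?d n x)) ~= \<infinity>"
  by (intro nn_integral_PInf_AE) auto
 hence conv: "AE x in lborel. convergent (%n. f n x)"
 proof eventually_elim
  fix x assume fin: "(\<Sum>n. ennreal (?d n x)) ~= \<infinity>"
  have "summable (%n. ?d n x)"
   by (rule summable_suminf_not_top) (use fin in auto)
  hence "Bseq (%n. ?d n x)"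
   using summable_LIMSEQ_zero convergentI convergent_imp_Bseq by blast
  then obtain K where K: "!!n. norm (?d n x) <= K" "K > 0" unfolding Bseq_def by auto
  have le: "norm (f (Suc n) x - f n x) <= sqrt K * (sqrt (1/2))^n" for n
  proof (rule power2_le_imp_le)
   have "(norm (f (Suc n) x - f n x))^2 <= K * (1/2)^n"
    using K(1)[of n] by (simp add: field_simps power_divide)
   also have "... = (sqrt K * sqrt (1/2)^n)^2"
    using K(2) by (simp add: power_mult_distrib power_mult[symmetric] mult.commute[of n])
     (simp add: power_mult)
   finally show "(norm (f (Suc n) x - f n x))^2 <= (sqrt K * sqrt (1/2)^n)^2" .
  qed (use K in simp)
  have "summable (%n. f (Suc n) x - f n x)"
  proof (rule summable_comparison_test'[where N=0])
   show "summable (%n. sqrt K * (sqrt (1/2))^n)"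
    by (intro summable_mult summable_geometric) (auto simp: real_sqrt_divide)
   show "norm (f (Suc n) x - f n x) <= sqrt K * sqrt (1/2) ^ n" for n by (rule le)
  qed
  hence "convergent (%n. \<Sum>i<n. f (Suc i) x - f i x)"
   by (simp add: summable_iff_convergent)
  also have "(%n. \<Sum>i<n. f (Suc i) x - f i x) = (%n. f n x - f 0 x)"
   by (intro ext sum_lessThan_telescope)
  finally have "convergent (%n. f n x - f 0 x)" .
  thus "convergent (%n. f n x)"
   using convergent_add[OF _ convergent_const[of "f 0 x"]] by fastforce
 qed
 define g where "g = (%x. lim (%n. f n x))"
 have [measurable]: "g : Borel" unfolding g_def by measurable
 have lim: "AE x in lborel. (%n. f n x) \<longlonglongrightarrow> g x"
  using conv unfolding g_def by eventually_elim (simp add: convergent_LIMSEQ_iff)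
 have diff: "L2_norm (%x. f (n + k) x - f n x) <= 2 * (1/2)^n - 2 * (1/2)^(n+k)" for n k
 proof (induction k)
  case (Suc k)
  have "L2_norm (%x. f (n + Suc k) x - f n x) =
     L2_norm (%x. (f (Suc (n + k)) x - f (n+k) x) + (f (n + k) x - f n x))" by simp
  also have "... <= L2_norm (%x. f (Suc (n + k)) x - f (n+k) x) + L2_norm (%x. f (n + k) x - f n x)"
   by (intro L2_norm_triangle L2_diff L)
  also have "... <= (1/2)^(n+k) + (2 * (1/2)^n - 2 * (1/2)^(n+k))"
   by (intro add_mono Suc cauchy)
  finally show ?case by simp
 qed (simp add: L2_norm_def)
 have lg: "L2 (%x. f n x - g x)" "(L2_norm (%x. f n x - g x))^2 <= (2 * (1/2)^n)^2" for n
 proof -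
  have 1: "L2 (%x. f n x - f (n + k) x)" for k by (intro L2_diff L)
  have 2: "(L2_norm (%x. f n x - f (n + k) x))^2 <= (2 * (1/2)^n)^2" for k
  proof (rule power_mono)
   show "L2_norm (%x. f n x - f (n + k) x) <= 2 * (1/2)^n"
    using diff[of n k] zero_le_power[of "1/2::real" "n+k"]
    by (subst L2_norm_minus_commute) linarith
  qed simp
  have 3: "AE x in lborel. (%k. f n x - f (n + k) x) \<longlonglongrightarrow> f n x - g x"
   using lim
  proof eventually_elim
   fix x assume "(%n. f n x) \<longlonglongrightarrow> g x"
   hence "(%k. f (n + k) x) \<longlonglongrightarrow> g x" by (subst add.commute) (rule LIMSEQ_ignore_initial_segment)
   thus "(%k. f n x - f (n + k) x) \<longlonglongrightarrow> f n x - g x" by (intro tendsto_intros)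
  qed
  show "L2 (%x. f n x - g x)" "(L2_norm (%x. f n x - g x))^2 <= (2 * (1/2)^n)^2"
   using L2_Fatou[OF 1 _ 3 2] by auto
 qed
 have "L2 g" using L2_diff[OF L[of 0] lg(1)[of 0]] by simp
 moreover have "L2_norm (%x. f n x - g x) <= 2 * (1/2)^n" for n
  using power2_le_imp_le[OF lg(2)] by simp
 ultimately show ?thesis using that lim by blast
qed

section \<open>The Fourier integral\<close>

lemma integrable_tensor:
 fixes f g :: "real => 'a::{real_normed_field, banach, second_countable_topology}"
 assumes f: "L1 f" and g: "L1 g"
 shows "integrable lborel2 (%(x, y). f x * g y)"
proof (rule lborel_pair.Fubini_integrable)
 note [measurable] = borel_measurable_integrable[OF f] borel_measurable_integrable[OF g]
 show "(%(x, y). f x * g y) : borel_measurable lborel2" by measurable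
 show "L1 (%x. \<integral>y. norm (case (x, y) of (x, y) => f x * g y) \<partial>lborel)"
  using f by (simp add: norm_mult)
 show "AE x in lborel. L1 (%y. case (x, y) of (x, y) => f x * g y)"
  using g by simp
qed

lemma integrable_lborel_inverse_square: "L1 (%x::real. 1 / (1 + x^2))"
proof -
 have "einterval (-\<infinity>) \<infinity> = UNIV" by (auto simp: einterval_def)
 thus ?thesis using integrable_inverse_1_plus_square
  by (simp add: set_integrable_def inverse_eq_divide)
qed

text \<open>The inverse Fourier transform in the unitary normalization. The forward transform is its
  reflection, as \<open>truncated_fourier_eq\<close> shows, so this one integral serves both
  directions.\<close>

definition ift :: "(real => complex) => real => complex" where
 "ift g x = cor (1 / sqrt (2 * pi)) * (Lint z. g z * cis (x * z))"

lemma measurable_cis[measurable]: "cis : Borel"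
 by (intro borel_measurable_continuous_onI continuous_intros)

lemma measurable_cnj[measurable]: "cnj : Borel"
 by (intro borel_measurable_continuous_onI continuous_intros)

lemma integrable_mult_cis:
 assumes "L1 g" shows "L1 (%z. g z * cis (c + x * z))"
 by (rule int_bound[OF assms])
  (use borel_measurable_integrable[OF assms] in \<open>measurable, simp add: norm_mult\<close>)

lemma integrable_mult_cis': "L1 g ==> L1 (%z. g z * cis (x * z))"
 using integrable_mult_cis[of g 0 x] by simp

lemma norm_ift_le:
 "cmod (ift g x) <= 1 / sqrt (2 * pi) * (Lint z. cmod (g z))"
proof -
 have "cmod (Lint z. g z * cis (x * z)) <= (Lint z. cmod (g z * cis (x * z)))"
  by (rule integral_norm_bound)
 thus ?thesis unfolding ift_def by (simp add: norm_mult norm_divide divide_right_mono)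
qed

lemma ift_cong_AE:
 assumes [measurable]: "f : Borel" "g : Borel" and "AE x in lborel. f x = g x"
 shows "ift f = ift g"
 unfolding ift_def by (intro ext arg_cong2[of _ _ _ _ "(*)"] refl integral_cong_AE) (use assms in auto)

lemma ift_add: "L1 f ==> L1 g ==> ift (%x. f x + g x) y = ift f y + ift g y"
 by (simp add: ift_def distrib_right distrib_left integrable_mult_cis' del: of_real_divide)

lemma ift_diff: "L1 f ==> L1 g ==> ift (%x. f x - g x) y = ift f y - ift g y"
 by (simp add: ift_def left_diff_distrib right_diff_distrib integrable_mult_cis' del: of_real_divide)

lemma ift_cmult: "ift (%x. c * f x) y = c * ift f y"
 by (simp add: ift_def mult.assoc)

lemma ift_uminus: "ift (%x. - f x) y = - ift f y"
 using ift_cmult[of "-1" f y] by simp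

lemma ift_cnj: "cnj (ift f y) = ift (%x. cnj (f x)) (- y)"
proof -
 have "(Lint x. cnj (f x * cis (y * x))) = cnj (Lint x. f x * cis (y * x))"
  by (rule integral_bounded_linear'[OF bounded_linear_cnj bounded_linear_cnj]) auto
 thus ?thesis by (simp add: ift_def cis_cnj)
qed

lemma lborel_integral_reflect: "(Lint x. f (- x)) = (Lint x. f x)"
 for f :: "real => 'a::{banach, second_countable_topology}"
 using lborel_integral_real_affine[of "-1" f 0] by simp

lemma lborel_integrable_reflect: "L1 (%x. f (- x)) \<longleftrightarrow> L1 f"
 for f :: "real => 'a::{banach, second_countable_topology}"
 using lborel_integrable_real_affine_iff[of "-1" f 0] by simp

lemma ift_reflect: "ift (%x. f (- x)) y = ift f (- y)"
 unfolding ift_def using lborel_integral_reflect[of "%x. f x * cis (- y * x)"] by simp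

lemma ift_hermitian_real:
 assumes "!!x. f (- x) = cnj (f x)" shows "ift f y = of_real (Re (ift f y))"
proof -
 have "cnj (ift f y) = ift f y"
  using ift_reflect[of "%x. cnj (f x)" y] assms by (simp add: ift_cnj)
 thus ?thesis by (metis complex_cnj_cancel_iff Reals_cnj_iff of_real_Re)
qed

lemma ift_measurable_param:
 assumes [measurable]: "(%(t, x). g t x) : borel_measurable (M \<Otimes>\<^sub>M borel)"
 shows "(%(t, x). ift (g t) x) : borel_measurable (M \<Otimes>\<^sub>M borel)"
proof -
 have [measurable]: "(%(t, x). g t x) : borel_measurable (M \<Otimes>\<^sub>M lborel)"
  using assms by (simp cong: measurable_cong_sets)
 show ?thesis unfolding ift_def by measurable
qed

lemma continuous_on_ift:
 assumes g: "L1 g" shows "continuous_on UNIV (ift g)"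
proof -
 note [measurable] = borel_measurable_integrable[OF g]
 have "continuous (at x) (%x. Lint z. g z * cis (x * z))" for x
  unfolding continuous_within tendsto_at_iff_sequentially
 proof (safe, unfold o_def)
  fix X :: "nat => real" assume "X \<longlonglongrightarrow> x"
  thus "(%n. Lint z. g z * cis (X n * z)) \<longlonglongrightarrow> (Lint z. g z * cis (x * z))"
   by (intro integral_dominated_convergence[where w="%z. cmod (g z)"] AE_I2 tendsto_intros
      isCont_tendsto_compose[of _ cis])
    (use g in \<open>auto simp: norm_mult intro: continuous_intros\<close>)
 qed
 thus ?thesis unfolding ift_def by (intro continuous_at_imp_continuous_on ballI continuous_intros) auto
qed

lemma ift_measurable[measurable]: "L1 g ==> ift g : Borel"
 by (intro borel_measurable_continuous_onI continuous_on_ift)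

lemma ift_mult_formula:
 assumes f: "L1 f" and h: "L1 h"
 shows "(Lint x. ift f x * h x) = (Lint z. f z * ift h z)"
proof -
 have i: "integrable lborel2 (%(x, z). h x * f z * cis (x * z))"
  by (rule int_bound[OF integrable_tensor[OF h f]])
   (use borel_measurable_integrable[OF f] borel_measurable_integrable[OF h] in
    \<open>measurable, auto simp: norm_mult\<close>)
 have "(Lint x. ift f x * h x)
  = cor (1 / sqrt (2 * pi)) * (Lint x. (Lint z. h x * f z * cis (x * z)))"
  unfolding integral_mult_right_zero[symmetric]
 proof (intro int_cong refl)
  fix x
  have "(Lint z. h x * f z * cis (x * z)) = (Lint z. h x * (f z * cis (x * z)))"
   by (simp only: mult.assoc)
  thus "ift f x * h x = (Lint z. cor (1 / sqrt (2 * pi)) * (h x * f z * cis (x * z)))"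
   by (simp add: ift_def)
 qed
 also have "(Lint x. (Lint z. h x * f z * cis (x * z)))
  = (Lint z. (Lint x. h x * f z * cis (x * z)))"
  by (rule lborel_pair.Fubini_integral[symmetric]) (rule i)
 also have "cor (1 / sqrt (2 * pi)) * ... = (Lint z. f z * ift h z)"
  unfolding integral_mult_right_zero[symmetric]
 proof (intro int_cong refl)
  fix z
  have "(Lint x. h x * f z * cis (x * z)) = (Lint x. f z * (h x * cis (z * x)))"
   by (simp add: ac_simps)
  thus "(Lint x. cor (1 / sqrt (2 * pi)) * (h x * f z * cis (x * z))) = f z * ift h z"
   by (simp add: ift_def)
 qed
 finally show ?thesis .
qed

section \<open>Gaussians, the L^2 bound for the Fourier integral, and injectivity\<close>

definition gauss :: "real => real => real" where
 "gauss p x = exp (- ((p * x)^2 / 2))"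

lemma gauss_measurable[measurable]: "gauss p : Borel"
 unfolding gauss_def[abs_def] by measurable

lemma gauss_pos: "0 < gauss p x" and gauss_nonneg[simp]: "0 <= gauss p x" and gauss_le_1[simp]: "gauss p x <= 1"
 by (auto simp: gauss_def)

lemma gauss_minus[simp]: "gauss p (- x) = gauss p x"
 by (simp add: gauss_def)

lemma gauss_eq_normal_density: "0 < p ==> gauss p x = sqrt (2 * pi) / p * normal_density 0 (1 / p) x"
 by (simp add: gauss_def normal_density_def power_mult_distrib real_sqrt_mult real_sqrt_divide field_simps)

lemma integrable_gauss: "0 < p ==> L1 (gauss p)"
 using integrable_normal_moment[of "1/p" 0 0] by (simp add: gauss_eq_normal_density cong: Bochner_Integration.integrable_cong)

lemma integral_gauss: assumes "0 < p" shows "(Lint x. gauss p x) = sqrt (2 * pi) / p"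
proof -
 interpret prob_space "density lborel (normal_density 0 (1 / p))"
  by (rule prob_space_normal_density) (use assms in simp)
 have "(Lint x. normal_density 0 (1/p) x) = (LINT x|density lborel (normal_density 0 (1 / p)). 1)"
  by (subst integral_density) auto
 also have "... = 1" using prob_space by simp
 finally show ?thesis using assms by (simp add: gauss_eq_normal_density)
qed

text \<open>Up to normalization the integral is the characteristic function of the standard normal
  distribution.\<close>

lemma gauss_transform_1: "(Lint x. of_real (gauss 1 x) * cis (t * x)) = cor (sqrt (2 * pi) * gauss 1 t)"
proof -
 have "cor (exp (- (t^2) / 2)) = char std_normal_distribution t"
  by (simp add: char_std_normal_distribution)
 also have "... = (Lint x. std_normal_density x *\<^sub>R iexp (t * x))"
  unfolding char_def by (subst integral_density) auto
 also have "... = (Lint x. of_real (1 / sqrt (2 * pi)) * (of_real (gauss 1 x) * cis (t * x)))"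
  by (intro int_cong refl)
   (simp add: std_normal_density_def gauss_def cis_conv_exp scaleR_conv_of_real)
 finally have "cor (gauss 1 t) = of_real (1 / sqrt (2 * pi)) * (Lint x. of_real (gauss 1 x) * cis (t * x))"
  by (simp add: gauss_def)
 thus ?thesis by (simp add: field_simps)
qed

lemma gauss_transform:
 assumes "0 < p"
 shows "(Lint x. of_real (gauss p x) * cis (t * x)) = cor (sqrt (2 * pi) / p * gauss (1 / p) t)"
proof -
 have "(Lint x. of_real (gauss p x) * cis (t * x))
   = \<bar>1/p\<bar> *\<^sub>R (Lint x. of_real (gauss p (0 + 1/p * x)) * cis (t * (0 + 1/p * x)))"
  by (rule lborel_integral_real_affine) (use assms in simp)
 also have "... = \<bar>1/p\<bar> *\<^sub>R (Lint x. of_real (gauss 1 x) * cis (t / p * x))"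
  using assms by (simp add: gauss_def)
 also have "... = of_real (1/p) * of_real (sqrt (2 * pi) * gauss 1 (t / p))"
  using assms by (subst gauss_transform_1) (simp add: scaleR_conv_of_real)
 also have "gauss 1 (t / p) = gauss (1 / p) t" by (simp add: gauss_def)
 finally show ?thesis by simp
qed

lemma ift_gauss_shift:
 assumes "0 < p"
 shows "ift (%y. of_real (gauss p y) * cis (x * y)) z = of_real (gauss (1 / p) (x + z) / p)"
proof -
 have "(Lint y. of_real (gauss p y) * cis (x * y) * cis (z * y))
   = (Lint y. of_real (gauss p y) * cis ((x + z) * y))"
  by (simp add: mult.assoc cis_mult distrib_right)
 thus ?thesis using assms by (simp add: ift_def gauss_transform)
qed

lemma ift_gauss_kernel:
 assumes "0 < p"
 shows "ift (%y. of_real (gauss (1 / p) (x - y) / p)) z = of_real (gauss p z) * cis (x * z)"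
proof -
 have "(Lint y. of_real (gauss (1 / p) (x - y) / p) * cis (z * y))
   = (Lint y. of_real (gauss (1 / p) y / p) * cis (z * (x - y)))"
  using lborel_integral_real_affine[of "-1" "%y. of_real (gauss (1 / p) (x - y) / p) * cis (z * y)" x] by simp
 also have "... = (Lint y. (cis (x * z) * of_real (1 / p)) * (of_real (gauss (1 / p) y) * cis ((- z) * y)))"
  by (intro int_cong refl)
   (simp add: cis_mult algebra_simps)
 also have "... = cis (x * z) * of_real (1 / p) * of_real (sqrt (2 * pi) / (1 / p) * gauss p (- z))"
  by (subst integral_mult_right_zero, subst gauss_transform) (use assms in auto)
 finally show ?thesis using assms by (simp add: ift_def)
qed

lemma integrable_gauss_kernel:
 assumes "0 < p" shows "L1 (%y. cor (gauss (1 / p) (x - y) / p))"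
 using lborel_integrable_real_affine[OF integrable_gauss[of "1/p"], of "-1" x] assms by simp

lemma gauss_pairing:
 assumes "L1 g" "0 < p"
 shows "(Lint y. ift g y * of_real (gauss (1 / p) (x - y) / p)) =
    (Lint z. g z * (of_real (gauss p z) * cis (x * z)))"
 using ift_mult_formula[OF assms(1) integrable_gauss_kernel[OF assms(2)]] ift_gauss_kernel[OF assms(2)] by simp

text \<open>The kernel has mass \<open>sqrt (2 * pi)\<close> for every \<open>p\<close>, by
  translation and scaling; this makes the next bound independent of \<open>p\<close>.\<close>

lemma gauss_kernel_swap:
 assumes [measurable]: "f : Borel" and s: "0 < p" and b: "!!x. 0 <= f x"
 shows "(\<integral>\<^sup>+z. \<integral>\<^sup>+k. ennreal (f z * (gauss (1 / p) (k - z) / p)) \<partial>lborel \<partial>lborel) = ennreal (sqrt (2 * pi)) * (\<integral>\<^sup>+z. ennreal (f z) \<partial>lborel)"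
proof -
 have "(\<integral>\<^sup>+k. ennreal (f z * (gauss (1 / p) (k - z) / p)) \<partial>lborel) = ennreal (sqrt (2 * pi)) * ennreal (f z)" for z
 proof -
  have i: "L1 (%k. gauss (1 / p) (k - z) / p)"
   using lborel_integrable_real_affine[OF integrable_gauss[of "1/p"], of 1 "-z"] s by simp
  have "(Lint k. gauss (1 / p) (k - z) / p) = sqrt (2 * pi)"
   using lborel_integral_real_affine[of 1 "gauss (1/p)" "-z"] s by (simp add: integral_gauss field_simps)
  moreover have "(\<integral>\<^sup>+k. ennreal (gauss (1 / p) (k - z) / p) \<partial>lborel) = ennreal (Lint k. gauss (1 / p) (k - z) / p)"
   by (rule nn_integral_eq_integral[OF i]) (use s in auto)
  moreover have "(\<integral>\<^sup>+k. ennreal (f z * (gauss (1 / p) (k - z) / p)) \<partial>lborel)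
    = (\<integral>\<^sup>+k. ennreal (f z) * ennreal (gauss (1 / p) (k - z) / p) \<partial>lborel)"
   by (intro nn_integral_cong ennreal_mult' b)
  ultimately show ?thesis
   by (simp add: nn_integral_cmult mult.commute)
 qed
 thus ?thesis by (simp add: nn_integral_cmult)
qed

text \<open>The Gaussian weight makes the quadratic form absolutely convergent, so the
  multiplication formula applies. It turns the weight into a positive kernel of mass
  \<open>sqrt (2 * pi)\<close>; bounding twice the product of \<open>cmod (f z)\<close> and
  \<open>cmod (f k)\<close> by the sum of the squares is then Schur's test and gives a constant free
  of \<open>p\<close>.\<close>

lemma L2_ift_weighted:
 assumes f: "L1 f" and L: "L2 f" and s: "0 < p"
 shows "(Lint x. (cmod (ift f x))^2 * gauss p x) <= (L2_norm f)^2"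
proof -
 note [measurable] = borel_measurable_integrable[OF f]
 define C where "C = 1 / sqrt (2 * pi) * (Lint z. cmod (f z))"
 have C: "cmod (ift f x) <= C" for x unfolding C_def by (rule norm_ift_le)
 have C0: "0 <= C" using order_trans[OF norm_ge_zero C[of 0]] .
 have gi: "L1 (%x. cor (gauss p x))" using integrable_gauss[OF s] by simp
 define h where "h = (%x. cnj (ift f x) * of_real (gauss p x))"
 have h: "L1 h"
 proof (rule int_bound)
  show "L1 (%x. C * gauss p x)" using integrable_gauss[OF s] by simp
  show "h : borel_measurable lborel" unfolding h_def using ift_measurable[OF f] by measurable
  show "AE x in lborel. norm (h x) <= norm (C * gauss p x)"
   using C C0 by (intro AE_I2) (simp add: h_def norm_mult mult_right_mono)
 qed
 have ih: "ift h z = of_real (1 / sqrt (2 * pi)) * (Lint k. cnj (f k) * of_real (gauss (1 / p) (k - z) / p))" for z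
 proof -
  have ci: "L1 (%x. cnj (f x))" using f by simp
  have "ift h z = ift (%x. h (- x)) (- z)" by (simp add: ift_reflect)
  also have "... = of_real (1 / sqrt (2 * pi)) * (Lint x. ift (%x. cnj (f x)) x * (of_real (gauss p x) * cis ((- z) * x)))"
   by (simp add: h_def ift_cnj) (simp add: ift_def[of _ "-z"] mult.assoc)
  also have "(Lint x. ift (%x. cnj (f x)) x * (of_real (gauss p x) * cis ((- z) * x)))
   = (Lint k. cnj (f k) * ift (%x. of_real (gauss p x) * cis ((- z) * x)) k)"
   by (intro ift_mult_formula ci integrable_mult_cis' gi)
  finally show ?thesis unfolding ift_gauss_shift[OF s] by simp
 qed
 have "cor (Lint x. (cmod (ift f x))^2 * gauss p x) = (Lint x. ift f x * h x)"
  unfolding h_def integral_complex_of_real[symmetric]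
  by (intro int_cong refl) (simp add: complex_norm_square mult.assoc[symmetric] del: of_real_power)
 also have "... = (Lint z. f z * ift h z)" by (rule ift_mult_formula[OF f h])
 finally have "ennreal \<bar>Lint x. (cmod (ift f x))^2 * gauss p x\<bar> = ennreal (cmod (Lint z. f z * ift h z))"
  by (metis norm_of_real)
 also have "... <= (\<integral>\<^sup>+z. ennreal (cmod (f z * ift h z)) \<partial>lborel)"
 proof (rule integral_norm_bound_ennreal)
  show "L1 (%z. f z * ift h z)"
  proof (rule int_bound)
   show "L1 (%z. (1 / sqrt (2 * pi) * (Lint x. cmod (h x))) * cmod (f z))" using f by simp
   show "(%z. f z * ift h z) : borel_measurable lborel" using ift_measurable[OF h] by simp
   show "AE z in lborel. norm (f z * ift h z) <= norm (1 / sqrt (2 * pi) * (Lint x. cmod (h x)) * cmod (f z))"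
   proof (rule AE_I2)
    fix z
    show "norm (f z * ift h z) <= norm (1 / sqrt (2 * pi) * (Lint x. cmod (h x)) * cmod (f z))"
     using mult_right_mono[OF norm_ift_le[of h z] norm_ge_zero[of "f z"]] by (simp add: norm_mult mult.commute)
   qed
  qed
 qed
 also have "... <= (\<integral>\<^sup>+z. ennreal (1 / (2 * sqrt (2 * pi))) * ((\<integral>\<^sup>+k. ennreal ((cmod (f z))^2 * (gauss (1 / p) (k - z) / p)) \<partial>lborel)
   + (\<integral>\<^sup>+k. ennreal ((cmod (f k))^2 * (gauss (1 / p) (z - k) / p)) \<partial>lborel)) \<partial>lborel)"
 proof (rule nn_integral_mono)
  fix z
  let ?K = "%k. gauss (1 / p) (k - z) / p"
  have Kc: "gauss (1 / p) (z - k) / p = ?K k" for k using gauss_minus[of "1/p" "k - z"] by simp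
  have "ennreal (cmod (f z * ift h z)) = ennreal (cmod (f z) / sqrt (2 * pi)) * ennreal (cmod (Lint k. cnj (f k) * of_real (?K k)))"
   unfolding ih by (simp add: norm_mult norm_divide flip: ennreal_mult)
  also have "... <= ennreal (cmod (f z) / sqrt (2 * pi)) * (\<integral>\<^sup>+k. ennreal (cmod (cnj (f k) * of_real (?K k))) \<partial>lborel)"
  proof (intro mult_left_mono integral_norm_bound_ennreal)
   show "L1 (%k. cnj (f k) * cor (?K k))"
   proof (rule int_bound)
    show "L1 (%k. (1/p) * cmod (f k))" using f by simp
    show "AE k in lborel. norm (cnj (f k) * cor (?K k)) <= norm (1 / p * cmod (f k))"
     using s by (intro AE_I2) (simp add: norm_mult norm_divide field_simps mult_left_le)
   qed measurable
  qed simp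
  also have "... = (\<integral>\<^sup>+k. ennreal (cmod (f z) / sqrt (2 * pi)) * ennreal (cmod (cnj (f k) * of_real (?K k))) \<partial>lborel)"
   by (intro nn_integral_cmult[symmetric]) measurable
  also have "... <= (\<integral>\<^sup>+k. ennreal (1 / (2 * sqrt (2 * pi))) * (ennreal ((cmod (f z))^2 * ?K k) + ennreal ((cmod (f k))^2 * ?K k)) \<partial>lborel)"
  proof (rule nn_integral_mono)
   fix k
   have K0: "0 <= ?K k" using s by simp
   have "2 * (cmod (f z) * cmod (f k)) <= (cmod (f z))^2 + (cmod (f k))^2"
    using sum_squares_bound[of "cmod (f z)" "cmod (f k)"] by simp
   hence "(1 / (2 * sqrt (2 * pi)) * ?K k) * (2 * (cmod (f z) * cmod (f k))) <= (1 / (2 * sqrt (2 * pi)) * ?K k) * ((cmod (f z))^2 + (cmod (f k))^2)"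
    by (intro mult_left_mono) (use s in auto)
   hence "cmod (f z) / sqrt (2 * pi) * (cmod (f k) * ?K k)
    <= 1 / (2 * sqrt (2 * pi)) * ((cmod (f z))^2 * ?K k + (cmod (f k))^2 * ?K k)"
    by (simp add: algebra_simps add_divide_distrib)
   thus "ennreal (cmod (f z) / sqrt (2 * pi)) * ennreal (cmod (cnj (f k) * of_real (?K k)))
    <= ennreal (1 / (2 * sqrt (2 * pi))) * (ennreal ((cmod (f z))^2 * ?K k) + ennreal ((cmod (f k))^2 * ?K k))"
    using s K0 by (simp add: norm_mult norm_divide flip: ennreal_mult ennreal_plus del: times_divide_eq_right times_divide_eq_left)
  qed
  also have "... = ennreal (1 / (2 * sqrt (2 * pi))) * ((\<integral>\<^sup>+k. ennreal ((cmod (f z))^2 * ?K k) \<partial>lborel) + (\<integral>\<^sup>+k. ennreal ((cmod (f k))^2 * ?K k) \<partial>lborel))"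
   by (simp add: nn_integral_cmult nn_integral_add)
  finally show "ennreal (cmod (f z * ift h z)) <= ennreal (1 / (2 * sqrt (2 * pi))) * ((\<integral>\<^sup>+k. ennreal ((cmod (f z))^2 * ?K k) \<partial>lborel)
   + (\<integral>\<^sup>+k. ennreal ((cmod (f k))^2 * (gauss (1 / p) (z - k) / p)) \<partial>lborel))"
   unfolding Kc .
 qed
 also have "... = ennreal (1 / (2 * sqrt (2 * pi))) * ((\<integral>\<^sup>+z. \<integral>\<^sup>+k. ennreal ((cmod (f z))^2 * (gauss (1 / p) (k - z) / p)) \<partial>lborel \<partial>lborel)
   + (\<integral>\<^sup>+z. \<integral>\<^sup>+k. ennreal ((cmod (f k))^2 * (gauss (1 / p) (z - k) / p)) \<partial>lborel \<partial>lborel))"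
  by (simp add: nn_integral_cmult nn_integral_add)
 also have "(\<integral>\<^sup>+z. \<integral>\<^sup>+k. ennreal ((cmod (f k))^2 * (gauss (1 / p) (z - k) / p)) \<partial>lborel \<partial>lborel)
   = (\<integral>\<^sup>+k. \<integral>\<^sup>+z. ennreal ((cmod (f k))^2 * (gauss (1 / p) (z - k) / p)) \<partial>lborel \<partial>lborel)"
  by (rule lborel_pair.Fubini') measurable
 also have "ennreal (1 / (2 * sqrt (2 * pi))) * ((\<integral>\<^sup>+z. \<integral>\<^sup>+k. ennreal ((cmod (f z))^2 * (gauss (1 / p) (k - z) / p)) \<partial>lborel \<partial>lborel) + ...)
  = ennreal ((L2_norm f)^2)"
  using nn_integral_sq_eq[OF L] s
  by (subst (1 2) gauss_kernel_swap) (auto simp flip: ennreal_mult ennreal_plus)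
 finally show ?thesis by simp
qed

text \<open>Fatou's lemma as the Gaussian weight spreads out to the constant 1. The square of a
  Gaussian is the Gaussian with \<open>p\<close> multiplied by \<open>sqrt 2\<close>, so
  \<open>L2_ift_weighted\<close> applies to the squares of the regularized functions
  \<open>F n\<close>.\<close>

lemma L2_ift:
 assumes f: "L1 f" and L: "L2 f"
 shows "L2 (ift f)" "L2_norm (ift f) <= L2_norm f"
proof -
 have [measurable]: "ift f : Borel" by (rule ift_measurable[OF f])
 define C where "C = 1 / sqrt (2 * pi) * (Lint z. cmod (f z))"
 have C: "cmod (ift f x) <= C" for x unfolding C_def by (rule norm_ift_le)
 define F where "F = (%n x. of_real (gauss (1 / real (Suc n)) x) * ift f x)"
 have sq: "(gauss p x)^2 = gauss (sqrt 2 * p) x" for p x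
  by (simp add: gauss_def power_mult_distrib exp_double[symmetric])
 have F: "(cmod (F n x))^2 = (cmod (ift f x))^2 * gauss (sqrt 2 / real (Suc n)) x" for n x
  unfolding F_def using sq[of "1 / real (Suc n)" x] by (simp add: norm_mult power_mult_distrib)
 have LF: "L2 (F n)" for n
 proof (rule L2I)
  show "L1 (%x. (cmod (F n x))^2)"
  proof (rule int_bound)
   show "L1 (%x. C^2 * gauss (sqrt 2 / real (Suc n)) x)"
    using integrable_gauss[of "sqrt 2 / real (Suc n)"] by simp
   show "AE x in lborel. norm ((cmod (F n x))^2) <= norm (C^2 * gauss (sqrt 2 / real (Suc n)) x)"
    unfolding F using C by (intro AE_I2) (auto intro!: mult_right_mono power_mono simp: abs_mult)
  qed (simp add: F_def)
 qed (simp add: F_def)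
 have b: "(L2_norm (F n))^2 <= (L2_norm f)^2" for n
  unfolding L2_norm_sq[of "F n"] F by (rule L2_ift_weighted[OF f L]) simp
 have lim: "AE x in lborel. (%n. F n x) \<longlonglongrightarrow> ift f x"
 proof (rule AE_I2)
  fix x
  have "(%n. gauss (1 / real (Suc n)) x) \<longlonglongrightarrow> exp (- ((0 * x)^2 / 2))"
   unfolding gauss_def using LIMSEQ_inverse_real_of_nat
   by (intro tendsto_intros) (auto simp: inverse_eq_divide)
  hence "(%n. F n x) \<longlonglongrightarrow> of_real 1 * ift f x"
   unfolding F_def by (intro tendsto_intros) simp
  thus "(%n. F n x) \<longlonglongrightarrow> ift f x" by simp
 qed
 show "L2 (ift f)" "L2_norm (ift f) <= L2_norm f"
  using L2_Fatou[OF LF _ lim b] power2_le_imp_le by auto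
qed

text \<open>The positive and the negative part of \<open>h\<close> have equal transforms and, at
  frequency 0, equal masses. Normalized, they are probability densities with the same characteristic
  function, so Levy's uniqueness theorem identifies them.\<close>

lemma real_transform_injective:
 fixes h :: "real => real"
 assumes h: "L1 h" and z: "!!x. (Lint y. of_real (h y) * cis (x * y)) = 0"
 shows "AE y in lborel. h y = 0"
proof -
 note [measurable] = borel_measurable_integrable[OF h]
 define p where "p = (%y. max 0 (h y))"
 define m where "m = (%y. max 0 (- h y))"
 have [measurable]: "p : Borel" "m : Borel"
  unfolding p_def m_def by measurable
 have pm: "h y = p y - m y" "0 <= p y" "0 <= m y" for y by (auto simp: p_def m_def)
 have ip: "L1 p" and im: "L1 m"
  unfolding p_def m_def using h by auto
 have eq: "(Lint y. of_real (p y) * cis (x * y)) = (Lint y. of_real (m y) * cis (x * y))" for x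
 proof -
  have "(Lint y. of_real (h y) * cis (x * y)) = (Lint y. of_real (p y) * cis (x * y) - of_real (m y) * cis (x * y))"
   by (simp add: pm(1) left_diff_distrib)
  also have "... = (Lint y. of_real (p y) * cis (x * y)) - (Lint y. of_real (m y) * cis (x * y))"
   by (intro lint_diff integrable_mult_cis' integrable_of_real ip im)
  finally show ?thesis using z[of x] by simp
 qed
 define c where "c = (Lint y. p y)"
 have "cor c = of_real (Lint y. m y)" using eq[of 0] by (simp add: c_def)
 hence cm: "(Lint y. m y) = c" by (simp only: of_real_eq_iff)
 have c0: "0 <= c" unfolding c_def using pm by simp
 show ?thesis
 proof (cases "c = 0")
  case True
  have "AE y in lborel. p y = 0" "AE y in lborel. m y = 0"
   using integral_nonneg_eq_0_iff_AE[OF ip] integral_nonneg_eq_0_iff_AE[OF im] pm True cm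
   by (auto simp: c_def)
  thus ?thesis by eventually_elim (simp add: pm)
 next
  case False
  hence c: "0 < c" using c0 by simp
  have rd: "real_distribution (density lborel (%y. ennreal (q y / c)))"
   if [measurable]: "q : Borel" and q: "L1 q" "(Lint y. q y) = c" "!!y. 0 <= q y" for q
  proof -
   have "(\<integral>\<^sup>+y. ennreal (q y / c) \<partial>lborel) = ennreal (Lint y. q y / c)"
    by (intro nn_integral_eq_integral) (use q c in auto)
   also have "... = 1" using q c by simp
   finally interpret prob_space "density lborel (%y. ennreal (q y / c))"
    by (intro prob_spaceI) (simp add: emeasure_density)
   show ?thesis by unfold_locales auto
  qed
  have ch: "char (density lborel (%y. ennreal (q y / c))) x = of_real (1/c) * (Lint y. of_real (q y) * cis (x * y))"
   if [measurable]: "q : Borel" and q: "!!y. 0 <= q y" for q x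
   unfolding char_def using c q
   by (subst integral_density) (auto simp: cis_conv_exp scaleR_conv_of_real mult.assoc mult.left_commute)
  have "density lborel (%y. ennreal (p y / c)) = density lborel (%y. ennreal (m y / c))"
   by (rule Levy_uniqueness) (use rd[of p] rd[of m] ch[of p] ch[of m] ip im pm cm eq in \<open>auto simp: c_def\<close>)
  hence "AE y in lborel. ennreal (p y / c) = ennreal (m y / c)"
   by (subst (asm) sigma_finite_measure.density_unique_iff[OF lborel.sigma_finite_measure_axioms]) auto
  thus ?thesis by eventually_elim (use c pm in \<open>auto simp: ennreal_inj\<close>)
 qed
qed

text \<open>The hypothesis passes to \<open>cnj g\<close> by conjugation and reflection of
  \<open>x\<close>, hence to the real and the imaginary part, where the real case applies.\<close>

lemma ift_injective:
 assumes g: "L1 g" and z: "!!x. ift g x = 0"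
 shows "AE y in lborel. g y = 0"
proof -
 have z': "(Lint y. g y * cis (x * y)) = 0" for x using z[of x] by (simp add: ift_def)
 have zc: "(Lint y. cnj (g y) * cis (x * y)) = 0" for x
 proof -
  have "(Lint y. cnj (g y) * cis (x * y)) = (Lint y. cnj (g y * cis ((-x) * y)))"
   by (simp add: cis_cnj del: integral_cnj)
  also have "... = cnj (Lint y. g y * cis ((-x) * y))"
   by (rule integral_bounded_linear'[OF bounded_linear_cnj bounded_linear_cnj]) auto
  finally show ?thesis using z'[of "-x"] by simp
 qed
 have ig: "L1 (%y. g y * cis (x * y))" "L1 (%y. cnj (g y) * cis (x * y))" for x
  using g by (auto intro!: integrable_mult_cis')
 have re: "(Lint y. of_real (Re (g y)) * cis (x * y)) = 0" for x
 proof -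
  have "(Lint y. of_real (Re (g y)) * cis (x * y)) = (Lint y. (g y * cis (x * y) + cnj (g y) * cis (x * y)) / 2)"
   by (intro int_cong refl) (simp add: complex_add_cnj flip: distrib_right)
  also have "... = 0" using ig[of x] z'[of x] zc[of x] by simp
  finally show ?thesis .
 qed
 have im: "(Lint y. of_real (Im (g y)) * cis (x * y)) = 0" for x
 proof -
  have "(Lint y. of_real (Im (g y)) * cis (x * y)) = (Lint y. (g y * cis (x * y) - cnj (g y) * cis (x * y)) / (2 * \<i>))"
   by (intro int_cong refl) (simp add: left_diff_distrib[symmetric] complex_diff_cnj field_simps)
  also have "... = 0" using ig[of x] z'[of x] zc[of x] by simp
  finally show ?thesis .
 qed
 have "AE y in lborel. Re (g y) = 0" "AE y in lborel. Im (g y) = 0"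
  by (intro real_transform_injective re im; use g in auto)+
 thus ?thesis by eventually_elim (simp add: complex_eq_iff)
qed

text \<open>A square integrable function need not be integrable; multiplied by a Gaussian it is, and
  the Gaussian has no zeros.\<close>

lemma ift_injective_L2:
 assumes g: "L2 g" and h: "L2 h"
  and eq: "!!x. (Lint y. g y * (of_real (gauss 1 y) * cis (x * y))) = (Lint y. h y * (of_real (gauss 1 y) * cis (x * y)))"
 shows "AE y in lborel. g y = h y"
proof -
 have Lg: "L2 (%y. cor (gauss 1 y))"
 proof (rule L2I)
  show "L1 (%x. (norm (cor (gauss 1 x)))^2)"
   by (rule int_bound[OF integrable_gauss[of 1]]) (auto simp: power2_eq_square mult_le_one intro!: AE_I2 mult_left_le)
 qed measurable
 have i: "L1 (%y. f y * of_real (gauss 1 y))" if f: "L2 f" for f :: "real => complex"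
  by (rule int_bound[OF L2_Cauchy_Schwarz(1)[OF f Lg]])
   (use L2_measurable[OF f] in \<open>auto simp: norm_mult\<close>)
 have "AE y in lborel. g y * of_real (gauss 1 y) - h y * of_real (gauss 1 y) = 0"
 proof (rule ift_injective)
  show "L1 (%y. g y * of_real (gauss 1 y) - h y * of_real (gauss 1 y))"
   by (intro int_diff i g h)
  show "ift (%y. g y * of_real (gauss 1 y) - h y * of_real (gauss 1 y)) x = 0" for x
   by (subst ift_diff[OF i[OF g] i[OF h]]) (use eq[of x] in \<open>simp add: ift_def mult.assoc\<close>)
 qed
 thus ?thesis
  by eventually_elim (simp add: gauss_def flip: left_diff_distrib)
qed

section \<open>The Plancherel transform\<close>

definition cut :: "(real => real) => real => real => complex" where
 "cut f R x = of_real (indicator {-R..R} x * f x)"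

lemma L2_cut: assumes "L2 f" shows "L2 (cut f R)"
 by (rule L2_bound[OF assms, where C=1])
  (use L2_measurable[OF assms] in \<open>auto simp: cut_def[abs_def] norm_mult indicator_def\<close>)

lemma integrable_cut: assumes "L2 f" shows "L1 (cut f R)"
proof -
 have L: "L2 (%x. indicator {-R..R} x :: real)"
 proof (rule L2I)
  have "(%x. (norm (indicator {-R..R} x :: real))^2) = (indicator {-R..R} :: real => real)"
   by (auto simp: indicator_def)
  thus "L1 (%x. (norm (indicator {-R..R} x :: real))^2)"
   by (simp add: emeasure_lborel_Icc_eq integrable_indicator_iff)
 qed measurable
 show ?thesis
  by (rule int_bound[OF L2_Cauchy_Schwarz(1)[OF L assms]])
   (use L2_measurable[OF assms] in \<open>auto simp: cut_def[abs_def] norm_mult indicator_def\<close>)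
qed

lemma truncated_fourier_eq: "truncated_fourier f R y = ift (cut f R) (- y)"
 unfolding truncated_fourier_def ift_def cut_def set_lebesgue_integral_def
 by (intro arg_cong2[of _ _ _ _ "(*)"] refl int_cong)
  (auto simp: indicator_def mult.commute)

lemma L2_reflect: "L2 (%x. f (- x)) \<longleftrightarrow> L2 f" for f :: "real => 'a::{real_normed_vector, second_countable_topology}"
proof -
 have "L2 (%x. f (- x))" if L: "L2 f" for f :: "real => 'a"
  using L2_measurable[OF L] L2_integrable[OF L]
  by (intro L2I) (auto simp: lborel_integrable_reflect[of "%x. (norm (f x))^2"])
 from this[of f] this[of "%x. f (- x)"] show ?thesis by auto
qed

lemma L2_norm_reflect: "L2_norm (%x. f (- x)) = L2_norm f"
 unfolding L2_norm_def using lborel_integral_reflect[of "%x. (norm (f x))^2"] by simp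

lemma L2_truncated_fourier:
 assumes "L2 f" shows "L2 (truncated_fourier f R)"
 using L2_ift(1)[OF integrable_cut[OF assms] L2_cut[OF assms]] L2_reflect[of "ift (cut f R)"]
 by (simp add: truncated_fourier_eq[abs_def])

text \<open>All differences here are square integrable, so the extended-valued integral of the
  definition is the square of the real-valued norm.\<close>

lemma is_fourier_transform_iff:
 assumes f: "L2 f"
 shows "is_fourier_transform f g \<longleftrightarrow> L2 g & ((%R. L2_norm (%y. truncated_fourier f R y - g y)) \<longlongrightarrow> 0) at_top"
proof (cases "L2 g")
 case True
 have e: "(\<integral>\<^sup>+y. ennreal ((cmod (truncated_fourier f R y - g y))^2) \<partial>lborel) = ennreal ((L2_norm (%y. truncated_fourier f R y - g y))^2)" for R
  by (intro nn_integral_sq_eq L2_diff L2_truncated_fourier f True)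
 have "((%R. ennreal ((L2_norm (%y. truncated_fourier f R y - g y))^2)) \<longlongrightarrow> ennreal 0) at_top \<longleftrightarrow>
  ((%R. (L2_norm (%y. truncated_fourier f R y - g y))^2) \<longlongrightarrow> 0) at_top"
  by (intro tendsto_ennreal_iff always_eventually) auto
 also have "... \<longleftrightarrow> ((%R. L2_norm (%y. truncated_fourier f R y - g y)) \<longlongrightarrow> 0) at_top"
 proof
  assume "((%R. (L2_norm (%y. truncated_fourier f R y - g y))^2) \<longlongrightarrow> 0) at_top"
  from tendsto_real_sqrt[OF this] show "((%R. L2_norm (%y. truncated_fourier f R y - g y)) \<longlongrightarrow> 0) at_top" by simp
 next
  assume "((%R. L2_norm (%y. truncated_fourier f R y - g y)) \<longlongrightarrow> 0) at_top"
  from tendsto_power[OF this, of 2] show "((%R. (L2_norm (%y. truncated_fourier f R y - g y))^2) \<longlongrightarrow> 0) at_top" by simp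
 qed
 finally show ?thesis using True by (simp add: is_fourier_transform_def e)
qed (simp add: is_fourier_transform_def)

lemma L2_tail_tendsto_0:
 fixes f :: "real => 'a::{real_normed_vector, second_countable_topology}"
 assumes f: "L2 f"
 shows "((%R. L2_norm (%x. indicator (- {-R..R}) x *\<^sub>R f x)) \<longlongrightarrow> 0) at_top"
proof -
 note [measurable] = L2_measurable[OF f]
 have "((%R. Lint x. (norm (indicator (- {-R..R}) x *\<^sub>R f x))^2) \<longlongrightarrow> (LINT x::real|lborel. (0::real))) at_top"
 proof (rule integral_dominated_convergence_at_top)
  show "L1 (%x. (norm (f x))^2)" by (rule L2_integrable[OF f])
  show "AE x in lborel. ((%R. (norm (indicator (- {-R..R}) x *\<^sub>R f x))^2) \<longlongrightarrow> 0) at_top"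
  proof (rule AE_I2, rule tendsto_eventually)
   fix x :: real
   show "\<forall>\<^sub>F R in at_top. (norm (indicator (- {-R..R}) x *\<^sub>R f x))^2 = 0"
    using eventually_ge_at_top[of "\<bar>x\<bar>"] by eventually_elim (auto simp: indicator_def abs_le_iff)
  qed
  show "\<forall>\<^sub>F R in at_top. AE x in lborel. norm ((norm (indicator (- {-R..R}) x *\<^sub>R f x))^2) <= (norm (f x))^2"
   by (intro always_eventually allI AE_I2) (auto simp: indicator_def)
 qed measurable
 from tendsto_real_sqrt[OF this] show ?thesis by (simp add: L2_norm_def)
qed

text \<open>The difference of two truncations is the transform of \<open>f\<close> restricted to a
  shell, so \<open>L2_ift\<close> bounds it by the tail beyond the smaller radius.\<close>

lemma truncated_fourier_diff_le:
 assumes f: "L2 f" and R: "R <= R'"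
 shows "L2_norm (%y. truncated_fourier f R' y - truncated_fourier f R y) <= L2_norm (%x. indicator (- {-R..R}) x *\<^sub>R f x)"
proof -
 let ?d = "%x. cut f R' x - cut f R x"
 have d: "L1 ?d" "L2 ?d" by (intro int_diff L2_diff integrable_cut L2_cut f)+
 have "L2_norm (%y. truncated_fourier f R' y - truncated_fourier f R y) = L2_norm (ift ?d)"
  unfolding truncated_fourier_eq using L2_norm_reflect[of "ift ?d"]
  by (simp add: ift_diff[OF integrable_cut[OF f] integrable_cut[OF f]])
 also have "... <= L2_norm ?d" by (rule L2_ift[OF d])
 also have "... <= L2_norm (%x. indicator (- {-R..R}) x *\<^sub>R f x)"
 proof (rule L2_norm_mono)
  show "L2 (%x. indicator (- {-R..R}) x *\<^sub>R f x)"
   by (rule L2_bound[OF f, where C=1]) (use L2_measurable[OF f] in \<open>auto simp: indicator_def\<close>)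
  show "cmod (?d x) <= norm (indicator (- {-R..R}) x *\<^sub>R f x)" for x
   using R by (auto simp: cut_def indicator_def)
 qed
 finally show ?thesis .
qed

lemma fourier_transform_exists:
 assumes f: "L2 f" shows "EX g. is_fourier_transform f g"
proof -
 let ?t = "%R. L2_norm (%x. indicator (- {-R..R}) x *\<^sub>R f x)"
 have "EX R. ALL r>=R. ?t r <= (1/2)^n" for n
 proof -
  have "eventually (%r. ?t r < (1/2)^n) at_top"
   using L2_tail_tendsto_0[OF f] by (rule order_tendstoD) simp
  thus ?thesis unfolding eventually_at_top_linorder by (auto intro: less_imp_le)
 qed
 then obtain S where S: "!!n r. r \<ge> S n ==> ?t r <= (1/2)^n" by metis
 \<comment> \<open>Taking maxima makes the radii increase, so each increment of the rapid sequence
   is bounded by the tail at the smaller radius.\<close>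
 define R where "R = (%n. Max (S ` {..n}))"
 have R: "S n <= R n" "R n <= R (Suc n)" for n unfolding R_def by (auto intro!: Max_mono)
 have tR: "?t (R n) <= (1/2)^n" for n by (rule S[OF R(1)])
 obtain g where g: "L2 g" "AE x in lborel. (%n. truncated_fourier f (R n) x) \<longlonglongrightarrow> g x"
  "!!n. L2_norm (%y. truncated_fourier f (R n) y - g y) <= 2 * (1/2)^n"
 proof (rule Riesz_Fischer_rapid[of "%n. truncated_fourier f (R n)"])
  show "L2 (truncated_fourier f (R n))" for n by (rule L2_truncated_fourier[OF f])
  show "L2_norm (%x. truncated_fourier f (R (Suc n)) x - truncated_fourier f (R n) x) <= (1/2)^n" for n
   using truncated_fourier_diff_le[OF f R(2)] tR order_trans by blast
 qed (rule that)
 have b: "L2_norm (%y. truncated_fourier f r y - g y) <= 3 * (1/2)^n" if "R n <= r" for r n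
 proof -
  have "L2_norm (%y. truncated_fourier f r y - g y) = L2_norm (%y. (truncated_fourier f r y - truncated_fourier f (R n) y) + (truncated_fourier f (R n) y - g y))" by simp
  also have "... <= L2_norm (%y. truncated_fourier f r y - truncated_fourier f (R n) y) + L2_norm (%y. truncated_fourier f (R n) y - g y)"
   by (intro L2_norm_triangle L2_diff L2_truncated_fourier f g)
  also have "... <= (1/2)^n + 2 * (1/2)^n"
   using truncated_fourier_diff_le[OF f that] tR[of n] g(3)[of n] by linarith
  finally show ?thesis by simp
 qed
 have "((%r. L2_norm (%y. truncated_fourier f r y - g y)) \<longlongrightarrow> 0) at_top"
 proof (rule tendstoI)
  fix e :: real assume e: "0 < e"
  have "(%n. 3 * (1/2::real)^n) \<longlonglongrightarrow> 3 * 0"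
   by (intro tendsto_mult tendsto_const LIMSEQ_power_zero) simp
  hence "eventually (%n. 3 * (1/2::real)^n < e) sequentially"
   using e by (intro order_tendstoD) auto
  then obtain n where n: "3 * (1/2::real)^n < e" by (metis eventually_sequentially order_refl)
  show "\<forall>\<^sub>F r in at_top. dist (L2_norm (%y. truncated_fourier f r y - g y)) 0 < e"
   using eventually_ge_at_top[of "R n"]
  proof eventually_elim
   case (elim r)
   thus ?case using b[OF elim] n by simp
  qed
 qed
 thus ?thesis using g is_fourier_transform_iff[OF f] by blast
qed

lemma is_fourier_transform_fourier: "L2 f ==> is_fourier_transform f (fourier f)"
 unfolding fourier_def using fourier_transform_exists by (rule someI_ex)

lemma is_fourier_transformD:
 assumes "is_fourier_transform f g" "L2 f"
 shows "L2 g" "((%R. L2_norm (%y. truncated_fourier f R y - g y)) \<longlongrightarrow> 0) at_top"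
 using assms is_fourier_transform_iff by blast+

lemma L2_norm_eq_0_AE:
 fixes f :: "real => 'a::{real_normed_vector, second_countable_topology}"
 assumes "L2 f" "L2_norm f = 0" shows "AE x in lborel. f x = 0"
proof -
 have "(Lint x. (norm (f x))^2) = 0" using assms(2) by (simp add: L2_norm_def)
 thus ?thesis using integral_nonneg_eq_0_iff_AE[OF L2_integrable[OF assms(1)]] by simp
qed

lemma is_fourier_transform_unique:
 assumes f: "L2 f" and g: "is_fourier_transform f g" "is_fourier_transform f h"
 shows "AE y in lborel. g y = h y"
proof -
 note G = is_fourier_transformD[OF g(1) f] and H = is_fourier_transformD[OF g(2) f]
 have "((%R. L2_norm (%y. truncated_fourier f R y - g y) + L2_norm (%y. truncated_fourier f R y - h y)) \<longlongrightarrow> 0 + 0) at_top"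
  by (intro tendsto_add G H)
 moreover have "L2_norm (%y. g y - h y) <= L2_norm (%y. truncated_fourier f R y - g y) + L2_norm (%y. truncated_fourier f R y - h y)" for R
  using L2_norm_triangle[of "%y. g y - truncated_fourier f R y" "%y. truncated_fourier f R y - h y"]
   L2_truncated_fourier[OF f] G H
  by (simp add: L2_diff L2_norm_minus_commute[of g])
 ultimately have "L2_norm (%y. g y - h y) <= 0 + 0"
  by (intro tendsto_lowerbound) (auto intro: always_eventually)
 hence "L2_norm (%y. g y - h y) = 0" by (simp add: antisym)
 from L2_norm_eq_0_AE[OF L2_diff this] show ?thesis using G H by auto
qed

lemma is_fourier_transform_cong_AE:
 assumes f: "L2 f" and g: "is_fourier_transform f g" and h: "h : Borel" "AE y in lborel. g y = h y"
 shows "is_fourier_transform f h"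
proof -
 note G = is_fourier_transformD[OF g f]
 have "L2_norm (%y. truncated_fourier f R y - h y) = L2_norm (%y. truncated_fourier f R y - g y)" for R
  using L2_measurable[OF L2_truncated_fourier[OF f]] L2_measurable[OF G(1)] h
  by (intro L2_norm_cong_AE) auto
 thus ?thesis using is_fourier_transform_iff[OF f] G L2_cong_AE[OF G(1) h] by simp
qed

lemma L2_norm_cut_le: assumes "L2 f" shows "L2_norm (cut f R) <= L2_norm f"
 by (rule L2_norm_mono[OF assms]) (simp add: cut_def indicator_def)

lemma Bessel:
 assumes f: "L2 f" and g: "is_fourier_transform f g" shows "L2_norm g <= L2_norm f"
proof -
 note G = is_fourier_transformD[OF g f]
 have t: "L2_norm (truncated_fourier f R) <= L2_norm f" for R
  using L2_ift(2)[OF integrable_cut[OF f, of R] L2_cut[OF f, of R]] L2_norm_cut_le[OF f, of R] L2_norm_reflect[of "ift (cut f R)"]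
  by (simp add: truncated_fourier_eq[abs_def])
 have "L2_norm g <= L2_norm f + L2_norm (%y. truncated_fourier f R y - g y)" for R
  using L2_norm_triangle[of "truncated_fourier f R" "%y. g y - truncated_fourier f R y"]
   L2_truncated_fourier[OF f, of R] G(1) t[of R]
  by (simp add: L2_diff L2_norm_minus_commute[of g])
 moreover have "((%R. L2_norm f + L2_norm (%y. truncated_fourier f R y - g y)) \<longlongrightarrow> L2_norm f + 0) at_top"
  by (intro tendsto_intros G)
 ultimately have "L2_norm g <= L2_norm f + 0"
  by (intro tendsto_lowerbound) (auto intro: always_eventually)
 thus ?thesis by simp
qed

lemma L2_gauss: assumes "0 < \<sigma>" shows "L2 (%m. cor (gauss \<sigma> m))"
proof (rule L2I)
 show "L1 (%x. (norm (cor (gauss \<sigma> x)))^2)"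
  by (rule int_bound[OF integrable_gauss[OF assms]])
   (auto simp: power2_eq_square mult_le_one intro!: AE_I2 mult_left_le)
qed measurable

lemma L2_mult_integrable:
 fixes f g :: "real => 'a::{real_normed_field, banach, second_countable_topology}"
 assumes "L2 f" "L2 g"
 shows "L1 (%x. f x * g x)" "norm (Lint x. f x * g x) <= L2_norm f * L2_norm g"
  "(Lint x. norm (f x * g x)) <= L2_norm f * L2_norm g"
proof -
 note CS = L2_Cauchy_Schwarz[OF assms]
 note [measurable] = L2_measurable[OF assms(1)] L2_measurable[OF assms(2)]
 show "L1 (%x. f x * g x)"
  by (rule int_bound[OF CS(1)]) (auto simp: norm_mult)
 show le: "(Lint x. norm (f x * g x)) <= L2_norm f * L2_norm g"
  using CS(2) by (simp add: norm_mult)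
 show "norm (Lint x. f x * g x) <= L2_norm f * L2_norm g"
  by (rule order_trans[OF integral_norm_bound le])
qed

text \<open>The transform of \<open>f\<close> is only an L^2 limit. Paired with a modulated Gaussian
  it becomes a pointwise quantity, a Gaussian mean of \<open>f\<close> around \<open>x\<close>;
  inversion and several identifications of transforms below compare such pairings.\<close>

lemma fourier_transform_gauss_pairing:
 assumes f: "L2 f" and g: "is_fourier_transform f g" and s: "0 < \<sigma>"
 shows "(Lint m. g m * (of_real (gauss \<sigma> m) * cis (x * m))) =
  (Lint y. of_real (f y) * of_real (gauss (1 / \<sigma>) (x - y) / \<sigma>))"
proof -
 note G = is_fourier_transformD[OF g f]
 note [measurable] = L2_measurable[OF f]
 let ?\<gamma> = "%m. of_real (gauss \<sigma> m) * cis (x * m)"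
 let ?K = "%y. cor (gauss (1 / \<sigma>) (x - y) / \<sigma>)"
 have L\<gamma>: "L2 ?\<gamma>"
  by (rule L2_bound[OF L2_gauss[OF s], where C=1]) (auto simp: norm_mult)
 have eq: "(Lint m. truncated_fourier f R m * ?\<gamma> m) = (Lint y. cut f R y * ?K y)" for R
 proof -
  have "(Lint m. truncated_fourier f R m * ?\<gamma> m)
   = (Lint m. truncated_fourier f R (- m) * ?\<gamma> (- m))"
   by (rule lborel_integral_reflect[symmetric])
  also have "... = (Lint m. ift (cut f R) m * (of_real (gauss \<sigma> m) * cis ((- x) * m)))"
   by (simp add: truncated_fourier_eq)
  also have "... = (Lint y. cut f R y * ift (%m. of_real (gauss \<sigma> m) * cis ((- x) * m)) y)"
   by (intro ift_mult_formula integrable_cut f integrable_mult_cis' integrable_of_real integrable_gauss s)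
  also have "... = (Lint y. cut f R y * ?K y)"
  proof -
   have "gauss (1 / \<sigma>) (- x + y) = gauss (1 / \<sigma>) (x - y)" for y
    using gauss_minus[of "1/\<sigma>" "x - y"] by simp
   thus ?thesis unfolding ift_gauss_shift[OF s] by simp
  qed
  finally show ?thesis .
 qed
 have "((%R. Lint m. truncated_fourier f R m * ?\<gamma> m) \<longlongrightarrow> (Lint m. g m * ?\<gamma> m)) at_top"
 proof (rule LIM_zero_cancel, rule Lim_null_comparison)
  show "((%R. L2_norm (%m. truncated_fourier f R m - g m) * L2_norm ?\<gamma>) \<longlongrightarrow> 0) at_top"
   using tendsto_mult_right[OF G(2), of "L2_norm ?\<gamma>"] by simp
  show "\<forall>\<^sub>F R in at_top. cmod ((Lint m. truncated_fourier f R m * ?\<gamma> m) - (Lint m. g m * ?\<gamma> m)) <=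
   L2_norm (%m. truncated_fourier f R m - g m) * L2_norm ?\<gamma>"
  proof (intro always_eventually allI)
   fix R
   have "(Lint m. truncated_fourier f R m * ?\<gamma> m) - (Lint m. g m * ?\<gamma> m)
    = (Lint m. (truncated_fourier f R m - g m) * ?\<gamma> m)"
    unfolding left_diff_distrib
    by (intro lint_diff[symmetric] L2_mult_integrable L2_truncated_fourier f G L\<gamma>)
   thus "cmod ((Lint m. truncated_fourier f R m * ?\<gamma> m) - (Lint m. g m * ?\<gamma> m)) <=
    L2_norm (%m. truncated_fourier f R m - g m) * L2_norm ?\<gamma>"
    using L2_mult_integrable(2)[OF L2_diff[OF L2_truncated_fourier[OF f] G(1)] L\<gamma>, of R] by simp
  qed
 qed
 moreover have "((%R. Lint y. cut f R y * ?K y) \<longlongrightarrow> (Lint y. of_real (f y) * ?K y)) at_top"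
 proof (rule integral_dominated_convergence_at_top)
  have "L2 (%y. gauss (1 / \<sigma>) (x - y) / \<sigma>)"
  proof (rule L2I)
   show "L1 (%y. (norm (gauss (1 / \<sigma>) (x - y) / \<sigma>))^2)"
    using L2_integrable[OF L2_cmult[OF L2_gauss[of "1/\<sigma>"], of "1/\<sigma>"]] s
     lborel_integrable_real_affine_iff[of "-1" "%y. (norm (cor (1/\<sigma>) * of_real (gauss (1 / \<sigma>) y)))^2" x]
    by (simp add: norm_mult norm_divide)
  qed measurable
  from L2_Cauchy_Schwarz(1)[OF f this] show "L1 (%y. norm (f y) * norm (gauss (1 / \<sigma>) (x - y) / \<sigma>))" .
  show "AE y in lborel. ((%R. cut f R y * ?K y) \<longlongrightarrow> of_real (f y) * ?K y) at_top"
  proof (rule AE_I2, rule tendsto_eventually)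
   fix y :: real
   show "\<forall>\<^sub>F R in at_top. cut f R y * ?K y = of_real (f y) * ?K y"
    using eventually_ge_at_top[of "\<bar>y\<bar>"] by eventually_elim (auto simp: cut_def indicator_def abs_le_iff)
  qed
  show "\<forall>\<^sub>F R in at_top. AE y in lborel. norm (cut f R y * ?K y) <= norm (f y) * norm (gauss (1 / \<sigma>) (x - y) / \<sigma>)"
   by (intro always_eventually allI AE_I2) (auto simp: cut_def indicator_def norm_mult norm_divide)
 qed (simp_all add: cut_def[abs_def])
 ultimately show ?thesis unfolding eq by (intro tendsto_unique) auto
qed

text \<open>Near \<open>x\<close> continuity is used. Away from \<open>x\<close> the function may be
  unbounded, so the kernel must supply the decay: with \<open>N = real (Suc n)\<close> it is at most
  \<open>(1 / N) * (2 / (y - x)^2)\<close>, and one integrable majorant \<open>H\<close> with the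
  factor \<open>1 / N\<close> serves all \<open>n\<close>.\<close>

lemma gauss_approximate_identity:
 fixes f :: "real => real"
 assumes f: "L2 f" and c: "isCont f x"
 shows "(%n. Lint y. f y * (gauss (real (Suc n)) (x - y) * real (Suc n))) \<longlonglongrightarrow> sqrt (2 * pi) * f x"
proof (rule LIMSEQ_I)
 note [measurable] = L2_measurable[OF f]
 fix r :: real assume r: "0 < r"
 define e where "e = r / (2 * sqrt (2 * pi))"
 have e: "0 < e" unfolding e_def using r by simp
 obtain d where d: "0 < d" "!!y. \<bar>y - x\<bar> < d ==> \<bar>f y - f x\<bar> < e"
  using c e unfolding continuous_at_eps_delta dist_real_def by metis
 let ?k = "%n y. gauss (real (Suc n)) (x - y) * real (Suc n)"
 have k0: "0 <= ?k n y" for n y by simp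
 have ki: "L1 (?k n)" for n
  using lborel_integrable_real_affine[OF integrable_gauss[of "real (Suc n)"], of "-1" x] by simp
 have kI: "(Lint y. ?k n y) = sqrt (2 * pi)" for n
  using lborel_integral_real_affine[of "-1" "%y. gauss (real (Suc n)) y * real (Suc n)" x] integral_gauss[of "real (Suc n)"]
  by simp
 let ?A = "{y. d <= \<bar>y - x\<bar>}"
 let ?p = "%y. indicator ?A y * (1 / (y - x)^2)"
 have [measurable]: "?A : sets borel" by measurable
 have p1: "L1 ?p"
 proof (rule int_bound)
  show "L1 (%y. (1 + 1 / d^2) * (1 / (1 + (- x + 1 * y)^2)))"
   by (intro integrable_mult_right lborel_integrable_real_affine[OF integrable_lborel_inverse_square]) simp
  show "AE y in lborel. norm (?p y) <= norm ((1 + 1 / d^2) * (1 / (1 + (- x + 1 * y)^2)))"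
  proof (rule AE_I2)
   fix y
   show "norm (?p y) <= norm ((1 + 1 / d^2) * (1 / (1 + (- x + 1 * y)^2)))"
   proof (cases "y : ?A")
    case True
    hence "d^2 <= \<bar>y - x\<bar>^2" using d by (intro power_mono) auto
    hence q: "d^2 <= (y - x)^2" by simp
    hence q0: "0 < (y - x)^2" using d by (smt (verit) zero_less_power)
    have "1 <= (y - x)^2 / d^2" using q d by simp
    hence "1 * (1 + (y - x)^2) <= (1 + 1 / d^2) * (y - x)^2" by (simp add: distrib_right)
    moreover have p: "0 < 1 + (y - x)^2" using q0 by linarith
    ultimately have "1 * (1 + (y - x)^2) / ((y - x)^2 * (1 + (y - x)^2)) <= (1 + 1 / d^2) * (y - x)^2 / ((y - x)^2 * (1 + (y - x)^2))"
     using q0 by (intro divide_right_mono) auto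
    hence "1 / (y - x)^2 <= (1 + 1 / d^2) / (1 + (y - x)^2)"
     using q0 p by (metis mult.commute mult_divide_mult_cancel_right order_less_irrefl)
    thus ?thesis using True by (simp add: abs_mult add_pos_nonneg)
   qed simp
  qed
 qed measurable
 have pL: "L2 ?p"
 proof (rule L2I)
  show "L1 (%y. (norm (?p y))^2)"
  proof (rule int_bound)
   show "L1 (%y. (1/d^2) * ?p y)" using p1 by (rule integrable_mult_right)
   show "AE y in lborel. norm ((norm (?p y))^2) <= norm ((1/d^2) * ?p y)"
   proof (rule AE_I2)
    fix y
    show "norm ((norm (?p y))^2) <= norm ((1/d^2) * ?p y)"
    proof (cases "y : ?A")
     case True
     hence "d^2 <= \<bar>y - x\<bar>^2" using d by (intro power_mono) auto
     hence "1 / (y - x)^2 <= 1 / d^2" using d by (intro divide_left_mono) (auto intro!: mult_pos_pos)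
     hence "1 / (y - x)^2 * (1 / (y - x)^2) <= 1 / d^2 * (1 / (y - x)^2)" by (intro mult_right_mono) auto
     thus ?thesis using True by (simp add: power2_eq_square abs_mult)
    qed simp
   qed
  qed measurable
 qed measurable
 define H where "H = (%y. 2 * (norm (f y) * norm (?p y)) + 2 * \<bar>f x\<bar> * ?p y)"
 have Hi: "L1 H"
  unfolding H_def using L2_Cauchy_Schwarz(1)[OF f pL] p1 by (intro int_add integrable_mult_right)
 have kL: "L2 (?k n)" for n
 proof (rule L2I)
  show "L1 (%y. (norm (?k n y))^2)"
  proof (rule int_bound)
   show "L1 (%y. real (Suc n) * ?k n y)" by (intro integrable_mult_right ki)
   show "AE y in lborel. norm ((norm (?k n y))^2) <= norm (real (Suc n) * ?k n y)"
   proof (rule AE_I2)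
    fix y
    have "?k n y * ?k n y <= real (Suc n) * ?k n y"
     by (intro mult_right_mono k0) (simp add: mult_le_cancel_right2)
    thus "norm ((norm (?k n y))^2) <= norm (real (Suc n) * ?k n y)"
     by (simp add: power2_eq_square)
   qed
  qed measurable
 qed measurable
 have fk: "L1 (%y. f y * ?k n y)" for n
  using L2_mult_integrable(1)[OF f kL[of n]] by simp
 have pt: "\<bar>(f y - f x) * ?k n y\<bar> <= e * ?k n y + (1 / real (Suc n)) * H y" for n y
 proof (cases "y : ?A")
  case False
  hence "\<bar>f y - f x\<bar> <= e" using d(2)[of y] by force
  hence "\<bar>f y - f x\<bar> * ?k n y <= e * ?k n y" by (intro mult_right_mono) auto
  moreover have "H y = 0" using False by (simp add: H_def)
  ultimately show ?thesis by (simp add: abs_mult)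
 next
  case True
  define N where "N = real (Suc n)"
  define z where "z = (y - x)^2"
  have N: "0 < N" by (simp add: N_def)
  have z: "0 < z" using True d by (auto simp: z_def)
  have "N^2 * z / 2 <= exp (N^2 * z / 2)" using exp_ge_add_one_self[of "N^2 * z / 2"] by linarith
  hence "exp (- (N^2 * z / 2)) <= 2 / (N^2 * z)"
   using N z by (simp add: exp_minus field_simps)
  moreover have "gauss N (x - y) = exp (- (N^2 * z / 2))"
   by (simp add: gauss_def z_def power_mult_distrib power2_commute)
  ultimately have "gauss N (x - y) * N <= 2 / (N^2 * z) * N" using N by (intro mult_right_mono) auto
  also have "... = (1 / N) * (2 / z)" using N z by (simp add: field_simps power2_eq_square)
  finally have k: "gauss N (x - y) * N <= (1 / N) * (2 / z)" .
  have "\<bar>(f y - f x) * (gauss N (x - y) * N)\<bar> <= (\<bar>f y\<bar> + \<bar>f x\<bar>) * ((1 / N) * (2 / z))"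
   unfolding abs_mult[of "f y - f x"] by (rule mult_mono) (use k N in auto)
  also have "... = (1 / N) * H y" using True z by (simp add: H_def z_def algebra_simps add_divide_distrib)
  also have "... <= e * (gauss N (x - y) * N) + (1 / N) * H y" using e N by simp
  finally show ?thesis unfolding N_def .
 qed
 have main: "\<bar>(Lint y. f y * ?k n y) - sqrt (2 * pi) * f x\<bar> <= r / 2 + (1 / real (Suc n)) * (Lint y. H y)" for n
 proof -
  have "(Lint y. f y * ?k n y) - sqrt (2 * pi) * f x = (Lint y. f y * ?k n y) - (Lint y. f x * ?k n y)"
   using kI[of n] by simp
  also have "... = (Lint y. f y * ?k n y - f x * ?k n y)"
   by (intro lint_diff[symmetric] fk integrable_mult_right ki)
  also have "... = (Lint y. (f y - f x) * ?k n y)" by (simp only: left_diff_distrib)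
  finally have "\<bar>(Lint y. f y * ?k n y) - sqrt (2 * pi) * f x\<bar> <= (Lint y. \<bar>(f y - f x) * ?k n y\<bar>)"
   by (simp only: integral_abs_bound)
  also have "... <= (Lint y. e * ?k n y + (1 / real (Suc n)) * H y)"
  proof (rule integral_mono)
   show "L1 (%y. \<bar>(f y - f x) * ?k n y\<bar>)"
    using int_diff[OF fk[of n] integrable_mult_right[OF ki[of n], of "f x"]]
    by (intro integrable_abs) (simp only: left_diff_distrib)
   show "L1 (%y. e * ?k n y + (1 / real (Suc n)) * H y)"
    by (intro int_add integrable_mult_right ki Hi)
  qed (rule pt)
  also have "... = e * sqrt (2 * pi) + (1 / real (Suc n)) * (Lint y. H y)"
   using ki Hi kI[of n] by (subst lint_add) auto
  also have "e * sqrt (2 * pi) = r / 2" by (simp add: e_def)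
  finally show ?thesis .
 qed
 have "(%n. (1 / real (Suc n)) * (Lint y. H y)) \<longlonglongrightarrow> 0 * (Lint y. H y)"
  using LIMSEQ_inverse_real_of_nat by (intro tendsto_mult tendsto_const) (simp add: inverse_eq_divide)
 hence "eventually (%n. (1 / real (Suc n)) * (Lint y. H y) < r / 2) sequentially"
  using r by (intro order_tendstoD) auto
 then obtain n0 where n0: "!!n. n \<ge> n0 ==> (1 / real (Suc n)) * (Lint y. H y) < r / 2"
  unfolding eventually_sequentially by blast
 show "EX no. ALL n>=no. norm ((Lint y. f y * ?k n y) - sqrt (2 * pi) * f x) < r"
 proof (intro exI allI impI)
  fix n assume "n0 <= n"
  from n0[OF this] main[of n] show "norm ((Lint y. f y * ?k n y) - sqrt (2 * pi) * f x) < r"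
   unfolding real_norm_def by linarith
 qed
qed

text \<open>As the Gaussian spreads out, its pairings with \<open>g\<close> have two limits: the
  inversion integral, by dominated convergence with majorant \<open>cmod (g m)\<close>, and a
  multiple of \<open>f x\<close>, because the dual kernels concentrate at \<open>x\<close>.\<close>

lemma Fourier_inversion:
 assumes f: "L2 f" and g: "is_fourier_transform f g" "L1 g" and c: "isCont f x"
 shows "of_real (f x) = ift g x"
proof -
 note [measurable] = borel_measurable_integrable[OF g(2)]
 let ?l = "%n. Lint m. g m * (of_real (gauss (1 / real (Suc n)) m) * cis (x * m))"
 have "?l \<longlonglongrightarrow> (Lint m. g m * (of_real 1 * cis (x * m)))"
 proof (rule integral_dominated_convergence[where w="%m. cmod (g m)"])
  show "AE m in lborel. (%n. g m * (of_real (gauss (1 / real (Suc n)) m) * cis (x * m))) \<longlonglongrightarrow> g m * (of_real 1 * cis (x * m))"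
  proof (rule AE_I2)
   fix m
   have "(%n. gauss (1 / real (Suc n)) m) \<longlonglongrightarrow> exp (- ((0 * m)^2 / 2))"
    unfolding gauss_def using LIMSEQ_inverse_real_of_nat
    by (intro tendsto_intros) (auto simp: inverse_eq_divide)
   thus "(%n. g m * (of_real (gauss (1 / real (Suc n)) m) * cis (x * m))) \<longlonglongrightarrow> g m * (of_real 1 * cis (x * m))"
    by (intro tendsto_intros) simp
  qed
  show "AE m in lborel. norm (g m * (of_real (gauss (1 / real (Suc n)) m) * cis (x * m))) <= cmod (g m)" for n
   by (intro AE_I2) (simp add: norm_mult mult_left_le)
 qed (use g in auto)
 moreover have "?l n = of_real (Lint y. f y * (gauss (real (Suc n)) (x - y) * real (Suc n)))" for n
  by (subst fourier_transform_gauss_pairing[OF f g(1)])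
   (auto simp: mult.assoc simp flip: integral_complex_of_real)
 hence "?l \<longlonglongrightarrow> of_real (sqrt (2 * pi) * f x)"
  using gauss_approximate_identity[OF f c] by (simp only: tendsto_of_real_iff)
 ultimately have "(Lint m. g m * (of_real 1 * cis (x * m))) = of_real (sqrt (2 * pi) * f x)"
  by (rule LIMSEQ_unique)
 thus ?thesis by (simp add: ift_def)
qed

text \<open>Inversion in the opposite order: the abstract transform \<open>h\<close> of
  \<open>f\<close> and the given \<open>g\<close> have equal Gaussian pairings, so they agree almost
  everywhere.\<close>

lemma is_fourier_transform_ift:
 assumes g: "L1 g" "L2 g" and f: "!!x. of_real (f x) = ift g x"
 shows "L2 f" "is_fourier_transform f g"
proof -
 have fR: "f = (%x. Re (ift g x))" using f by (metis Re_complex_of_real)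
 have [measurable]: "f : Borel" unfolding fR using ift_measurable[OF g(1)] by measurable
 show L: "L2 f"
  by (rule L2_bound[OF L2_ift(1)[OF g], where C=1]) (auto simp flip: f)
 obtain h where h: "is_fourier_transform f h" using fourier_transform_exists[OF L] by blast
 note H = is_fourier_transformD[OF h L]
 have "AE m in lborel. h m = g m"
  by (rule ift_injective_L2[OF H(1) g(2)])
   (simp only: fourier_transform_gauss_pairing[OF L h zero_less_one] gauss_pairing[OF g(1) zero_less_one, symmetric] f)
 thus "is_fourier_transform f g" using is_fourier_transform_cong_AE[OF L h] L2_measurable[OF g(2)] by blast
qed

lemma ift_ift:
 assumes g: "L1 g" and f: "L1 (ift g)"
 shows "AE m in lborel. ift (ift g) (- m) = g m"
proof -
 note [measurable] = borel_measurable_integrable[OF g] ift_measurable[OF f]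
 have i1: "L1 (%m. ift (ift g) (- m) * of_real (gauss 1 m))"
 proof (rule int_bound)
  show "L1 (%m. 1 / sqrt (2 * pi) * (Lint x. cmod (ift g x)) * gauss 1 m)"
   by (intro integrable_mult_right integrable_gauss) simp
  show "AE m in lborel. norm (ift (ift g) (- m) * of_real (gauss 1 m)) <= norm (1 / sqrt (2 * pi) * (Lint x. cmod (ift g x)) * gauss 1 m)"
  proof (rule AE_I2)
   fix m
   show "norm (ift (ift g) (- m) * of_real (gauss 1 m)) <= norm (1 / sqrt (2 * pi) * (Lint x. cmod (ift g x)) * gauss 1 m)"
    using mult_right_mono[OF norm_ift_le[of "ift g" "-m"] gauss_nonneg[of 1 m]] by (simp add: norm_mult)
  qed
 qed measurable
 have i2: "L1 (%m. g m * of_real (gauss 1 m))"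
  by (rule int_bound[OF g]) (auto simp: norm_mult mult_left_le)
 have eq: "(Lint m. ift (ift g) (- m) * (of_real (gauss 1 m) * cis (x * m))) = (Lint m. g m * (of_real (gauss 1 m) * cis (x * m)))" for x
 proof -
  have "(Lint m. ift (ift g) (- m) * (of_real (gauss 1 m) * cis (x * m)))
   = (Lint m. ift (ift g) m * (of_real (gauss 1 m) * cis ((- x) * m)))"
   using lborel_integral_reflect[of "%m. ift (ift g) (- m) * (of_real (gauss 1 m) * cis (x * m))"] by simp
  also have "... = (Lint y. ift g y * ift (%m. of_real (gauss 1 m) * cis ((- x) * m)) y)"
   by (intro ift_mult_formula f integrable_mult_cis' integrable_of_real integrable_gauss) simp
  also have "... = (Lint y. ift g y * of_real (gauss (1/1) (x - y) / 1))"
  proof -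
   have "gauss (1 / 1) (- x + y) = gauss (1 / 1) (x - y)" for y
    using gauss_minus[of 1 "x - y"] by simp
   thus ?thesis unfolding ift_gauss_shift[OF zero_less_one] by simp
  qed
  also have "... = (Lint m. g m * (of_real (gauss 1 m) * cis (x * m)))"
   by (rule gauss_pairing[OF g zero_less_one])
  finally show ?thesis .
 qed
 have "AE m in lborel. ift (ift g) (- m) * of_real (gauss 1 m) - g m * of_real (gauss 1 m) = 0"
 proof (rule ift_injective)
  show "L1 (%m. ift (ift g) (- m) * of_real (gauss 1 m) - g m * of_real (gauss 1 m))"
   by (intro int_diff i1 i2)
  show "ift (%m. ift (ift g) (- m) * of_real (gauss 1 m) - g m * of_real (gauss 1 m)) x = 0" for x
   by (subst ift_diff[OF i1 i2]) (use eq[of x] in \<open>simp add: ift_def[of _ x] mult.assoc\<close>)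
 qed
 thus ?thesis by eventually_elim (simp add: gauss_def flip: left_diff_distrib)
qed

section \<open>Convolution\<close>

definition cnv :: "(real => complex) => (real => complex) => real => complex" where
 "cnv a b p = (Lint q. a (p - q) * b q)"

lemma cnv_measurable[measurable]:
 assumes [measurable]: "a : Borel" "b : Borel"
 shows "cnv a b : Borel"
 unfolding cnv_def[abs_def] by measurable

lemma L2_shift: assumes "L2 a" shows "L2 (%q. a (p - q))" "L2_norm (%q. a (p - q)) = L2_norm a"
proof -
 note [measurable] = L2_measurable[OF assms]
 show "L2 (%q. a (p - q))"
  using lborel_integrable_real_affine[OF L2_integrable[OF assms], of "-1" p] by (intro L2I) auto
 show "L2_norm (%q. a (p - q)) = L2_norm a"
  using lborel_integral_real_affine[of "-1" "%q. (norm (a q))^2" p] by (simp add: L2_norm_def)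
qed

lemma integrable_cnv_kernel:
 fixes a b :: "real => complex"
 assumes a: "L1 a" and b: "L1 b"
 shows "integrable lborel2 (%(p, q). a (p - q) * b q :: complex)"
proof -
 note [measurable] = borel_measurable_integrable[OF a] borel_measurable_integrable[OF b]
 have ai: "L1 (%p. a (p - q))" for q
  using lborel_integrable_real_affine[OF a, of 1 "-q"] by simp
 have "integrable lborel2 (%(q, p). a (p - q) * b q)"
 proof (rule lborel_pair.Fubini_integrable)
  have "(Lint p. cmod (a (p - q))) = (Lint p. cmod (a p))" for q
   using lborel_integral_real_affine[of 1 "%p. cmod (a p)" "-q"] by simp
  thus "L1 (%x. Lint y. cmod (case (x, y) of (q, p) => a (p - q) * b q))"
   using b by (simp add: norm_mult)
  show "AE x in lborel. L1 (%y. case (x, y) of (q, p) => a (p - q) * b q)"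
   using ai by simp
 qed measurable
 thus ?thesis using lborel_pair.integrable_product_swap_iff[of "%(q, p). a (p - q) * b q"] by simp
qed

lemma integrable_cnv: "L1 a ==> L1 b ==> L1 (cnv a b)"
 unfolding cnv_def[abs_def] using lborel_pair.integrable_fst[OF integrable_cnv_kernel] by simp

lemma ift_cnv:
 assumes a: "L1 a" and b: "L1 b"
 shows "ift (cnv a b) x = of_real (sqrt (2 * pi)) * (ift a x * ift b x)"
proof -
 note [measurable] = borel_measurable_integrable[OF a] borel_measurable_integrable[OF b]
 have i: "integrable lborel2 (%(p, q). a (p - q) * b q * cis (x * p))"
  by (rule int_bound[OF integrable_cnv_kernel[OF a b]]) (measurable, auto simp: norm_mult)
 have "(Lint p. cnv a b p * cis (x * p)) = (Lint p. Lint q. a (p - q) * b q * cis (x * p))"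
  by (simp add: cnv_def)
 also have "... = (Lint q. Lint p. a (p - q) * b q * cis (x * p))"
  by (rule lborel_pair.Fubini_integral[symmetric, OF i])
 also have "... = (Lint q. (Lint p. a p * cis (x * p)) * (b q * cis (x * q)))"
 proof (intro int_cong refl)
  fix q
  have "(Lint p. a (p - q) * b q * cis (x * p)) = (Lint p. a (q + 1 * p - q) * b q * cis (x * (q + 1 * p)))"
   using lborel_integral_real_affine[of 1 "%p. a (p - q) * b q * cis (x * p)" q] by simp
  also have "... = (Lint p. (a p * cis (x * p)) * (b q * cis (x * q)))"
   by (intro int_cong refl) (simp add: distrib_left cis_mult[symmetric] mult_ac)
  finally show "(Lint p. a (p - q) * b q * cis (x * p)) = (Lint p. a p * cis (x * p)) * (b q * cis (x * q))"
   by simp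
 qed
 finally show ?thesis
  by (simp add: ift_def power2_eq_square[symmetric] flip: of_real_mult of_real_power)
   (simp add: field_simps flip: of_real_mult)
qed

text \<open>Cauchy-Schwarz with respect to the measure of density \<open>cmod (a (p - q))\<close>,
  then Tonelli. The function \<open>f\<close> is only assumed to be dominated, so the lemma covers
  convolutions and the positive majorants in \<open>hs_cnv\<close> alike.\<close>

lemma Young_L1_L2:
 assumes a: "L1 a" and b: "L2 b"
  and aa: "!!p. cmod (f p) <= (Lint q. cmod (a (p - q)) * cmod (b q))"
  and [measurable]: "f : Borel"
 shows "L2 f" "L2_norm f <= (Lint x. cmod (a x)) * L2_norm b"
proof -
 note [measurable] = borel_measurable_integrable[OF a] L2_measurable[OF b]
 define A where "A = (Lint x. cmod (a x))"
 have A0: "0 <= A" by (simp add: A_def)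
 have ai: "L1 (%q. cmod (a (p - q)))" "(Lint q. cmod (a (p - q))) = A" for p
  using lborel_integrable_real_affine[OF integrable_norm[OF a], of "-1" p]
   lborel_integral_real_affine[of "-1" "%q. cmod (a q)" p] by (auto simp: A_def)
 have nA: "(\<integral>\<^sup>+p. ennreal (cmod (a (p - q))) \<partial>lborel) = ennreal A" for q
  using lborel_integrable_real_affine[OF integrable_norm[OF a], of 1 "-q"]
   lborel_integral_real_affine[of 1 "%q. cmod (a q)" "-q"]
  by (subst nn_integral_eq_integral) (auto simp: A_def)
 have pt: "ennreal ((cmod (f p))^2) <= ennreal A * (\<integral>\<^sup>+q. ennreal (cmod (a (p - q))) * ennreal ((cmod (b q))^2) \<partial>lborel)" for p
 proof (cases "(\<integral>\<^sup>+q. ennreal (cmod (a (p - q)) * (cmod (b q))^2) \<partial>lborel) = \<infinity>")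
  case False
  have ib: "L1 (%q. cmod (a (p - q)) * (cmod (b q))^2)"
   using False by (intro integrableI_bounded) (auto simp: less_top)
  let ?s = "%q. sqrt (cmod (a (p - q)))"
  have i1: "L1 (%q. (?s q)^2)" and i2: "L1 (%q. (?s q * cmod (b q))^2)"
   using ai(1) ib by (simp_all add: power_mult_distrib)
  have "(cmod (f p))^2 <= (Lint q. cmod (a (p - q)) * cmod (b q))^2"
   by (intro power_mono aa) simp
  also have "... = (Lint q. ?s q * (?s q * cmod (b q)))^2" by (simp add: mult.assoc[symmetric])
  also have "... <= (Lint q. (?s q)^2) * (Lint q. (?s q * cmod (b q))^2)"
   by (intro Cauchy_Schwarz_integral(2) i1 i2) measurable
  also have "... = A * (Lint q. cmod (a (p - q)) * (cmod (b q))^2)"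
   using ai(2)[of p] by (simp add: power_mult_distrib)
  finally have "ennreal ((cmod (f p))^2) <= ennreal (A * (Lint q. cmod (a (p - q)) * (cmod (b q))^2))" by (rule ennreal_leI)
  also have "... = ennreal A * (\<integral>\<^sup>+q. ennreal (cmod (a (p - q)) * (cmod (b q))^2) \<partial>lborel)"
   using A0 by (subst nn_integral_eq_integral[OF ib]) (auto simp: ennreal_mult')
  finally show ?thesis by (simp add: ennreal_mult')
 next
  case True
  \<comment> \<open>The right-hand side is infinite unless \<open>A = 0\<close>, and then
    \<open>a (p - q)\<close> vanishes for almost every \<open>q\<close>.\<close>
  show ?thesis
  proof (cases "A = 0")
   case True
   have "AE q in lborel. cmod (a (p - q)) = 0"
    using ai[of p] True integral_nonneg_eq_0_iff_AE[OF ai(1)[of p]] by simp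
   hence "(Lint q. cmod (a (p - q)) * cmod (b q)) = (LINT (q::real)|lborel. 0)"
    by (intro integral_cong_AE) auto
   hence "cmod (f p) <= 0" using aa[of p] by simp
   thus ?thesis by simp
  next
   case False
   thus ?thesis using \<open>_ = \<infinity>\<close> A0 by (simp add: ennreal_mult' ennreal_mult_top)
  qed
 qed
 have "(\<integral>\<^sup>+p. ennreal ((cmod (f p))^2) \<partial>lborel) <= (\<integral>\<^sup>+p. ennreal A * (\<integral>\<^sup>+q. ennreal (cmod (a (p - q))) * ennreal ((cmod (b q))^2) \<partial>lborel) \<partial>lborel)"
  by (intro nn_integral_mono pt)
 also have "... = ennreal A * (\<integral>\<^sup>+p. \<integral>\<^sup>+q. ennreal (cmod (a (p - q))) * ennreal ((cmod (b q))^2) \<partial>lborel \<partial>lborel)"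
  by (intro nn_integral_cmult) measurable
 also have "(\<integral>\<^sup>+p. \<integral>\<^sup>+q. ennreal (cmod (a (p - q))) * ennreal ((cmod (b q))^2) \<partial>lborel \<partial>lborel)
  = (\<integral>\<^sup>+q. \<integral>\<^sup>+p. ennreal (cmod (a (p - q))) * ennreal ((cmod (b q))^2) \<partial>lborel \<partial>lborel)"
  by (rule lborel_pair.Fubini') measurable
 also have "... = (\<integral>\<^sup>+q. ennreal A * ennreal ((cmod (b q))^2) \<partial>lborel)"
  by (simp add: nn_integral_multc nA)
 also have "ennreal A * ... = ennreal ((A * L2_norm b)^2)"
 proof -
  have "(\<integral>\<^sup>+q. ennreal A * ennreal ((cmod (b q))^2) \<partial>lborel) = ennreal A * ennreal ((L2_norm b)^2)"
   by (simp add: nn_integral_cmult nn_integral_sq_eq[OF b])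
  thus ?thesis using A0 by (simp add: power_mult_distrib power2_eq_square mult.assoc mult.left_commute flip: ennreal_mult)
 qed
 finally have le: "(\<integral>\<^sup>+p. ennreal ((cmod (f p))^2) \<partial>lborel) <= ennreal ((A * L2_norm b)^2)" .
 show "L2 f" by (rule L2_of_nn_integral_le(1)[OF _ le]) auto
 have "(L2_norm f)^2 <= (A * L2_norm b)^2" by (rule L2_of_nn_integral_le(2)[OF _ le]) auto
 thus "L2_norm f <= A * L2_norm b" by (rule power2_le_imp_le) (use A0 in simp)
qed

lemma norm_cnv_le: "cmod (cnv a b p) <= (Lint q. cmod (a (p - q)) * cmod (b q))"
 unfolding cnv_def using integral_norm_bound[of lborel "%q. a (p - q) * b q"] by (simp add: norm_mult)

lemma L2_cnv:
 assumes a: "L1 a" and b: "L2 b"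
 shows "L2 (cnv a b)" "L2_norm (cnv a b) <= (Lint x. cmod (a x)) * L2_norm b"
 using Young_L1_L2[OF a b norm_cnv_le cnv_measurable] borel_measurable_integrable[OF a] L2_measurable[OF b] by auto

text \<open>The transform of a product. It agrees almost everywhere with the convolution of the
 transforms but is continuous without any regularity assumption on the factors.\<close>

definition prod_ft :: "(real => complex) => (real => complex) => real => complex" where
 "prod_ft a b p = ift (%x. ift a x * ift b x) (- p)"

lemma integrable_ift_mult:
 assumes "L1 a" "L2 a" "L1 b" "L2 b"
 shows "L1 (%x. ift a x * ift b x)" "(Lint x. cmod (ift a x * ift b x)) <= L2_norm a * L2_norm b"
proof -
 note A = L2_ift[OF assms(1,2)] and B = L2_ift[OF assms(3,4)]
 note M = L2_mult_integrable[OF A(1) B(1)]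
 show "L1 (%x. ift a x * ift b x)" by (rule M(1))
 have "L2_norm (ift a) * L2_norm (ift b) <= L2_norm a * L2_norm b"
  by (intro mult_mono A(2) B(2)) auto
 thus "(Lint x. cmod (ift a x * ift b x)) <= L2_norm a * L2_norm b" using M(3) by linarith
qed

lemma prod_ft_bound:
 assumes "L1 a" "L2 a" "L1 b" "L2 b"
 shows "cmod (prod_ft a b p) <= L2_norm a * L2_norm b"
proof -
 have "cmod (prod_ft a b p) <= 1 / sqrt (2 * pi) * (Lint x. cmod (ift a x * ift b x))"
  unfolding prod_ft_def by (rule norm_ift_le)
 also have "... <= 1 * (Lint x. cmod (ift a x * ift b x))"
  using pi_gt3 by (intro mult_right_mono) (auto simp: real_le_rsqrt)
 also have "... <= L2_norm a * L2_norm b" using integrable_ift_mult(2)[OF assms] by simp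
 finally show ?thesis .
qed

lemma continuous_on_prod_ft:
 assumes "L1 a" "L2 a" "L1 b" "L2 b"
 shows "continuous_on UNIV (prod_ft a b)"
proof -
 have "continuous_on UNIV (%p. ift (%x. ift a x * ift b x) (- p))"
  by (rule continuous_on_compose2[OF continuous_on_ift[OF integrable_ift_mult(1)[OF assms]]])
   (auto intro!: continuous_intros)
 thus ?thesis by (simp add: prod_ft_def[abs_def])
qed

lemma prod_ft_measurable:
 assumes "L1 a" "L2 a" "L1 b" "L2 b"
 shows "prod_ft a b : Borel"
 by (intro borel_measurable_continuous_onI continuous_on_prod_ft assms)

lemma prod_ft_eq_cnv:
 assumes "L1 a" "L2 a" "L1 b" "L2 b"
 shows "AE p in lborel. prod_ft a b p = of_real (1 / sqrt (2 * pi)) * cnv a b p"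
proof -
 have i: "L1 (%p. of_real (1 / sqrt (2 * pi)) * cnv a b p)"
  by (intro integrable_mult_right integrable_cnv assms)
 have e: "ift (%p. of_real (1 / sqrt (2 * pi)) * cnv a b p) = (%x. ift a x * ift b x)"
  by (rule ext, subst ift_cmult) (simp add: ift_cnv assms)
 show ?thesis using ift_ift[OF i] integrable_ift_mult(1)[OF assms] unfolding e prod_ft_def by simp
qed

text \<open>The factorization of a difference of squares on the transform side; the difference
  estimates for the nonlinearity start here.\<close>

lemma prod_ft_square_diff:
 assumes a: "L1 a" "L2 a" and b: "L1 b" "L2 b"
 shows "prod_ft a a p - prod_ft b b p = prod_ft (%x. a x + b x) (%x. a x - b x) p"
 unfolding prod_ft_def
 by (subst ift_diff[symmetric]) (use integrable_ift_mult(1)[OF a a] integrable_ift_mult(1)[OF b b] in \<open>auto simp: ift_add ift_diff a b algebra_simps\<close>)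

lemma prod_ft_hermitian:
 assumes "!!x. a (- x) = cnj (a x)"
 shows "prod_ft a a (- p) = cnj (prod_ft a a p)"
proof -
 have "cnj (ift a x * ift a x) = ift a x * ift a x" for x
 proof -
  have "cnj (ift a x) = ift a x"
   using ift_hermitian_real[of a x, OF assms] by (metis complex_cnj_complex_of_real)
  thus ?thesis by simp
 qed
 thus ?thesis by (simp add: prod_ft_def ift_cnj)
qed

section \<open>Derivatives and the dispersive operator\<close>

lemma norm_cis_diff_le: "cmod (cis a - cis b) <= \<bar>a - b\<bar>"
proof -
 have "cis a - cis b = cis b * (cis (a - b) - 1)" by (simp add: cis_mult right_diff_distrib)
 hence "cmod (cis a - cis b) = cmod (cis (a - b) - 1)" by (simp add: norm_mult)
 also have "... <= \<bar>a - b\<bar>" using iexp_approx1[of "a - b" 0] by (simp add: cis_conv_exp)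
 finally show ?thesis .
qed

text \<open>The difference quotients of the integrand are dominated by
  \<open>cmod (of_real p * g p)\<close>, because \<open>cis\<close> is Lipschitz with constant
  1.\<close>

lemma has_real_derivative_ift:
 assumes g: "L1 g" and xg: "L1 (%p. of_real p * g p)"
  and f: "!!x. of_real (f x) = ift g x"
 shows "(f has_real_derivative Re (ift (%p. \<i> * (of_real p * g p)) x)) (at x)"
 unfolding has_field_derivative_iff tendsto_at_iff_sequentially o_def
proof (intro allI impI)
 fix X :: "nat => real" assume X: "ALL i. X i : UNIV - {x}" "X \<longlonglongrightarrow> x"
 note [measurable] = borel_measurable_integrable[OF g]
 have ne: "X n - x ~= 0" for n using X by auto
 define D where "D = (%n p. g p * ((cis (X n * p) - cis (x * p)) / of_real (X n - x)))"
 have "(%n. Lint p. D n p) \<longlonglongrightarrow> (Lint p. g p * (\<i> * of_real p * cis (x * p)))"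
 proof (rule integral_dominated_convergence)
  show "L1 (%p. cmod (of_real p * g p))" using xg by (rule integrable_norm)
  show "AE p in lborel. norm (D n p) <= cmod (of_real p * g p)" for n
  proof (rule AE_I2)
   fix p
   have "cmod (cis (X n * p) - cis (x * p)) <= \<bar>(X n - x) * p\<bar>"
    using norm_cis_diff_le[of "X n * p" "x * p"] by (simp add: left_diff_distrib)
   hence "cmod ((cis (X n * p) - cis (x * p)) / of_real (X n - x)) <= \<bar>p\<bar>"
    using ne[of n] by (simp add: norm_divide divide_le_eq abs_mult mult.commute flip: of_real_diff)
   hence "cmod (g p) * cmod ((cis (X n * p) - cis (x * p)) / of_real (X n - x)) <= cmod (g p) * \<bar>p\<bar>"
    by (rule mult_left_mono) simp
   thus "norm (D n p) <= cmod (of_real p * g p)" unfolding D_def norm_mult by (simp add: mult.commute)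
  qed
  show "AE p in lborel. (%n. D n p) \<longlonglongrightarrow> g p * (\<i> * of_real p * cis (x * p))"
  proof (rule AE_I2)
   fix p
   have "((%z. exp (\<i> * of_real p * z)) has_field_derivative \<i> * of_real p * exp (\<i> * of_real p * of_real x)) (at (of_real x))"
    by (auto intro!: derivative_eq_intros)
   hence "((%z. (exp (\<i> * of_real p * z) - exp (\<i> * of_real p * of_real x)) / (z - of_real x)) \<longlongrightarrow> \<i> * of_real p * exp (\<i> * of_real p * of_real x)) (at (of_real x))"
    unfolding has_field_derivative_iff .
   moreover have "filterlim (%n. cor (X n)) (at (of_real x)) sequentially"
    unfolding filterlim_at using X by (auto intro!: tendsto_of_real always_eventually)
   ultimately have "(%n. (exp (\<i> * of_real p * of_real (X n)) - exp (\<i> * of_real p * of_real x)) / (of_real (X n) - of_real x)) \<longlonglongrightarrow> \<i> * of_real p * exp (\<i> * of_real p * of_real x)"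
    by (rule filterlim_compose)
   hence "(%n. (cis (X n * p) - cis (x * p)) / of_real (X n - x)) \<longlonglongrightarrow> \<i> * of_real p * cis (x * p)"
    by (simp add: cis_conv_exp mult_ac)
   thus "(%n. D n p) \<longlonglongrightarrow> g p * (\<i> * of_real p * cis (x * p))"
    unfolding D_def by (intro tendsto_intros)
  qed
 qed (simp_all add: D_def)
 hence "(%n. Re (of_real (1 / sqrt (2 * pi)) * (Lint p. D n p))) \<longlonglongrightarrow> Re (of_real (1 / sqrt (2 * pi)) * (Lint p. g p * (\<i> * of_real p * cis (x * p))))"
  by (intro tendsto_intros)
 moreover have "(f (X n) - f x) / (X n - x) = Re (of_real (1 / sqrt (2 * pi)) * (Lint p. D n p))" for n
 proof -
  have "(Lint p. D n p) = (Lint p. (g p * cis (X n * p) - g p * cis (x * p)) / of_real (X n - x))"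
   by (simp add: D_def right_diff_distrib del: of_real_diff)
  also have "... = ((Lint p. g p * cis (X n * p)) - (Lint p. g p * cis (x * p))) / of_real (X n - x)"
   using integrable_mult_cis'[OF g] by simp
  finally have "of_real (1 / sqrt (2 * pi)) * (Lint p. D n p) = (ift g (X n) - ift g x) / of_real (X n - x)"
   by (simp add: ift_def right_diff_distrib)
  also have "... = of_real ((f (X n) - f x) / (X n - x))" by (simp flip: f)
  finally show ?thesis by simp
 qed
 moreover have "of_real (1 / sqrt (2 * pi)) * (Lint p. g p * (\<i> * of_real p * cis (x * p))) = ift (%p. \<i> * (of_real p * g p)) x"
  by (simp add: ift_def mult_ac)
 ultimately show "(%n. (f (X n) - f x) / (X n - x)) \<longlonglongrightarrow> Re (ift (%p. \<i> * (of_real p * g p)) x)"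
  by (simp only:)
qed

lemma exponential_half_line:
 fixes b x :: real
 assumes b: "0 < b"
 shows "has_bochner_integral lborel (%y. indicator {0..} y *\<^sub>R (of_real (exp (- b * y)) * cis (x * y))) (1 / (of_real b - \<i> * of_real x))"
proof -
 let ?c = "of_real b - \<i> * of_real x :: complex"
 have c0: "?c ~= 0" using b by (auto simp: complex_eq_iff)
 let ?f = "%y. cor (exp (- b * y)) * cis (x * y)"
 let ?F = "%y. - (1 / ?c) * ?f y"
 have fe: "?f y = exp (- ?c * of_real y)" for y
  by (simp add: cis_conv_exp exp_of_real[symmetric] mult_exp_exp algebra_simps)
 have n: "cmod (?f y) = exp (- b * y)" for y by (simp add: norm_mult)
 have i0: "L1 (%y. indicator {0<..} y *\<^sub>R exp (- (y * b)))"
  using integrable_I0i_exp_mscale[OF b] by (simp add: set_integrable_def)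
 have AE0: "AE y in lborel. y ~= (0::real)" by (rule AE_lborel_singleton)
 have i1: "L1 (%y. indicator {0<..} y *\<^sub>R ?f y)"
  by (rule int_bound[OF i0]) (auto simp: indicator_def norm_mult mult.commute)
 have lim0: "(?F \<longlongrightarrow> - (1 / ?c)) (at_right 0)"
 proof -
  have "continuous_on UNIV ?F" by (intro continuous_intros)
  hence "isCont ?F 0" by (rule continuous_on_interior) simp
  hence "(?F \<longlongrightarrow> ?F 0) (at 0)" by (simp only: isCont_def)
  hence "(?F \<longlongrightarrow> ?F 0) (at_right 0)" by (rule tendsto_within_subset) simp
  moreover have "?F 0 = - (1 / ?c)" by simp
  ultimately show ?thesis by (simp only:)
 qed
 have liminf: "(?F \<longlongrightarrow> 0) at_top"
 proof (rule Lim_null_comparison)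
  show "\<forall>\<^sub>F y in at_top. norm (?F y) <= cmod (1 / ?c) * exp (- b * y)"
   by (rule always_eventually) (simp add: norm_mult norm_divide)
  have "filterlim (%y. - b * y) at_bot at_top"
   by (rule filterlim_tendsto_neg_mult_at_bot[OF tendsto_const _ filterlim_ident]) (use b in simp)
  from filterlim_compose[OF exp_at_bot this] have "((%y. exp (- b * y)) \<longlongrightarrow> 0) at_top" .
  from tendsto_mult_left[OF this, of "cmod (1 / ?c)"]
  show "((%y. cmod (1 / ?c) * exp (- b * y)) \<longlongrightarrow> 0) at_top" by (simp only: mult_zero_right)
 qed
 have "(LBINT y=ereal 0..\<infinity>. ?f y) = 0 - (- (1 / ?c))"
 proof (rule interval_integral_FTC_integrable)
  show "(?F has_vector_derivative ?f y) (at y)" for y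
  proof -
   have "((%z. - (1 / c) * exp (- c * z)) has_field_derivative exp (- c * w)) (at w)" if "c ~= 0" for c w :: complex
    using that by (auto intro!: derivative_eq_intros)
   from this[OF c0] have "((%z. - (1 / ?c) * exp (- ?c * z)) has_field_derivative exp (- ?c * of_real y)) (at (of_real y))" .
   from has_vector_derivative_real_field[OF this] show ?thesis unfolding fe by simp
  qed
  show "isCont ?f y" for y
  proof -
   have "continuous_on UNIV ?f" by (intro continuous_intros)
   thus ?thesis by (simp add: continuous_on_eq_continuous_at)
  qed
  show "set_integrable lborel (einterval (ereal 0) \<infinity>) ?f"
  proof -
   have e: "einterval (ereal 0) \<infinity> = {0<..}" by (auto simp: einterval_def)
   show ?thesis unfolding set_integrable_def e by (rule i1)
  qed
  show "((?F \<circ> real_of_ereal) \<longlongrightarrow> - (1 / ?c)) (at_right (ereal 0))"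
   unfolding ereal_tendsto_simps by (rule lim0)
  show "((?F \<circ> real_of_ereal) \<longlongrightarrow> 0) (at_left \<infinity>)"
   unfolding ereal_tendsto_simps by (rule liminf)
  show "ereal 0 < \<infinity>" by simp
 qed
 hence "(LBINT y=0..\<infinity>. ?f y) = 0 - (- (1 / ?c))" by (simp only: zero_ereal_def)
 hence "(Lint y. indicator {0<..} y *\<^sub>R ?f y) = 1 / ?c"
  unfolding interval_lebesgue_integral_0_infty set_lebesgue_integral_def by simp
 hence "has_bochner_integral lborel (%y. indicator {0<..} y *\<^sub>R ?f y) (1 / ?c)"
  using i1 by (simp only: has_bochner_integral_iff)
 note h1 = this
 have h2: "AE y in lborel. indicator {0<..} y *\<^sub>R ?f y = indicator {0..} y *\<^sub>R ?f y"
  using AE0 by eventually_elim (auto simp: indicator_def)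
 show ?thesis
  by (rule has_bochner_integral_cong_AE[THEN iffD1, OF _ _ h2 h1]) measurable
qed

lemma exponential_kernel:
 fixes b x :: real
 assumes b: "0 < b"
 shows "has_bochner_integral lborel (%y. of_real (exp (- b * \<bar>y\<bar>)) * cis (x * y)) (cor (2 * b / (b^2 + x^2)))"
proof -
 let ?c = "of_real b - \<i> * of_real x :: complex"
 let ?h = "%x y. indicator {0..} y *\<^sub>R (of_real (exp (- b * y)) * cis (x * y))"
 have "has_bochner_integral lborel (%y. ?h (-x) (0 + (-1) * y)) (1 / (of_real b - \<i> * of_real (-x)) /\<^sub>R \<bar>-1\<bar>)"
  by (rule lborel_has_bochner_integral_real_affine_iff[THEN iffD1, OF _ exponential_half_line[OF b]]) simp
 from has_bochner_integral_add[OF exponential_half_line[OF b, of x] this]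
 have "has_bochner_integral lborel (%y. ?h x y + ?h (-x) (-y)) (1 / ?c + 1 / (of_real b + \<i> * of_real x))" by simp
 moreover have "1 / ?c + 1 / (of_real b + \<i> * of_real x) = cor (2 * b / (b^2 + x^2))"
 proof -
  have n: "of_real b - \<i> * of_real x ~= 0" "of_real b + \<i> * of_real x ~= 0" using b by (auto simp: complex_eq_iff)
  have "(of_real b - \<i> * of_real x) * (of_real b + \<i> * of_real x) = cor (b^2 + x^2)"
   by (simp add: complex_eq_iff power2_eq_square)
  moreover have "1 / ?c + 1 / (of_real b + \<i> * of_real x) = cor (2 * b) / ((of_real b - \<i> * of_real x) * (of_real b + \<i> * of_real x))"
   using n by (simp add: add_frac_eq)
  ultimately show ?thesis by (simp only: of_real_divide)
 qed
 ultimately have "has_bochner_integral lborel (%y. ?h x y + ?h (-x) (-y)) (cor (2 * b / (b^2 + x^2)))" by simp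
 note h1 = this
 have h2: "AE y in lborel. ?h x y + ?h (-x) (-y) = of_real (exp (- b * \<bar>y\<bar>)) * cis (x * y)"
  using AE_lborel_singleton[of "0::real"] by eventually_elim (auto simp: indicator_def)
 show ?thesis
  by (rule has_bochner_integral_cong_AE[THEN iffD1, OF _ _ h2 h1]) measurable
qed

text \<open>The multiplier m of the overview: the transform of the kernel contributes
  \<open>2 * b * B / (b^2 + p^2)\<close> and the derivative of the unknown the factor
  \<open>p\<close>. The factor \<open>\<i>\<close> stays outside so that the multiplier is
  real.\<close>

definition disp :: "real => real => real => real" where
 "disp B b p = 2 * b * B * p / (b^2 + p^2)"

text \<open>The multiplication formula moves the transform from the derivative \<open>d\<close> onto
  the shifted exponential kernel, whose transform is explicit.\<close>

lemma dispersive_operator: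
 assumes b: "0 < b" and g: "L1 (%p. of_real p * g p)"
  and d: "!!x. of_real (d x) = ift (%p. \<i> * (of_real p * g p)) x"
 shows "of_real (Lint p. B * exp (- b * \<bar>x - p\<bar>) * d p) = ift (%p. \<i> * of_real (disp B b p) * g p) x"
proof -
 let ?h = "%y. cor (B * exp (- b * \<bar>x - y\<bar>))"
 have k: "has_bochner_integral lborel (%y. ?h y * cis (p * y)) (of_real (B * (2 * b / (b^2 + p^2))) * cis (x * p))" for p
 proof -
  have "has_bochner_integral lborel (%y. of_real (exp (- b * \<bar>x + (-1) * y\<bar>)) * cis ((-p) * (x + (-1) * y))) (cor (2 * b / (b^2 + (-p)^2)) /\<^sub>R \<bar>-1\<bar>)"
   by (rule lborel_has_bochner_integral_real_affine_iff[THEN iffD1, OF _ exponential_kernel[OF b]]) simp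
  hence "has_bochner_integral lborel (%y. (of_real B * cis (x * p)) * (of_real (exp (- b * \<bar>x + (-1) * y\<bar>)) * cis ((-p) * (x + (-1) * y)))) ((of_real B * cis (x * p)) * (cor (2 * b / (b^2 + (-p)^2)) /\<^sub>R \<bar>-1\<bar>))"
   by (rule has_bochner_integral_mult_right)
  moreover have "(%y. (of_real B * cis (x * p)) * (of_real (exp (- b * \<bar>x + (-1) * y\<bar>)) * cis ((-p) * (x + (-1) * y)))) = (%y. ?h y * cis (p * y))"
  proof (rule ext)
   fix y
   have "cis (x * p) * cis ((-p) * (x + (-1) * y)) = cis (p * y)" by (simp add: cis_mult algebra_simps)
   thus "(of_real B * cis (x * p)) * (of_real (exp (- b * \<bar>x + (-1) * y\<bar>)) * cis ((-p) * (x + (-1) * y))) = ?h y * cis (p * y)"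
    by (metis (no_types, lifting) mult.assoc mult.commute mult_minus1 of_real_mult uminus_add_conv_diff add.commute)
  qed
  ultimately have "has_bochner_integral lborel (%y. ?h y * cis (p * y)) ((of_real B * cis (x * p)) * (cor (2 * b / (b^2 + (-p)^2)) /\<^sub>R \<bar>-1\<bar>))"
   by (simp only:)
  moreover have "(of_real B * cis (x * p)) * (cor (2 * b / (b^2 + (-p)^2)) /\<^sub>R \<bar>-1\<bar>) = of_real (B * (2 * b / (b^2 + p^2))) * cis (x * p)"
   by (simp add: mult_ac)
  ultimately show ?thesis by (simp only:)
 qed
 have h: "L1 ?h" using k[of 0] by (auto dest: has_bochner_integral_integrable simp: has_bochner_integral_iff)
 have ih: "ift ?h p = of_real (1 / sqrt (2 * pi)) * (of_real (B * (2 * b / (b^2 + p^2))) * cis (x * p))" for p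
  unfolding ift_def using k[of p] by (simp add: has_bochner_integral_integral_eq)
 have gi: "L1 (%p. \<i> * (of_real p * g p))" using g by simp
 have "of_real (Lint p. B * exp (- b * \<bar>x - p\<bar>) * d p) = (Lint y. ift (%p. \<i> * (of_real p * g p)) y * ?h y)"
  by (simp add: d[symmetric] mult.commute mult.left_commute flip: integral_complex_of_real)
 also have "... = (Lint p. (\<i> * (of_real p * g p)) * ift ?h p)" by (rule ift_mult_formula[OF gi h])
 also have "... = ift (%p. \<i> * of_real (disp B b p) * g p) x"
  unfolding ih ift_def[of _ x] integral_mult_right_zero[symmetric]
  by (intro int_cong refl) (simp add: disp_def mult_ac)
 finally show ?thesis .
qed

section \<open>Sobolev weights\<close>

text \<open>The Japanese bracket of \<open>y\<close> to the power \<open>s\<close>.\<close>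

definition jp :: "real => real => real" where
 "jp s y = (1 + y^2) powr (s / 2)"

definition hs :: "real => (real => complex) => bool" where
 "hs s g \<longleftrightarrow> L2 (%y. of_real (jp s y) * g y)"

definition hsn :: "real => (real => complex) => real" where
 "hsn s g = L2_norm (%y. of_real (jp s y) * g y)"

text \<open>The symmetry of transforms of real-valued functions, required at every frequency and not
  only almost everywhere.\<close>

definition herm :: "(real => complex) => bool" where
 "herm g \<longleftrightarrow> (ALL y. g (- y) = cnj (g y))"

lemma one_plus_sq_pos[simp]: "0 < 1 + (y::real)^2"
 by (rule add_pos_nonneg) auto

lemma one_plus_sq_neq[simp]: "1 + (y::real)^2 ~= 0"
 using one_plus_sq_pos[of y] by linarith

lemma jp_measurable[measurable]: "jp s : Borel"
 unfolding jp_def[abs_def] by measurable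

lemma jp_pos[simp]: "0 < jp s y"
 by (simp add: jp_def)

lemma jp_nonneg[simp]: "0 <= jp s y" and jp_neq_0[simp]: "jp s y ~= 0"
 using jp_pos[of s y] by linarith+

lemma jp_add: "jp (s + t) y = jp s y * jp t y"
 by (simp add: jp_def powr_add add_divide_distrib)

lemma jp_0[simp]: "jp 0 y = 1"
 by (simp add: jp_def)

lemma jp_mono: "s <= t ==> jp s y <= jp t y"
 unfolding jp_def by (intro powr_mono) auto

lemma jp_minus[simp]: "jp s (- y) = jp s y"
 by (simp add: jp_def)

lemma jp_1: "jp 1 y = sqrt (1 + y^2)"
 by (simp add: jp_def powr_half_sqrt)

lemma jp_2: "jp 2 y = 1 + y^2"
 by (simp add: jp_def)

lemma jp_sq: "(jp s y)^2 = (1 + y^2) powr s"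
proof -
 have "jp s y * jp s y = jp (s + s) y" by (simp only: jp_add)
 moreover have "jp (s + s) y = (1 + y^2) powr s" by (simp add: jp_def)
 ultimately show ?thesis by (metis power2_eq_square)
qed

lemma abs_le_jp_1: "\<bar>y\<bar> <= jp 1 y"
 unfolding jp_1 by (rule real_le_rsqrt) simp

lemma abs_power_le_jp: "\<bar>y\<bar> ^ k <= jp (real k) y"
proof (induction k)
 case (Suc k)
 have "\<bar>y\<bar> * \<bar>y\<bar> ^ k <= jp 1 y * jp (real k) y"
  by (intro mult_mono Suc abs_le_jp_1) auto
 thus ?case by (simp add: jp_add[of 1 "real k", symmetric] add.commute)
qed simp

lemma L2_jp_minus_1: "L2 (%y. jp (-1) y)"
proof (rule L2I)
 have "(%y. (norm (jp (-1) y))^2) = (%y. 1 / (1 + y^2))"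
  by (simp add: jp_sq powr_minus_divide)
 thus "L1 (%y. (norm (jp (-1) y))^2)"
  using integrable_lborel_inverse_square by simp
qed measurable

lemma hs_integrable_sq: "hs s g ==> L1 (%y. (1 + y^2) powr s * (cmod (g y))^2)"
 unfolding hs_def using L2_integrable[of "%y. of_real (jp s y) * g y"] by (auto simp: norm_mult power_mult_distrib jp_sq)

lemma hsn_sq: "(hsn s g)^2 = (Lint y. (1 + y^2) powr s * (cmod (g y))^2)"
 unfolding hsn_def L2_norm_sq by (simp add: norm_mult power_mult_distrib jp_sq)

lemma hs_measurable[measurable_dest]: assumes "hs s g" shows "g : Borel"
proof -
 have "(%y. of_real (1 / jp s y) * (of_real (jp s y) * g y)) : Borel"
  using L2_measurable[OF assms[unfolded hs_def]] by measurable
 thus ?thesis by (simp flip: of_real_mult mult.assoc)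
qed

lemma hsn_nonneg[simp]: "0 <= hsn s g" by (simp add: hsn_def)

lemma hs_bound:
 assumes h: "hs s g" and [measurable]: "f : Borel"
  and le: "!!y. jp t y * cmod (f y) <= C * (jp s y * cmod (g y))" and C: "0 <= C"
 shows "hs t f" "hsn t f <= C * hsn s g"
proof -
 show "hs t f" unfolding hs_def
  by (rule L2_bound[OF h[unfolded hs_def], where C=C]) (auto simp: norm_mult le)
 have "hsn t f <= L2_norm (%y. of_real C * (of_real (jp s y) * g y))"
  unfolding hsn_def by (rule L2_norm_mono[OF L2_cmult[OF h[unfolded hs_def]]]) (use le C in \<open>simp add: norm_mult\<close>)
 also have "... = C * hsn s g" using C by (simp add: L2_norm_cmult hsn_def)
 finally show "hsn t f <= C * hsn s g" .
qed

lemma hs_mono: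
 assumes "hs s g" "t <= s" shows "hs t g" "hsn t g <= hsn s g"
 using hs_bound[OF assms(1) hs_measurable[OF assms(1)], of t 1] mult_right_mono[OF jp_mono[OF assms(2)]] by auto

lemma hs_0: "hs 0 g \<longleftrightarrow> L2 g" "hsn 0 g = L2_norm g"
 by (simp_all add: hs_def hsn_def)

lemma hs_L2: assumes "hs s g" "0 <= s" shows "L2 g" "L2_norm g <= hsn s g"
 using hs_mono[OF assms] by (simp_all add: hs_0)

lemma hs_add: "hs s f ==> hs s g ==> hs s (%y. f y + g y)"
 unfolding hs_def distrib_left by (rule L2_add)

lemma hs_diff: "hs s f ==> hs s g ==> hs s (%y. f y - g y)"
 unfolding hs_def right_diff_distrib by (rule L2_diff)

lemma hs_cmult: "hs s f ==> hs s (%y. c * f y)"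
 unfolding hs_def using L2_cmult[of "%y. of_real (jp s y) * f y" c] by (simp add: mult.left_commute)

lemma hsn_cmult: "hsn s (%y. c * f y) = cmod c * hsn s f"
 unfolding hsn_def using L2_norm_cmult[of c "%y. of_real (jp s y) * f y"] by (simp add: mult.left_commute)

lemma hsn_triangle: "hs s f ==> hs s g ==> hsn s (%y. f y + g y) <= hsn s f + hsn s g"
 unfolding hs_def hsn_def distrib_left by (rule L2_norm_triangle)

lemma hsn_uminus: "hsn s (%y. - f y) = hsn s f"
 using hsn_cmult[of s "-1" f] by simp

lemma hs_uminus: "hs s f ==> hs s (%y. - f y)"
 using hs_cmult[of s f "-1"] by simp

lemma hsn_triangle_diff: "hs s f ==> hs s g ==> hsn s (%y. f y - g y) <= hsn s f + hsn s g"
 using hsn_triangle[of s f "%y. - g y"] by (simp add: hs_uminus hsn_uminus)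

lemma hsn_minus_commute: "hsn s (%y. f y - g y) = hsn s (%y. g y - f y)"
 using hsn_uminus[of s "%y. f y - g y"] by simp

lemma hsn_diff_abs: assumes "hs s f" "hs s g" shows "\<bar>hsn s f - hsn s g\<bar> <= hsn s (%y. f y - g y)"
proof -
 have "hsn s f <= hsn s (%y. f y - g y) + hsn s g" "hsn s g <= hsn s (%y. g y - f y) + hsn s f"
  using hsn_triangle[OF hs_diff[OF assms(1,2)] assms(2)] hsn_triangle[OF hs_diff[OF assms(2,1)] assms(1)] by simp_all
 thus ?thesis using hsn_minus_commute[of s f g] by linarith
qed

lemma hs_cong_AE:
 assumes h: "hs s f" and [measurable]: "g : Borel" and e: "AE y in lborel. f y = g y"
 shows "hs s g" "hsn s g = hsn s f"
proof -
 note [measurable] = hs_measurable[OF h]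
 have e': "AE y in lborel. of_real (jp s y) * f y = of_real (jp s y) * g y" using e by eventually_elim simp
 show "hs s g" using L2_cong_AE[OF h[unfolded hs_def] _ e'] by (simp add: hs_def)
 show "hsn s g = hsn s f" unfolding hsn_def by (rule L2_norm_cong_AE[symmetric, OF _ _ e']) auto
qed

text \<open>The L^2 norm of \<open>1 / sqrt (1 + y^2)\<close>. It is the constant of the Sobolev
  embedding in the form that the H^1 norm controls the L^1 norm of the transform.\<close>

definition c1 :: real where "c1 = L2_norm (jp (-1))"

lemma c1_nonneg[simp]: "0 <= c1" by (simp add: c1_def)

text \<open>Cauchy-Schwarz after splitting off the square integrable weight \<open>jp (-1)\<close>;
  this costs one power of the weight.\<close>

lemma hs_moment:
 assumes h: "hs s g" and k: "real k + 1 <= s"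
 shows "L1 (%y. of_real (y ^ k) * g y)"
  "(Lint y. \<bar>y\<bar> ^ k * cmod (g y)) <= c1 * hsn s g"
proof -
 note [measurable] = hs_measurable[OF h]
 note h' = hs_mono[OF h k]
 have le: "\<bar>y\<bar> ^ k * cmod (g y) <= norm (jp (-1) y) * norm (of_real (jp (real k + 1) y) * g y)" for y
 proof -
  have "jp (-1) y * jp (real k + 1) y = jp (real k) y" unfolding jp_add[symmetric] by simp
  thus ?thesis using mult_right_mono[OF abs_power_le_jp[of y k], of "cmod (g y)"]
   by (simp add: norm_mult flip: mult.assoc)
 qed
 note CS = L2_Cauchy_Schwarz[OF L2_jp_minus_1 h'(1)[unfolded hs_def]]
 show "L1 (%y. of_real (y ^ k) * g y)"
  by (rule int_bound[OF CS(1)]) (use le in \<open>auto simp: norm_mult norm_power\<close>)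
 have "(Lint y. \<bar>y\<bar> ^ k * cmod (g y)) <= (Lint y. norm (jp (-1) y) * norm (of_real (jp (real k + 1) y) * g y))"
  by (rule integral_mono_AE'[OF CS(1)]) (use le in auto)
 also have "... <= c1 * hsn (real k + 1) g" using CS(2) by (simp add: c1_def hsn_def)
 also have "... <= c1 * hsn s g" by (intro mult_left_mono h') simp
 finally show "(Lint y. \<bar>y\<bar> ^ k * cmod (g y)) <= c1 * hsn s g" .
qed

lemma hs_integrable: assumes "hs s g" "1 <= s" shows "L1 g" "(Lint y. cmod (g y)) <= c1 * hsn s g"
 using hs_moment[OF assms(1), of 0] assms(2) by auto

lemma hs_integrable_1: assumes "hs s g" "2 <= s"
 shows "L1 (%y. of_real y * g y)" "(moment g) <= c1 * hsn s g"
 using hs_moment[OF assms(1), of 1] assms(2) by auto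

lemma hs_shift:
 assumes h: "hs s g" shows "hs (s - 1) (%y. of_real y * g y)" "hsn (s - 1) (%y. of_real y * g y) <= hsn s g"
proof -
 note [measurable] = hs_measurable[OF h]
 have "jp (s - 1) y * (\<bar>y\<bar> * cmod (g y)) <= 1 * (jp s y * cmod (g y))" for y
 proof -
  have "jp s y = jp (s - 1) y * jp 1 y" unfolding jp_add[symmetric] by simp
  thus ?thesis using mult_left_mono[OF mult_right_mono[OF abs_le_jp_1[of y]], of "cmod (g y)" "jp (s - 1) y"]
   by (simp add: mult.assoc)
 qed
 thus "hs (s - 1) (%y. of_real y * g y)" "hsn (s - 1) (%y. of_real y * g y) <= hsn s g"
  using hs_bound[OF h, of "%y. of_real y * g y" "s - 1" 1] by (auto simp: norm_mult)
qed

lemma norm_ift_hs: assumes "hs s g" "1 <= s" shows "cmod (ift g x) <= c1 * hsn s g"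
proof -
 have "cmod (ift g x) <= 1 / sqrt (2 * pi) * (Lint y. cmod (g y))" by (rule norm_ift_le)
 also have "... <= 1 * (Lint y. cmod (g y))"
  using pi_gt3 by (intro mult_right_mono) (auto simp: real_le_rsqrt)
 finally show ?thesis using hs_integrable(2)[OF assms] by linarith
qed

text \<open>The link between functions and transforms. In contrast to \<open>fourier f\<close>, the
  representative \<open>g\<close> may be chosen, hermitian everywhere, so that transforms can be
  evolved frequency by frequency.\<close>

definition rep :: "real => (real => real) => (real => complex) => bool" where
 "rep s f g \<longleftrightarrow> hs s g & herm g & (ALL x. of_real (f x) = ift g x)"

lemma repI: assumes "hs s g" "herm g" shows "rep s (%x. Re (ift g x)) g"
 using assms ift_hermitian_real[of g] by (auto simp: rep_def herm_def)

lemma repD: assumes "rep s f g" shows "hs s g" "herm g" "of_real (f x) = ift g x"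
 using assms by (auto simp: rep_def)

lemma rep_fourier:
 assumes r: "rep s f g" and s: "1 <= s"
 shows "L2 f" "is_fourier_transform f g" "AE y in lborel. fourier f y = g y" "fourier f : Borel"
proof -
 note R = repD[OF r]
 have i: "L1 g" "L2 g" using hs_integrable[OF R(1) s] hs_L2[OF R(1)] s by auto
 show L: "L2 f" and F: "is_fourier_transform f g" using is_fourier_transform_ift[OF i R(3)] by auto
 show "AE y in lborel. fourier f y = g y"
  by (rule is_fourier_transform_unique[OF L is_fourier_transform_fourier[OF L] F])
 show "fourier f : Borel"
  using is_fourier_transformD(1)[OF is_fourier_transform_fourier[OF L] L] by (rule L2_measurable)
qed

lemma bessel_weighted_eq: "bessel_weighted s f = (%y. of_real (jp s y) * fourier f y)"
 by (simp add: bessel_weighted_def[abs_def] jp_def)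

text \<open>The bridge back to the given definitions: \<open>fourier f\<close> and \<open>g\<close>
  are both transforms of \<open>f\<close>, hence equal almost everywhere. The exponent
  \<open>t\<close> may be smaller than \<open>s\<close>, so that time derivatives can be measured
  with one derivative less.\<close>

lemma rep_sobolev:
 assumes r: "rep s f g" and s: "1 <= s" and t: "t <= s"
 shows "f : sobolev t" "sobolev_norm t f = hsn t g"
proof -
 note R = repD[OF r] and F = rep_fourier[OF r s]
 have h: "hs t g" using hs_mono(1)[OF R(1) t] .
 have e: "AE y in lborel. g y = fourier f y" using F(3) by eventually_elim simp
 note H = hs_cong_AE[OF h F(4) e]
 have "continuous_on UNIV (%x. Re (ift g x))"
  by (intro continuous_intros continuous_on_ift hs_integrable(1)[OF R(1) s])
 moreover have "(%x. Re (ift g x)) = f" by (simp flip: R(3))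
 ultimately have "continuous_on UNIV f" by (simp only:)
 thus "f : sobolev t" using F(1) H(1) by (simp add: sobolev_def bessel_weighted_eq hs_def)
 show "sobolev_norm t f = hsn t g" using H(2) by (simp add: sobolev_norm_def bessel_weighted_eq hsn_def)
qed

lemma hs_reflect: assumes "hs s g" shows "hs s (%y. cnj (g (- y)))"
proof -
 note [measurable] = hs_measurable[OF assms]
 have "L2 (%y. of_real (jp s (-y)) * g (- y))"
  using assms L2_reflect[of "%y. of_real (jp s y) * g y"] by (simp add: hs_def)
 thus ?thesis unfolding hs_def
  by (rule L2_bound[where C=1]) (auto simp: norm_mult)
qed

lemma sobolev_rep:
 assumes f: "f : sobolev s" and s: "1 <= s"
 obtains g where "rep s f g"
proof -
 let ?h = "fourier f"
 have L: "L2 f" and c: "continuous_on UNIV f" and h: "hs s ?h"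
  using f by (auto simp: sobolev_def bessel_weighted_eq hs_def)
 have hi: "L1 ?h" by (rule hs_integrable(1)[OF h s])
 have inv: "of_real (f x) = ift ?h x" for x
  by (rule Fourier_inversion[OF L is_fourier_transform_fourier[OF L] hi])
   (use c in \<open>auto simp: continuous_on_eq_continuous_at\<close>)
 let ?r = "%y. cnj (?h (- y))"
 \<comment> \<open>\<open>fourier f\<close> is hermitian only up to a null set. Averaging it with
   its reflected conjugate makes the symmetry hold everywhere and leaves the inverse transform,
   which is real, unchanged.\<close>
 define g where "g = (%y. (1/2) * (?h y + ?r y))"
 have r: "hs s ?r" by (rule hs_reflect[OF h])
 have ri: "L1 ?r" by (rule hs_integrable(1)[OF r s])
 have "ift ?r x = cnj (ift ?h x)" for x
  using ift_reflect[of "%y. cnj (?h y)" x] by (simp add: ift_cnj)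
 hence "ift ?r x = of_real (f x)" for x by (simp flip: inv)
 hence "ift g x = of_real (f x)" for x
  unfolding g_def by (subst ift_cmult, subst ift_add[OF hi ri]) (simp flip: inv)
 moreover have "hs s g" unfolding g_def by (intro hs_cmult hs_add h r)
 moreover have "herm g" by (simp add: herm_def g_def add.commute)
 ultimately show ?thesis using that unfolding rep_def by metis
qed

lemma herm_diff: "herm f ==> herm g ==> herm (%y. f y - g y)" by (simp add: herm_def)
lemma herm_add: "herm f ==> herm g ==> herm (%y. f y + g y)" by (simp add: herm_def)
lemma herm_uminus: "herm f ==> herm (%y. - f y)" by (simp add: herm_def)
lemma herm_scale: "herm f ==> herm (%y. of_real c * f y)" by (simp add: herm_def)
lemma herm_odd: "herm f ==> (!!y. m (- y) = - m y) ==> herm (%y. \<i> * of_real (m y) * f y)" by (simp add: herm_def)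

lemma rep_diff: assumes "rep s f g" "rep s f' g'" "1 <= s" shows "rep s (%x. f x - f' x) (%y. g y - g' y)"
 using repD[OF assms(1)] repD[OF assms(2)] assms(3)
 by (auto simp: rep_def hs_diff herm_diff ift_diff hs_integrable)

lemma rep_scale: assumes "rep s f g" shows "rep s (%x. c * f x) (%y. of_real c * g y)"
 using repD[OF assms] by (auto simp: rep_def hs_cmult herm_scale ift_cmult)

lemma rep_mono: "rep s f g ==> t <= s ==> rep t f g"
 using hs_mono(1) by (auto simp: rep_def)

lemma rep_deriv:
 assumes r: "rep s f g" and s: "2 <= s"
 shows "(f has_real_derivative deriv f x) (at x)" "rep (s - 1) (deriv f) (%y. \<i> * (of_real y * g y))"
proof -
 note R = repD[OF r]
 have i: "L1 g" "L1 (%y. of_real y * g y)"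
  using hs_integrable[OF R(1)] hs_integrable_1[OF R(1)] s by auto
 have d: "(f has_real_derivative Re (ift (%y. \<i> * (of_real y * g y)) x)) (at x)" for x
  by (rule has_real_derivative_ift[OF i R(3)])
 hence e: "deriv f = (%x. Re (ift (%y. \<i> * (of_real y * g y)) x))" by (intro ext DERIV_imp_deriv)
 show "(f has_real_derivative deriv f x) (at x)" using d e by simp
 show "rep (s - 1) (deriv f) (%y. \<i> * (of_real y * g y))"
  unfolding e
 proof (rule repI)
  show "hs (s - 1) (%y. \<i> * (of_real y * g y))" by (intro hs_cmult hs_shift R)
  show "herm (%y. \<i> * (of_real y * g y))" using R(2) by (simp add: herm_def)
 qed
qed

lemma rep_unique:
 assumes "rep s f g" "rep s f h" "1 <= s" shows "AE y in lborel. g y = h y"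
 using rep_fourier[OF assms(1,3)] rep_fourier[OF assms(2,3)] by (auto elim: eventually_elim2)

text \<open>One of \<open>y - z\<close> and \<open>z\<close> has at least half the size of
  \<open>y\<close>.\<close>

lemma jp_subadd: assumes "0 <= s" shows "jp s y <= 2 powr s * (jp s (y - z) + jp s z)"
proof -
 have key: "jp s y <= 2 powr s * jp s \<zeta>" if "\<bar>y\<bar> <= 2 * \<bar>\<zeta>\<bar>" for \<zeta>
 proof -
  have "\<bar>y\<bar>^2 <= (2 * \<bar>\<zeta>\<bar>)^2" using that by (intro power_mono) auto
  hence "1 + y^2 <= 4 * (1 + \<zeta>^2)" by (simp add: power_mult_distrib)
  hence "jp s y <= (4 * (1 + \<zeta>^2)) powr (s / 2)"
   unfolding jp_def using assms by (intro powr_mono2) auto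
  also have "... = 4 powr (s / 2) * jp s \<zeta>" unfolding jp_def by (rule powr_mult)
  also have "(4::real) powr (s / 2) = 2 powr s"
  proof -
   have "(4::real) powr (s / 2) = (2 powr 2) powr (s / 2)" by simp
   also have "... = 2 powr (2 * (s / 2))" by (simp only: powr_powr)
   finally show ?thesis by simp
  qed
  finally show ?thesis .
 qed
 have p: "0 <= 2 powr s * jp s \<zeta>" for \<zeta> by simp
 have "\<bar>y\<bar> <= 2 * \<bar>y - z\<bar> \<or> \<bar>y\<bar> <= 2 * \<bar>z\<bar>" by (smt (verit))
 thus ?thesis
  using key[of "y - z"] key[of z] p[of "y - z"] p[of z] unfolding distrib_left by linarith
qed

text \<open>By \<open>jp_subadd\<close> the weight falls on one of the two factors; the other factor
  is integrable because \<open>s >= 1\<close>, and Young's inequality applies to each part.\<close>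

lemma hs_cnv:
 assumes a: "hs s a" and b: "hs s b" and s: "1 <= s"
 shows "hs s (cnv a b)" "hsn s (cnv a b) <= (2 * 2 powr s * c1) * (hsn s a * hsn s b)"
proof -
 note [measurable] = hs_measurable[OF a] hs_measurable[OF b]
 have i: "L1 a" "L1 b" "L2 a" "L2 b"
  using hs_integrable[OF a s] hs_integrable[OF b s] hs_L2[OF a] hs_L2[OF b] s by auto
 let ?wa = "%y. of_real (jp s y) * a y" and ?wb = "%y. of_real (jp s y) * b y"
 have w: "L2 ?wa" "L2 ?wb" using a b by (auto simp: hs_def)
 define f1 where "f1 = (%y. Lint z. cmod (b (y - z)) * cmod (?wa z))"
 define f2 where "f2 = (%y. Lint z. cmod (a (y - z)) * cmod (?wb z))"
 have fn: "0 <= f1 y" "0 <= f2 y" for y by (auto simp: f1_def f2_def)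
 have [measurable]: "f1 : Borel" "f2 : Borel"
  unfolding f1_def[abs_def] f2_def[abs_def] by measurable
 have Y1: "L2 (%y. cor (f1 y))" "L2_norm (%y. cor (f1 y)) <= (Lint x. cmod (b x)) * L2_norm ?wa"
  by (rule Young_L1_L2[OF i(2) w(1)]; (simp add: f1_def)?; measurable)+
 have Y2: "L2 (%y. cor (f2 y))" "L2_norm (%y. cor (f2 y)) <= (Lint x. cmod (a x)) * L2_norm ?wb"
  by (rule Young_L1_L2[OF i(1) w(2)]; (simp add: f2_def)?; measurable)+
 have le: "jp s y * cmod (cnv a b y) <= 2 powr s * (f1 y + f2 y)" for y
 proof -
  have j1: "L1 (%z. cmod (?wa (y - z)) * cmod (b z))"
   by (rule L2_Cauchy_Schwarz(1)[OF L2_shift(1)[OF w(1)] i(4)])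
  have j2: "L1 (%z. cmod (a (y - z)) * cmod (?wb z))"
   by (rule L2_Cauchy_Schwarz(1)[OF L2_shift(1)[OF i(3)] w(2)])
  have f1: "f1 y = (Lint z. cmod (?wa (y - z)) * cmod (b z))"
   unfolding f1_def using lborel_integral_real_affine[of "-1" "%z. cmod (b (y - z)) * cmod (?wa z)" y] by (simp add: mult.commute)
  have "jp s y * cmod (cnv a b y) <= jp s y * (Lint z. cmod (a (y - z)) * cmod (b z))"
   by (intro mult_left_mono norm_cnv_le) simp
  also have "... = (Lint z. jp s y * (cmod (a (y - z)) * cmod (b z)))" by simp
  also have "... <= (Lint z. 2 powr s * (cmod (?wa (y - z)) * cmod (b z) + cmod (a (y - z)) * cmod (?wb z)))"
  proof (rule integral_mono_AE')
   show "L1 (%z. 2 powr s * (cmod (?wa (y - z)) * cmod (b z) + cmod (a (y - z)) * cmod (?wb z)))"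
    using j1 j2 by simp
   show "AE z in lborel. jp s y * (cmod (a (y - z)) * cmod (b z)) <= 2 powr s * (cmod (?wa (y - z)) * cmod (b z) + cmod (a (y - z)) * cmod (?wb z))"
   proof (rule AE_I2)
    fix z
    have "jp s y * (cmod (a (y - z)) * cmod (b z)) <= (2 powr s * (jp s (y - z) + jp s z)) * (cmod (a (y - z)) * cmod (b z))"
     using s by (intro mult_right_mono jp_subadd) auto
    thus "jp s y * (cmod (a (y - z)) * cmod (b z)) <= 2 powr s * (cmod (?wa (y - z)) * cmod (b z) + cmod (a (y - z)) * cmod (?wb z))"
     by (simp add: norm_mult algebra_simps)
   qed
  qed auto
  also have "... = 2 powr s * (f1 y + f2 y)" using j1 j2 by (simp add: f1 f2_def)
  finally show ?thesis .
 qed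
 let ?f = "%y. cor (f1 y) + cor (f2 y)"
 have nf: "cmod (?f y) = f1 y + f2 y" for y using fn[of y] by (simp flip: of_real_add)
 have F: "hs 0 ?f" using L2_add[OF Y1(1) Y2(1)] by (simp add: hs_0)
 have bd: "jp s y * cmod (cnv a b y) <= 2 powr s * (jp 0 y * cmod (?f y))" for y
  unfolding nf using le by simp
 note H = hs_bound[OF F cnv_measurable bd]
 show "hs s (cnv a b)" by (rule H(1)) auto
 have "hsn s (cnv a b) <= 2 powr s * hsn 0 ?f" by (rule H(2)) auto
 also have "hsn 0 ?f <= (Lint x. cmod (b x)) * hsn s a + (Lint x. cmod (a x)) * hsn s b"
  using L2_norm_triangle[OF Y1(1) Y2(1)] Y1(2) Y2(2) by (simp add: hs_0 hsn_def)
 also have "... <= (c1 * hsn s b) * hsn s a + (c1 * hsn s a) * hsn s b"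
  using hs_integrable(2)[OF a s] hs_integrable(2)[OF b s] by (intro add_mono mult_right_mono) auto
 also have "... = 2 * c1 * (hsn s a * hsn s b)" by simp
 finally show "hsn s (cnv a b) <= (2 * 2 powr s * c1) * (hsn s a * hsn s b)" by (simp add: mult_ac)
qed

lemma hs_prod_ft:
 assumes a: "hs s a" and b: "hs s b" and s: "1 <= s"
 shows "hs s (prod_ft a b)" "hsn s (prod_ft a b) <= (2 * 2 powr s * c1) * (hsn s a * hsn s b)"
proof -
 have i: "L1 a" "L2 a" "L1 b" "L2 b"
  using hs_integrable[OF a s] hs_integrable[OF b s] hs_L2[OF a] hs_L2[OF b] s by auto
 note C = hs_cnv[OF a b s]
 have h: "hs s (%y. of_real (1 / sqrt (2 * pi)) * cnv a b y)" by (rule hs_cmult[OF C(1)])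
 note E = hs_cong_AE[OF h prod_ft_measurable[OF i]]
 have e: "AE y in lborel. of_real (1 / sqrt (2 * pi)) * cnv a b y = prod_ft a b y"
  using prod_ft_eq_cnv[OF i] by eventually_elim simp
 show "hs s (prod_ft a b)" by (rule E(1)[OF e])
 have "hsn s (prod_ft a b) = 1 / sqrt (2 * pi) * hsn s (cnv a b)" by (subst E(2)[OF e], subst hsn_cmult) (simp add: norm_divide)
 also have "... <= 1 * hsn s (cnv a b)" using pi_gt3 by (intro mult_right_mono) (auto simp: real_le_rsqrt)
 finally show "hsn s (prod_ft a b) <= (2 * 2 powr s * c1) * (hsn s a * hsn s b)" using C(2) by linarith
qed

lemma rep_mult:
 assumes f: "rep s f g" and f': "rep s f' g'" and s: "1 <= s"
 shows "of_real (f x * f' x) = ift (prod_ft g g') x"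
proof -
 note R = repD[OF f] and R' = repD[OF f']
 have i: "L1 g" "L2 g" "L1 g'" "L2 g'"
  using hs_integrable[OF R(1) s] hs_integrable[OF R'(1) s] hs_L2[OF R(1)] hs_L2[OF R'(1)] s by auto
 have "ift (prod_ft g g') x = ift (%y. of_real (1 / sqrt (2 * pi)) * cnv g g' y) x"
  using i by (subst ift_cong_AE[OF _ _ prod_ft_eq_cnv[OF i]]) (auto intro!: prod_ft_measurable)
 also have "... = ift g x * ift g' x" by (subst ift_cmult) (simp add: ift_cnv i)
 finally show ?thesis by (simp flip: R(3) R'(3))
qed

section \<open>Trilinear forms\<close>

text \<open>Up to a constant, the integral of the product of the three inverse transforms: the three
  frequencies sum to 0.\<close>

definition tri :: "(real => complex) => (real => complex) => (real => complex) => complex" where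
 "tri a b c = (LINT p|lborel2. (case p of (k, m) => a k * b m * c (- k - m)))"

definition tint :: "(real => complex) => (real => complex) => (real => complex) => bool" where
 "tint a b c \<longleftrightarrow> integrable lborel2 (%(k, m). a k * b m * c (- k - m))"

text \<open>The absolute version takes values in \<open>ennreal\<close>, so the frequencies can be
  permuted before integrability is known; integrability is then read off from the finiteness of any
  permutation.\<close>

definition ntri :: "(real => complex) => (real => complex) => (real => complex) => ennreal" where
 "ntri a b c = (\<integral>\<^sup>+k. \<integral>\<^sup>+m. ennreal (cmod (a k * b m * c (- k - m))) \<partial>lborel \<partial>lborel)"

context
 fixes a b c :: "real => complex"
 assumes [measurable]: "a : Borel" "b : Borel" "c : Borel"
begin

lemma ntri_eq: "ntri a b c = (\<integral>\<^sup>+p. ennreal (cmod (case p of (k, m) => a k * b m * c (- k - m))) \<partial>lborel2)"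
proof -
 have "(%p. ennreal (cmod (case p of (k, m) => a k * b m * c (- k - m)))) : borel_measurable lborel2"
  by measurable
 from lborel.nn_integral_fst[OF this] show ?thesis by (simp add: ntri_def)
qed

lemma ntri_swap: "ntri a b c = ntri b a c"
proof -
 have "ntri a b c = (\<integral>\<^sup>+m. \<integral>\<^sup>+k. ennreal (cmod (a k * b m * c (- k - m))) \<partial>lborel \<partial>lborel)"
  unfolding ntri_def by (rule lborel_pair.Fubini'[symmetric]) measurable
 also have "... = ntri b a c"
  unfolding ntri_def by (intro nn_integral_cong) (simp add: mult.commute minus_diff_commute)
 finally show ?thesis .
qed

lemma ntri_reflect: "ntri a b c = ntri a c b"
 unfolding ntri_def
proof (rule nn_integral_cong)
 fix k
 have "(\<integral>\<^sup>+m. ennreal (cmod (a k * b m * c (- k - m))) \<partial>lborel)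
  = (\<integral>\<^sup>+m. ennreal (cmod (a k * b (- k + (-1) * m) * c (- k - (- k + (-1) * m)))) \<partial>lborel)"
  by (subst nn_integral_real_affine[where c="-1" and t="-k"]) auto
 thus "(\<integral>\<^sup>+m. ennreal (cmod (a k * b m * c (- k - m))) \<partial>lborel)
  = (\<integral>\<^sup>+m. ennreal (cmod (a k * c m * b (- k - m))) \<partial>lborel)"
  by (simp add: mult_ac)
qed

lemma tint_iff: "tint a b c \<longleftrightarrow> ntri a b c < \<infinity>"
 unfolding tint_def integrable_iff_bounded ntri_eq by auto

text \<open>Cauchy-Schwarz in the inner variable; the outer integral then sees only
  \<open>a\<close>. Together with the permutations, any one of the three factors may play the
  integrable role.\<close>

lemma ntri_le:
 assumes a: "L1 a" and b: "L2 b" and c: "L2 c"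
 shows "ntri a b c <= ennreal ((Lint x. cmod (a x)) * (L2_norm b * L2_norm c))"
proof -
 have "ntri a b c <= (\<integral>\<^sup>+k. ennreal (L2_norm b * L2_norm c) * ennreal (cmod (a k)) \<partial>lborel)"
  unfolding ntri_def
 proof (rule nn_integral_mono)
  fix k
  note S = L2_shift[OF c, of "-k"]
  note CS = L2_Cauchy_Schwarz[OF b S(1)]
  have "(\<integral>\<^sup>+m. ennreal (cmod (a k * b m * c (- k - m))) \<partial>lborel)
   = ennreal (cmod (a k)) * (\<integral>\<^sup>+m. ennreal (cmod (b m) * cmod (c (- k - m))) \<partial>lborel)"
   by (subst nn_integral_cmult[symmetric]) (auto simp: norm_mult ennreal_mult' mult.assoc)
  also have "(\<integral>\<^sup>+m. ennreal (cmod (b m) * cmod (c (- k - m))) \<partial>lborel) = ennreal (Lint m. cmod (b m) * cmod (c (- k - m)))"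
   by (rule nn_integral_eq_integral[OF CS(1)]) auto
  also have "ennreal (cmod (a k)) * ... <= ennreal (cmod (a k)) * ennreal (L2_norm b * L2_norm c)"
   using CS(2) S(2) by (intro mult_left_mono ennreal_leI) simp_all
  finally show "(\<integral>\<^sup>+m. ennreal (cmod (a k * b m * c (- k - m))) \<partial>lborel) <= ennreal (L2_norm b * L2_norm c) * ennreal (cmod (a k))"
   by (simp add: mult.commute)
 qed
 also have "... = ennreal (L2_norm b * L2_norm c) * ennreal (Lint x. cmod (a x))"
  by (subst nn_integral_cmult) (auto simp: nn_integral_eq_integral[OF integrable_norm[OF a]])
 also have "... = ennreal ((Lint x. cmod (a x)) * (L2_norm b * L2_norm c))"
  by (subst ennreal_mult[symmetric]) (auto simp: mult.commute)
 finally show ?thesis .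
qed

lemma norm_tri_le:
 assumes "ntri a b c <= ennreal C" "0 <= C" shows "cmod (tri a b c) <= C"
proof -
 have t: "tint a b c" unfolding tint_iff using assms(1) by (simp add: le_less_trans[OF _ ennreal_less_top])
 have "ennreal (cmod (tri a b c)) <= ntri a b c"
  unfolding tri_def ntri_eq by (rule integral_norm_bound_ennreal[OF t[unfolded tint_def]])
 also have "... <= ennreal C" by (rule assms)
 finally show ?thesis using assms(2) by simp
qed

lemma tri_swap: "tri a b c = tri b a c"
proof -
 have "tri a b c = (LINT p|lborel2. (case p of (m, k) => a k * b m * c (- k - m)))"
  unfolding tri_def using lborel_pair.integral_product_swap[of "%(k, m). a k * b m * c (- k - m)"] by (simp add: split_beta')
 also have "... = tri b a c"
  unfolding tri_def by (intro int_cong refl) (auto simp: mult.commute minus_diff_commute)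
 finally show ?thesis .
qed

lemma tri_fst: "tint a b c ==> tri a b c = (Lint k. Lint m. a k * b m * c (- k - m))"
 unfolding tri_def tint_def by (rule lborel_pair.integral_fst[symmetric])

end

lemma tri_reflect:
 assumes [measurable]: "a : Borel" "b : Borel" "c : Borel"
  and t: "tint a b c"
 shows "tri a b c = tri a c b"
proof -
 have t': "tint a c b" using t by (simp add: tint_iff ntri_reflect[of a b c])
 have "(Lint m. a k * b m * c (- k - m)) = (Lint m. a k * c m * b (- k - m))" for k
  using lborel_integral_real_affine[of "-1" "%m. a k * b m * c (- k - m)" "-k"] by (simp add: mult_ac)
 thus ?thesis using t t' by (simp add: tri_fst)
qed

text \<open>Hermitian symmetry turns \<open>cnj (a k)\<close> into \<open>a (- k)\<close>. After
  reflecting \<open>k\<close> the pairing is a trilinear form in frequencies with sum 0, and the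
  oddness of \<open>\<phi>\<close> produces the sign.\<close>

lemma cnv_pairing:
 assumes [measurable]: "a : Borel" "b : Borel" "c : Borel"
  and h: "herm a" and odd: "!!k. \<phi> (- k) = - \<phi> k" and [measurable]: "\<phi> : Borel"
  and t: "tint (%k. of_real (\<phi> k) * a k) b c"
 shows "(Lint k. cnj (a k) * (\<i> * of_real (\<phi> k) * cnv c b k)) = - \<i> * tri (%k. of_real (\<phi> k) * a k) b c"
proof -
 have "(Lint k. cnj (a k) * (\<i> * of_real (\<phi> k) * cnv c b k))
  = (Lint k. cnj (a (- k)) * (\<i> * of_real (\<phi> (- k)) * cnv c b (- k)))"
  by (rule lborel_integral_reflect[symmetric])
 also have "... = (Lint k. - \<i> * (Lint m. of_real (\<phi> k) * a k * b m * c (- k - m)))"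
 proof (intro int_cong refl)
  fix k
  have "cnj (a (- k)) = a k" using h by (simp add: herm_def)
  moreover have "(Lint m. of_real (\<phi> k) * a k * b m * c (- k - m)) = of_real (\<phi> k) * a k * cnv c b (- k)"
   by (simp add: cnv_def mult.assoc mult.commute[of "b _"])
  ultimately show "cnj (a (- k)) * (\<i> * of_real (\<phi> (- k)) * cnv c b (- k)) = - \<i> * (Lint m. of_real (\<phi> k) * a k * b m * c (- k - m))"
   by (simp add: odd)
 qed
 also have "... = - \<i> * (Lint k. Lint m. of_real (\<phi> k) * a k * b m * c (- k - m))"
  by simp
 also have "... = - \<i> * tri (%k. of_real (\<phi> k) * a k) b c"
  using t by (subst tri_fst) auto
 finally show ?thesis .
qed

text \<open>The integrand \<open>g k g m g(-k-m)\<close> is invariant under permutations of the three frequencies, so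
 the multiplier may be symmetrized; the symmetrized multiplier loses one derivative less.\<close>

lemma symmetrized_trilinear_bound:
 fixes A :: "real => real"
 assumes h: "herm g" and i: "L1 g" and L: "L2 g" and [measurable]: "A : Borel"
  and even: "!!x. A (- x) = A x" and A0: "!!x. 0 <= A x"
  and LA: "L2 (%k. of_real (A k * k) * g k)" and Lw: "L2 (%k. of_real (sqrt (A k)) * g k)"
  and ix: "L1 (%k. of_real k * g k)"
  and K: "0 <= K" "!!x y. \<bar>A x * x + A y * y + A (- x - y) * (- x - y)\<bar> <=
   K * (\<bar>x\<bar> * (sqrt (A y) * sqrt (A (- x - y))) + \<bar>y\<bar> * (sqrt (A x) * sqrt (A (- x - y))) + \<bar>- x - y\<bar> * (sqrt (A x) * sqrt (A y)))"
 shows "cmod (Lint k. cnj (g k) * (\<i> * of_real (A k * k) * cnv g g k)) <=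
  K * (moment g) * (L2_norm (%k. of_real (sqrt (A k)) * g k))^2"
proof -
 note [measurable] = L2_measurable[OF L]
 let ?p = "%k. cor (A k * k) * g k"
 let ?w = "%k. cor (sqrt (A k)) * g k"
 let ?x = "%k. cor k * g k"
 define X where "X = (moment g)"
 define W where "W = (L2_norm ?w)^2"
 have X0: "0 <= X" "0 <= W" by (auto simp: X_def W_def)
 \<comment> \<open>Integrability is obtained with the full multiplier on one factor; the bound
   itself uses only the symmetrized multiplier.\<close>
 have fin: "ntri g ?p g < \<infinity>"
  by (rule le_less_trans[OF ntri_le[OF _ _ _ i LA L]]) auto
 have t1: "tint ?p g g" "tint g ?p g" "tint g g ?p"
  using fin by (simp_all add: tint_iff ntri_swap[of ?p g g] ntri_reflect[of g g ?p] del: of_real_mult)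
 have nb: "ntri ?x ?w ?w <= ennreal (X * W)"
  using ntri_le[OF _ _ _ ix Lw Lw] by (simp add: X_def W_def norm_mult power2_eq_square)
 have e: "tri ?p g g = tri g ?p g" "tri g ?p g = tri g g ?p"
  using tri_swap[of ?p g g] tri_reflect[OF _ _ _ t1(2)] by auto
 have "3 * tri ?p g g = tri ?p g g + tri g ?p g + tri g g ?p" using e by simp
 also have "... = (LINT p|lborel2. (case p of (k, m) => of_real (A k * k + A m * m + A (- k - m) * (- k - m)) * (g k * g m * g (- k - m))))"
  unfolding tri_def using t1[unfolded tint_def]
  by (subst lint_add[symmetric], simp, simp)+
   (intro int_cong refl, auto simp: algebra_simps)
 finally have T3: "3 * tri ?p g g = (LINT p|lborel2. (case p of (k, m) => of_real (A k * k + A m * m + A (- k - m) * (- k - m)) * (g k * g m * g (- k - m))))" (is "_ = integral\<^sup>L _ ?S") .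
 have iS: "integrable lborel2 ?S"
 proof -
  have "?S = (%p. (case p of (k, m) => ?p k * g m * g (- k - m)) + (case p of (k, m) => g k * ?p m * g (- k - m)) + (case p of (k, m) => g k * g m * ?p (- k - m)))"
   by (auto simp: fun_eq_iff algebra_simps)
  thus ?thesis using t1[unfolded tint_def] by simp
 qed
 have "ennreal (cmod (3 * tri ?p g g)) <= (\<integral>\<^sup>+p. ennreal (cmod (?S p)) \<partial>lborel2)"
  unfolding T3 by (rule integral_norm_bound_ennreal[OF iS])
 also have "... <= (\<integral>\<^sup>+p. ennreal K * (ennreal (cmod (case p of (k, m) => ?x k * ?w m * ?w (- k - m)))
   + ennreal (cmod (case p of (k, m) => ?w k * ?x m * ?w (- k - m)))
   + ennreal (cmod (case p of (k, m) => ?w k * ?w m * ?x (- k - m)))) \<partial>lborel2)"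
 proof (rule nn_integral_mono)
  fix p :: "real \<times> real"
  obtain k m where p: "p = (k, m)" by (cases p)
  define G where "G = cmod (g k * g m * g (- k - m))"
  have "cmod (?S p) = \<bar>A k * k + A m * m + A (- k - m) * (- k - m)\<bar> * G"
   by (simp add: p G_def norm_mult del: of_real_add of_real_mult of_real_diff of_real_minus)
  also have "... <= K * (\<bar>k\<bar> * (sqrt (A m) * sqrt (A (- k - m))) + \<bar>m\<bar> * (sqrt (A k) * sqrt (A (- k - m))) + \<bar>- k - m\<bar> * (sqrt (A k) * sqrt (A m))) * G"
   by (rule mult_right_mono[OF K(2)]) (simp add: G_def)
  also have "... = K * (cmod (case p of (k, m) => ?x k * ?w m * ?w (- k - m))
   + cmod (case p of (k, m) => ?w k * ?x m * ?w (- k - m))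
   + cmod (case p of (k, m) => ?w k * ?w m * ?x (- k - m)))"
  proof -
   have n: "cmod (cor (- k) - cor m) = \<bar>- k - m\<bar>"
    by (simp only: of_real_diff[symmetric] norm_of_real)
   show ?thesis using A0 by (simp add: p G_def norm_mult del: of_real_diff of_real_minus) (simp add: algebra_simps)
  qed
  finally have "cmod (?S p) <= K * (cmod (case p of (k, m) => ?x k * ?w m * ?w (- k - m))
   + cmod (case p of (k, m) => ?w k * ?x m * ?w (- k - m))
   + cmod (case p of (k, m) => ?w k * ?w m * ?x (- k - m)))" .
  from ennreal_leI[OF this] show "ennreal (cmod (?S p)) <= ennreal K * (ennreal (cmod (case p of (k, m) => ?x k * ?w m * ?w (- k - m)))
   + ennreal (cmod (case p of (k, m) => ?w k * ?x m * ?w (- k - m)))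
   + ennreal (cmod (case p of (k, m) => ?w k * ?w m * ?x (- k - m))))"
   by (simp only: ennreal_mult'[OF norm_ge_zero] ennreal_mult[OF K(1)] add_nonneg_nonneg norm_ge_zero ennreal_plus)
 qed
 also have "... = ennreal K * (ntri ?x ?w ?w + ntri ?w ?x ?w + ntri ?w ?w ?x)"
  by (simp add: nn_integral_cmult nn_integral_add ntri_eq)
 also have "... = ennreal K * (3 * ntri ?x ?w ?w)"
 proof -
  have "ntri ?w ?x ?w = ntri ?x ?w ?w" by (rule ntri_swap) measurable
  moreover have "ntri ?w ?w ?x = ntri ?w ?x ?w" by (rule ntri_reflect) measurable
  moreover have "x + x + x = 3 * x" for x :: ennreal
  proof -
   have "(3::ennreal) = 1 + 1 + 1" by simp
   thus ?thesis by (simp only: distrib_right mult_1_left)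
  qed
  ultimately show ?thesis by (simp only:)
 qed
 also have "... <= ennreal K * (3 * ennreal (X * W))" by (intro mult_left_mono nb) auto
 also have "... = ennreal (K * (3 * (X * W)))" using X0 K by (simp add: ennreal_mult)
 finally have "3 * cmod (tri ?p g g) <= K * (3 * (X * W))"
  using X0 K by (simp add: norm_mult)
 moreover have "(Lint k. cnj (g k) * (\<i> * of_real (A k * k) * cnv g g k)) = - \<i> * tri ?p g g"
  by (rule cnv_pairing[where \<phi>="%k. A k * k"]) (use h even t1 in auto)
 ultimately show ?thesis unfolding X_def[symmetric] W_def[symmetric] by (simp add: norm_mult)
qed

text \<open>On the transform side this is the integration by parts that turns the integral of r r_x
  q into minus half that of r^2 q_x: symmetrizing in the first two frequencies replaces
  \<open>k + m\<close> by minus the frequency of \<open>q\<close>.\<close>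

lemma transport_form_bound:
 assumes h: "herm r" "herm q" and r: "L2 r" "L2 (%k. of_real k * r k)"
  and q: "L1 q" "L1 (%k. of_real k * q k)"
 shows "cmod (Lint k. cnj (r k) * (\<i> * of_real k * cnv q r k)) <=
  1/2 * (moment q) * (L2_norm r)^2"
proof -
 note [measurable] = L2_measurable[OF r(1)] borel_measurable_integrable[OF q(1)]
 let ?r = "%k. cor k * r k" and ?q = "%k. cor k * q k"
 have fin: "ntri q ?r r < \<infinity>" by (rule le_less_trans[OF ntri_le[OF _ _ _ q(1) r(2,1)]]) auto
 have t: "tint ?r r q" "tint r ?r q"
  using fin by (simp_all add: tint_iff ntri_swap[of q ?r r] ntri_reflect[of ?r q r] ntri_swap[of r ?r q])
 have nq: "ntri r r ?q <= ennreal ((moment q) * (L2_norm r)^2)"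
  using ntri_le[OF _ _ _ q(2) r(1) r(1)] by (simp add: norm_mult power2_eq_square ntri_reflect[of r r ?q] ntri_swap[of r ?q r])
 have tq: "tint r r ?q" by (simp add: tint_iff le_less_trans[OF nq])
 have "2 * tri ?r r q = tri ?r r q + tri r ?r q" using tri_swap[of ?r r q] by simp
 also have "... = (LINT p|lborel2. (case p of (k, m) => ?r k * r m * q (- k - m)) + (case p of (k, m) => r k * ?r m * q (- k - m)))"
  unfolding tri_def using t[unfolded tint_def] by simp
 also have "... = (LINT p|lborel2. - (case p of (k, m) => r k * r m * ?q (- k - m)))"
  by (intro int_cong refl) (auto simp: algebra_simps)
 also have "... = - tri r r ?q" by (simp add: tri_def)
 finally have e: "2 * tri ?r r q = - tri r r ?q" .
 have "2 * cmod (tri ?r r q) = cmod (tri r r ?q)"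
  using arg_cong[OF e, of cmod] by (simp add: norm_mult)
 also have "... <= (moment q) * (L2_norm r)^2"
  by (rule norm_tri_le[OF _ _ _ nq]) auto
 finally have "2 * cmod (tri ?r r q) <= (moment q) * (L2_norm r)^2" .
 moreover have "(Lint k. cnj (r k) * (\<i> * of_real k * cnv q r k)) = - \<i> * tri ?r r q"
  by (rule cnv_pairing[where \<phi>="%k. k"]) (use h t in auto)
 ultimately show ?thesis by (simp add: norm_mult)
qed

section \<open>Admissible weights\<close>

text \<open>The last clause is polynomial growth of degree \<open>K\<close> under dilation. For
  \<open>l\<close> near 1 it bounds the increment of \<open>A\<close> by \<open>A\<close> times the
  relative increment of the argument, which is what the symmetrized form needs. The growth rate in
  the energy estimates depends on \<open>A\<close> through \<open>K\<close> only, so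
  \<open>A\<close> may contain a parameter such as the \<open>R\<close> of
  \<open>weight_tail\<close>.\<close>

definition weight :: "nat => (real => real) => bool" where
 "weight K A \<longleftrightarrow> (ALL x. A (- x) = A x) & (ALL x. 0 <= A x) & (ALL x y. 0 <= x --> x <= y --> A x <= A y) &
  (ALL l x. 1 <= l --> 0 <= x --> A (l * x) <= l ^ K * A x)"

text \<open>Convexity: on [0,1] the power lies below its chord.\<close>

lemma power_chord: "0 <= t ==> t <= 1 ==> (1 + t) ^ K <= 1 + (2 ^ K - 1) * (t::real)"
proof (induction K)
 case (Suc K)
 have "(1 + t) ^ Suc K <= (1 + t) * (1 + (2 ^ K - 1) * t)"
  using Suc by (simp add: mult_left_mono)
 also have "... = 1 + t + (2 ^ K - 1) * t + (2 ^ K - 1) * (t * t)" by (simp add: algebra_simps)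
 also have "... <= 1 + t + (2 ^ K - 1) * t + (2 ^ K - 1) * t"
  using Suc.prems by (intro add_left_mono mult_left_mono) (auto simp: mult_left_le)
 finally show ?case by (simp add: algebra_simps)
qed simp

text \<open>With \<open>z = x + y\<close> the symmetrized multiplier is minus the sum of
  \<open>(A z - A x) * x\<close> and \<open>(A z - A y) * y\<close>. The first term contains the
  small frequency \<open>x\<close>; the second gains the factor \<open>x / y\<close> from the growth
  condition. So the derivative always falls on the smallest frequency.\<close>

lemma weight_ineq_aux:
 assumes w: "weight K A" and xy: "0 <= x" "x <= y"
 shows "\<bar>A x * x + A y * y + A (- x - y) * (- x - y)\<bar> <= (2 * 2 ^ K) * (x * (sqrt (A y) * sqrt (A (- x - y))))"
proof -
 have W: "A (- z) = A z" "0 <= A z" "0 <= z ==> z <= z' ==> A z <= A z'" "1 <= l ==> 0 <= z ==> A (l * z) <= l ^ K * A z" for z z' l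
  using w by (auto simp: weight_def)
 define z where "z = x + y"
 have z: "A (- x - y) = A z" "- x - y = - z" using W(1)[of z] by (simp_all add: z_def)
 have mono: "A x <= A z" "A y <= A z" using W(3) xy by (auto simp: z_def)
 have sq: "sqrt (A y) <= sqrt (A z)" using mono by simp
 have p1: "(1::real) <= 2 ^ K" by simp
 have "A z <= A (2 * y)" using xy by (intro W(3)) (auto simp: z_def)
 also have "... <= 2 ^ K * A y" using xy by (intro W(4)) auto
 also have "... <= (2 ^ K)^2 * A y" using p1 W(2)[of y] by (intro mult_right_mono) (auto simp: power2_eq_square)
 finally have "sqrt (A z) <= sqrt ((2 ^ K)^2 * A y)" by simp
 hence sz: "sqrt (A z) <= 2 ^ K * sqrt (A y)" by (simp add: real_sqrt_mult)
 have "(A z - A x) * x <= A z * x" using W(2)[of x] xy by (intro mult_right_mono) auto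
 also have "... = x * (sqrt (A z) * sqrt (A z))" using W(2)[of z] by simp
 also have "... <= x * ((2 ^ K * sqrt (A y)) * sqrt (A z))"
  by (intro mult_left_mono mult_right_mono sz) (use xy W(2) in auto)
 finally have b1: "(A z - A x) * x <= 2 ^ K * (x * (sqrt (A y) * sqrt (A z)))" by (simp add: mult_ac)
 have b2: "(A z - A y) * y <= 2 ^ K * (x * (sqrt (A y) * sqrt (A z)))"
 proof (cases "y = 0")
  case True
  thus ?thesis using xy W(2) by simp
 next
  case False
  hence y: "0 < y" using xy by simp
  have t: "0 <= x / y" "x / y <= 1" using xy y by auto
  have "A z = A ((1 + x / y) * y)" using y by (simp add: z_def distrib_right add.commute)
  also have "... <= (1 + x / y) ^ K * A y" using t y by (intro W(4)) auto
  also have "... <= (1 + (2 ^ K - 1) * (x / y)) * A y" by (intro mult_right_mono power_chord t W(2))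
  also have "... <= (1 + 2 ^ K * (x / y)) * A y"
   by (intro mult_right_mono add_left_mono W(2) t) auto
  finally have "(A z - A y) * y <= (2 ^ K * (x / y) * A y) * y"
   using y by (intro mult_right_mono) (auto simp: algebra_simps)
  also have "... = 2 ^ K * (x * (sqrt (A y) * sqrt (A y)))" using y W(2)[of y] by simp
  also have "... <= 2 ^ K * (x * (sqrt (A y) * sqrt (A z)))"
   by (intro mult_left_mono sq) (use xy W(2) in auto)
  finally show ?thesis .
 qed
 have "A x * x + A y * y + A (- x - y) * (- x - y) = - ((A z - A x) * x + (A z - A y) * y)"
  by (simp add: z(1)[unfolded z_def] z_def algebra_simps)
 moreover have "0 <= (A z - A x) * x" "0 <= (A z - A y) * y" using mono xy by auto
 ultimately show ?thesis using b1 b2 by (simp add: z(1))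
qed

lemma weight_ineq:
 assumes w: "weight K A"
 shows "\<bar>A x * x + A y * y + A (- x - y) * (- x - y)\<bar> <= (2 * 2 ^ K) *
  (\<bar>x\<bar> * (sqrt (A y) * sqrt (A (- x - y))) + \<bar>y\<bar> * (sqrt (A x) * sqrt (A (- x - y))) + \<bar>- x - y\<bar> * (sqrt (A x) * sqrt (A y)))"
proof -
 define Q where "Q = (%x y z. \<bar>A x * x + A y * y + A z * z\<bar> <= (2 * 2 ^ K) *
  (\<bar>x\<bar> * (sqrt (A y) * sqrt (A z)) + \<bar>y\<bar> * (sqrt (A x) * sqrt (A z)) + \<bar>z\<bar> * (sqrt (A x) * sqrt (A y))))"
 have W: "A (- z) = A z" "0 <= A z" for z using w by (auto simp: weight_def)
 have s1: "Q x y z ==> Q y x z" and s2: "Q x y z ==> Q x z y" for x y z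
  unfolding Q_def by (simp_all add: add.commute add.left_commute mult.commute)
 have s3: "Q x y z ==> Q (- x) (- y) (- z)" for x y z
 proof -
  assume "Q x y z"
  moreover have "\<bar>A (- x) * - x + A (- y) * - y + A (- z) * - z\<bar> = \<bar>A x * x + A y * y + A z * z\<bar>" by (simp add: W)
  ultimately show "Q (- x) (- y) (- z)" unfolding Q_def by (simp add: W)
 qed
 have p0: "Q x y (- x - y)" if "0 <= x" "x <= y" for x y
  unfolding Q_def using weight_ineq_aux[OF w that]
  by (rule order_trans) (intro mult_left_mono, use that W in auto)
 have p1: "Q x y (- x - y)" if "0 <= x" "0 <= y" for x y
 proof (cases "x <= y")
  case False
  thus ?thesis using s1[OF p0[of y x]] that by (simp add: minus_diff_commute)
 qed (use p0 that in auto)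
 have p2: "Q x y z" if "x + y + z = 0" "0 <= x" "0 <= y" for x y z
 proof -
  have "z = - x - y" using that by linarith
  thus ?thesis using p1[OF that(2,3)] by (simp only:)
 qed
 have p3: "Q x y z" if "x + y + z = 0" "x <= 0" "y <= 0" for x y z
  using s3[OF p2[of "-x" "-y" "-z"]] that by simp
 have p4: "Q x y z" if e: "x + y + z = 0" for x y z
 proof -
  \<comment> \<open>Among three numbers two have the same weak sign; permutation and reflection of
    \<open>Q\<close> reduce every case to two nonnegative ones.\<close>
  consider "0 <= x" "0 <= y" | "x <= 0" "y <= 0" | "0 <= x" "0 <= z" | "x <= 0" "z <= 0" | "0 <= y" "0 <= z" | "y <= 0" "z <= 0"
   by linarith
  thus ?thesis
  proof cases
   case 3 thus ?thesis using s2[OF p2[of x z y]] e by simp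
  next
   case 4 thus ?thesis using s2[OF p3[of x z y]] e by simp
  next
   case 5 thus ?thesis using s1[OF s2[OF p2[of y z x]]] e by simp
  next
   case 6 thus ?thesis using s1[OF s2[OF p3[of y z x]]] e by simp
  qed (use p2 p3 e in auto)
 qed
 show ?thesis using p4[of x y "- x - y"] unfolding Q_def by simp
qed

lemma weight_const: "0 <= c ==> weight K (%x. c)"
 unfolding weight_def by (auto simp: mult_left_le_one_le mult_le_cancel_right1)

lemma weight_jp: assumes "0 <= s" "2 * s <= real K" shows "weight K (%x. (1 + x^2) powr s)"
 unfolding weight_def
proof (intro conjI allI impI)
 fix x y :: real assume "0 <= x" "x <= y"
 hence "x^2 <= y^2" by (intro power_mono) auto
 thus "(1 + x^2) powr s <= (1 + y^2) powr s" using assms by (intro powr_mono2) auto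
next
 fix l x :: real assume l: "1 <= l" and "0 <= x"
 have "1 + (l * x)^2 <= l^2 * (1 + x^2)" using l by (simp add: power_mult_distrib distrib_left)
 hence "(1 + (l * x)^2) powr s <= (l^2 * (1 + x^2)) powr s" using assms by (intro powr_mono2) auto
 also have "... = (l^2) powr s * (1 + x^2) powr s" by (rule powr_mult)
 also have "(l^2) powr s = l powr (2 * s)" using l by (simp add: powr_powr flip: powr_numeral)
 also have "... <= l powr (real K)" using l assms by (intro powr_mono) auto
 also have "... = l ^ K" using l by (simp add: powr_realpow)
 finally show "(1 + (l * x)^2) powr s <= l ^ K * (1 + x^2) powr s" by (simp add: mult_right_mono)
qed auto

text \<open>A sharp cutoff to high frequencies violates the dilation condition at its jump. This
  smooth substitute satisfies it with a degree independent of \<open>R\<close>.\<close>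

lemma weight_tail: assumes R: "0 < R" shows "weight 2 (%x. x^2 / (R^2 + x^2))"
proof -
 have p: "0 < R^2 + x^2" for x :: real using R by (simp add: add_pos_nonneg)
 have e: "x^2 / (R^2 + x^2) = 1 - R^2 / (R^2 + x^2)" for x
 proof -
  have "R^2 / (R^2 + x^2) + x^2 / (R^2 + x^2) = 1" using p[of x] R by (simp add: add_divide_distrib[symmetric])
  thus ?thesis by linarith
 qed
 show ?thesis
  unfolding weight_def
 proof (intro conjI allI impI)
  fix x y :: real assume "0 <= x" "x <= y"
  hence "x^2 <= y^2" by (intro power_mono) auto
  thus "x^2 / (R^2 + x^2) <= y^2 / (R^2 + y^2)"
   unfolding e using p[of x] p[of y] by (intro diff_left_mono divide_left_mono) auto
 next
  fix l x :: real assume l: "1 <= l" and "0 <= x"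
  have "x^2 <= (l * x)^2" using l by (simp add: power_mult_distrib mult_le_cancel_right1)
  hence "(l * x)^2 / (R^2 + (l * x)^2) <= (l * x)^2 / (R^2 + x^2)"
   using p[of x] p[of "l * x"] by (intro divide_left_mono) auto
  thus "(l * x)^2 / (R^2 + (l * x)^2) <= l^2 * (x^2 / (R^2 + x^2))" by (simp add: power_mult_distrib)
 qed (use p in \<open>auto intro!: divide_nonneg_pos\<close>)
qed

lemma weight_mult: assumes "weight K A" "weight K' A'" shows "weight (K + K') (%x. A x * A' x)"
proof -
 have W: "A (- z) = A z" "0 <= A z" "0 <= z ==> z <= z' ==> A z <= A z'" "1 <= l ==> 0 <= z ==> A (l * z) <= l ^ K * A z" for z z' l
  using assms(1) by (auto simp: weight_def)
 have W': "A' (- z) = A' z" "0 <= A' z" "0 <= z ==> z <= z' ==> A' z <= A' z'" "1 <= l ==> 0 <= z ==> A' (l * z) <= l ^ K' * A' z" for z z' l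
  using assms(2) by (auto simp: weight_def)
 show ?thesis
  unfolding weight_def
 proof (intro conjI allI impI)
  fix l x :: real assume l: "1 <= l" and x: "0 <= x"
  have "A (l * x) * A' (l * x) <= (l ^ K * A x) * (l ^ K' * A' x)"
   using l x W W' by (intro mult_mono) auto
  thus "A (l * x) * A' (l * x) <= l ^ (K + K') * (A x * A' x)" by (simp add: power_add mult_ac)
 qed (use W W' in \<open>auto intro!: mult_mono\<close>)
qed

section \<open>Ordinary differential equations and continuity arguments\<close>

text \<open>The contraction takes place in the sup norm weighted by \<open>exp (- L * t)\<close>:
  the integral operator then contracts by \<open>K / L <= 1/2\<close> on all of \<open>[0,T]\<close>
  at once, without gluing short intervals.\<close>

theorem Picard_global:
 fixes F :: "real => 'a::banach => 'a"
 assumes T: "0 <= T" and K: "0 <= K"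
  and cont: "continuous_on ({0..T} \<times> UNIV) (%(t, x). F t x)"
  and lip: "!!t x y. t : {0..T} ==> norm (F t x - F t y) <= K * norm (x - y)"
 obtains y where "y 0 = x0" "!!t. t : {0..T} ==> (y has_vector_derivative F t (y t)) (at t within {0..T})"
proof -
 define L where "L = 2 * K + 1"
 have L: "0 < L" "K / L <= 1 / 2" using K by (auto simp: L_def)
 have cF: "continuous_on S (%s. F s (v s))" if v: "continuous_on S v" and S: "S \<subseteq> {0..T}" for v S
 proof -
  have "continuous_on S (%s. (s, v s))" by (intro continuous_intros v)
  from continuous_on_compose2[OF cont this] S show ?thesis by auto
 qed
 define I where "I = (%(z :: real \<Rightarrow>\<^sub>C 'a) s. F s (exp (L * s) *\<^sub>R z s))"
 have cI: "continuous_on {0..t} (I z)" if "t <= T" for z t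
  unfolding I_def using that by (intro cF continuous_intros) auto
 define H where "H = (%z t. exp (- L * t) *\<^sub>R (x0 + integral {0..t} (I z)))"
 have dI: "((%u. x0 + integral {0..u} (I z)) has_vector_derivative I z t) (at t within {0..T})" if "t : {0..T}" for z t
  using has_vector_derivative_add[OF has_vector_derivative_const integral_has_vector_derivative[OF cI[OF order_refl] that]] by simp
 have cI2: "continuous_on {0..T} (%u. x0 + integral {0..u} (I z))" for z
  unfolding continuous_on_eq_continuous_within using dI has_vector_derivative_continuous by blast
 have cH: "continuous_on (cbox 0 T) (H z)" for z
  unfolding H_def cbox_interval by (intro continuous_on_scaleR cI2 continuous_intros)
 \<comment> \<open>Clamping the time argument extends a continuous function on \<open>[0,T]\<close>
   to a bounded continuous function on the line, so that the fixed point theorem applies in the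
   Banach space of such functions.\<close>
 have "EX g. (ALL x. apply_bcontfun g x = H z (clamp 0 T x))" for z
  using continuous_on_cbox_bcontfunE[OF cH[of z]] by metis
 then obtain \<Psi> where \<Psi>: "!!z x. apply_bcontfun (\<Psi> z) x = H z (clamp 0 T x)" by metis
 have contr: "norm (H z t - H z' t) <= 1 / 2 * dist z z'" if t: "t : {0..T}" for z z' t
 proof -
  let ?d = "dist z z'"
  have "H z t - H z' t = exp (- L * t) *\<^sub>R (integral {0..t} (I z) - integral {0..t} (I z'))"
   by (simp add: H_def scaleR_diff_right flip: scaleR_diff_right)
  also have "integral {0..t} (I z) - integral {0..t} (I z') = integral {0..t} (%s. I z s - I z' s)"
   using t by (intro integral_diff[symmetric] integrable_continuous_real cI) auto
  finally have e: "H z t - H z' t = exp (- L * t) *\<^sub>R integral {0..t} (%s. I z s - I z' s)" .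
  have hi: "((%s. K * ?d * exp (L * s)) has_integral (K * ?d / L * exp (L * t) - K * ?d / L * exp (L * 0))) {0..t}"
   using t L by (intro fundamental_theorem_of_calculus)
    (auto intro!: derivative_eq_intros simp flip: has_real_derivative_iff_has_vector_derivative)
  have "norm (integral {0..t} (%s. I z s - I z' s)) <= integral {0..t} (%s. K * ?d * exp (L * s))"
  proof (rule Henstock_Kurzweil_Integration.integral_norm_bound_integral)
   show "(%s. I z s - I z' s) integrable_on {0..t}"
    using t by (intro integrable_continuous_real continuous_intros cI) auto
   show "(%s. K * ?d * exp (L * s)) integrable_on {0..t}" using hi by blast
   fix s assume s: "s : {0..t}"
   have "norm (I z s - I z' s) <= K * norm (exp (L * s) *\<^sub>R z s - exp (L * s) *\<^sub>R z' s)"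
    unfolding I_def using s t by (intro lip) auto
   also have "... = K * (exp (L * s) * dist (z s) (z' s))"
    by (simp add: dist_norm flip: scaleR_diff_right)
   also have "... <= K * (exp (L * s) * ?d)" using K by (intro mult_left_mono dist_bounded) auto
   finally show "norm (I z s - I z' s) <= K * ?d * exp (L * s)" by (simp add: mult_ac)
  qed
  also have "... = K * ?d / L * exp (L * t) - K * ?d / L * exp (L * 0)" by (rule integral_unique[OF hi])
  also have "... <= K * ?d / L * exp (L * t)" using K L by simp
  finally have "exp (- L * t) * norm (integral {0..t} (%s. I z s - I z' s)) <= exp (- L * t) * (K * ?d / L * exp (L * t))"
   by (rule mult_left_mono) simp
  hence "norm (H z t - H z' t) <= exp (- L * t) * (K * ?d / L * exp (L * t))"
   unfolding e norm_scaleR abs_exp_cancel .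
  also have "... = K / L * ?d" by (simp add: exp_minus)
  also have "... <= 1 / 2 * ?d" by (intro mult_right_mono L) simp
  finally show ?thesis .
 qed
 have cl: "clamp 0 T x : {0..T}" for x :: real using clamp_in_interval[of 0 T x] T by simp
 have "EX! z. \<Psi> z = z"
 proof (rule banach_fix_type[where c="1/2"])
  show "ALL x y. dist (\<Psi> x) (\<Psi> y) <= 1 / 2 * dist x y"
  proof (intro allI)
   fix x y
   show "dist (\<Psi> x) (\<Psi> y) <= 1 / 2 * dist x y"
   proof (rule dist_bound)
    fix t show "dist (\<Psi> x t) (\<Psi> y t) <= 1 / 2 * dist x y"
     using contr[OF cl, of x t y] by (simp add: \<Psi> dist_norm)
   qed
  qed
 qed auto
 then obtain z where z: "\<Psi> z = z" by blast
 define y where "y = (%t. x0 + integral {0..t} (I z))"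
 have zy: "exp (L * t) *\<^sub>R z t = y t" if t: "t : {0..T}" for t
 proof -
  have "clamp 0 T t = t" using t by (simp add: clamp_cancel_cbox)
  hence "z t = H z t" using \<Psi>[of z t] z by simp
  thus ?thesis by (simp add: H_def y_def exp_minus)
 qed
 show ?thesis
 proof
  show "y 0 = x0" by (simp add: y_def)
  fix t assume t: "t : {0..T}"
  show "(y has_vector_derivative F t (y t)) (at t within {0..T})"
   using dI[OF t, of z] unfolding y_def[symmetric] by (simp add: I_def zy[OF t])
 qed
qed

text \<open>At the first time \<open>u\<close> with \<open>R <= p u\<close> the bound
  \<open>p <= R\<close> still holds on \<open>[0,u]\<close>, and \<open>step\<close> improves it to
  \<open>p u <= R' < R\<close>, a contradiction.\<close>

lemma bootstrap:
 fixes p :: "real => real"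
 assumes c: "continuous_on {0..T} p" and R: "R' < R" "p 0 <= R'"
  and step: "!!t. t : {0..T} ==> (!!s. s : {0..t} ==> p s <= R) ==> p t <= R'"
  and t: "t : {0..T}"
 shows "p t <= R'"
proof (cases "EX t1:{0..T}. R <= p t1")
 case False
 thus ?thesis using t by (intro step) force+
next
 case True
 let ?S = "{t\<in>{0..T}. R <= p t}"
 have "closed ?S" using continuous_on_closed_Collect_le[OF continuous_on_const c] by simp
 moreover have "bounded ?S" by (rule bounded_subset[of "{0..T}"]) auto
 ultimately have "compact ?S" by (simp add: compact_eq_bounded_closed)
 then obtain u where u: "u : ?S" "!!s. s : ?S ==> u <= s"
  using compact_attains_inf[of ?S] True by blast
 have lt: "p s < R" if "s : {0..<u}" for s using u(2)[of s] u(1) that by force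
 have u0: "0 < u" using u(1) R by (cases "u = 0") auto
 have cl: "closure {0..<u} = {0..u}" using u0 by simp
 have "continuous_on {0..u} p" using u(1) by (intro continuous_on_subset[OF c]) auto
 hence le: "p s <= R" if "s : {0..u}" for s
  using continuous_le_on_closure[of "{0..<u}" p s R] lt that unfolding cl by force
 have "p u <= R'" using step[of u] le u(1) by simp
 thus ?thesis using u(1) R by simp
qed

section \<open>Energy estimates for curves of transforms\<close>

text \<open>Differentiability in time at each fixed frequency, with joint measurability for Fubini.
  Estimates in norm are recovered from it by \<open>energy_identity\<close> and
  \<open>flow_Lipschitz\<close>.\<close>

definition flow :: "real => (real => real => complex) => (real => real => complex) => bool" where
 "flow T g f \<longleftrightarrow> (%(t, k). g t k) : Borel2 &
  (%(t, k). f t k) : Borel2 &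
  (ALL k. ALL t:{0..T}. ((%t. g t k) has_vector_derivative f t k) (at t within {0..T})) &
  (ALL k. continuous_on {0..T} (%t. f t k))"

lemma flowD:
 assumes "flow T g f"
 shows "(%(t, k). g t k) : Borel2"
  "(%(t, k). f t k) : Borel2"
  "t : {0..T} ==> ((%t. g t k) has_vector_derivative f t k) (at t within {0..T})"
  "continuous_on {0..T} (%t. f t k)" "continuous_on {0..T} (%t. g t k)"
proof -
 show "continuous_on {0..T} (%t. g t k)"
  using assms has_vector_derivative_continuous unfolding flow_def continuous_on_eq_continuous_within by blast
qed (use assms in \<open>auto simp: flow_def\<close>)

lemma flow_restrict: "flow T g f ==> t <= T ==> flow t g f"
 unfolding flow_def
 by (auto intro: has_vector_derivative_within_subset[of _ _ _ "{0..T}"] continuous_on_subset[of "{0..T}"])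

lemma flow_diff: "flow T g f ==> flow T g' f' ==> flow T (%t k. g t k - g' t k) (%t k. f t k - f' t k)"
 unfolding flow_def
 by (auto intro!: has_vector_derivative_diff continuous_intros borel_measurable_diff simp: case_prod_beta')

lemma flow_measurable: assumes "flow T g f"
 shows "g t : Borel" "f t : Borel"
proof -
 have "(%k. (%(t, k). g t k) (t, k)) : Borel"
  using flowD(1)[OF assms] by measurable
 thus "g t : Borel" by simp
 have "(%k. (%(t, k). f t k) (t, k)) : Borel"
  using flowD(2)[OF assms] by measurable
 thus "f t : Borel" by simp
qed

text \<open>The fundamental theorem of calculus at each frequency, then Fubini; the bounds by
  \<open>c\<close> make the integral over time and frequency absolutely convergent. Nothing is
  differentiated under the integral sign.\<close>

lemma energy_identity:
 fixes A :: "real => real"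
 assumes fl: "flow T g f" and [measurable]: "A : Borel" and A0: "!!k. 0 <= A k"
  and bg: "!!t. t : {0..T} ==> L1 (%k. A k * (cmod (g t k))^2)" "!!t. t : {0..T} ==> (Lint k. A k * (cmod (g t k))^2) <= c"
  and bf: "!!t. t : {0..T} ==> L1 (%k. A k * (cmod (f t k))^2)" "!!t. t : {0..T} ==> (Lint k. A k * (cmod (f t k))^2) <= c"
  and t: "t : {0..T}"
 defines "z \<equiv> %s. Lint k. A k * (2 * Re (cnj (g s k) * f s k))"
 shows "L1 (%s. indicator {0..t} s * z s)"
  "(Lint k. A k * (cmod (g t k))^2) = (Lint k. A k * (cmod (g 0 k))^2) + (Lint s. indicator {0..t} s * z s)"
proof -
 note [measurable] = flowD(1,2)[OF fl] flow_measurable[OF fl]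
 have [measurable]: "(%(s, k). g s k) : borel_measurable lborel2" "(%(s, k). f s k) : borel_measurable lborel2"
  using flowD(1,2)[OF fl] by (simp_all cong: measurable_cong_sets sets_pair_measure_cong)
 define h where "h = (%s k. A k * (2 * Re (cnj (g s k) * f s k)))"
 have hb: "\<bar>h s k\<bar> <= A k * (cmod (g s k))^2 + A k * (cmod (f s k))^2" for s k
 proof -
  have "\<bar>2 * Re (cnj (g s k) * f s k)\<bar> <= 2 * (cmod (g s k) * cmod (f s k))"
   using abs_Re_le_cmod[of "cnj (g s k) * f s k"] by (simp add: norm_mult)
  also have "... <= (cmod (g s k))^2 + (cmod (f s k))^2"
   using sum_squares_bound[of "cmod (g s k)" "cmod (f s k)"] by simp
  finally have "A k * \<bar>2 * Re (cnj (g s k) * f s k)\<bar> <= A k * ((cmod (g s k))^2 + (cmod (f s k))^2)"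
   using A0 by (intro mult_left_mono) auto
  thus ?thesis unfolding h_def abs_mult[of "A k"] by (simp only: abs_of_nonneg[OF A0] distrib_left)
 qed
 have ih: "L1 (h s)" if "s : {0..T}" for s
  by (rule int_bound[OF int_add[OF bg(1)[OF that] bf(1)[OF that]]])
   (use hb[of s] A0 in \<open>auto simp: h_def\<close>)
 have nh: "(Lint k. \<bar>h s k\<bar>) <= 2 * c" if s: "s : {0..T}" for s
 proof -
  have "(Lint k. \<bar>h s k\<bar>) <= (Lint k. A k * (cmod (g s k))^2 + A k * (cmod (f s k))^2)"
   by (intro integral_mono hb integrable_abs ih s int_add bg(1) bf(1))
  thus ?thesis using bg[OF s] bf[OF s] by simp
 qed
 let ?H = "%s k. indicator {0..t} s * h s k"
 have iH: "integrable lborel2 (%(s, k). ?H s k)"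
 proof (rule lborel_pair.Fubini_integrable)
  show "(%(s, k). ?H s k) : borel_measurable lborel2" unfolding h_def by measurable
  show "L1 (%s. Lint k. norm (case (s, k) of (s, k) => ?H s k))"
  proof (rule int_bound)
   show "L1 (%s. (2 * c) * indicator {0..t} s)" by (intro integrable_mult_right) (simp add: integrable_indicator_iff emeasure_lborel_Icc_eq)
   show "AE s in lborel. norm (Lint k. norm (case (s, k) of (s, k) => ?H s k)) <= norm (2 * c * indicator {0..t} s :: real)"
    using nh t by (intro AE_I2) (auto simp: indicator_def intro: order_trans[OF _ abs_ge_self])
   show "(%s. Lint k. norm (case (s, k) of (s, k) => ?H s k)) : borel_measurable lborel"
    unfolding h_def by measurable
  qed
  show "AE s in lborel. L1 (%k. case (s, k) of (s, k) => ?H s k)"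
   using ih t by (intro AE_I2) (auto simp: indicator_def)
 qed
 have z: "(Lint k. ?H s k) = indicator {0..t} s * z s" for s by (simp add: z_def h_def)
 show "L1 (%s. indicator {0..t} s * z s)"
  unfolding z[symmetric] by (rule lborel_pair.integrable_fst[OF iH])
 have ftc: "(Lint s. ?H s k) = A k * (cmod (g t k))^2 - A k * (cmod (g 0 k))^2" for k
 proof -
  have "(Lint s. indicator {0..t} s *\<^sub>R (2 * Re (cnj (g s k) * f s k))) = (cmod (g t k))^2 - (cmod (g 0 k))^2"
  proof (rule integral_FTC_atLeastAtMost)
   show "0 <= t" using t by simp
   have fl': "flow t g f" using flow_restrict[OF fl] t by simp
   show "continuous_on {0..t} (%s. 2 * Re (cnj (g s k) * f s k))"
    by (intro continuous_intros flowD[OF fl'])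
   fix s assume "0 <= s" "s <= t"
   hence d: "((%s. g s k) has_vector_derivative f s k) (at s within {0..t})" using flowD(3)[OF fl'] by simp
   have "((%s. cnj (g s k) * g s k) has_vector_derivative (cnj (g s k) * f s k + cnj (f s k) * g s k)) (at s within {0..t})"
    by (intro has_vector_derivative_mult bounded_linear.has_vector_derivative[OF bounded_linear_cnj] d)
   from bounded_linear.has_vector_derivative[OF bounded_linear_Re this]
   have "((%s. Re (cnj (g s k) * g s k)) has_vector_derivative Re (cnj (g s k) * f s k + cnj (f s k) * g s k)) (at s within {0..t})" .
   moreover have "Re (cnj (g s k) * g s k) = (cmod (g s k))^2" for s
    unfolding cmod_power2 by (simp add: power2_eq_square)
   moreover have "Re (cnj (g s k) * f s k + cnj (f s k) * g s k) = 2 * Re (cnj (g s k) * f s k)" by simp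
   ultimately show "((%s. (cmod (g s k))^2) has_vector_derivative 2 * Re (cnj (g s k) * f s k)) (at s within {0..t})" by (simp only:)
  qed
  hence "A k * (Lint s. indicator {0..t} s *\<^sub>R (2 * Re (cnj (g s k) * f s k))) = A k * ((cmod (g t k))^2 - (cmod (g 0 k))^2)" by simp
  moreover have "A k * (Lint s. indicator {0..t} s *\<^sub>R (2 * Re (cnj (g s k) * f s k))) = (Lint s. ?H s k)"
   unfolding h_def by (subst integral_mult_right_zero[symmetric]) (simp add: mult_ac)
  ultimately show ?thesis by (simp add: right_diff_distrib)
 qed
 have "(Lint s. indicator {0..t} s * z s) = (Lint s. Lint k. ?H s k)" by (simp only: z)
 also have "... = (Lint k. Lint s. ?H s k)"
  by (rule lborel_pair.Fubini_integral[symmetric]) (rule iH)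
 also have "... = (Lint k. A k * (cmod (g t k))^2) - (Lint k. A k * (cmod (g 0 k))^2)"
  unfolding ftc using t by (intro lint_diff bg(1)) auto
 finally show "(Lint k. A k * (cmod (g t k))^2) = (Lint k. A k * (cmod (g 0 k))^2) + (Lint s. indicator {0..t} s * z s)"
  by simp
qed

text \<open>The energy is only known to be bounded and to satisfy an integral identity. The supremum
  \<open>S\<close> of \<open>y t * exp (- (2 * C * t))\<close> is finite, and integrating
  \<open>C * S * exp (2 * C * r)\<close> gives back only half of it, which is absorbed; hence the
  factors 2 in the conclusion.\<close>

lemma Gronwall_sup:
 fixes y z :: "real => real"
 assumes C: "0 < C" and D: "0 <= D" and y: "!!t. t : {0..T} ==> 0 <= y t" "!!t. t : {0..T} ==> y t <= c"
  and iz: "!!t. t : {0..T} ==> L1 (%s. indicator {0..t} s * z s)"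
  and eq: "!!t. t : {0..T} ==> y t = y 0 + (Lint s. indicator {0..t} s * z s)"
  and zb: "!!s. s : {0..T} ==> z s <= C * y s + D"
  and t: "t : {0..T}"
 shows "y t <= 2 * (y 0 + T * D) * exp (2 * C * T)"
proof -
 define S where "S = (SUP t\<in>{0..T}. y t * exp (- (2 * C * t)))"
 have bdd: "bdd_above ((%t. y t * exp (- (2 * C * t))) ` {0..T})"
 proof (rule bdd_aboveI2)
  fix s assume s: "s : {0..T}"
  have "y s * exp (- (2 * C * s)) <= y s * 1" using s C y by (intro mult_left_mono) auto
  thus "y s * exp (- (2 * C * s)) <= c" using y(2)[OF s] by simp
 qed
 have yS: "y s <= S * exp (2 * C * s)" if s: "s : {0..T}" for s
 proof -
  have "y s * exp (- (2 * C * s)) <= S" unfolding S_def by (rule cSUP_upper[OF s bdd])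
  hence "y s * exp (- (2 * C * s)) * exp (2 * C * s) <= S * exp (2 * C * s)" by (intro mult_right_mono) auto
  thus ?thesis by (simp add: mult.assoc flip: exp_add)
 qed
 have T0: "0 : {0..T}" using t by simp
 have S0: "0 <= S" using yS[OF T0] y(1)[OF T0] by simp
 have step: "y s * exp (- (2 * C * s)) <= (y 0 + T * D) + S / 2" if s: "s : {0..T}" for s
 proof -
  have ftc: "(Lint r. indicator {0..s} r *\<^sub>R (C * S * exp (2 * C * r) + D)) = (S / 2 * exp (2 * C * s) + D * s) - (S / 2 * exp (2 * C * 0) + D * 0)"
   by (rule integral_FTC_atLeastAtMost)
    (use s C in \<open>auto intro!: derivative_eq_intros continuous_intros simp flip: has_real_derivative_iff_has_vector_derivative\<close>)
  have "(Lint r. indicator {0..s} r * z r) <= (Lint r. indicator {0..s} r *\<^sub>R (C * S * exp (2 * C * r) + D))"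
  proof (rule integral_mono[OF iz[OF s]])
   show "L1 (%r. indicator {0..s} r *\<^sub>R (C * S * exp (2 * C * r) + D))"
    unfolding set_integrable_def[symmetric] by (intro borel_integrable_atLeastAtMost' continuous_intros)
   fix r :: real
   show "indicator {0..s} r * z r <= indicator {0..s} r *\<^sub>R (C * S * exp (2 * C * r) + D)"
   proof (cases "r : {0..s}")
    case True
    hence "r : {0..T}" using s by auto
    from zb[OF this] have "z r <= C * y r + D" .
    also have "... <= C * (S * exp (2 * C * r)) + D"
     using C by (intro add_right_mono mult_left_mono yS \<open>r : {0..T}\<close>) auto
    finally show ?thesis using True by (simp add: mult.assoc)
   qed simp
  qed
  hence "y s <= y 0 + D * s + S / 2 * exp (2 * C * s)" using eq[OF s] S0 unfolding ftc by simp
  also have "D * s <= T * D" using s D by (simp add: mult.commute[of T] mult_left_mono)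
  also have "y 0 + T * D + S / 2 * exp (2 * C * s) <= (y 0 + T * D + S / 2) * exp (2 * C * s)"
  proof -
   have "0 <= y 0 + T * D" using y(1)[OF T0] D T0 by simp
   hence "(y 0 + T * D) * 1 <= (y 0 + T * D) * exp (2 * C * s)" using C s by (intro mult_left_mono) auto
   thus ?thesis by (simp add: distrib_right)
  qed
  finally have "y s * exp (- (2 * C * s)) <= (y 0 + T * D + S / 2) * exp (2 * C * s) * exp (- (2 * C * s))"
   by (intro mult_right_mono) auto
  thus ?thesis by (simp add: mult.assoc flip: exp_add)
 qed
 have "S <= (y 0 + T * D) + S / 2"
  unfolding S_def using T0 step by (intro cSUP_least) (auto simp: S_def)
 hence S2: "S <= 2 * (y 0 + T * D)" by simp
 have "y t <= S * exp (2 * C * t)" by (rule yS[OF t])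
 also have "... <= S * exp (2 * C * T)" using S0 t C by (intro mult_left_mono) auto
 also have "... <= 2 * (y 0 + T * D) * exp (2 * C * T)" using S2 by (intro mult_right_mono) auto
 finally show ?thesis .
qed

lemma energy_Gronwall:
 fixes A :: "real => real"
 assumes fl: "flow T g f" and A: "A : Borel" "!!k. 0 <= A k"
  and bg: "!!t. t : {0..T} ==> L1 (%k. A k * (cmod (g t k))^2)" "!!t. t : {0..T} ==> (Lint k. A k * (cmod (g t k))^2) <= c"
  and bf: "!!t. t : {0..T} ==> L1 (%k. A k * (cmod (f t k))^2)" "!!t. t : {0..T} ==> (Lint k. A k * (cmod (f t k))^2) <= c"
  and C: "0 < C" and D: "0 <= D"
  and le: "!!s. s : {0..T} ==> (Lint k. A k * (2 * Re (cnj (g s k) * f s k))) <= C * (Lint k. A k * (cmod (g s k))^2) + D"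
  and t: "t : {0..T}"
 shows "(Lint k. A k * (cmod (g t k))^2) <= 2 * ((Lint k. A k * (cmod (g 0 k))^2) + T * D) * exp (2 * C * T)"
 by (rule Gronwall_sup[where y="%t. Lint k. A k * (cmod (g t k))^2" and c=c, OF C D _ bg(2)
    energy_identity(1)[OF fl A bg bf] energy_identity(2)[OF fl A bg bf] le t])
  (auto intro!: integral_nonneg_AE simp: A)

text \<open>The transform of u u_x, written as half the derivative of the square so that a single
  product of transforms appears.\<close>

definition burg :: "(real => complex) => real => complex" where
 "burg g k = \<i> * of_real (k / 2) * prod_ft g g k"

lemma hs_burg:
 assumes g: "hs s g" and s: "1 <= s"
 shows "hs (s - 1) (burg g)" "hsn (s - 1) (burg g) <= (2 * 2 powr s * c1) * (hsn s g)^2"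
proof -
 note P = hs_prod_ft[OF g g s] and h = hs_shift[OF hs_prod_ft(1)[OF g g s]]
 have e: "burg g = (%k. (\<i> / 2) * (of_real k * prod_ft g g k))" by (auto simp: burg_def)
 show "hs (s - 1) (burg g)" unfolding e by (intro hs_cmult h)
 have "hsn (s - 1) (burg g) = 1/2 * hsn (s - 1) (%k. of_real k * prod_ft g g k)"
  unfolding e hsn_cmult by (simp add: norm_divide)
 also have "... <= 1 * hsn (s - 1) (%k. of_real k * prod_ft g g k)" by (intro mult_right_mono) auto
 finally show "hsn (s - 1) (burg g) <= (2 * 2 powr s * c1) * (hsn s g)^2"
  using h(2) P(2) by (simp add: power2_eq_square)
qed

lemma burg_diff:
 assumes a: "hs s a" and b: "hs s b" and s: "1 <= s"
 shows "burg a k - burg b k = \<i> * of_real (k / 2) * prod_ft (%x. a x + b x) (%x. a x - b x) k"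
proof -
 have "L1 a" "L2 a" "L1 b" "L2 b"
  using hs_integrable[OF a s] hs_integrable[OF b s] hs_L2[OF a] hs_L2[OF b] s by auto
 from prod_ft_square_diff[OF this, of k] show ?thesis by (simp add: burg_def flip: right_diff_distrib)
qed

lemma burg_herm: assumes "herm g" shows "herm (burg g)"
 using prod_ft_hermitian[of g] assms by (auto simp: herm_def burg_def)

text \<open>The difference of the nonlinearities is half the derivative of the product of sum and
  difference, to which \<open>transport_form_bound\<close> applies; no derivative of
  \<open>r\<close> enters the bound.\<close>

lemma transport_difference_bound:
 assumes g: "hs 2 g" "herm g" "(moment g) <= M"
  and g': "hs 2 g'" "herm g'" "(moment g') <= M"
 defines "r \<equiv> %k. g k - g' k"
 shows "L1 (%k. cnj (r k) * (burg g k - burg g' k))"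
  "cmod (Lint k. cnj (r k) * (burg g k - burg g' k)) <= M / 2 * (L2_norm r)^2"
proof -
 define q where "q = (%k. g k + g' k)"
 have hr: "hs 2 r" and hq: "hs 2 q" unfolding r_def q_def by (intro hs_diff hs_add g g')+
 have her: "herm r" "herm q" unfolding r_def q_def by (intro herm_diff herm_add g g')+
 note [measurable] = hs_measurable[OF hr] hs_measurable[OF hq]
 have L: "L2 r" "L2 q" "L2 (%k. of_real k * r k)"
  using hs_L2[OF hr] hs_L2[OF hq] hs_L2[OF hs_shift(1)[OF hr]] by auto
 have I: "L1 r" "L1 q" "L1 (%k. of_real k * q k)"
  using hs_integrable[OF hr] hs_integrable[OF hq] hs_integrable_1[OF hq] by auto
 have Lc: "L2 (%x. cnj (r x))" by (rule L2_bound[OF L(1), where C=1]) auto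
 have Lb: "L2 (%k. burg g k - burg g' k)"
  using hs_burg(1)[OF g(1)] hs_burg(1)[OF g'(1)] by (intro L2_diff) (auto intro: hs_L2)
 show "L1 (%k. cnj (r k) * (burg g k - burg g' k))"
  by (rule L2_mult_integrable(1)[OF Lc Lb])
 have pm: "prod_ft q r : Borel" by (intro prod_ft_measurable I L)
 have "(Lint k. cnj (r k) * (burg g k - burg g' k)) = (Lint k. cnj (r k) * (\<i> * of_real (k / 2) * prod_ft q r k))"
  unfolding burg_diff[OF g(1) g'(1), OF one_le_numeral] q_def r_def by (rule refl)
 also have "... = (Lint k. of_real (1 / (2 * sqrt (2 * pi))) * (cnj (r k) * (\<i> * of_real k * cnv q r k)))"
 proof (rule integral_cong_AE)
  show "AE k in lborel. cnj (r k) * (\<i> * of_real (k / 2) * prod_ft q r k) = of_real (1 / (2 * sqrt (2 * pi))) * (cnj (r k) * (\<i> * of_real k * cnv q r k))"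
   using prod_ft_eq_cnv[OF I(2) L(2) I(1) L(1)] by eventually_elim simp
 qed (use pm in auto)
 also have "cmod ... = 1 / (2 * sqrt (2 * pi)) * cmod (Lint k. cnj (r k) * (\<i> * of_real k * cnv q r k))"
  by (subst integral_mult_right_zero) (simp add: norm_mult norm_divide)
 also have "... <= 1 / 2 * (1/2 * (moment q) * (L2_norm r)^2)"
 proof (rule mult_mono)
  have "1 <= sqrt (2 * pi)" using pi_gt3 by (intro real_le_rsqrt) auto
  thus "1 / (2 * sqrt (2 * pi)) <= 1 / 2" by (simp add: field_simps)
  show "cmod (Lint k. cnj (r k) * (\<i> * of_real k * cnv q r k)) <= 1/2 * (moment q) * (L2_norm r)^2"
   by (rule transport_form_bound[OF her L(1,3) I(2,3)])
 qed auto
 also have "(moment q) <= 2 * M"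
 proof -
  have i: "L1 (%k. \<bar>k\<bar> * cmod (g k))" "L1 (%k. \<bar>k\<bar> * cmod (g' k))"
   using integrable_norm[OF hs_integrable_1(1)[OF g(1)]] integrable_norm[OF hs_integrable_1(1)[OF g'(1)]] by (auto simp: norm_mult)
  have "(moment q) <= (Lint k. \<bar>k\<bar> * cmod (g k) + \<bar>k\<bar> * cmod (g' k))"
  proof (rule integral_mono)
   show "L1 (%k. \<bar>k\<bar> * cmod (q k))" using integrable_norm[OF I(3)] by (simp add: norm_mult)
   show "L1 (%k. \<bar>k\<bar> * cmod (g k) + \<bar>k\<bar> * cmod (g' k))" by (intro int_add i)
   show "\<bar>k\<bar> * cmod (q k) <= \<bar>k\<bar> * cmod (g k) + \<bar>k\<bar> * cmod (g' k)" for k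
    unfolding distrib_left[symmetric] q_def by (intro mult_left_mono norm_triangle_ineq) simp
  qed
  also have "... <= 2 * M" using i g(3) g'(3) by simp
  finally show ?thesis .
 qed
 finally show "cmod (Lint k. cnj (r k) * (burg g k - burg g' k)) <= M / 2 * (L2_norm r)^2"
  by (simp add: mult_right_mono)
qed

definition approx_sol :: "real => (real => real) => (real => real => complex) => (real => real => complex) => (real => real => complex) => bool" where
 "approx_sol T \<mu> g f e \<longleftrightarrow> flow T g f &
  (ALL t:{0..T}. herm (g t) & hs 2 (g t) & L2 (f t) & L2 (e t) &
    (ALL k. f t k = - \<i> * of_real (\<mu> k) * g t k - burg (g t) k + e t k))"

lemma integral_Re_lincomb:
 fixes X Y :: "'a => complex" and a b :: real
 assumes "integrable M X" "integrable M Y"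
 shows "(LINT x|M. a * Re (X x) + b * Re (Y x)) = a * Re (integral\<^sup>L M X) + b * Re (integral\<^sup>L M Y)"
 using assms by simp

text \<open>The real multiplier contributes nothing to the energy of the difference, the
  nonlinearity contributes \<open>M\<close> times the squared difference, and the residuals are
  split off by Cauchy-Schwarz. The bound \<open>c\<close> serves integrability and does not appear
  in the conclusion.\<close>

lemma stability:
 assumes s: "approx_sol T \<mu> g f e" and s': "approx_sol T \<mu> g' f' e'"
  and M: "!!t. t : {0..T} ==> (moment (g t)) <= M" "!!t. t : {0..T} ==> (moment (g' t)) <= M"
  and c: "!!t. t : {0..T} ==> L2_norm (g t) <= c" "!!t. t : {0..T} ==> L2_norm (g' t) <= c"
   "!!t. t : {0..T} ==> L2_norm (f t) <= c" "!!t. t : {0..T} ==> L2_norm (f' t) <= c"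
  and e: "!!t. t : {0..T} ==> L2_norm (%k. e t k - e' t k) <= \<epsilon>"
  and t: "t : {0..T}"
 shows "(L2_norm (%k. g t k - g' t k))^2 <= 2 * ((L2_norm (%k. g 0 k - g' 0 k))^2 + T * \<epsilon>^2) * exp (2 * (M + 1) * T)"
proof -
 have fl: "flow T (%t k. g t k - g' t k) (%t k. f t k - f' t k)"
  using s s' by (intro flow_diff) (auto simp: approx_sol_def)
 note S = s[unfolded approx_sol_def, THEN conjunct2, rule_format] and S' = s'[unfolded approx_sol_def, THEN conjunct2, rule_format]
 have M0: "0 <= M" using M(1)[of 0] t by (intro order_trans[OF integral_nonneg_AE M(1)[of 0]]) auto
 have Lg: "L2 (g t)" "L2 (g' t)" if "t : {0..T}" for t using S[OF that] S'[OF that] by (auto intro: hs_L2)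
 have b2: "L1 (%k. 1 * (cmod (u k - v k))^2) & (Lint k. 1 * (cmod (u k - v k))^2) <= (2 * c)^2"
  if "L2 u" "L2 v" "L2_norm u <= c" "L2_norm v <= c" for u v :: "real => complex"
 proof -
  have "L2_norm (%k. u k - v k) <= L2_norm u + L2_norm v"
   using L2_norm_triangle[OF that(1) L2_uminus[OF that(2)]] by (simp add: L2_norm_uminus)
  hence "(L2_norm (%k. u k - v k))^2 <= (2 * c)^2" using that by (intro power_mono) auto
  thus ?thesis using L2_integrable[OF L2_diff[OF that(1,2)]] by (simp add: L2_norm_sq)
 qed
 have "(Lint k. 1 * (cmod (g t k - g' t k))^2) <= 2 * ((Lint k. 1 * (cmod (g 0 k - g' 0 k))^2) + T * \<epsilon>^2) * exp (2 * (M + 1) * T)"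
 proof (rule energy_Gronwall[where A="%k. 1" and c="(2 * c)^2", OF fl _ _ _ _ _ _ _ _ _ t])
  show "L1 (%k. 1 * (cmod (g t k - g' t k))^2)" "(Lint k. 1 * (cmod (g t k - g' t k))^2) <= (2 * c)^2"
   "L1 (%k. 1 * (cmod (f t k - f' t k))^2)" "(Lint k. 1 * (cmod (f t k - f' t k))^2) <= (2 * c)^2" if "t : {0..T}" for t
   using b2[of "g t" "g' t"] b2[of "f t" "f' t"] Lg[OF that] S[OF that] S'[OF that] c[OF that] by auto
  show "0 < M + 1" "0 <= \<epsilon>^2" using M0 by auto
  fix t assume t: "t : {0..T}"
  define r where "r = (%k. g t k - g' t k)"
  define d where "d = (%k. e t k - e' t k)"
  have Lr: "L2 r" and Ld: "L2 d" unfolding r_def d_def using Lg[OF t] S[OF t] S'[OF t] by (auto intro: L2_diff)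
  have Lc: "L2 (%x. cnj (r x))" using L2_measurable[OF Lr] by (intro L2_bound[OF Lr, where C=1]) auto
  have nc: "L2_norm (%x. cnj (r x)) = L2_norm r" by (simp add: L2_norm_def)
  have B1: "L1 (%k. cnj (r k) * (burg (g t) k - burg (g' t) k))"
   and B2: "cmod (Lint k. cnj (r k) * (burg (g t) k - burg (g' t) k)) <= M / 2 * (L2_norm r)^2"
   unfolding r_def by (rule transport_difference_bound; use S[OF t] S'[OF t] M[OF t] in blast)+
  note D = L2_mult_integrable[OF Lc Ld, unfolded nc]
  have pt: "1 * (2 * Re (cnj (g t k - g' t k) * (f t k - f' t k))) =
   - 2 * Re (cnj (r k) * (burg (g t) k - burg (g' t) k)) + 2 * Re (cnj (r k) * d k)" for k
  proof -
   have "f t k - f' t k = - \<i> * of_real (\<mu> k) * r k - (burg (g t) k - burg (g' t) k) + d k"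
    using S[OF t] S'[OF t] by (simp add: r_def d_def algebra_simps)
   moreover have "Re (cnj (r k) * (- \<i> * of_real (\<mu> k) * r k)) = 0" by (simp add: algebra_simps)
   moreover have "g t k - g' t k = r k" by (simp add: r_def)
   moreover have "Re (cnj (r k) * (X - Y + d k)) = Re (cnj (r k) * X) - Re (cnj (r k) * Y) + Re (cnj (r k) * d k)" for X Y
    by (simp only: distrib_left right_diff_distrib plus_complex.sel minus_complex.sel)
   ultimately show ?thesis by (simp only:) (simp only: mult_minus_left mult_minus_right mult_1_left distrib_left diff_0 minus_zero)
  qed
  have "(Lint k. 1 * (2 * Re (cnj (g t k - g' t k) * (f t k - f' t k))))
   = (Lint k. - 2 * Re (cnj (r k) * (burg (g t) k - burg (g' t) k)) + 2 * Re (cnj (r k) * d k))"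
   by (intro int_cong refl pt)
  also have "... = - 2 * Re (Lint k. cnj (r k) * (burg (g t) k - burg (g' t) k)) + 2 * Re (Lint k. cnj (r k) * d k)"
   by (rule integral_Re_lincomb[OF B1 D(1)])
  also have "... <= 2 * (M / 2 * (L2_norm r)^2) + 2 * (L2_norm r * L2_norm d)"
   using order_trans[OF complex_Re_le_cmod D(2)] abs_le_D2[OF order_trans[OF abs_Re_le_cmod B2]] by linarith
  also have "2 * (L2_norm r * L2_norm d) <= (L2_norm r)^2 + (L2_norm d)^2" using sum_squares_bound[of "L2_norm r" "L2_norm d"] by simp
  also have "(L2_norm d)^2 <= \<epsilon>^2" using e[OF t] by (intro power_mono) (auto simp: d_def)
  finally show "(Lint k. 1 * (2 * Re (cnj (g t k - g' t k) * (f t k - f' t k)))) <= (M + 1) * (Lint k. 1 * (cmod (g t k - g' t k))^2) + \<epsilon>^2"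
   by (simp add: L2_norm_sq r_def distrib_right)
 qed auto
 thus ?thesis by (simp add: L2_norm_sq)
qed

section \<open>Galerkin approximation\<close>

lemma L2_indicator:
 assumes "0 <= R"
 shows "L2 (%k. cor (indicator {-R..R} k))" "L2_norm (%k. cor (indicator {-R..R} k)) = sqrt (2 * R)"
proof -
 have e: "(%k. (norm (cor (indicator {-R..R} k)))^2) = (indicator {-R..R} :: real => real)"
  by (auto simp: indicator_def)
 show "L2 (%k. cor (indicator {-R..R} k))"
  by (rule L2I, measurable) (unfold e, simp add: integrable_indicator_iff emeasure_lborel_Icc_eq)
 show "L2_norm (%k. cor (indicator {-R..R} k)) = sqrt (2 * R)"
  unfolding L2_norm_def e using assms by simp
qed

lemma L2_bounded_support:
 assumes R: "0 <= R" and [measurable]: "u : Borel" and c: "0 <= c" and b: "!!k. cmod (u k) <= c * indicator {-R..R} k"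
 shows "L2 u" "L2_norm u <= c * sqrt (2 * R)"
proof -
 have b': "cmod (u k) <= cmod (of_real c * cor (indicator {-R..R} k))" for k
  using b[of k] c by (simp add: norm_mult)
 note L = L2_cmult[OF L2_indicator(1)[OF R], of "of_real c"]
 show "L2 u" by (rule L2_bound[OF L, where C=1]) (use b' in auto)
 have "L2_norm u <= L2_norm (%k. of_real c * cor (indicator {-R..R} k))"
  by (rule L2_norm_mono[OF L b'])
 thus "L2_norm u <= c * sqrt (2 * R)" using c by (simp add: L2_norm_cmult L2_indicator[OF R])
qed

lemma L2_support_weighted:
 fixes p :: "real => real" and u :: "real => complex"
 assumes u: "L2 u" "!!k. R < \<bar>k\<bar> ==> u k = 0" and [measurable]: "p : Borel"
  and p: "!!k. \<bar>k\<bar> <= R ==> \<bar>p k\<bar> <= P"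
 shows "L2 (%k. of_real (p k) * u k)" "0 <= P ==> L2_norm (%k. of_real (p k) * u k) <= P * L2_norm u"
proof -
 note [measurable] = L2_measurable[OF u(1)]
 have b: "cmod (of_real (p k) * u k) <= P * cmod (u k)" for k
  using p[of k] u(2)[of k] by (cases "R < \<bar>k\<bar>") (auto simp: norm_mult intro: mult_right_mono)
 show "L2 (%k. of_real (p k) * u k)" by (rule L2_bound[OF u(1), where C=P]) (use b in auto)
 assume "0 <= P"
 hence "L2_norm (%k. of_real (p k) * u k) <= L2_norm (%k. of_real P * u k)"
  using b by (intro L2_norm_mono L2_cmult u) (simp add: norm_mult)
 thus "L2_norm (%k. of_real (p k) * u k) <= P * L2_norm u" using \<open>0 <= P\<close> by (simp add: L2_norm_cmult)
qed

lemma L2_support_integrable: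
 fixes u :: "real => complex"
 assumes u: "L2 u" "!!k. R < \<bar>k\<bar> ==> u k = 0" and R: "0 <= R"
 shows "L1 u" "(Lint k. cmod (u k)) <= sqrt (2 * R) * L2_norm u"
proof -
 have e: "cor (indicator {-R..R} k) * u k = u k" for k
  using u(2)[of k] by (cases "R < \<bar>k\<bar>") (auto simp: indicator_def abs_if split: if_splits)
 note M = L2_mult_integrable[OF L2_indicator(1)[OF R] u(1)]
 show "L1 u" using M(1) unfolding e .
 show "(Lint k. cmod (u k)) <= sqrt (2 * R) * L2_norm u" using M(3) unfolding e L2_indicator(2)[OF R] .
qed

lemma L2_support_hs:
 assumes u: "L2 u" "!!k. R < \<bar>k\<bar> ==> u k = 0" and R: "0 <= R" and s: "0 <= s"
 shows "hs s u" "hsn s u <= jp s R * L2_norm u"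
proof -
 have p: "\<bar>jp s k\<bar> <= jp s R" if "\<bar>k\<bar> <= R" for k
 proof -
  have "\<bar>k\<bar>^2 <= R^2" using that by (intro power_mono) auto
  thus ?thesis unfolding jp_def using s by (simp add: powr_mono2)
 qed
 show "hs s u" "hsn s u <= jp s R * L2_norm u"
  unfolding hs_def hsn_def using L2_support_weighted[OF u jp_measurable p] by auto
qed

lemma prod_ft_measurable_param:
 assumes [measurable]: "(%(t, x). g t x) : Borel2"
 shows "(%(t, k). prod_ft (g t) (g t) k) : Borel2"
proof -
 have [measurable]: "(%(t, x). ift (g t) x) : Borel2"
  by (rule ift_measurable_param) measurable
 have "(%(t, x). ift (g t) x * ift (g t) x) : Borel2" by measurable
 from ift_measurable_param[OF this]
 have [measurable]: "(%(t, x). ift (%x. ift (g t) x * ift (g t) x) x) : Borel2" .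
 have "(%(t, k). (%(t, x). ift (%x. ift (g t) x * ift (g t) x) x) (t, - k)) : Borel2"
  by measurable
 thus ?thesis by (simp add: prod_ft_def)
qed

lemma burg_measurable_param:
 assumes [measurable]: "(%(t, x). g t x) : Borel2"
 shows "(%(t, k). burg (g t) k) : Borel2"
 unfolding burg_def using prod_ft_measurable_param[OF assms] by measurable

text \<open>The equation truncated to frequencies in \<open>[-n,n]\<close>, the nonlinearity being
  cut off after the product is formed. The bound \<open>c\<close> in the last clause is used only
  qualitatively; its size never enters a final estimate.\<close>

definition galerkin :: "real => real => (real => real) => (real => complex) => (real => real => complex) => (real => real => complex) => bool" where
 "galerkin T n \<mu> a v f \<longleftrightarrow> flow T v f &
  (ALL t:{0..T}. herm (v t) & L2 (v t) & (ALL k. n < \<bar>k\<bar> --> v t k = 0) &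
    (ALL k. f t k = - \<i> * of_real (\<mu> k) * v t k - of_real (indicator {-n..n} k) * burg (v t) k)) &
  (ALL k. v 0 k = of_real (indicator {-n..n} k) * a k) &
  (EX c. ALL t:{0..T}. L2_norm (v t) <= c)"

lemma Re_complex_of_real_mult: "Re (of_real x * z) = x * Re z"
 by simp

text \<open>Since \<open>v t\<close> vanishes beyond \<open>n\<close>, the cutoff of the
  nonlinearity is invisible in its pairing with \<open>v t\<close>. The symmetrized bound therefore
  applies as for the full equation, with a growth rate free of \<open>n\<close>.\<close>

lemma galerkin_energy:
 assumes G: "galerkin T n \<mu> a v f" and n: "0 <= n" and \<mu>: "\<mu> : Borel" "!!k. \<bar>\<mu> k\<bar> <= B"
  and A: "A : Borel" "weight K A"
  and M: "!!t. t : {0..T} ==> (moment (v t)) <= M" and t: "t : {0..T}"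
 shows "(Lint k. A k * (cmod (v t k))^2) <= 2 * (Lint k. A k * (cmod (v 0 k))^2) * exp (2 * (2 * 2 ^ K * M + 1) * T)"
  and "L2_norm (v t) = L2_norm (v 0)"
proof -
 note [measurable] = A(1) \<mu>(1)
 have fl: "flow T v f" using G by (simp add: galerkin_def)
 note [measurable] = flow_measurable[OF fl]
 have P: "herm (v s)" "L2 (v s)" "n < \<bar>k\<bar> ==> v s k = 0"
  "f s k = - \<i> * of_real (\<mu> k) * v s k - of_real (indicator {-n..n} k) * burg (v s) k" if "s : {0..T}" for s k
  using G that by (auto simp: galerkin_def)
 obtain c where c: "!!s. s : {0..T} ==> L2_norm (v s) <= c" using G unfolding galerkin_def by blast
 have c0: "0 <= c" using c[OF t] by (rule order_trans[rotated]) simp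
 have B0: "0 <= B" using \<mu>(2)[of 0] by simp
 have I: "L1 (v s)" if "s : {0..T}" for s using L2_support_integrable(1)[OF P(2,3)] that n by blast
 have H: "hs s' (v s)" if "s : {0..T}" "0 <= s'" for s s' using L2_support_hs(1)[OF P(2,3)] that n by blast
 have fs: "f s k = 0" if "s : {0..T}" "n < \<bar>k\<bar>" for s k
  using P(3,4)[OF that(1)] that by (auto simp: indicator_def)
 define c' where "c' = B * c + (n / 2 * c^2) * sqrt (2 * n)"
 have Lf: "L2 (f s)" "L2_norm (f s) <= c'" if s: "s : {0..T}" for s
 proof -
  let ?u = "%k. of_real (indicator {-n..n} k) * burg (v s) k"
  have pm: "prod_ft (v s) (v s) : Borel" by (intro prod_ft_measurable I P(2) s)
  have um: "?u : Borel" unfolding burg_def using pm by measurable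
  have ub: "cmod (?u k) <= (n / 2 * c^2) * indicator {-n..n} k" for k
  proof (cases "k : {-n..n}")
   case True
   have "cmod (prod_ft (v s) (v s) k) <= L2_norm (v s) * L2_norm (v s)" by (intro prod_ft_bound I P(2) s)
   also have "... <= c * c" using c[OF s] c0 by (intro mult_mono) auto
   finally have "\<bar>k\<bar> / 2 * cmod (prod_ft (v s) (v s) k) <= n / 2 * (c * c)"
    using True n by (intro mult_mono) auto
   thus ?thesis using True by (simp add: burg_def norm_mult power2_eq_square)
  qed simp
  note U = L2_bounded_support[OF n um _ ub]
  have v: "L2 (%k. of_real (\<mu> k) * v s k)" "L2_norm (%k. of_real (\<mu> k) * v s k) <= B * L2_norm (v s)"
   using L2_support_weighted[OF P(2,3)[OF s] \<mu>(1) \<mu>(2)] B0 by auto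
  have e: "f s = (%k. (- \<i>) * (of_real (\<mu> k) * v s k) + - ?u k)" using P(4)[OF s] by (auto simp: fun_eq_iff)
  have U1: "L2 ?u" "L2_norm ?u <= (n / 2 * c^2) * sqrt (2 * n)" using U n c0 by auto
  show "L2 (f s)" unfolding e by (intro L2_add L2_uminus L2_cmult U1 v)
  have "L2_norm (f s) <= L2_norm (%k. (- \<i>) * (of_real (\<mu> k) * v s k)) + L2_norm (%k. - ?u k)"
   unfolding e by (intro L2_norm_triangle L2_uminus L2_cmult U1 v)
  also have "... = L2_norm (%k. of_real (\<mu> k) * v s k) + L2_norm ?u" by (simp add: L2_norm_cmult L2_norm_uminus)
  also have "... <= c'" unfolding c'_def using v(2) U1(2) mult_left_mono[OF c[OF s] B0] by linarith
  finally show "L2_norm (f s) <= c'" .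
 qed
 have W: "A' (- x) = A' x" "0 <= A' x" "\<bar>x\<bar> <= n ==> A' x <= A' n" if "weight K' A'" for K' A' x
 proof -
  show "A' (- x) = A' x" "0 <= A' x" using that by (auto simp: weight_def)
  have "A' \<bar>x\<bar> = A' x" using that by (auto simp: weight_def abs_if)
  thus "\<bar>x\<bar> <= n ==> A' x <= A' n" using that unfolding weight_def by (metis abs_ge_zero)
 qed
 have wb: "L2 (%k. of_real (sqrt (A' k)) * u k)" "L1 (%k. A' k * (cmod (u k))^2)" "(Lint k. A' k * (cmod (u k))^2) = (L2_norm (%k. of_real (sqrt (A' k)) * u k))^2"
  "(Lint k. A' k * (cmod (u k))^2) <= A' n * (max c c')^2"
  if u: "L2 u" "!!k. n < \<bar>k\<bar> ==> u k = 0" "L2_norm u <= max c c'" and w: "weight K' A'" and [measurable]: "A' : Borel" for u A' K'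
 proof -
  have n2: "(cmod (of_real (sqrt (A' k)) * u k))^2 = A' k * (cmod (u k))^2" for k
   using W(2)[OF w] by (simp add: norm_mult power_mult_distrib)
  have sb: "\<bar>sqrt (A' k)\<bar> <= sqrt (A' n)" if "\<bar>k\<bar> <= n" for k using W[OF w] that by simp
  have q: "(%k. sqrt (A' k)) : Borel" by measurable
  note S = L2_support_weighted[OF u(1,2) q sb]
  show L: "L2 (%k. of_real (sqrt (A' k)) * u k)" by (rule S(1))
  show "L1 (%k. A' k * (cmod (u k))^2)" using L2_integrable[OF L] by (simp only: n2)
  show e: "(Lint k. A' k * (cmod (u k))^2) = (L2_norm (%k. of_real (sqrt (A' k)) * u k))^2" unfolding L2_norm_sq n2 ..
  have "L2_norm (%k. of_real (sqrt (A' k)) * u k) <= sqrt (A' n) * max c c'"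
   using S(2) W(2)[OF w] u(3) by (meson mult_left_mono order_trans real_sqrt_ge_zero)
  hence "(L2_norm (%k. of_real (sqrt (A' k)) * u k))^2 <= (sqrt (A' n) * max c c')^2" by (intro power_mono) auto
  thus "(Lint k. A' k * (cmod (u k))^2) <= A' n * (max c c')^2"
   unfolding e using W(2)[OF w] by (simp add: power_mult_distrib)
 qed
 \<comment> \<open>The constant \<open>K2\<close> is kept general: \<open>weight_ineq\<close>
   supplies \<open>2 * 2 ^ K\<close> for \<open>A\<close>, while for the constant weight 1 the
   symmetrized multiplier vanishes, so \<open>K2 = 0\<close> yields conservation of the L^2
   norm.\<close>
 have z: "\<bar>Lint k. A' k * (2 * Re (cnj (v s k) * f s k))\<bar> <= K2 * M' * (Lint k. A' k * (cmod (v s k))^2)"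
  if s: "s : {0..T}" and w: "weight K' A'" and [measurable]: "A' : Borel" and K2: "0 <= K2"
  and ineq: "!!x y. \<bar>A' x * x + A' y * y + A' (- x - y) * (- x - y)\<bar> <= K2 * (\<bar>x\<bar> * (sqrt (A' y) * sqrt (A' (- x - y))) + \<bar>y\<bar> * (sqrt (A' x) * sqrt (A' (- x - y))) + \<bar>- x - y\<bar> * (sqrt (A' x) * sqrt (A' y)))"
  and M': "(moment (v s)) <= M'" for s A' K' K2 M'
 proof -
  define J where "J = (Lint k. cnj (v s k) * (\<i> * of_real (A' k * k) * cnv (v s) (v s) k))"
  have pt: "AE k in lborel. A' k * (2 * Re (cnj (v s k) * f s k)) = - (1 / sqrt (2 * pi)) * Re (cnj (v s k) * (\<i> * of_real (A' k * k) * cnv (v s) (v s) k))"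
   using prod_ft_eq_cnv[OF I[OF s] P(2)[OF s] I[OF s] P(2)[OF s]]
  proof eventually_elim
   fix k assume p: "prod_ft (v s) (v s) k = of_real (1 / sqrt (2 * pi)) * cnv (v s) (v s) k"
   show "A' k * (2 * Re (cnj (v s k) * f s k)) = - (1 / sqrt (2 * pi)) * Re (cnj (v s k) * (\<i> * of_real (A' k * k) * cnv (v s) (v s) k))"
   proof (cases "n < \<bar>k\<bar>")
    case True
    thus ?thesis using P(3)[OF s] by simp
   next
    case False
    hence "k : {-n..n}" by auto
    hence f: "f s k = - \<i> * of_real (\<mu> k) * v s k - burg (v s) k" using P(4)[OF s, of k] by simp
    have "Re (cnj (v s k) * (- \<i> * of_real (\<mu> k) * v s k)) = 0" by simp
    hence "Re (cnj (v s k) * f s k) = - Re (cnj (v s k) * burg (v s) k)"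
     unfolding f right_diff_distrib by simp
    hence "A' k * (2 * Re (cnj (v s k) * f s k)) = - Re (of_real (2 * A' k) * (cnj (v s k) * burg (v s) k))"
     by (simp only: Re_complex_of_real_mult)
    also have "of_real (2 * A' k) * (cnj (v s k) * burg (v s) k) = of_real (1 / sqrt (2 * pi)) * (cnj (v s k) * (\<i> * of_real (A' k * k) * cnv (v s) (v s) k))"
     by (simp add: burg_def p)
    also have "Re ... = (1 / sqrt (2 * pi)) * Re (cnj (v s k) * (\<i> * of_real (A' k * k) * cnv (v s) (v s) k))"
     by (rule Re_complex_of_real_mult)
    finally show ?thesis by (simp only: mult_minus_left)
   qed
  qed
  let ?X = "%k. cnj (v s k) * (\<i> * of_real (A' k * k) * cnv (v s) (v s) k)"
  have Lp: "L2 (%k. of_real (A' k * k) * v s k)"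
  proof (rule L2_support_weighted(1)[OF P(2,3)[OF s], where P="A' n * n"])
   fix k :: real assume "\<bar>k\<bar> <= n"
   thus "\<bar>A' k * k\<bar> <= A' n * n" unfolding abs_mult using W[OF w] by (intro mult_mono) auto
  qed auto
  have iX: "L1 ?X"
  proof (rule int_bound)
   show "L1 (%k. (of_real (A' k * k) * v s k) * cnv (v s) (v s) k)"
    by (rule L2_mult_integrable(1)[OF Lp L2_cnv(1)[OF I[OF s] P(2)[OF s]]])
   show "AE k in lborel. norm (?X k) <= norm ((of_real (A' k * k) * v s k) * cnv (v s) (v s) k)"
    by (intro AE_I2) (simp add: norm_mult)
  qed measurable
  have "(Lint k. A' k * (2 * Re (cnj (v s k) * f s k))) = (Lint k. - (1 / sqrt (2 * pi)) * Re (?X k))"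
   by (rule integral_cong_AE[OF _ _ pt]) measurable
  also have "... = - (1 / sqrt (2 * pi)) * Re J"
   unfolding J_def by (subst integral_mult_right_zero, subst integral_Re[OF iX]) simp
  finally have e: "(Lint k. A' k * (2 * Re (cnj (v s k) * f s k))) = - (1 / sqrt (2 * pi)) * Re J" .
  have ix: "L1 (%k. of_real k * v s k)" by (rule hs_integrable_1(1)[OF H[OF s, of 2]]) auto
  note wv = wb[OF P(2,3)[OF s] _ w \<open>A' : Borel\<close>]
  have Lw: "L2 (%k. of_real (sqrt (A' k)) * v s k)" using wv(1) c[OF s] by simp
  have "cmod J <= K2 * (moment (v s)) * (L2_norm (%k. of_real (sqrt (A' k)) * v s k))^2"
   unfolding J_def
   by (rule symmetrized_trilinear_bound[OF P(1)[OF s] I[OF s] P(2)[OF s] _ W(1)[OF w] W(2)[OF w] Lp Lw ix K2 ineq]) measurable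
  also have "... <= K2 * M' * (L2_norm (%k. of_real (sqrt (A' k)) * v s k))^2"
   by (intro mult_right_mono mult_left_mono M' K2) auto
  also have "(L2_norm (%k. of_real (sqrt (A' k)) * v s k))^2 = (Lint k. A' k * (cmod (v s k))^2)"
   using wv(3) c[OF s] by simp
  finally have J: "cmod J <= K2 * M' * (Lint k. A' k * (cmod (v s k))^2)" .
  have "1 / sqrt (2 * pi) <= 1" using pi_gt3 by (auto simp: real_le_rsqrt)
  hence "\<bar>- (1 / sqrt (2 * pi)) * Re J\<bar> <= 1 * cmod J"
   unfolding abs_mult using abs_Re_le_cmod[of J] by (intro mult_mono) auto
  thus ?thesis unfolding e using J by simp
 qed
 have Ac: "L1 (%k. A' k * (cmod (v s k))^2)" "(Lint k. A' k * (cmod (v s k))^2) <= A' n * (max c c')^2"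
  "L1 (%k. A' k * (cmod (f s k))^2)" "(Lint k. A' k * (cmod (f s k))^2) <= A' n * (max c c')^2"
  if s: "s : {0..T}" and w: "weight K' A'" "A' : Borel" for s A' K'
  using wb[OF P(2,3)[OF s] _ w] wb[OF Lf(1)[OF s] fs[OF s] _ w] c[OF s] Lf(2)[OF s] by auto
 have M0: "0 <= M" by (rule order_trans[OF integral_nonneg_AE M[OF t]]) auto
 have "(Lint k. A k * (cmod (v t k))^2) <= 2 * ((Lint k. A k * (cmod (v 0 k))^2) + T * 0) * exp (2 * (2 * 2 ^ K * M + 1) * T)"
 proof (rule energy_Gronwall[where A=A and c="A n * (max c c')^2", OF fl A(1) W(2)[OF A(2)] _ _ _ _ _ _ _ t])
  show "0 < 2 * 2 ^ K * M + 1" using M0 by (intro add_nonneg_pos) auto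
  fix s assume s: "s : {0..T}"
  have "(Lint k. A k * (2 * Re (cnj (v s k) * f s k))) <= 2 * 2 ^ K * M * (Lint k. A k * (cmod (v s k))^2)"
   using z[OF s A(2,1) _ weight_ineq[OF A(2)] M[OF s]] by simp
  also have "... <= (2 * 2 ^ K * M + 1) * (Lint k. A k * (cmod (v s k))^2) + 0"
   using W(2)[OF A(2)] by (simp add: distrib_right)
  finally show "(Lint k. A k * (2 * Re (cnj (v s k) * f s k))) <= (2 * 2 ^ K * M + 1) * (Lint k. A k * (cmod (v s k))^2) + 0" .
 qed (use Ac[OF _ A(2,1)] in auto)
 thus "(Lint k. A k * (cmod (v t k))^2) <= 2 * (Lint k. A k * (cmod (v 0 k))^2) * exp (2 * (2 * 2 ^ K * M + 1) * T)"
  by simp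
 have w1: "weight 0 (%x::real. 1)" by (rule weight_const) simp
 have z0: "(Lint k. 1 * (2 * Re (cnj (v s k) * f s k))) = 0" if "s : {0..T}" for s
  using z[OF that w1 _ _ _ order_refl, of 0] by simp
 have "(Lint k. 1 * (cmod (v t k))^2) = (Lint k. 1 * (cmod (v 0 k))^2) + (Lint s. indicator {0..t} s * (Lint k. 1 * (2 * Re (cnj (v s k) * f s k))))"
  by (rule energy_identity(2)[where c="1 * (max c c')^2", OF fl _ _ _ _ _ _ t]) (use Ac[OF _ w1] in auto)
 also have "(Lint s. indicator {0..t} s * (Lint k. 1 * (2 * Re (cnj (v s k) * f s k)))) = (LINT (s::real)|lborel. 0)"
  using z0 t by (intro int_cong refl) (auto simp: indicator_def)
 finally show "L2_norm (v t) = L2_norm (v 0)" by (simp add: L2_norm_def)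
qed

instance bcontfun :: (metric_space, banach) banach ..

lemma bounded_linear_apply_bcontfun: "bounded_linear (%h :: 'a::topological_space \<Rightarrow>\<^sub>C 'b::real_normed_vector. h x)"
 by (rule bounded_linear_intro[where K=1]) (auto simp: norm_bounded)

lemma vector_derivative_bound:
 fixes f :: "real => 'a::real_normed_vector"
 assumes d: "!!t. t : {a..b} ==> (f has_vector_derivative f' t) (at t within {a..b})"
  and C: "!!t. t : {a..b} ==> norm (f' t) <= C" and ab: "a <= b"
 shows "norm (f b - f a) <= C * (b - a)"
proof -
 have "norm (f b - f a) <= C * norm (b - a)"
 proof (rule differentiable_bound[of "{a..b}" f "%t s. s *\<^sub>R f' t"])
  show "onorm (%s. s *\<^sub>R f' t) <= C" if "t : {a..b}" for t
   by (rule onorm_le) (use C[OF that] in \<open>simp add: mult.commute[of C] mult_left_mono\<close>)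
 qed (use d ab in \<open>auto simp: has_vector_derivative_def\<close>)
 thus ?thesis using ab by simp
qed

section \<open>The truncated equation as an ordinary differential equation in a Banach space\<close>

definition clip :: "real => complex => complex" where
 "clip R z = closest_point (cball 0 R) z"

lemma clip_props:
 assumes "0 <= R"
 shows "cmod (clip R z) <= R" "cmod (clip R z - clip R w) <= cmod (z - w)" "cmod z <= R ==> clip R z = z"
proof -
 have ne: "closed (cball (0::complex) R)" "convex (cball (0::complex) R)" "cball (0::complex) R ~= {}" using assms by auto
 show "cmod (clip R z) <= R" unfolding clip_def using closest_point_in_set[OF ne(1,3), of z] by simp
 show "cmod (clip R z - clip R w) <= cmod (z - w)"
  unfolding clip_def using closest_point_lipschitz[OF ne(2,1,3), of z w] by (simp add: dist_norm)
 show "cmod z <= R ==> clip R z = z" unfolding clip_def by (rule closest_point_self) simp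
qed

lemma clip_measurable[measurable]: assumes "0 <= R" shows "clip R : Borel"
proof (rule borel_measurable_continuous_onI)
 show "continuous_on UNIV (clip R)"
  unfolding continuous_on_iff
 proof (intro ballI allI impI)
  fix z :: complex and e :: real assume "0 < e"
  thus "EX d>0. ALL w:UNIV. dist w z < d --> dist (clip R w) (clip R z) < e"
   using clip_props(2)[OF assms] by (intro exI[of _ e]) (auto simp: dist_norm intro: le_less_trans)
 qed
qed

locale galerkin_ode =
 fixes \<mu> :: "real => real" and a :: "real => complex" and n B R :: real
 assumes n: "0 <= n" and R: "0 <= R"
  and mu_cont: "continuous_on UNIV \<mu>" and mu_bound: "!!k. \<bar>\<mu> k\<bar> <= B" and mu_odd: "!!k. \<mu> (- k) = - \<mu> k"
  and a_L2: "L2 a" and a_herm: "herm a"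
begin

lemma mu_measurable[measurable]: "\<mu> : Borel"
 by (rule borel_measurable_continuous_onI[OF mu_cont])

lemma a_measurable[measurable]: "a : Borel"
 by (rule L2_measurable[OF a_L2])

lemma B_nonneg: "0 <= B" using mu_bound[of 0] by simp

text \<open>The unknown \<open>h\<close> is \<open>cis (\<mu> t) v - a\<close>, which removes the linear term. Clipping it makes the
 right-hand side globally Lipschitz and symmetrizing it keeps \<open>v\<close> hermitian; neither changes the solution
 once \<open>R\<close> is large, because the \<open>L^2\<close> norm of \<open>v\<close> is conserved.\<close>

definition sy :: "(real => complex) => real => complex" where
 "sy h k = (clip R (h k) + cnj (clip R (h (- k)))) / 2"

definition V :: "real => (real => complex) => real => complex" where
 "V t h k = of_real (indicator {-n..n} k) * (cis (- (\<mu> k * t)) * (a k + sy h k))"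

lemma sy_bound: "cmod (sy h k) <= R"
 using norm_triangle_ineq[of "clip R (h k)" "cnj (clip R (h (- k)))"] clip_props(1)[OF R, of "h k"] clip_props(1)[OF R, of "h (- k)"]
 by (simp add: sy_def norm_divide)

lemma sy_lipschitz:
 assumes "!!k. cmod (h k - h' k) <= d" shows "cmod (sy h k - sy h' k) <= d"
proof -
 have "sy h k - sy h' k = ((clip R (h k) - clip R (h' k)) + cnj (clip R (h (- k)) - clip R (h' (- k)))) / 2"
  by (simp add: sy_def field_simps)
 also have "cmod ... <= (cmod (clip R (h k) - clip R (h' k)) + cmod (cnj (clip R (h (- k)) - clip R (h' (- k))))) / 2"
  using norm_triangle_ineq[of "clip R (h k) - clip R (h' k)" "cnj (clip R (h (- k)) - clip R (h' (- k)))"]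
  by (simp add: norm_divide del: complex_cnj_diff)
 also have "... <= (d + d) / 2"
  unfolding complex_mod_cnj
  by (intro divide_right_mono add_mono order_trans[OF clip_props(2)[OF R] assms]) auto
 finally show ?thesis by simp
qed

lemma sy_herm: "herm (sy h)"
 by (simp add: herm_def sy_def add.commute)

lemma sy_eq: "[|herm h; !!k. cmod (h k) <= R|] ==> sy h = h"
 by (simp add: sy_def[abs_def] clip_props(3)[OF R] herm_def)

lemma sy_measurable[measurable]:
 assumes [measurable]: "h : Borel" shows "sy h : Borel"
proof -
 note [measurable] = clip_measurable[OF R]
 show ?thesis unfolding sy_def[abs_def] by measurable
qed

lemma V_measurable[measurable]: "h : Borel ==> V t h : Borel"
 unfolding V_def[abs_def] by measurable

lemma V_herm: "herm (V t h)"
proof -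
 have "indicator {-n..n} (- k) = (indicator {-n..n} k :: real)" for k by (auto simp: indicator_def)
 thus ?thesis using sy_herm[of h] a_herm by (simp add: herm_def V_def mu_odd cis_cnj)
qed

lemma V_support: "n < \<bar>k\<bar> ==> V t h k = 0"
 by (auto simp: V_def indicator_def)

definition cV :: real where "cV = L2_norm a + R * sqrt (2 * n)"

lemma cV_nonneg: "0 <= cV" unfolding cV_def using R n by simp

lemma V_L2:
 assumes [measurable]: "h : Borel" shows "L2 (V t h)" "L2_norm (V t h) <= cV"
proof -
 let ?i = "%k. cor (indicator {-n..n} k)"
 have l1: "L2 (%k. ?i k * (cis (- (\<mu> k * t)) * a k))"
  by (rule L2_bound[OF a_L2, where C=1]) (auto simp: norm_mult indicator_def)
 have n1: "L2_norm (%k. ?i k * (cis (- (\<mu> k * t)) * a k)) <= L2_norm a"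
  by (rule L2_norm_mono[OF a_L2]) (auto simp: norm_mult indicator_def)
 have b: "cmod (?i k * (cis (- (\<mu> k * t)) * sy h k)) <= R * indicator {-n..n} k" for k
  using sy_bound[of h k] by (auto simp: norm_mult indicator_def)
 note S = L2_bounded_support[OF n _ R b]
 have e: "V t h = (%k. ?i k * (cis (- (\<mu> k * t)) * a k) + ?i k * (cis (- (\<mu> k * t)) * sy h k))"
  by (simp add: V_def[abs_def] distrib_left)
 show "L2 (V t h)" unfolding e by (intro L2_add l1 S) measurable
 have "L2_norm (V t h) <= L2_norm (%k. ?i k * (cis (- (\<mu> k * t)) * a k)) + L2_norm (%k. ?i k * (cis (- (\<mu> k * t)) * sy h k))"
  unfolding e by (intro L2_norm_triangle l1 S) measurable
 also have "... <= cV" unfolding cV_def by (intro add_mono n1 S) measurable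
 finally show "L2_norm (V t h) <= cV" .
qed

lemma V_lipschitz:
 assumes [measurable]: "h : Borel" "h' : Borel"
  and d: "!!k. cmod (h k - h' k) <= d"
 shows "L2_norm (%k. V t h k - V t' h' k) <= B * cV * \<bar>t - t'\<bar> + sqrt (2 * n) * d"
proof -
 let ?i = "%k. cor (indicator {-n..n} k)"
 have d0: "0 <= d" using d[of 0] by (rule order_trans[rotated]) simp
 let ?p = "%k. (cis (- (\<mu> k * t)) - cis (- (\<mu> k * t'))) * (cis (\<mu> k * t) * V t h k)"
 let ?q = "%k. ?i k * (cis (- (\<mu> k * t')) * (sy h k - sy h' k))"
 have e: "(%k. V t h k - V t' h' k) = (%k. ?p k + ?q k)"
 proof
  fix k
  have "cis (\<mu> k * t) * V t h k = ?i k * ((cis (\<mu> k * t) * cis (- (\<mu> k * t))) * (a k + sy h k))"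
   by (simp only: V_def mult_ac)
  also have "cis (\<mu> k * t) * cis (- (\<mu> k * t)) = 1" by (simp add: cis_mult)
  finally show "V t h k - V t' h' k = ?p k + ?q k" by (simp add: V_def algebra_simps)
 qed
 have pb: "cmod (?p k) <= (B * \<bar>t - t'\<bar>) * cmod (V t h k)" for k
 proof -
  have "cmod (cis (- (\<mu> k * t)) - cis (- (\<mu> k * t'))) <= \<bar>\<mu> k * (t' - t)\<bar>"
   using norm_cis_diff_le[of "- (\<mu> k * t)" "- (\<mu> k * t')"] by (simp add: algebra_simps)
  also have "... <= B * \<bar>t - t'\<bar>" unfolding abs_mult abs_minus_commute[of t'] by (intro mult_right_mono mu_bound) simp
  finally show ?thesis unfolding norm_mult by (simp add: mult_right_mono)
 qed
 have p: "L2 ?p" by (rule L2_bound[OF V_L2(1)[OF assms(1)] _ pb]) measurable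
 have pn: "L2_norm ?p <= B * \<bar>t - t'\<bar> * cV"
 proof -
  have "L2_norm ?p <= L2_norm (%k. of_real (B * \<bar>t - t'\<bar>) * V t h k)"
   by (rule L2_norm_mono[OF L2_cmult[OF V_L2(1)[OF assms(1)]]]) (use pb B_nonneg in \<open>simp add: norm_mult\<close>)
  also have "... = B * \<bar>t - t'\<bar> * L2_norm (V t h)" using B_nonneg by (simp add: L2_norm_cmult del: of_real_mult)
  also have "... <= B * \<bar>t - t'\<bar> * cV" using V_L2(2)[OF assms(1)] B_nonneg by (intro mult_left_mono) auto
  finally show ?thesis .
 qed
 have qb: "cmod (?q k) <= d * indicator {-n..n} k" for k
  using sy_lipschitz[of h h' d k] d by (auto simp: norm_mult indicator_def)
 note Q = L2_bounded_support[OF n _ d0 qb]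
 have "L2_norm (%k. V t h k - V t' h' k) <= L2_norm ?p + L2_norm ?q"
  unfolding e by (intro L2_norm_triangle p Q) measurable
 also have "... <= B * \<bar>t - t'\<bar> * cV + d * sqrt (2 * n)" by (intro add_mono pn Q) measurable
 finally show ?thesis by (simp add: mult_ac)
qed

lemma V_integrable: "h : Borel ==> L1 (V t h)"
 using L2_support_integrable(1)[OF V_L2(1) V_support n] by blast

text \<open>The frequency factor is clamped to \<open>[-n,n]\<close> instead of being cut off, so
  that the right-hand side is a bounded continuous function of \<open>k\<close> and stays in the
  Banach space. For \<open>k\<close> in \<open>[-n,n]\<close>, the only frequencies that
  \<open>V\<close> sees, the factor is \<open>k\<close>.\<close>

definition rhs :: "real => (real => complex) => real => complex" where
 "rhs t h k = - (cis (\<mu> k * t) * (\<i> * of_real (max (- n) (min n k) / 2) * prod_ft (V t h) (V t h) k))"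

lemma rhs_continuous: assumes "h : Borel" shows "continuous_on UNIV (rhs t h)"
proof -
 have p: "continuous_on UNIV (prod_ft (V t h) (V t h))"
  by (rule continuous_on_prod_ft[OF V_integrable[OF assms] V_L2(1)[OF assms] V_integrable[OF assms] V_L2(1)[OF assms]])
 show ?thesis unfolding rhs_def[abs_def] by (intro continuous_intros mu_cont p) auto
qed

lemma clamp_abs: "\<bar>max (- n) (min n k)\<bar> <= n" using n by (auto simp: abs_le_iff)

lemma prod_V_bound:
 assumes "h : Borel" shows "cmod (prod_ft (V t h) (V t h) k) <= cV * cV"
proof -
 have "cmod (prod_ft (V t h) (V t h) k) <= L2_norm (V t h) * L2_norm (V t h)"
  by (intro prod_ft_bound V_integrable V_L2 assms)
 also have "... <= cV * cV" by (intro mult_mono V_L2 assms cV_nonneg) simp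
 finally show ?thesis .
qed

lemma rhs_bound: assumes "h : Borel"
 shows "cmod (rhs t h k) <= n / 2 * (L2_norm (V t h))^2"
proof -
 have "cmod (prod_ft (V t h) (V t h) k) <= (L2_norm (V t h))^2"
  using prod_ft_bound[OF V_integrable V_L2(1) V_integrable V_L2(1), OF assms assms assms assms] by (simp add: power2_eq_square)
 hence "\<bar>max (- n) (min n k)\<bar> / 2 * cmod (prod_ft (V t h) (V t h) k) <= n / 2 * (L2_norm (V t h))^2"
  using clamp_abs[of k] n by (intro mult_mono) auto
 thus ?thesis by (simp add: rhs_def norm_mult)
qed

lemma rhs_lipschitz:
 assumes h: "h : Borel" and h': "h' : Borel"
  and d: "!!k. cmod (h k - h' k) <= d"
 shows "cmod (rhs t h k - rhs t' h' k) <= n / 2 * (B * \<bar>t - t'\<bar> * (cV * cV) + 2 * cV * (B * cV * \<bar>t - t'\<bar> + sqrt (2 * n) * d))"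
proof -
 let ?P = "prod_ft (V t h) (V t h) k" and ?P' = "prod_ft (V t' h') (V t' h') k"
 let ?m = "max (- n) (min n k)"
 have VI: "L1 (V t h)" "L2 (V t h)" "L1 (V t' h')" "L2 (V t' h')"
  by (rule V_integrable[OF h] V_L2(1)[OF h] V_integrable[OF h'] V_L2(1)[OF h'])+
 have eP: "?P - ?P' = prod_ft (%x. V t h x + V t' h' x) (%x. V t h x - V t' h' x) k"
  by (rule prod_ft_square_diff[OF VI])
 have "cmod (?P - ?P') <= L2_norm (%x. V t h x + V t' h' x) * L2_norm (%x. V t h x - V t' h' x)"
  unfolding eP by (rule prod_ft_bound[OF int_add[OF VI(1,3)] L2_add[OF VI(2,4)] int_diff[OF VI(1,3)] L2_diff[OF VI(2,4)]])
 also have "... <= (2 * cV) * (B * cV * \<bar>t - t'\<bar> + sqrt (2 * n) * d)"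
 proof (rule mult_mono[OF _ V_lipschitz[OF h h' d]])
  show "L2_norm (%x. V t h x + V t' h' x) <= 2 * cV"
   using L2_norm_triangle[OF VI(2,4)] V_L2(2)[OF h, of t] V_L2(2)[OF h', of t'] by linarith
 qed (use cV_nonneg in simp_all)
 finally have PP: "cmod (?P - ?P') <= (2 * cV) * (B * cV * \<bar>t - t'\<bar> + sqrt (2 * n) * d)" .
 have cc: "cmod (cis (\<mu> k * t) - cis (\<mu> k * t')) <= B * \<bar>t - t'\<bar>"
 proof -
  have "cmod (cis (\<mu> k * t) - cis (\<mu> k * t')) <= \<bar>\<mu> k * (t - t')\<bar>"
   using norm_cis_diff_le[of "\<mu> k * t" "\<mu> k * t'"] by (simp add: algebra_simps)
  also have "... <= B * \<bar>t - t'\<bar>" unfolding abs_mult by (intro mult_right_mono mu_bound) simp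
  finally show ?thesis .
 qed
 have eR: "rhs t h k - rhs t' h' k = - (\<i> * of_real (?m / 2)) * ((cis (\<mu> k * t) - cis (\<mu> k * t')) * ?P + cis (\<mu> k * t') * (?P - ?P'))"
 proof -
  have "- (c * (m * P)) - - (c' * (m * P')) = - m * ((c - c') * P + c' * (P - P'))" for c c' m P P' :: complex
   by (simp add: algebra_simps)
  thus ?thesis unfolding rhs_def .
 qed
 have "cmod (rhs t h k - rhs t' h' k) = \<bar>?m\<bar> / 2 * cmod ((cis (\<mu> k * t) - cis (\<mu> k * t')) * ?P + cis (\<mu> k * t') * (?P - ?P'))"
  unfolding eR norm_mult norm_minus_cancel norm_of_real norm_ii by simp
 also have "... <= n / 2 * (B * \<bar>t - t'\<bar> * (cV * cV) + (2 * cV) * (B * cV * \<bar>t - t'\<bar> + sqrt (2 * n) * d))"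
 proof (intro mult_mono)
  have "cmod ((cis (\<mu> k * t) - cis (\<mu> k * t')) * ?P + cis (\<mu> k * t') * (?P - ?P')) <= cmod (cis (\<mu> k * t) - cis (\<mu> k * t')) * cmod ?P + cmod (?P - ?P')"
   using norm_triangle_ineq[of "(cis (\<mu> k * t) - cis (\<mu> k * t')) * ?P" "cis (\<mu> k * t') * (?P - ?P')"] by (simp add: norm_mult)
  also have "... <= B * \<bar>t - t'\<bar> * (cV * cV) + (2 * cV) * (B * cV * \<bar>t - t'\<bar> + sqrt (2 * n) * d)"
   by (rule add_mono[OF mult_mono[OF cc prod_V_bound[OF h]] PP]) (use B_nonneg in auto)
  finally show "cmod ((cis (\<mu> k * t) - cis (\<mu> k * t')) * ?P + cis (\<mu> k * t') * (?P - ?P')) <= B * \<bar>t - t'\<bar> * (cV * cV) + (2 * cV) * (B * cV * \<bar>t - t'\<bar> + sqrt (2 * n) * d)" .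
 qed (use clamp_abs[of k] n in auto)
 finally show ?thesis .
qed

lemma rhs_herm: assumes "h : Borel" shows "rhs t h (- k) = cnj (rhs t h k)"
proof -
 have p: "prod_ft (V t h) (V t h) (- k) = cnj (prod_ft (V t h) (V t h) k)"
  using V_herm[of t h] by (intro prod_ft_hermitian) (auto simp: herm_def)
 have m: "max (- n) (min n (- k)) = - max (- n) (min n k)" using n by (auto simp: max_def min_def)
 show ?thesis unfolding rhs_def p m mu_odd by (simp add: cis_cnj)
qed

lemma bcontfun_measurable: "apply_bcontfun h : Borel" for h :: "real \<Rightarrow>\<^sub>C complex"
 by (intro borel_measurable_continuous_onI continuous_on_apply_bcontfun continuous_on_id)

definition F :: "real => (real \<Rightarrow>\<^sub>C complex) => (real \<Rightarrow>\<^sub>C complex)" where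
 "F t h = Bcontfun (rhs t (apply_bcontfun h))"

lemma F_apply: "apply_bcontfun (F t h) = rhs t (apply_bcontfun h)"
proof -
 have "rhs t (apply_bcontfun h) : bcontfun"
  by (rule bcontfun_normI[where b="n / 2 * (L2_norm (V t (apply_bcontfun h)))^2"])
   (use rhs_continuous rhs_bound bcontfun_measurable in auto)
 thus ?thesis unfolding F_def by (rule Bcontfun_inverse)
qed

definition LF :: real where "LF = n / 2 * (B * (cV * cV) + 2 * cV * (B * cV) + 2 * cV * sqrt (2 * n))"

lemma F_lipschitz: "norm (F t h - F t' h') <= LF * (\<bar>t - t'\<bar> + norm (h - h'))"
proof (rule norm_bound)
 fix k
 have d: "cmod (h k - h' k) <= norm (h - h')" for k using norm_bounded[of "h - h'" k] by simp
 have "norm ((F t h - F t' h') k) = cmod (rhs t h k - rhs t' h' k)" by (simp add: F_apply)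
 also have "... <= n / 2 * (B * \<bar>t - t'\<bar> * (cV * cV) + 2 * cV * (B * cV * \<bar>t - t'\<bar> + sqrt (2 * n) * norm (h - h')))"
  by (rule rhs_lipschitz[OF bcontfun_measurable bcontfun_measurable d])
 also have "... <= LF * (\<bar>t - t'\<bar> + norm (h - h'))"
 proof -
  have p: "0 <= n / 2 * (2 * cV * sqrt (2 * n)) * \<bar>t - t'\<bar>" "0 <= n / 2 * (B * (cV * cV) + 2 * cV * (B * cV)) * norm (h - h')"
   using n B_nonneg cV_nonneg by auto
  have "LF * (\<bar>t - t'\<bar> + norm (h - h')) = n / 2 * (B * \<bar>t - t'\<bar> * (cV * cV) + 2 * cV * (B * cV * \<bar>t - t'\<bar> + sqrt (2 * n) * norm (h - h')))
   + n / 2 * (2 * cV * sqrt (2 * n)) * \<bar>t - t'\<bar> + n / 2 * (B * (cV * cV) + 2 * cV * (B * cV)) * norm (h - h')"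
   by (simp add: LF_def algebra_simps)
  thus ?thesis using p by linarith
 qed
 finally show "norm ((F t h - F t' h') k) <= LF * (\<bar>t - t'\<bar> + norm (h - h'))" .
qed

lemma LF_nonneg: "0 <= LF" unfolding LF_def using n B_nonneg cV_nonneg by simp

lemma ode_solution:
 assumes T: "0 <= T"
 obtains h where "h 0 = 0" "!!t. t : {0..T} ==> (h has_vector_derivative F t (h t)) (at t within {0..T})"
proof (rule Picard_global[of T LF F 0])
 show "continuous_on ({0..T} \<times> UNIV) (%(t, x). F t x)"
  unfolding continuous_on_iff
 proof (intro ballI allI impI)
  fix p :: "real \<times> (real \<Rightarrow>\<^sub>C complex)" and e :: real assume e: "0 < e"
  show "EX d>0. ALL q:{0..T} \<times> UNIV. dist q p < d --> dist (case q of (t, x) => F t x) (case p of (t, x) => F t x) < e"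
  proof (intro exI[of _ "e / (2 * (LF + 1))"] conjI ballI impI)
   show "0 < e / (2 * (LF + 1))" using e LF_nonneg by simp
   fix q assume "dist q p < e / (2 * (LF + 1))"
   hence "dist (fst q) (fst p) < e / (2 * (LF + 1))" "dist (snd q) (snd p) < e / (2 * (LF + 1))"
    using dist_fst_le[of q p] dist_snd_le[of q p] by linarith+
   hence "LF * (\<bar>fst q - fst p\<bar> + norm (snd q - snd p)) <= LF * (e / (LF + 1))"
    using LF_nonneg by (intro mult_left_mono) (auto simp: dist_norm field_simps)
   also have "... < e" using LF_nonneg e by (simp add: field_simps)
   finally show "dist (case q of (t, x) => F t x) (case p of (t, x) => F t x) < e"
    using F_lipschitz[of "fst q" "snd q" "fst p" "snd p"] by (simp add: dist_norm split_beta)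
  qed
 qed
 show "norm (F t x - F t y) <= LF * norm (x - y)" for t x y using F_lipschitz[of t x t y] by simp
qed (use T LF_nonneg that in auto)

end

theorem galerkin_exists:
 fixes \<mu> :: "real => real"
 assumes n: "0 <= n" and T: "0 <= T" and mu: "continuous_on UNIV \<mu>" "!!k. \<bar>\<mu> k\<bar> <= B" "!!k. \<mu> (- k) = - \<mu> k"
  and a: "L2 a" "herm a"
 obtains v f where "galerkin T n \<mu> a v f"
proof -
 \<comment> \<open>The sup norm of the right-hand side is at most \<open>n / 2\<close> times the
   squared L^2 norm of \<open>v\<close>, which is conserved while the clipping is inactive. So
   \<open>h\<close> moves by at most \<open>R'\<close> up to time \<open>T\<close>, and the clipping
   radius \<open>R\<close> is never reached.\<close>
 define R' where "R' = n / 2 * (L2_norm a)^2 * T"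
 define R where "R = R' + 1"
 have R': "0 <= R'" "R' < R" using n T by (auto simp: R'_def R_def)
 interpret galerkin_ode \<mu> a n B R
  by unfold_locales (use n mu a R' in auto)
 obtain h where h0: "h 0 = 0" and h: "!!t. t : {0..T} ==> (h has_vector_derivative F t (h t)) (at t within {0..T})"
  using ode_solution[OF T] by blast
 have hc: "continuous_on {0..T} h"
  unfolding continuous_on_eq_continuous_within using h has_vector_derivative_continuous by blast
 have hx: "((%t. h t k) has_vector_derivative rhs t (h t) k) (at t within {0..T})" if "t : {0..T}" for t k
  using bounded_linear.has_vector_derivative[OF bounded_linear_apply_bcontfun h[OF that], of k] by (simp add: F_apply)
 have hh: "herm (h t)" if t: "t : {0..T}" for t
  unfolding herm_def
 proof
  fix k
  have "((%t. h t (- k) - cnj (h t k)) has_vector_derivative 0) (at s within {0..T})" if "s : {0..T}" for s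
  proof -
   have "((%t. h t (- k) - cnj (h t k)) has_vector_derivative rhs s (h s) (- k) - cnj (rhs s (h s) k)) (at s within {0..T})"
    by (intro has_vector_derivative_diff bounded_linear.has_vector_derivative[OF bounded_linear_cnj] hx that)
   thus ?thesis by (simp add: rhs_herm[OF bcontfun_measurable])
  qed
  from has_vector_derivative_zero_constant[OF convex_real_interval(5) this]
  obtain c where c: "!!s. s : {0..T} ==> h s (- k) - cnj (h s k) = c" by blast
  have "c = 0" using c[of 0] T by (simp add: h0)
  thus "h t (- k) = cnj (h t k)" using c[OF t] by simp
 qed
 \<comment> \<open>Clamping time makes \<open>v\<close> jointly measurable over all real times, as
   \<open>flow\<close> demands.\<close>
 define \<tau> where "\<tau> = (%t::real. max 0 (min T t))"
 have \<tau>: "\<tau> t : {0..T}" "t : {0..T} ==> \<tau> t = t" for t using T by (auto simp: \<tau>_def)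
 define v where "v = (%t. V (\<tau> t) (h (\<tau> t)))"
 define f where "f = (%t k. - \<i> * of_real (\<mu> k) * v t k - of_real (indicator {-n..n} k) * burg (v t) k)"
 have c\<tau>: "continuous_on UNIV \<tau>" unfolding \<tau>_def by (intro continuous_intros)
 have ch: "continuous_on UNIV (%t. h (\<tau> t))"
  by (rule continuous_on_compose2[OF hc c\<tau>]) (use \<tau> in auto)
 have [measurable]: "(%(t, k). h (\<tau> t) k) : Borel2"
 proof -
  have "continuous_on UNIV (%p::real\<times>real. h (\<tau> (fst p)) (snd p))"
   unfolding continuous_on_iff
  proof (intro ballI allI impI)
   fix p :: "real \<times> real" and e :: real assume e: "0 < e"
   obtain d1 where d1: "0 < d1" "!!t. dist t (fst p) < d1 ==> dist (h (\<tau> t)) (h (\<tau> (fst p))) < e / 2"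
    using ch e unfolding continuous_on_iff by (metis UNIV_I half_gt_zero)
   have "continuous_on UNIV (apply_bcontfun (h (\<tau> (fst p))))" by (intro continuous_on_apply_bcontfun continuous_on_id)
   then obtain d2 where d2: "0 < d2" "!!x. dist x (snd p) < d2 ==> dist (h (\<tau> (fst p)) x) (h (\<tau> (fst p)) (snd p)) < e / 2"
    using e unfolding continuous_on_iff by (metis UNIV_I half_gt_zero)
   show "EX d>0. ALL q:UNIV. dist q p < d --> dist (h (\<tau> (fst q)) (snd q)) (h (\<tau> (fst p)) (snd p)) < e"
   proof (intro exI[of _ "min d1 d2"] conjI ballI impI)
    fix q assume "dist q p < min d1 d2"
    hence "dist (fst q) (fst p) < d1" "dist (snd q) (snd p) < d2"
     using dist_fst_le[of q p] dist_snd_le[of q p] by linarith+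
    hence a: "dist (h (\<tau> (fst q)) (snd q)) (h (\<tau> (fst p)) (snd q)) < e / 2"
     "dist (h (\<tau> (fst p)) (snd q)) (h (\<tau> (fst p)) (snd p)) < e / 2"
     using d1(2) d2(2) le_less_trans[OF dist_bounded] by blast+
    show "dist (h (\<tau> (fst q)) (snd q)) (h (\<tau> (fst p)) (snd p)) < e"
     using dist_triangle[of "h (\<tau> (fst q)) (snd q)" "h (\<tau> (fst p)) (snd p)" "h (\<tau> (fst p)) (snd q)"] a by linarith
   qed (use d1 d2 in auto)
  qed
  hence "(%p::real\<times>real. h (\<tau> (fst p)) (snd p)) : Borel" by (rule borel_measurable_continuous_onI)
  thus ?thesis by (simp add: split_beta borel_prod)
 qed
 have clip_m[measurable]: "clip R : Borel" using R' by (intro clip_measurable) auto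
 have [measurable]: "\<tau> : Borel" by (rule borel_measurable_continuous_onI[OF c\<tau>])
 have vm[measurable]: "(%(t, k). v t k) : Borel2"
  unfolding v_def V_def sy_def by measurable
 have [measurable]: "(%(t, k). burg (v t) k) : Borel2"
  by (rule burg_measurable_param[OF vm])
 have fm: "(%(t, k). f t k) : Borel2"
  unfolding f_def by measurable
 have VI: "L1 (v t)" "L2 (v t)" "L2_norm (v t) <= cV" for t
  unfolding v_def by (intro V_integrable V_L2 bcontfun_measurable)+
 have v0: "v 0 k = of_real (indicator {-n..n} k) * a k" for k
  using \<tau>(2)[of 0] T R' by (simp add: v_def V_def h0 sy_def clip_props(3))
 have gal: "galerkin u n \<mu> a v f" if u: "u : {0..T}" and hb: "!!s. s : {0..u} ==> norm (h s) <= R" for u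
 proof -
  have uT: "s : {0..T}" if "s : {0..u}" for s using u that by auto
  have sy: "sy (h s) = h s" if "s : {0..u}" for s
   by (rule sy_eq[OF hh[OF uT[OF that]]]) (rule order_trans[OF norm_bounded hb[OF that]])
  have der: "((%t. v t k) has_vector_derivative f t k) (at t within {0..u})" if t: "t : {0..u}" for t k
  proof -
   have d1: "((%t. cis (- (\<mu> k * t))) has_vector_derivative (- \<i> * of_real (\<mu> k)) * cis (- (\<mu> k * t))) (at t within {0..u})"
   proof -
    have "((%z. exp (- \<i> * of_real (\<mu> k) * z)) has_field_derivative (- \<i> * of_real (\<mu> k)) * exp (- \<i> * of_real (\<mu> k) * of_real t)) (at (of_real t))"
     by (auto intro!: derivative_eq_intros)
    from has_vector_derivative_at_within[OF has_vector_derivative_real_field[OF this]]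
    show ?thesis by (simp add: cis_conv_exp mult.assoc)
   qed
   have d2: "((%t. a k + h t k) has_vector_derivative rhs t (h t) k) (at t within {0..u})"
    using has_vector_derivative_add[OF has_vector_derivative_const has_vector_derivative_within_subset[OF hx[OF uT[OF t]]], of "{0..u}" "a k"] u by simp
   have d3: "((%t. of_real (indicator {-n..n} k) * (cis (- (\<mu> k * t)) * (a k + h t k))) has_vector_derivative
     of_real (indicator {-n..n} k) * (cis (- (\<mu> k * t)) * rhs t (h t) k + ((- \<i> * of_real (\<mu> k)) * cis (- (\<mu> k * t))) * (a k + h t k))) (at t within {0..u})"
    by (intro has_vector_derivative_mult_right has_vector_derivative_mult d1 d2)
   have vt: "v s k = of_real (indicator {-n..n} k) * (cis (- (\<mu> k * s)) * (a k + h s k))" if "s : {0..u}" for s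
    using \<tau>(2)[OF uT[OF that]] sy[OF that] by (simp add: v_def V_def)
   have "of_real (indicator {-n..n} k) * (cis (- (\<mu> k * t)) * rhs t (h t) k + ((- \<i> * of_real (\<mu> k)) * cis (- (\<mu> k * t))) * (a k + h t k)) = f t k"
   proof (cases "k : {-n..n}")
    case True
    have "cis (- (\<mu> k * t)) * rhs t (h t) k = - ((cis (- (\<mu> k * t)) * cis (\<mu> k * t)) * (\<i> * of_real (max (- n) (min n k) / 2) * prod_ft (V t (h t)) (V t (h t)) k))"
     by (simp only: rhs_def mult_minus_right mult.assoc)
    also have "cis (- (\<mu> k * t)) * cis (\<mu> k * t) = 1" by (simp add: cis_mult)
    also have "max (- n) (min n k) = k" using True by auto
    also have "V t (h t) = v t" using \<tau>(2)[OF uT[OF t]] by (simp add: v_def)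
    finally have "cis (- (\<mu> k * t)) * rhs t (h t) k = - burg (v t) k" by (simp add: burg_def)
    thus ?thesis using True vt[OF t] by (simp add: f_def)
   next
    case False
    thus ?thesis using vt[OF t] by (simp add: f_def)
   qed
   with d3 have "((%t. of_real (indicator {-n..n} k) * (cis (- (\<mu> k * t)) * (a k + h t k))) has_vector_derivative f t k) (at t within {0..u})"
    by (simp only:)
   thus ?thesis
    by (rule has_vector_derivative_transform[rotated 2]) (use t vt in auto)
  qed
  have fc: "continuous_on {0..u} (%t. f t k)" for k
  proof -
   have vc: "continuous_on {0..u} (%t. v t k)"
    unfolding continuous_on_eq_continuous_within using der has_vector_derivative_continuous by blast
   have Fc: "continuous_on {0..u} (%t. F t (h t))"
   proof -
    have hcu: "continuous_on {0..u} h" using u by (intro continuous_on_subset[OF hc]) auto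
    show ?thesis
     unfolding continuous_on_iff
    proof (intro ballI allI impI)
     fix t e :: real assume t: "t : {0..u}" and e: "0 < e"
     define e' where "e' = e / (2 * (LF + 1))"
     have e': "0 < e'" using e LF_nonneg by (simp add: e'_def)
     obtain d where d: "0 < d" "!!s. s : {0..u} ==> dist s t < d ==> dist (h s) (h t) < e'"
      using hcu t e' unfolding continuous_on_iff by metis
     show "EX d>0. ALL s:{0..u}. dist s t < d --> dist (F s (h s)) (F t (h t)) < e"
     proof (intro exI[of _ "min d e'"] conjI ballI impI)
      fix s assume s: "s : {0..u}" "dist s t < min d e'"
      hence "\<bar>s - t\<bar> + norm (h s - h t) <= 2 * e'" using d(2)[of s] by (auto simp: dist_norm)
      hence "LF * (\<bar>s - t\<bar> + norm (h s - h t)) <= LF * (2 * e')" by (intro mult_left_mono LF_nonneg)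
      also have "... < e" using LF_nonneg e by (simp add: e'_def field_simps)
      finally show "dist (F s (h s)) (F t (h t)) < e" using F_lipschitz[of s "h s" t "h t"] by (simp add: dist_norm)
     qed (use d e' in auto)
    qed
   qed
   have rc: "continuous_on {0..u} (%t. rhs t (h t) k)"
    using bounded_linear.continuous_on[OF bounded_linear_apply_bcontfun Fc, of k] by (simp add: F_apply)
   have ce: "continuous_on {0..u} (%t. - \<i> * of_real (\<mu> k) * v t k + of_real (indicator {-n..n} k) * (cis (- (\<mu> k * t)) * rhs t (h t) k))"
    by (intro continuous_intros vc rc)
   have fe: "f t k = - \<i> * of_real (\<mu> k) * v t k + of_real (indicator {-n..n} k) * (cis (- (\<mu> k * t)) * rhs t (h t) k)" if t: "t : {0..u}" for t
   proof (cases "k : {-n..n}")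
    case True
    have "cis (- (\<mu> k * t)) * rhs t (h t) k = - ((cis (- (\<mu> k * t)) * cis (\<mu> k * t)) * (\<i> * of_real (max (- n) (min n k) / 2) * prod_ft (V t (h t)) (V t (h t)) k))"
     by (simp only: rhs_def mult_minus_right mult.assoc)
    also have "cis (- (\<mu> k * t)) * cis (\<mu> k * t) = 1" by (simp add: cis_mult)
    also have "max (- n) (min n k) = k" using True by auto
    also have "V t (h t) = v t" using \<tau>(2)[OF uT[OF t]] by (simp add: v_def)
    finally show ?thesis using True by (simp add: f_def burg_def)
   qed (simp add: f_def)
   show ?thesis by (rule continuous_on_eq[OF ce fe[symmetric]])
  qed
  have fl: "flow u v f" unfolding flow_def using vm fm der fc by blast
  have hv: "herm (v t)" "n < \<bar>k\<bar> ==> v t k = 0" for t k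
   unfolding v_def by (rule V_herm, rule V_support)
  have ff: "f t k = - \<i> * of_real (\<mu> k) * v t k - of_real (indicator {-n..n} k) * burg (v t) k" for t k
   by (simp add: f_def)
  show ?thesis unfolding galerkin_def using fl hv ff v0 VI by blast
 qed
 have "norm (h t) <= R'" if t: "t : {0..T}" for t
 proof (rule bootstrap[OF _ R'(2) _ _ t])
  show "continuous_on {0..T} (%t. norm (h t))" by (intro continuous_intros hc)
  show "norm (h 0) <= R'" using R' by (simp add: h0)
  fix u assume u: "u : {0..T}" and hb: "!!s. s : {0..u} ==> norm (h s) <= R"
  note G = gal[OF u hb]
  \<comment> \<open>This crude bound depends on \<open>n\<close>. It only makes
    \<open>galerkin_energy\<close> applicable, whose conservation of the L^2 norm does not involve
    it.\<close>
  have Mb: "(moment (v t)) <= n * (sqrt (2 * n) * cV)" for t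
  proof -
   have sp: "v t k = 0" if "n < \<bar>k\<bar>" for k unfolding v_def using that by (rule V_support)
   have L: "L2 (%k. of_real k * v t k)" "L2_norm (%k. of_real k * v t k) <= n * L2_norm (v t)"
    using L2_support_weighted[OF VI(2) sp, of n "%x. x" n] n by auto
   have "(Lint k. cmod (of_real k * v t k)) <= sqrt (2 * n) * L2_norm (%k. of_real k * v t k)"
    by (rule L2_support_integrable(2)[OF L(1) _ n]) (use sp in auto)
   also have "... <= sqrt (2 * n) * (n * cV)"
    using L(2) mult_left_mono[OF VI(3) n] n by (intro mult_left_mono) (auto intro: order_trans)
   finally show ?thesis by (simp add: norm_mult mult_ac)
  qed
  have vn: "L2_norm (v s) <= L2_norm a" if s: "s : {0..u}" for s
  proof -
   have "L2_norm (v s) = L2_norm (v 0)"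
    by (rule galerkin_energy(2)[OF G n mu_measurable mu(2) _ weight_const[of 1 0] Mb s]) auto
   also have "... <= L2_norm a"
    by (rule L2_norm_mono[OF a(1)]) (auto simp: v0 norm_mult indicator_def)
   finally show ?thesis .
  qed
  have "norm (h u - h 0) <= n / 2 * (L2_norm a)^2 * (u - 0)"
  proof (rule vector_derivative_bound[where f'="%t. F t (h t)"])
   show "(h has_vector_derivative F t (h t)) (at t within {0..u})" if "t : {0..u}" for t
    using has_vector_derivative_within_subset[OF h, of t "{0..u}"] that u by auto
   show "norm (F t (h t)) <= n / 2 * (L2_norm a)^2" if t: "t : {0..u}" for t
   proof (rule norm_bound)
    fix k
    have "\<tau> t = t" using \<tau>(2) t u by auto
    hence "L2_norm (V t (h t)) <= L2_norm a" using vn[OF t] by (simp add: v_def)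
    hence "n / 2 * (L2_norm (V t (h t)))^2 <= n / 2 * (L2_norm a)^2" using n by (intro mult_left_mono power_mono) auto
    thus "norm (apply_bcontfun (F t (h t)) k) <= n / 2 * (L2_norm a)^2"
     unfolding F_apply using rhs_bound[OF bcontfun_measurable, of t "h t" k] by linarith
   qed
  qed (use u in auto)
  also have "... <= R'" unfolding R'_def using u n by (intro mult_left_mono) auto
  finally show "norm (h u) <= R'" by (simp add: h0)
 qed
 hence "galerkin T n \<mu> a v f" using R' T by (intro gal) force+
 thus ?thesis by (rule that)
qed

section \<open>The inviscid Burgers equation before breaking\<close>

text \<open>An integrable function need not decay at infinity, but it must be small somewhere beyond
  every bound. Boundary terms at infinity are made to vanish along such points.\<close>

lemma integrable_small_values:
 fixes h :: "real => real"
 assumes i: "L1 h" and h: "!!x. 0 <= h x"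
 obtains R where "!!n. real n <= R n" "!!n. h (R n) < 1 / real (Suc n)"
proof -
 have "EX r>=real n. h r < 1 / real (Suc n)" for n
 proof (rule ccontr)
  assume "~  (EX r>=real n. h r < 1 / real (Suc n))"
  hence ge: "1 / real (Suc n) <= h r" if "real n <= r" for r using that by force
  have bound: "(1 / real (Suc n)) * real k <= (Lint x. h x)" for k
  proof -
   have "(Lint x. (1 / real (Suc n)) * indicator {real n..real n + real k} x) <= (Lint x. h x)"
   proof (rule integral_mono[OF integrable_mult_right i])
    show "L1 (indicator {real n..real n + real k} :: real => real)"
     by (simp add: integrable_indicator_iff emeasure_lborel_Icc_eq)
    show "1 / real (Suc n) * indicator {real n..real n + real k} x <= h x" for x
     using ge[of x] h[of x] by (simp add: indicator_def del: of_nat_Suc)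
   qed
   thus ?thesis by simp
  qed
  obtain k where "(Lint x. h x) * real (Suc n) < real k" using reals_Archimedean2 by blast
  thus False using bound[of k] by (simp add: field_simps)
 qed
 thus ?thesis using that by metis
qed

lemma integral_of_derivative:
 fixes F f :: "real => complex"
 assumes F: "!!x. (F has_vector_derivative f x) (at x)" and c: "continuous_on UNIV f"
  and iF: "L1 F" and i: "L1 f"
 shows "(Lint x. f x) = 0"
proof -
 have "L1 (%x. cmod (F x) + cmod (F (- x)))"
  using iF lborel_integrable_reflect[of F] by simp
 then obtain R where R: "!!n. real n <= R n" "!!n. cmod (F (R n)) + cmod (F (- R n)) < 1 / real (Suc n)"
  using integrable_small_values[of "%x. cmod (F x) + cmod (F (- x))"] by auto
 have ftc: "(Lint x. indicator {- R n..R n} x *\<^sub>R f x) = F (R n) - F (- R n)" for n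
 proof (rule integral_FTC_atLeastAtMost)
  show "- R n <= R n" using R(1)[of n] of_nat_0_le_iff[of n] by linarith
 qed (auto intro: has_vector_derivative_at_within F continuous_on_subset[OF c])
 have "(%n. Lint x. indicator {- R n..R n} x *\<^sub>R f x) \<longlonglongrightarrow> (Lint x. f x)"
 proof (rule integral_dominated_convergence[where w="%x. cmod (f x)"])
  show "AE x in lborel. (%n. indicator {- R n..R n} x *\<^sub>R f x) \<longlonglongrightarrow> f x"
  proof (rule AE_I2, rule tendsto_eventually)
   fix x :: real
   obtain N where "\<bar>x\<bar> <= real N" using real_arch_simple by blast
   hence "indicator {- R n..R n} x *\<^sub>R f x = f x" if "N <= n" for n
    using R(1)[of n] that by (auto simp: indicator_def abs_le_iff)
   thus "\<forall>\<^sub>F n in sequentially. indicator {- R n..R n} x *\<^sub>R f x = f x"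
    unfolding eventually_sequentially by blast
  qed
 qed (use i in \<open>auto simp: indicator_def\<close>)
 moreover have "(%n. Lint x. indicator {- R n..R n} x *\<^sub>R f x) \<longlonglongrightarrow> 0"
  unfolding ftc
 proof (rule Lim_null_comparison)
  show "\<forall>\<^sub>F n in sequentially. norm (F (R n) - F (- R n)) <= 1 / real (Suc n)"
  proof (intro always_eventually allI)
   fix n show "norm (F (R n) - F (- R n)) <= 1 / real (Suc n)"
    using R(2)[of n] norm_triangle_ineq4[of "F (R n)" "F (- R n)"] by linarith
  qed
  show "(%n. 1 / real (Suc n)) \<longlonglongrightarrow> 0" using LIMSEQ_inverse_real_of_nat by (simp add: inverse_eq_divide)
 qed
 ultimately show ?thesis by (rule LIMSEQ_unique)
qed

text \<open>Integration by parts over \<open>{- R n..R n}\<close> leaves boundary terms that tend to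
  0 but, as functions of \<open>y\<close>, are only bounded. The comparison therefore takes place in
  L^2 with the weight \<open>jp (-1) y\<close>, which also absorbs the factor
  \<open>y\<close>.\<close>

lemma fourier_transform_derivative:
 assumes d: "!!x. (f has_real_derivative f' x) (at x)" and c: "continuous_on UNIV f'"
  and L: "L2 f" "L2 f'" and g: "is_fourier_transform f g" and G: "is_fourier_transform f' G"
 shows "AE y in lborel. G y = \<i> * of_real y * g y"
proof -
 note gD = is_fourier_transformD[OF g L(1)] and GD = is_fourier_transformD[OF G L(2)]
 note [measurable] = L2_measurable[OF gD(1)] L2_measurable[OF GD(1)] L2_measurable[OF L2_truncated_fourier[OF L(1)]] L2_measurable[OF L2_truncated_fourier[OF L(2)]]
 have "L1 (%x. (f x)^2 + (f (- x))^2)"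
  using L2_integrable[OF L(1)] lborel_integrable_reflect[of "%x. (f x)^2"] by simp
 then obtain R where R: "!!n. real n <= R n" "!!n. (f (R n))^2 + (f (- R n))^2 < 1 / real (Suc n)"
  using integrable_small_values[of "%x. (f x)^2 + (f (- x))^2"] by auto
 have R0: "0 <= R n" for n using R(1)[of n] of_nat_0_le_iff[of n] by linarith
 have Rt: "filterlim R at_top sequentially"
  by (rule filterlim_at_top_mono[OF filterlim_real_sequentially]) (use R(1) in auto)
 define b where "b = (%n. sqrt (1 / real (Suc n)))"
 have fb: "\<bar>f (R n)\<bar> <= b n" "\<bar>f (- R n)\<bar> <= b n" for n
 proof -
  have "(\<bar>f (R n)\<bar>)^2 <= 1 / real (Suc n)" "(\<bar>f (- R n)\<bar>)^2 <= 1 / real (Suc n)"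
   unfolding power2_abs using R(2)[of n] zero_le_power2[of "f (R n)"] zero_le_power2[of "f (- R n)"] by linarith+
  thus "\<bar>f (R n)\<bar> <= b n" "\<bar>f (- R n)\<bar> <= b n" unfolding b_def by (auto intro: real_le_rsqrt)
 qed
 have b0: "b \<longlonglongrightarrow> 0"
  unfolding b_def using tendsto_real_sqrt[OF LIMSEQ_inverse_real_of_nat] by (simp add: inverse_eq_divide)
 have parts: "truncated_fourier f' (R n) y - \<i> * of_real y * truncated_fourier f (R n) y
  = of_real (1 / sqrt (2 * pi)) * (of_real (f (R n)) * cis (- (R n * y)) - of_real (f (- R n)) * cis (R n * y))" for n y
 proof -
  let ?h = "%x. of_real (f' x) * cis (- (x * y)) - \<i> * of_real y * (of_real (f x) * cis (- (x * y)))"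
  have fc: "continuous_on UNIV f" using d by (auto intro: DERIV_isCont continuous_at_imp_continuous_on)
  have "(Lint x. indicator {- R n..R n} x *\<^sub>R ?h x) = of_real (f (R n)) * cis (- (R n * y)) - of_real (f (- R n)) * cis (- (- R n * y))"
  proof (rule integral_FTC_atLeastAtMost)
   show "((%x. of_real (f x) * cis (- (x * y))) has_vector_derivative ?h x) (at x within {- R n..R n})" for x
   proof -
    have "((%x. cis (- (x * y))) has_vector_derivative (- \<i> * of_real y) * cis (- (x * y))) (at x)"
     unfolding has_vector_derivative_complex_iff by (auto intro!: derivative_eq_intros)
    from has_vector_derivative_mult[OF has_vector_derivative_of_real[OF d] this]
    have "((%x. of_real (f x) * cis (- (x * y))) has_vector_derivative ?h x) (at x)"
     by (rule has_vector_derivative_eq_rhs) (simp add: algebra_simps)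
    thus ?thesis by (rule has_vector_derivative_at_within)
   qed
   show "continuous_on {- R n..R n} ?h"
    by (intro continuous_intros continuous_on_subset[OF fc] continuous_on_subset[OF c]) auto
  qed (use R0[of n] in simp)
  moreover have "(Lint x. indicator {- R n..R n} x *\<^sub>R ?h x) =
   (Lint x. cut f' (R n) x * cis ((- y) * x)) - \<i> * of_real y * (Lint x. cut f (R n) x * cis ((- y) * x))"
  proof -
   have "(Lint x. indicator {- R n..R n} x *\<^sub>R ?h x) = (Lint x. cut f' (R n) x * cis ((- y) * x) - \<i> * of_real y * (cut f (R n) x * cis ((- y) * x)))"
    by (intro int_cong refl) (simp add: cut_def indicator_def mult.commute)
   thus ?thesis using integrable_mult_cis'[OF integrable_cut[OF L(1)], of "R n" "- y"] integrable_mult_cis'[OF integrable_cut[OF L(2)], of "R n" "- y"] by simp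
  qed
  ultimately have "(Lint x. cut f' (R n) x * cis ((- y) * x)) - \<i> * of_real y * (Lint x. cut f (R n) x * cis ((- y) * x))
    = of_real (f (R n)) * cis (- (R n * y)) - of_real (f (- R n)) * cis (R n * y)" by simp
  from this[symmetric] show ?thesis
   by (simp only: truncated_fourier_eq ift_def right_diff_distrib mult.left_commute[of "\<i> * of_real y"])
 qed
 let ?d = "%y. of_real (jp (-1) y) * (G y - \<i> * of_real y * g y)"
 have j1: "jp (-1) y <= 1" "jp (-1) y * \<bar>y\<bar> <= 1" for y
 proof -
  show "jp (-1) y <= 1" using jp_mono[of "-1" 0 y] by simp
  have "jp (-1) y * \<bar>y\<bar> <= jp (-1) y * jp 1 y" by (intro mult_left_mono abs_le_jp_1) simp
  also have "... = 1" by (simp flip: jp_add)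
  finally show "jp (-1) y * \<bar>y\<bar> <= 1" .
 qed
 define A1 where "A1 = (%n y. of_real (jp (-1) y) * (G y - truncated_fourier f' (R n) y))"
 define A2 where "A2 = (%n y. of_real (jp (-1) y) * (truncated_fourier f' (R n) y - \<i> * of_real y * truncated_fourier f (R n) y))"
 define A3 where "A3 = (%n y. of_real (jp (-1) y) * (\<i> * of_real y * (truncated_fourier f (R n) y - g y)))"
 have l1: "L2 (%y. truncated_fourier f' (R n) y - G y)" and l3: "L2 (%y. truncated_fourier f (R n) y - g y)" for n
  using L2_truncated_fourier L gD GD by (auto intro!: L2_diff)
 have p1: "cmod (A1 n y) <= cmod (truncated_fourier f' (R n) y - G y)" for n y
  unfolding A1_def using mult_right_mono[OF j1(1)] by (simp add: norm_mult norm_minus_commute)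
 have p2: "cmod (A2 n y) <= cmod (of_real (2 * b n) * cor (jp (-1) y))" for n y
 proof -
  have b0: "0 <= b n" by (simp add: b_def)
  have "cmod (of_real (f (R n)) * cis (- (R n * y)) - of_real (f (- R n)) * cis (R n * y)) <= \<bar>f (R n)\<bar> + \<bar>f (- R n)\<bar>"
   using norm_triangle_ineq4[of "of_real (f (R n)) * cis (- (R n * y))" "of_real (f (- R n)) * cis (R n * y)"] by (simp add: norm_mult)
  also have "... <= 2 * b n" using fb[of n] by linarith
  finally have "1 / sqrt (2 * pi) * cmod (of_real (f (R n)) * cis (- (R n * y)) - of_real (f (- R n)) * cis (R n * y)) <= 1 * (2 * b n)"
   using pi_gt3 by (intro mult_mono) (auto simp: real_le_rsqrt)
  hence "jp (-1) y * (1 / sqrt (2 * pi) * cmod (of_real (f (R n)) * cis (- (R n * y)) - of_real (f (- R n)) * cis (R n * y))) <= jp (-1) y * (2 * b n)"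
   by (intro mult_left_mono) auto
  thus ?thesis unfolding A2_def parts norm_mult using b0 by (simp add: norm_divide mult.commute)
 qed
 have p3: "cmod (A3 n y) <= cmod (truncated_fourier f (R n) y - g y)" for n y
 proof -
  have "cmod (A3 n y) = (jp (-1) y * \<bar>y\<bar>) * cmod (truncated_fourier f (R n) y - g y)"
   by (simp add: A3_def norm_mult)
  also have "... <= 1 * cmod (truncated_fourier f (R n) y - g y)" by (intro mult_right_mono j1) simp
  finally show ?thesis by simp
 qed
 have jL: "L2 (%y. of_real (2 * b n) * cor (jp (-1) y))" for n
  by (intro L2_cmult L2_bound[OF L2_jp_minus_1, where C=1]) auto
 have jn: "L2_norm (%y. of_real (2 * b n) * cor (jp (-1) y)) = 2 * b n * c1" for n
 proof -
  have "L2_norm (%y. cor (jp (-1) y)) = c1" by (simp add: c1_def L2_norm_def)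
  thus ?thesis unfolding L2_norm_cmult by (simp add: b_def norm_divide)
 qed
 have LA: "L2 (A1 n)" "L2 (A2 n)" "L2 (A3 n)" for n
  by (rule L2_bound[OF l1[of n], where C=1], simp add: A1_def, use p1 in simp)
   (rule L2_bound[OF jL[of n], where C=1], simp add: A2_def, use p2 in simp,
    rule L2_bound[OF l3[of n], where C=1], simp add: A3_def, use p3 in simp)
 have e: "?d = (%y. A1 n y + (A2 n y + A3 n y))" for n
  by (auto simp: fun_eq_iff A1_def A2_def A3_def algebra_simps)
 have Ld: "L2 ?d" unfolding e[of 0] by (intro L2_add LA)
 have le: "L2_norm ?d <= L2_norm (%y. truncated_fourier f' (R n) y - G y) + (2 * b n * c1 + L2_norm (%y. truncated_fourier f (R n) y - g y))" for n
 proof -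
  have "L2_norm ?d <= L2_norm (A1 n) + (L2_norm (A2 n) + L2_norm (A3 n))"
   unfolding e[of n]
   by (rule order_trans[OF L2_norm_triangle[OF LA(1) L2_add[OF LA(2,3)]] add_left_mono[OF L2_norm_triangle[OF LA(2,3)]]])
  also have "... <= L2_norm (%y. truncated_fourier f' (R n) y - G y) + (2 * b n * c1 + L2_norm (%y. truncated_fourier f (R n) y - g y))"
   by (intro add_mono L2_norm_mono[OF l1 p1] L2_norm_mono[OF l3 p3] order_trans[OF L2_norm_mono[OF jL p2]]) (simp only: jn)
  finally show ?thesis .
 qed
 have "(%n. L2_norm (%y. truncated_fourier f' (R n) y - G y) + (2 * b n * c1 + L2_norm (%y. truncated_fourier f (R n) y - g y))) \<longlonglongrightarrow> 0 + (2 * 0 * c1 + 0)"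
  by (intro tendsto_add tendsto_mult tendsto_const b0 filterlim_compose[OF GD(2) Rt] filterlim_compose[OF gD(2) Rt])
 hence "L2_norm ?d <= 0 + (2 * 0 * c1 + 0)"
  by (rule LIMSEQ_le_const) (use le in auto)
 hence "L2_norm ?d = 0" by (simp add: antisym)
 from L2_norm_eq_0_AE[OF Ld this] show ?thesis by eventually_elim simp
qed

section \<open>Change of variables along characteristics\<close>

locale diffeomorphism =
 fixes X J :: "real => real" and \<delta> C :: real
 assumes dX: "!!a. (X has_real_derivative J a) (at a)" and J: "!!a. \<delta> <= J a" and \<delta>: "0 < \<delta>"
  and Jc: "continuous_on UNIV J" and XC: "!!a. \<bar>X a - a\<bar> <= C"
begin

lemma strict_mono_X: "strict_mono X"
proof (rule strict_monoI)
 fix a b :: real assume "a < b"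
 thus "X a < X b" using dX J \<delta> by (intro DERIV_pos_imp_increasing[of a b X]) (auto intro: order_less_le_trans)
qed

lemma isCont_X: "isCont X a" using dX by (rule DERIV_isCont)

lemma X_measurable[measurable]: "X : Borel"
 using isCont_X by (intro borel_measurable_continuous_onI continuous_at_imp_continuous_on) auto

lemma J_measurable[measurable]: "J : Borel"
 using Jc by (rule borel_measurable_continuous_onI)

lemma J_pos: "0 < J a" using J[of a] \<delta> by linarith

definition Y :: "real => real" where "Y = inv X"

lemma surj_X: "surj X"
proof -
 have "EX a. X a = x" for x
 proof -
  have "EX a>=x - C. a <= x + C & X a = x"
   using XC[of "x - C"] XC[of "x + C"] isCont_X by (intro IVT) auto
  thus ?thesis by blast
 qed
 thus ?thesis by (metis surjI)
qed

lemma X_Y[simp]: "X (Y x) = x" unfolding Y_def by (rule surj_f_inv_f[OF surj_X])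
lemma Y_X[simp]: "Y (X a) = a" unfolding Y_def by (rule inv_f_f[OF strict_mono_imp_inj_on[OF strict_mono_X]])

lemma isCont_Y: "isCont Y x"
 using isCont_inverse_function[of 1 "Y x" Y X] isCont_X by simp

lemma deriv_Y: "(Y has_real_derivative 1 / J (Y x)) (at x)"
 using DERIV_inverse_function[where f=X and g=Y and x=x and D="J (Y x)" and a="x - 1" and b="x + 1"] dX[of "Y x"] J_pos[of "Y x"] isCont_Y
 by (simp add: inverse_eq_divide)

lemma Y_measurable[measurable]: "Y : Borel"
 using isCont_Y by (intro borel_measurable_continuous_onI continuous_at_imp_continuous_on) auto

text \<open>Lebesgue measure is determined by its values on open intervals, and there the
  fundamental theorem of calculus evaluates the integral of \<open>J\<close>.\<close>

lemma distr_X: "distr (density lborel (%a. ennreal (J a))) borel X = lborel"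
proof (rule lborel_eqI[symmetric])
 fix l u :: real assume "!!b. b : Basis ==> l \<bullet> b <= u \<bullet> b"
 hence lu: "l <= u" by simp
 have Ylu: "Y l <= Y u" using lu strict_mono_less_eq[OF strict_mono_X, of "Y l" "Y u"] by simp
 have vi: "X -` {l<..<u} \<inter> space lborel = {Y l<..<Y u}"
  using strict_mono_less[OF strict_mono_X, of "Y l"] strict_mono_less[OF strict_mono_X, of _ "Y u"] by auto
 have "emeasure (distr (density lborel (%a. ennreal (J a))) borel X) {l<..<u} = (\<integral>\<^sup>+a. ennreal (J a) * indicator {Y l<..<Y u} a \<partial>lborel)"
  using vi by (simp add: emeasure_distr emeasure_density)
 also have "... = (\<integral>\<^sup>+a. ennreal (J a) * indicator {Y l..Y u} a \<partial>lborel)"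
  using AE_lborel_singleton[of "Y l"] AE_lborel_singleton[of "Y u"]
  by (intro nn_integral_cong_AE) (auto simp: indicator_def)
 also have "... = X (Y u) - X (Y l)"
  by (rule nn_integral_FTC_Icc) (auto intro: dX Ylu less_imp_le[OF J_pos])
 finally show "emeasure (distr (density lborel (%a. ennreal (J a))) borel X) (box l u) = (\<Prod>b\<in>Basis. (u - l) \<bullet> b)"
  by (simp add: box_real)
qed simp

lemma change_of_variables:
 fixes h :: "real => 'a::{banach, second_countable_topology}"
 assumes [measurable]: "h : Borel"
 shows "L1 h \<longleftrightarrow> L1 (%a. J a *\<^sub>R h (X a))" "(Lint x. h x) = (Lint a. J a *\<^sub>R h (X a))"
proof -
 have "L1 h \<longleftrightarrow> integrable (distr (density lborel (%a. ennreal (J a))) borel X) h" unfolding distr_X ..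
 thus "L1 h \<longleftrightarrow> L1 (%a. J a *\<^sub>R h (X a))"
  by (simp add: integrable_distr_eq integrable_density less_imp_le[OF J_pos])
 have "(Lint x. h x) = (LINT x|distr (density lborel (%a. ennreal (J a))) borel X. h x)" unfolding distr_X ..
 thus "(Lint x. h x) = (Lint a. J a *\<^sub>R h (X a))"
  by (simp add: integral_distr integral_density less_imp_le[OF J_pos])
qed

lemma L2_compose_Y:
 fixes k :: "real => real"
 assumes k: "L2 k" and D: "!!a. J a <= D"
 shows "L2 (%x. k (Y x))" "L2_norm (%x. k (Y x)) <= sqrt D * L2_norm k"
proof -
 note [measurable] = L2_measurable[OF k]
 have i: "L1 (%a. D * (norm (k a))^2)" using L2_integrable[OF k] by simp
 have i': "L1 (%a. J a *\<^sub>R (norm (k (Y (X a))))^2)"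
 proof (rule int_bound[OF i])
  have "0 <= J a" "J a <= \<bar>D\<bar>" for a using D[of a] J_pos[of a] by auto
  thus "AE a in lborel. norm (J a *\<^sub>R (norm (k (Y (X a))))^2) <= norm (D * (norm (k a))^2)"
   by (simp add: abs_mult mult_right_mono)
 qed simp
 thus "L2 (%x. k (Y x))" using change_of_variables(1)[of "%x. (norm (k (Y x)))^2"] by (intro L2I) simp_all
 have "(Lint x. (norm (k (Y x)))^2) <= D * (Lint a. (norm (k a))^2)"
 proof -
  have "(Lint x. (norm (k (Y x)))^2) = (Lint a. J a *\<^sub>R (norm (k (Y (X a))))^2)"
   by (rule change_of_variables(2)) simp
  thus ?thesis using integral_mono[OF i' i] D by (simp add: mult_right_mono)
 qed
 thus "L2_norm (%x. k (Y x)) <= sqrt D * L2_norm k"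
  unfolding L2_norm_def by (simp flip: real_sqrt_mult)
qed

end

lemma Fubini_time:
 fixes h :: "real => real => 'a::{banach, second_countable_topology}"
 assumes [measurable]: "(%(s, x). h s x) : Borel2"
  and w: "L1 w" and b: "!!s x. s : {0..t} ==> norm (h s x) <= w x"
 shows "(Lint x. Lint s. indicator {0..t} s *\<^sub>R h s x) = (Lint s. indicator {0..t} s *\<^sub>R (Lint x. h s x))"
  "L1 (%x. Lint s. indicator {0..t} s *\<^sub>R h s x)"
proof -
 have "integrable lborel2 (%(s, x). indicator {0..t} s * w x)"
  using integrable_tensor[OF _ w, of "indicator {0..t}"] by (simp add: integrable_indicator_iff emeasure_lborel_Icc_eq)
 hence i: "integrable lborel2 (%(s, x). indicator {0..t} s *\<^sub>R h s x)"
 proof (rule int_bound)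
  show "AE p in lborel2. norm (case p of (s, x) => indicator {0..t} s *\<^sub>R h s x) <= norm (case p of (s, x) => indicator {0..t} s * w x)"
   using order_trans[OF b abs_ge_self] by (intro AE_I2) (auto simp: indicator_def)
 qed simp
 show "(Lint x. Lint s. indicator {0..t} s *\<^sub>R h s x) = (Lint s. indicator {0..t} s *\<^sub>R (Lint x. h s x))"
  using lborel_pair.Fubini_integral[OF i] by simp
 show "L1 (%x. Lint s. indicator {0..t} s *\<^sub>R h s x)"
  using lborel_pair.integrable_snd[OF i] by simp
qed

section \<open>The transform of the Burgers solution\<close>

lemma gauss_deriv:
 "((%y. gauss 1 (x - y)) has_real_derivative (x - y) * gauss 1 (x - y)) (at y)"
 unfolding gauss_def by (rule derivative_eq_intros refl | simp add: field_simps)+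

lemma abs_gauss_le: "\<bar>v\<bar> * gauss 1 v <= gauss (1/2) v"
proof -
 \<comment> \<open>The coefficient \<open>3/8\<close> is the gap between the exponent coefficients
   \<open>1/2\<close> of \<open>gauss 1\<close> and \<open>1/8\<close> of
   \<open>gauss (1/2)\<close>. Centring the square at \<open>4/3\<close> leaves the constant term
   \<open>2/3\<close>, which is below 1.\<close>
 have "0 <= (3/8) * (\<bar>v\<bar> - 4/3)^2" by simp
 hence "\<bar>v\<bar> <= 1 + 3/8 * v^2" by (simp add: power2_eq_square algebra_simps)
 also have "... <= exp (3/8 * v^2)" by (rule exp_ge_add_one_self)
 finally have "\<bar>v\<bar> * gauss 1 v <= exp (3/8 * v^2) * gauss 1 v" by (rule mult_right_mono) simp
 also have "... = gauss (1/2) v" by (simp add: gauss_def power2_eq_square flip: exp_add)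
 finally show ?thesis .
qed

lemma abs_gauss_le_1: "\<bar>v\<bar> * gauss 1 v <= 1"
 using order_trans[OF abs_gauss_le gauss_le_1] .

lemma integrable_id_gauss: "L1 (%v. v * gauss 1 v)"
 by (rule int_bound[OF integrable_gauss[of "1/2"]]) (use abs_gauss_le in \<open>simp_all add: abs_mult\<close>)

lemma L2_shift_gauss: "L2 (%y. gauss 1 (x - y))"
 using L2_shift(1)[OF L2_gauss[OF zero_less_one], of x] unfolding L2_def by simp

lemma gauss_deriv_ift:
 "of_real ((x - y) * gauss 1 (x - y)) = - ift (%v. \<i> * (of_real v * (of_real (gauss 1 v) * cis (x * v)))) (- y)"
proof -
 let ?G = "%v. cor (gauss 1 v) * cis (x * v)"
 have G: "L1 ?G" using integrable_mult_cis'[OF integrable_of_real[OF integrable_gauss[of 1]]] by simp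
 have j: "of_real (gauss 1 (x + z)) = ift ?G z" for z using ift_gauss_shift[of 1 x z] by simp
 have "L1 (%v. of_real v * ?G v)"
  using integrable_mult_cis'[OF integrable_of_real[OF integrable_id_gauss]] by (simp add: mult.assoc)
 from has_real_derivative_ift[OF G this j]
 have "((%z. gauss 1 (x + z)) has_real_derivative Re (ift (%v. \<i> * (of_real v * ?G v)) (- y))) (at (- y))" .
 moreover have "((%z. gauss 1 (x + z)) has_real_derivative - ((x - y) * gauss 1 (x - y))) (at (- y))"
  unfolding gauss_def by (rule derivative_eq_intros refl | simp add: field_simps)+
 ultimately have "Re (ift (%v. \<i> * (of_real v * ?G v)) (- y)) = - ((x - y) * gauss 1 (x - y))" by (rule DERIV_unique)
 moreover have "ift (%v. \<i> * (of_real v * ?G v)) (- y) = of_real (Re (ift (%v. \<i> * (of_real v * ?G v)) (- y)))"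
  by (rule ift_hermitian_real) (simp add: cis_cnj)
 ultimately show ?thesis by (metis of_real_minus minus_minus)
qed

text \<open>The time before breaking: \<open>1 + t * u1 x\<close> is affine in \<open>t\<close>,
  equals 1 at time 0 and is at least \<open>\<delta>\<close> at time \<open>T\<close>, hence at
  least \<open>\<delta>\<close> in between because \<open>\<delta> <= 1\<close>.\<close>

locale smooth_burgers =
 fixes u0 u1 u2 :: "real => real" and M T \<delta> :: real and a :: "real => complex"
 assumes d0: "!!x. (u0 has_real_derivative u1 x) (at x)" and d1: "!!x. (u1 has_real_derivative u2 x) (at x)"
  and c2: "continuous_on UNIV u2" and L: "L2 u0" "L2 u1" "L2 u2"
  and M: "!!x. \<bar>u0 x\<bar> <= M" "!!x. \<bar>u1 x\<bar> <= M" and T: "0 <= T" and \<delta>: "0 < \<delta>" "\<delta> <= 1" "!!x. \<delta> <= 1 + T * u1 x"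
  and a: "is_fourier_transform u0 a" "herm a"
begin

definition X where "X t x = x + t * u0 x"
definition J where "J t x = 1 + t * u1 x"

lemma M_nonneg: "0 <= M" using M(1)[of 0] by simp
lemma c0: "continuous_on UNIV u0" and c1: "continuous_on UNIV u1"
 using d0 d1 by (auto intro: DERIV_isCont continuous_at_imp_continuous_on)

lemma u_measurable[measurable]: "u0 : Borel" "u1 : Borel" "u2 : Borel"
 by (intro borel_measurable_continuous_onI c0 c1 c2)+

lemma XJ_measurable[measurable]: "(%(t, x). X t x) : Borel2" "(%(t, x). J t x) : Borel2"
 unfolding X_def J_def by measurable

lemma J_bound: assumes t: "t : {0..T}" shows "J t x <= 1 + T * M" "\<bar>J t x\<bar> <= 1 + T * M" "\<delta> <= J t x"
proof -
 have "\<bar>t * u1 x\<bar> <= T * M"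
  unfolding abs_mult using t M(2)[of x] M_nonneg by (intro mult_mono) auto
 thus "J t x <= 1 + T * M" "\<bar>J t x\<bar> <= 1 + T * M" unfolding J_def by auto
 show "\<delta> <= J t x"
 proof (cases "0 <= u1 x")
  case True
  hence "0 <= t * u1 x" using t by simp
  thus ?thesis unfolding J_def using \<delta>(2) by linarith
 next
  case False
  hence "T * u1 x <= t * u1 x" using t by (intro mult_right_mono_neg) auto
  thus ?thesis unfolding J_def using \<delta>(3)[of x] by linarith
 qed
qed

lemma diffeo: assumes t: "t : {0..T}" shows "diffeomorphism (X t) (J t) \<delta> (T * M)"
proof
 show "(X t has_real_derivative J t x) (at x)" for x unfolding X_def[abs_def] J_def by (auto intro!: derivative_eq_intros d0)
 show "continuous_on UNIV (J t)" unfolding J_def[abs_def] by (intro continuous_intros c1)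
 show "\<bar>X t x - x\<bar> <= T * M" for x unfolding X_def using t M(1)[of x] M_nonneg by (auto simp: abs_mult intro: mult_mono)
qed (use \<delta> J_bound t in auto)

definition Y where "Y t = diffeomorphism.Y (X t)"
text \<open>The solution by characteristics: its value at \<open>X t x\<close> is
  \<open>u0 x\<close>.\<close>

definition W where "W t x = u0 (Y t x)"

text \<open>The transform of the square of \<open>W t\<close>, see \<open>q_eq\<close>, written in
  the coordinate that moves with the characteristics. In this form the dependence on
  \<open>t\<close> is explicit, and measurability, continuity and bounds are immediate.\<close>

definition q where "q t v = of_real (1 / sqrt (2 * pi)) * (Lint x. of_real ((u0 x)^2 * J t x) * cis (- (v * X t x)))"

definition f where "f t v = - (\<i> * of_real (v / 2) * q t v)"
text \<open>Taking the time integral as definition gives \<open>g\<close> the time derivative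
  \<open>f\<close> at every frequency by construction, and bounds its distance from \<open>a\<close>
  by a multiple of \<open>\<bar>v\<bar>\<close>. That \<open>g t\<close> is the transform of
  \<open>W t\<close> is shown in \<open>g_props\<close>.\<close>

definition g where "g t v = a v + (Lint s. indicator {0..t} s *\<^sub>R f s v)"

lemma sq_int: "L1 (%x. (u0 x)^2)" "L1 (%x. \<bar>u0 x * u1 x\<bar>)"
 using L2_integrable[OF L(1)] L2_mult_integrable(1)[OF L(1,2)] by auto

lemma a_L2: "L2 a" and a_measurable[measurable]: "a : Borel"
 using is_fourier_transformD(1)[OF a(1) L(1)] L2_measurable by blast+

definition cq where "cq = (Lint x. (1 + T * M) * (u0 x)^2)"

lemma cq_nonneg: "0 <= cq" unfolding cq_def using T M_nonneg by (intro Bochner_Integration.integral_nonneg) simp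

lemma q_integrand_bound: assumes t: "t : {0..T}"
 shows "cmod (of_real ((u0 x)^2 * J t x) * cis y) <= (1 + T * M) * (u0 x)^2"
proof -
 have "cmod (of_real ((u0 x)^2 * J t x) * cis y) = \<bar>J t x\<bar> * (u0 x)^2"
  by (simp only: norm_mult norm_cis norm_of_real abs_mult abs_power2 mult_1_right mult.commute)
 thus ?thesis using mult_right_mono[OF J_bound(2)[OF t, of x], of "(u0 x)^2"] by simp
qed

lemma q_bound: assumes t: "t : {0..T}" shows "cmod (q t v) <= cq"
proof -
 have "norm (Lint x. of_real ((u0 x)^2 * J t x) * cis (- (v * X t x))) <= cq"
  unfolding cq_def
 proof (rule Bochner_Integration.integral_norm_bound_integral)
  show "cmod (of_real ((u0 x)^2 * J t x) * cis (- (v * X t x))) <= (1 + T * M) * (u0 x)^2" for x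
   by (rule q_integrand_bound[OF t])
  thus "L1 (%x. of_real ((u0 x)^2 * J t x) * cis (- (v * X t x)))"
   by (intro int_bound[OF integrable_mult_right[OF sq_int(1), of "1 + T * M"]])
    (auto simp: J_def X_def intro: order_trans[OF _ abs_ge_self])
 qed (use sq_int in simp)
 moreover have "1 / sqrt (2 * pi) <= 1" using pi_gt3 by (simp add: real_le_rsqrt)
 ultimately have "1 / sqrt (2 * pi) * cmod (Lint x. of_real ((u0 x)^2 * J t x) * cis (- (v * X t x))) <= 1 * cq"
  by (intro mult_mono) auto
 thus ?thesis by (simp add: q_def norm_mult norm_divide)
qed

lemma q_measurable[measurable]: "(%(t, v). q t v) : Borel2"
 unfolding q_def by (simp only: case_prod_beta') measurable

lemma f_measurable[measurable]: "(%(t, v). f t v) : Borel2"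
 unfolding f_def by (simp only: case_prod_beta') measurable

lemma f_bound: assumes t: "t : {0..T}" shows "cmod (f t v) <= \<bar>v\<bar> * cq"
 using mult_mono[OF _ q_bound[OF t, of v], of "\<bar>v\<bar> / 2" "\<bar>v\<bar>"] by (simp add: f_def norm_mult)

lemma f_continuous: "continuous_on {0..T} (%t. f t v)"
 unfolding continuous_on_sequentially comp_def
proof (intro allI ballI impI)
 fix r t assume t: "t : {0..T}" and r: "(ALL n. r n : {0..T}) & r \<longlonglongrightarrow> t"
 have "(%n. Lint x. of_real ((u0 x)^2 * J (r n) x) * cis (- (v * X (r n) x))) \<longlonglongrightarrow> (Lint x. of_real ((u0 x)^2 * J t x) * cis (- (v * X t x)))"
 proof (rule integral_dominated_convergence[where w="%x. (1 + T * M) * (u0 x)^2"])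
  show "AE x in lborel. cmod (of_real ((u0 x)^2 * J (r n) x) * cis (- (v * X (r n) x))) <= (1 + T * M) * (u0 x)^2" for n
   by (intro AE_I2 q_integrand_bound) (use r in blast)
  have "isCont cis z" for z unfolding cis_conv_exp[abs_def] by (intro continuous_intros)
  thus "AE x in lborel. (%n. of_real ((u0 x)^2 * J (r n) x) * cis (- (v * X (r n) x))) \<longlonglongrightarrow> of_real ((u0 x)^2 * J t x) * cis (- (v * X t x))"
   unfolding J_def X_def using r by (intro AE_I2 tendsto_intros isCont_tendsto_compose[where g=cis]) auto
 qed (use sq_int(1) in \<open>simp_all add: J_def X_def\<close>)
 thus "(%n. f (r n) v) \<longlonglongrightarrow> f t v" unfolding f_def q_def by (intro tendsto_intros)
qed

lemma flow: "flow T g f"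
 unfolding flow_def
proof (intro conjI allI ballI f_continuous f_measurable)
 have "(%(t, v). a v + (Lint s. (if 0 <= s & s <= t then f s v else 0))) : Borel2"
  by (simp only: case_prod_beta') measurable
 moreover have "indicator {0..t} s *\<^sub>R f s v = (if 0 <= s & s <= t then f s v else 0)" for t s v by simp
 ultimately show "(%(t, v). g t v) : Borel2" unfolding g_def by simp
 fix v t assume t: "t : {0..T}"
 have "((%t. a v + integral {0..t} (%s. f s v)) has_vector_derivative f t v) (at t within {0..T})"
  using integral_has_vector_derivative[OF f_continuous t] by (auto intro!: derivative_eq_intros)
 thus "((%t. g t v) has_vector_derivative f t v) (at t within {0..T})"
 proof (rule has_vector_derivative_transform[OF t, rotated])
  fix r assume "r : {0..T}"
  hence "set_integrable lborel {0..r} (%s. f s v)"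
   by (intro borel_integrable_atLeastAtMost' continuous_on_subset[OF f_continuous]) auto
  from set_borel_integral_eq_integral(2)[OF this] show "g r v = a v + integral {0..r} (%s. f s v)"
   unfolding g_def set_lebesgue_integral_def by simp
 qed
qed

lemma g_bound: assumes t: "t : {0..T}" shows "cmod (g t v) <= cmod (a v) + T * cq * \<bar>v\<bar>"
proof -
 have "norm (Lint s. indicator {0..t} s *\<^sub>R f s v) <= (Lint s. indicator {0..t} s * (\<bar>v\<bar> * cq))"
 proof (rule Bochner_Integration.integral_norm_bound_integral)
  show i: "L1 (%s. indicator {0..t} s * (\<bar>v\<bar> * cq))"
   by (intro integrable_mult_left) (simp add: integrable_indicator_iff emeasure_lborel_Icc_eq)
  show b: "cmod (indicator {0..t} s *\<^sub>R f s v) <= indicator {0..t} s * (\<bar>v\<bar> * cq)" for s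
   using t f_bound[of s v] by (simp add: indicator_def)
  show "L1 (%s. indicator {0..t} s *\<^sub>R f s v)"
   by (rule int_bound[OF i], measurable) (rule AE_I2, use order_trans[OF b abs_ge_self] in simp)
 qed
 also have "... = t * (\<bar>v\<bar> * cq)" using t by simp
 also have "... <= T * (\<bar>v\<bar> * cq)" using t cq_nonneg by (intro mult_right_mono) auto
 finally show ?thesis unfolding g_def by (intro order_trans[OF norm_triangle_ineq] add_left_mono) (simp add: mult_ac)
qed

lemma g_herm: "herm (g t)"
proof -
 have q: "q s (- v) = cnj (q s v)" for s v
 proof -
  have "cnj (q s v) = of_real (1 / sqrt (2 * pi)) * (Lint x. cnj (of_real ((u0 x)^2 * J s x) * cis (- (v * X s x))))"
   unfolding q_def by (simp only: complex_cnj_mult complex_cnj_complex_of_real Bochner_Integration.integral_cnj[symmetric])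
  thus ?thesis by (simp add: q_def cis_cnj)
 qed
 have "f s (- v) = cnj (f s v)" for s v unfolding f_def q by simp
 hence "(Lint s. indicator {0..t} s *\<^sub>R f s (- v)) = cnj (Lint s. indicator {0..t} s *\<^sub>R f s v)" for v
  unfolding Bochner_Integration.integral_cnj[symmetric] by simp
 thus ?thesis using a(2) unfolding herm_def g_def by simp
qed

context
 fixes t assumes t: "t : {0..T}"
begin

interpretation D: diffeomorphism "X t" "J t" \<delta> "T * M" by (rule diffeo[OF t])

lemma Y_eq: "Y t = D.Y" unfolding Y_def ..

lemma W_measurable[measurable]: "W t : Borel"
 unfolding W_def[abs_def] Y_eq by measurable

lemma W_L2: "L2 (W t)" "L2_norm (W t) <= sqrt (1 + T * M) * L2_norm u0"
 using D.L2_compose_Y[OF L(1) J_bound(1)[OF t]] unfolding W_def[abs_def] Y_eq by auto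

lemma q_eq: "q t v = ift (%x. of_real ((W t x)^2)) (- v)"
proof -
 have "(Lint x. of_real ((W t x)^2) * cis ((- v) * x)) = (Lint x. J t x *\<^sub>R (of_real ((W t (X t x))^2) * cis ((- v) * X t x)))"
  by (rule D.change_of_variables(2)) simp
 also have "... = (Lint x. of_real ((u0 x)^2 * J t x) * cis (- (v * X t x)))"
  by (intro int_cong refl) (simp add: W_def Y_eq scaleR_conv_of_real)
 finally show ?thesis unfolding q_def ift_def by simp
qed

lemma W_pairing:
 "(Lint y. of_real (W t y) * of_real (gauss 1 (x - y))) = cor (Lint y. J t y * (u0 y * gauss 1 (x - X t y)))"
proof -
 have "(Lint y. W t y * gauss 1 (x - y)) = (Lint y. J t y *\<^sub>R (W t (X t y) * gauss 1 (x - X t y)))"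
  by (rule D.change_of_variables(2)) simp
 thus ?thesis by (simp add: W_def Y_eq flip: of_real_mult)
qed

text \<open>The derivative of the Gaussian is itself an inverse transform, so the multiplication
  formula carries the pairing with the square of \<open>W t\<close> over to frequencies, where the
  factor \<open>v\<close> of \<open>f\<close> appears.\<close>

lemma q_pairing:
 "cor (Lint y. (u0 y)^2 * J t y * ((x - X t y) * gauss 1 (x - X t y)))
 = 2 * (Lint v. f t v * (of_real (gauss 1 v) * cis (x * v)))"
proof -
 let ?k = "%v. \<i> * (of_real v * (of_real (gauss 1 v) * cis (x * v)))"
 have k: "L1 ?k"
  using integrable_mult_cis'[OF integrable_of_real[OF integrable_id_gauss]] by (simp add: mult.assoc)
 have W2: "L1 (%y. cor ((W t y)^2))"
  using L2_integrable[OF W_L2(1)] by (simp add: integrable_of_real del: of_real_power)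
 have "(Lint y. (W t y)^2 * ((x - y) * gauss 1 (x - y))) = (Lint y. J t y *\<^sub>R ((W t (X t y))^2 * ((x - X t y) * gauss 1 (x - X t y))))"
  by (rule D.change_of_variables(2)) simp
 hence "(Lint y. (u0 y)^2 * J t y * ((x - X t y) * gauss 1 (x - X t y))) = (Lint y. (W t y)^2 * ((x - y) * gauss 1 (x - y)))"
  by (simp add: W_def Y_eq mult_ac)
 hence "cor (Lint y. (u0 y)^2 * J t y * ((x - X t y) * gauss 1 (x - X t y)))
  = (Lint y. of_real ((W t y)^2) * of_real ((x - y) * gauss 1 (x - y)))"
  by (simp only: flip: of_real_mult integral_complex_of_real)
 also have "... = - (Lint y. of_real ((W t y)^2) * ift ?k (- y))"
  unfolding gauss_deriv_ift by simp
 also have "(Lint y. of_real ((W t y)^2) * ift ?k (- y)) = (Lint y. ift ?k y * of_real ((W t (- y))^2))"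
  using lborel_integral_reflect[of "%y. of_real ((W t y)^2) * ift ?k (- y)"] by (simp add: mult.commute)
 also have "... = (Lint v. ?k v * ift (%y. of_real ((W t (- y))^2)) v)"
  using W2 lborel_integrable_reflect[of "%y. cor ((W t y)^2)"] by (intro ift_mult_formula[OF k]) simp
 also have "... = (Lint v. - 2 * (f t v * (of_real (gauss 1 v) * cis (x * v))))"
  using ift_reflect[of "%y. cor ((W t y)^2)"] by (simp add: f_def q_eq mult_ac)
 finally show ?thesis by simp
qed

end

text \<open>The \<open>y\<close>-derivative of \<open>(u0 y)^2 * gauss 1 (x - X s y)\<close>
  integrates to 0. This trades one term of the integrand for the other and produces the factor 1/2
  of the Burgers flux.\<close>

lemma transport_identity:
 assumes s: "s : {0..T}"
 shows "2 * (Lint y. (u0 y)^2 * J s y * ((x - X s y) * gauss 1 (x - X s y)) + u0 y * u1 y * gauss 1 (x - X s y))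
  = (Lint y. (u0 y)^2 * J s y * ((x - X s y) * gauss 1 (x - X s y)))"
  and "L1 (%y. (u0 y)^2 * J s y * ((x - X s y) * gauss 1 (x - X s y)))" "L1 (%y. u0 y * u1 y * gauss 1 (x - X s y))"
  and "\<bar>(u0 y)^2 * J s y * ((x - X s y) * gauss 1 (x - X s y)) + u0 y * u1 y * gauss 1 (x - X s y)\<bar> <= (1 + T * M) * (u0 y)^2 + \<bar>u0 y * u1 y\<bar>"
proof -
 let ?p = "%y. (u0 y)^2 * J s y * ((x - X s y) * gauss 1 (x - X s y))" and ?r = "%y. u0 y * u1 y * gauss 1 (x - X s y)"
 note [measurable] = XJ_measurable
 have p: "\<bar>?p y\<bar> <= (1 + T * M) * (u0 y)^2" for y
 proof -
  have "\<bar>?p y\<bar> = (u0 y)^2 * \<bar>J s y\<bar> * (\<bar>x - X s y\<bar> * gauss 1 (x - X s y))" by (simp add: abs_mult)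
  also have "... <= (u0 y)^2 * (1 + T * M) * 1"
   using abs_gauss_le_1 J_bound(2)[OF s] T M_nonneg by (intro mult_mono) auto
  finally show ?thesis by (simp add: mult.commute)
 qed
 have r: "\<bar>?r y\<bar> <= \<bar>u0 y * u1 y\<bar>" for y
  using mult_left_mono[OF gauss_le_1[of 1 "x - X s y"], of "\<bar>u0 y * u1 y\<bar>"] by (simp add: abs_mult)
 show "\<bar>?p y + ?r y\<bar> <= (1 + T * M) * (u0 y)^2 + \<bar>u0 y * u1 y\<bar>" using p[of y] r[of y] by linarith
 show ip: "L1 ?p"
  by (rule int_bound[OF integrable_mult_right[OF sq_int(1), of "1 + T * M"]], measurable)
   (rule AE_I2, simp only: real_norm_def, rule order_trans[OF p abs_ge_self])
 show ir: "L1 ?r"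
  by (rule int_bound[OF sq_int(2)]) (use r in \<open>auto simp: X_def\<close>)
 let ?F = "%y. cor ((u0 y)^2 * gauss 1 (x - X s y))"
 have "((%y. (u0 y)^2 * gauss 1 (x - X s y)) has_real_derivative ?p y + 2 * ?r y) (at y)" for y
 proof -
  have dX: "(X s has_real_derivative J s y) (at y)" unfolding X_def[abs_def] J_def by (auto intro!: derivative_eq_intros d0)
  show ?thesis
   by (rule DERIV_cong[OF DERIV_mult[OF DERIV_power[OF d0, of 2] DERIV_chain2[OF gauss_deriv dX]]]) (simp add: algebra_simps power2_eq_square)
 qed
 hence "(?F has_vector_derivative of_real (?p y + 2 * ?r y)) (at y)" for y
  by (rule has_vector_derivative_of_real)
 moreover have "continuous_on UNIV (%y. cor (?p y + 2 * ?r y))"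
  unfolding J_def X_def gauss_def by (intro continuous_intros c0 c1) auto
 moreover have "L1 ?F"
  by (rule int_bound[OF sq_int(1)]) (auto simp: X_def norm_mult norm_power intro!: mult_left_le)
 moreover have ic: "L1 (%y. cor (?p y + 2 * ?r y))"
  using ip ir by (intro integrable_of_real int_add integrable_mult_right)
 ultimately have "(Lint y. cor (?p y + 2 * ?r y)) = 0" by (rule integral_of_derivative)
 hence "(Lint y. ?p y + 2 * ?r y) = 0" unfolding integral_complex_of_real by simp
 thus "2 * (Lint y. ?p y + ?r y) = (Lint y. ?p y)" using ip ir by simp
qed

text \<open>The weak form of Burgers' equation tested with Gaussians. Pulled back along the
  characteristics, the pairing of \<open>W\<close> has at each fixed \<open>y\<close> an explicit
  time derivative; \<open>transport_identity\<close> and \<open>q_pairing\<close> recognize its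
  integral as the pairing of \<open>f\<close>.\<close>

lemma g_pairing:
 assumes t: "t : {0..T}"
 shows "(Lint v. g t v * (of_real (gauss 1 v) * cis (x * v))) = (Lint y. of_real (W t y) * of_real (gauss 1 (x - y)))"
  and "L1 (%v. g t v * (of_real (gauss 1 v) * cis (x * v)))"
proof -
 let ?G = "%v. cor (gauss 1 v) * cis (x * v)"
 let ?\<psi> = "%s y. (u0 y)^2 * J s y * ((x - X s y) * gauss 1 (x - X s y)) + u0 y * u1 y * gauss 1 (x - X s y)"
 note [measurable] = XJ_measurable
 have st: "s : {0..t} ==> s : {0..T}" for s using t by auto
 have z: "0 : {0..T}" using T by simp
 have iG: "L1 (%v. a v * ?G v)"
  using L2_mult_integrable(1)[OF a_L2 L2_gauss[OF zero_less_one]] integrable_mult_cis' by (simp add: mult.assoc[symmetric])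
 have mf: "(%(s, v). f s v * ?G v) : Borel2" by (simp only: case_prod_beta') measurable
 have bf: "norm (f s v * ?G v) <= norm (cq * (v * gauss 1 v))" if "s : {0..t}" for s v
  using mult_right_mono[OF f_bound[OF st[OF that], of v], of "gauss 1 v"] cq_nonneg by (simp add: norm_mult abs_mult mult_ac)
 have wf: "L1 (%v. norm (cq * (v * gauss 1 v)))" using integrable_id_gauss by (intro integrable_norm integrable_mult_right)
 note Ff = Fubini_time[OF mf wf bf]
 have m\<psi>: "(%(s, y). ?\<psi> s y) : Borel2" by (simp only: case_prod_beta') measurable
 have w\<psi>: "L1 (%y. (1 + T * M) * (u0 y)^2 + \<bar>u0 y * u1 y\<bar>)" using sq_int by simp
 have b\<psi>: "norm (?\<psi> s y) <= (1 + T * M) * (u0 y)^2 + \<bar>u0 y * u1 y\<bar>" if "s : {0..t}" for s y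
  using transport_identity(4)[OF st[OF that]] by simp
 note F\<psi> = Fubini_time[OF m\<psi> w\<psi> b\<psi>]
 have ftc: "J t y * (u0 y * gauss 1 (x - X t y)) = u0 y * gauss 1 (x - y) + (Lint s. indicator {0..t} s *\<^sub>R ?\<psi> s y)" for y
 proof -
  have "(Lint s. indicator {0..t} s *\<^sub>R ?\<psi> s y) = J t y * (u0 y * gauss 1 (x - X t y)) - J 0 y * (u0 y * gauss 1 (x - X 0 y))"
  proof (rule integral_FTC_atLeastAtMost)
   show "((%s. J s y * (u0 y * gauss 1 (x - X s y))) has_vector_derivative ?\<psi> s y) (at s within {0..t})" for s
   proof -
    have dX: "((%s. X s y) has_real_derivative u0 y) (at s)" and dJ: "((%s. J s y) has_real_derivative u1 y) (at s)"
     unfolding X_def J_def by (auto intro!: derivative_eq_intros)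
    have "((%s. J s y * (u0 y * gauss 1 (x - X s y))) has_real_derivative ?\<psi> s y) (at s)"
     by (rule DERIV_cong[OF DERIV_mult[OF dJ DERIV_cmult[OF DERIV_chain2[OF gauss_deriv dX]]]]) (simp add: algebra_simps power2_eq_square)
    thus ?thesis unfolding has_real_derivative_iff_has_vector_derivative by (rule has_vector_derivative_at_within)
   qed
   show "continuous_on {0..t} (%s. ?\<psi> s y)" unfolding J_def X_def gauss_def by (intro continuous_intros) auto
  qed (use t in simp)
  thus ?thesis by (simp add: J_def X_def)
 qed
 have i0: "L1 (%y. u0 y * gauss 1 (x - y))"
  by (rule L2_mult_integrable(1)[OF L(1) L2_shift_gauss])
 have "(Lint y. J t y * (u0 y * gauss 1 (x - X t y))) = (Lint y. u0 y * gauss 1 (x - y)) + (Lint s. indicator {0..t} s *\<^sub>R (Lint y. ?\<psi> s y))"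
  unfolding ftc using i0 F\<psi> by simp
 hence "cor (Lint y. J t y * (u0 y * gauss 1 (x - X t y))) =
  of_real (Lint y. u0 y * gauss 1 (x - y)) + (Lint s. of_real (indicator {0..t} s *\<^sub>R (Lint y. ?\<psi> s y)))"
  unfolding integral_complex_of_real by (simp only: of_real_add)
 also have "(Lint s. cor (indicator {0..t} s *\<^sub>R (Lint y. ?\<psi> s y))) = (Lint s. indicator {0..t} s *\<^sub>R (Lint v. f s v * ?G v))"
 proof (intro int_cong refl)
  fix s
  show "cor (indicator {0..t} s *\<^sub>R (Lint y. ?\<psi> s y)) = indicator {0..t} s *\<^sub>R (Lint v. f s v * ?G v)"
  proof (cases "s : {0..t}")
   case True
   have "2 * cor (Lint y. ?\<psi> s y) = 2 * (Lint v. f s v * ?G v)"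
    unfolding q_pairing[OF st[OF True], symmetric] transport_identity(1)[OF st[OF True], symmetric] by simp
   hence "cor (Lint y. ?\<psi> s y) = (Lint v. f s v * ?G v)" by (simp only: mult_cancel_left) simp
   thus ?thesis using True by simp
  qed simp
 qed
 also have "cor (Lint y. u0 y * gauss 1 (x - y)) = (Lint v. a v * ?G v)"
  unfolding fourier_transform_gauss_pairing[OF L(1) a(1) zero_less_one] by (simp flip: of_real_mult)
 also have "(Lint s. indicator {0..t} s *\<^sub>R (Lint v. f s v * ?G v)) = (Lint v. Lint s. indicator {0..t} s *\<^sub>R (f s v * ?G v))"
  by (rule Ff(1)[symmetric])
 also have "(Lint v. a v * ?G v) + ... = (Lint v. a v * ?G v + (Lint s. indicator {0..t} s *\<^sub>R (f s v * ?G v)))"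
  by (rule lint_add[symmetric, OF iG Ff(2)])
 also have e: "(%v. a v * ?G v + (Lint s. indicator {0..t} s *\<^sub>R (f s v * ?G v))) = (%v. g t v * ?G v)"
 proof
  fix v
  have "(Lint s. (indicator {0..t} s *\<^sub>R f s v) * ?G v) = (Lint s. indicator {0..t} s *\<^sub>R f s v) * ?G v"
   by (rule integral_mult_left_zero)
  thus "a v * ?G v + (Lint s. indicator {0..t} s *\<^sub>R (f s v * ?G v)) = g t v * ?G v"
   unfolding g_def distrib_right by simp
 qed
 finally show "(Lint v. g t v * ?G v) = (Lint y. of_real (W t y) * of_real (gauss 1 (x - y)))"
  unfolding W_pairing[OF t] by simp
 show "L1 (%v. g t v * ?G v)" unfolding e[symmetric] by (intro int_add iG Ff(2))
qed

definition cg where "cg = sqrt (1 + T * M) * L2_norm u0 + 1 / \<delta> ^ 3 * (sqrt (1 + T * M) * L2_norm u2)"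

text \<open>Gaussian pairings identify \<open>g t\<close> with the transform of \<open>W t\<close>
  almost everywhere. Differentiating \<open>W t\<close> twice through the inverse characteristic map
  gives \<open>u2\<close> over the cube of \<open>J\<close>, so the H^2 norm is bounded while
  \<open>J\<close> is at least \<open>\<delta>\<close>. The last claim holds at every frequency
  because \<open>f\<close> and \<open>burg\<close> are both defined through the square of a function
  of \<open>x\<close>, here \<open>W t\<close>.\<close>

lemma g_props:
 assumes t: "t : {0..T}"
 shows "hs 2 (g t)" "hsn 2 (g t) <= cg" "of_real (W t x) = ift (g t) x" "f t v = - burg (g t) v"
proof -
 interpret D: diffeomorphism "X t" "J t" \<delta> "T * M" by (rule diffeo[OF t])
 have [measurable]: "g t : Borel" using flow_measurable(1)[OF flow] .
 note [measurable] = W_measurable[OF t]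
 have W: "W t = (%x. u0 (D.Y x))" unfolding W_def[abs_def] Y_eq[OF t] ..
 define W1 where "W1 = (%x. u1 (D.Y x) / J t (D.Y x))"
 define W2 where "W2 = (%x. u2 (D.Y x) / J t (D.Y x) ^ 3)"
 have J: "0 < J t x" "1 / J t x <= 1 / \<delta>" for x
  using J_bound(3)[OF t, of x] \<delta>(1) by (auto intro: divide_left_mono order_less_le_trans)
 have dW: "(W t has_real_derivative W1 x) (at x)" for x
  unfolding W by (rule DERIV_cong[OF DERIV_chain2[OF d0 D.deriv_Y]]) (simp add: W1_def)
 have dW1: "(W1 has_real_derivative W2 x) (at x)" for x
 proof -
  have "((%a. u1 a / J t a) has_real_derivative u2 a / (J t a)^2) (at a)" for a
   unfolding J_def
   by (rule DERIV_cong[OF DERIV_divide[OF d1 DERIV_add[OF DERIV_const DERIV_cmult[OF d1]]]])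
    (use J(1)[of a] in \<open>auto simp: J_def algebra_simps power2_eq_square\<close>)
  from DERIV_chain2[OF this D.deriv_Y] show ?thesis
   unfolding W1_def by (rule DERIV_cong) (simp add: W2_def power2_eq_square power3_eq_cube)
 qed
 have c: "continuous_on UNIV W1" "continuous_on UNIV W2"
 proof -
  show "continuous_on UNIV W1" using dW1 by (auto intro: DERIV_isCont continuous_at_imp_continuous_on)
  have cY: "continuous_on UNIV D.Y" using D.isCont_Y by (simp add: continuous_at_imp_continuous_on)
  have "D.Y x : UNIV" for x by simp
  show "continuous_on UNIV W2"
   unfolding W2_def using J(1) by (intro continuous_on_divide continuous_on_power continuous_on_compose2[OF c2 cY] continuous_on_compose2[OF D.Jc cY]) (auto simp: less_imp_neq[symmetric])
 qed
 note [measurable] = borel_measurable_continuous_onI[OF c(1)] borel_measurable_continuous_onI[OF c(2)]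
 have b1: "norm (W1 x) <= 1 / \<delta> * norm (u1 (D.Y x))" for x
  using mult_right_mono[OF J(2)[of "D.Y x"], of "\<bar>u1 (D.Y x)\<bar>"] J(1)[of "D.Y x"] by (simp add: W1_def abs_mult)
 have b2: "norm (W2 x) <= 1 / \<delta> ^ 3 * norm (u2 (D.Y x))" for x
  using mult_right_mono[OF power_mono[OF J(2)[of "D.Y x"], of 3], of "\<bar>u2 (D.Y x)\<bar>"] J(1)[of "D.Y x"]
  by (simp add: W2_def abs_mult power_one_over power_abs)
 note Lu1 = D.L2_compose_Y[OF L(2) J_bound(1)[OF t]] and Lu2 = D.L2_compose_Y[OF L(3) J_bound(1)[OF t]]
 have L1: "L2 W1" by (rule L2_bound[OF Lu1(1) _ b1]) simp
 have L2': "L2 W2" by (rule L2_bound[OF Lu2(1) _ b2]) simp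
 have n2: "L2_norm W2 <= 1 / \<delta> ^ 3 * (sqrt (1 + T * M) * L2_norm u2)"
 proof -
  have "L2_norm W2 <= L2_norm (%x. 1 / \<delta> ^ 3 * u2 (D.Y x))"
   by (rule L2_norm_mono[OF L2_cmult[OF Lu2(1)]]) (use b2 \<delta>(1) in \<open>simp add: abs_mult\<close>)
  also have "... <= 1 / \<delta> ^ 3 * (sqrt (1 + T * M) * L2_norm u2)"
   unfolding L2_norm_cmult using mult_left_mono[OF Lu2(2), of "1 / \<delta> ^ 3"] \<delta>(1) by simp
  finally show ?thesis .
 qed
 obtain h h1 h2 where h: "is_fourier_transform (W t) h" "is_fourier_transform W1 h1" "is_fourier_transform W2 h2"
  using fourier_transform_exists W_L2(1)[OF t] L1 L2' by metis
 note hL = is_fourier_transformD(1)[OF h(1) W_L2(1)[OF t]] is_fourier_transformD(1)[OF h(3) L2']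
 note [measurable] = L2_measurable[OF hL(1)] L2_measurable[OF hL(2)]
 have hh: "L1 (%v. h v * (of_real (gauss 1 v) * cis (x * v)))" for x
  using L2_mult_integrable(1)[OF hL(1) L2_gauss[OF zero_less_one]] integrable_mult_cis' by (simp add: mult.assoc[symmetric])
 have "AE v in lborel. (h v - g t v) * of_real (gauss 1 v) = 0"
 proof (rule ift_injective)
  show "L1 (%v. (h v - g t v) * of_real (gauss 1 v))"
   using int_diff[OF hh[of 0] g_pairing(2)[OF t, of 0]] by (simp add: left_diff_distrib)
  fix x
  have "(Lint v. (h v - g t v) * of_real (gauss 1 v) * cis (x * v)) =
   (Lint v. h v * (of_real (gauss 1 v) * cis (x * v)) - g t v * (of_real (gauss 1 v) * cis (x * v)))"
   by (simp add: left_diff_distrib mult.assoc)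
  also have "... = 0"
   unfolding lint_diff[OF hh g_pairing(2)[OF t]] g_pairing(1)[OF t]
    fourier_transform_gauss_pairing[OF W_L2(1)[OF t] h(1) zero_less_one] by simp
  finally show "ift (%v. (h v - g t v) * of_real (gauss 1 v)) x = 0" unfolding ift_def by simp
 qed
 hence hg: "AE v in lborel. h v = g t v" by eventually_elim (use gauss_pos[of 1] less_imp_neq in fastforce)
 have e1: "AE v in lborel. h1 v = \<i> * of_real v * h v"
  by (rule fourier_transform_derivative[OF dW c(1) W_L2(1)[OF t] L1 h(1,2)])
 have e2: "AE v in lborel. h2 v = \<i> * of_real v * h1 v"
  by (rule fourier_transform_derivative[OF dW1 c(2) L1 L2' h(2,3)])
 \<comment> \<open>On the transform side, subtracting the second derivative is multiplication by
   \<open>1 + v^2\<close>, the weight of H^2.\<close>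
 have ae: "AE v in lborel. h v - h2 v = of_real (jp 2 v) * g t v"
  using hg e1 e2 by eventually_elim (simp add: jp_2 algebra_simps power2_eq_square)
 have Ld: "L2 (%v. h v - h2 v)" by (intro L2_diff hL)
 show H: "hs 2 (g t)" unfolding hs_def by (rule L2_cong_AE[OF Ld _ ae]) simp
 have "hsn 2 (g t) = L2_norm (%v. h v - h2 v)" unfolding hsn_def by (rule L2_norm_cong_AE[symmetric, OF _ _ ae]) simp_all
 also have "... <= L2_norm h + L2_norm h2" using L2_norm_triangle[OF hL(1) L2_uminus[OF hL(2)]] by (simp add: L2_norm_uminus)
 also have "... <= cg" unfolding cg_def
  by (intro add_mono order_trans[OF Bessel[OF _ h(1)]] order_trans[OF Bessel[OF _ h(3)]] W_L2[OF t] L2' n2)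
 finally show "hsn 2 (g t) <= cg" .
 have inv: "of_real (W t x) = ift (g t) x" for x
  using is_fourier_transform_cong_AE[OF W_L2(1)[OF t] h(1) _ hg] hs_integrable(1)[OF H] DERIV_isCont[OF dW]
  by (intro Fourier_inversion[OF W_L2(1)[OF t]]) auto
 thus "of_real (W t x) = ift (g t) x" .
 show "f t v = - burg (g t) v"
  unfolding f_def burg_def prod_ft_def q_eq[OF t] inv[symmetric] by (simp add: power2_eq_square)
qed

end

lemma burgers_flow:
 fixes u0 u1 u2 :: "real => real"
 assumes d: "!!x. (u0 has_real_derivative u1 x) (at x)" "!!x. (u1 has_real_derivative u2 x) (at x)"
  and c: "continuous_on UNIV u2" and L: "L2 u0" "L2 u1" "L2 u2"
  and M: "!!x. \<bar>u0 x\<bar> <= M" "!!x. \<bar>u1 x\<bar> <= M" and T: "0 <= T" and \<delta>: "0 < \<delta>" "!!x. \<delta> <= 1 + T * u1 x"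
  and a: "is_fourier_transform u0 a" "herm a"
 obtains g f C where "flow T g f" "g 0 = a" "0 <= C"
  "!!t. t : {0..T} ==> herm (g t) & hs 2 (g t) & hsn 2 (g t) <= C"
  "!!t v. t : {0..T} ==> f t v = - burg (g t) v" "!!t v. t : {0..T} ==> cmod (g t v) <= cmod (a v) + C * \<bar>v\<bar>"
proof -
 \<comment> \<open>The locale requires a lower bound for \<open>J\<close> that does not exceed its
   value 1 at time 0.\<close>
 interpret smooth_burgers u0 u1 u2 M T "min 1 \<delta>" a
  using assms by unfold_locales (auto simp: min_le_iff_disj)
 define C where "C = cg + T * cq"
 have C: "0 <= cg" "0 <= T * cq" using T M_nonneg \<delta>(1) cq_nonneg by (simp_all add: cg_def)
 have i0: "g 0 = a"
 proof
  fix v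
  have "AE s in lborel. indicator {0..0} s *\<^sub>R f s v = 0"
   using AE_lborel_singleton[of "0::real"] by eventually_elim simp
  hence "(Lint s. indicator {0..0} s *\<^sub>R f s v) = 0" by (rule integral_eq_zero_AE)
  thus "g 0 v = a v" unfolding g_def by simp
 qed
 show ?thesis
 proof (rule that[OF flow i0])
  show "0 <= C" using C by (simp add: C_def)
  show "herm (g t) & hs 2 (g t) & hsn 2 (g t) <= C" if "t : {0..T}" for t
   using g_herm g_props(1,2)[OF that] C by (simp add: C_def)
  show "f t v = - burg (g t) v" if "t : {0..T}" for t v by (rule g_props(4)[OF that])
  show "cmod (g t v) <= cmod (a v) + C * \<bar>v\<bar>" if "t : {0..T}" for t v
   using order_trans[OF g_bound[OF that, of v] add_left_mono[OF mult_right_mono[of "T * cq" C]]] C by (simp add: C_def)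
 qed
qed

section \<open>Existence up to times before breaking\<close>

definition cb :: real where "cb = 2 * 2 powr 2 * c1"

lemma cb_nonneg[simp]: "0 <= cb" by (simp add: cb_def)

lemma hs_burg_2:
 assumes g: "hs 2 g" "hsn 2 g <= D"
 shows "hs 1 (burg g)" "hsn 1 (burg g) <= cb * D^2" "L2 (burg g)" "L2_norm (burg g) <= cb * D^2"
proof -
 have "(hsn 2 g)^2 <= D^2" using g(2) by (intro power_mono) auto
 thus h: "hs 1 (burg g)" "hsn 1 (burg g) <= cb * D^2"
  using hs_burg[OF g(1)] mult_left_mono[of "(hsn 2 g)^2" "D^2" cb] by (simp_all add: cb_def)
 show "L2 (burg g)" "L2_norm (burg g) <= cb * D^2" using hs_L2[OF h(1)] h(2) by auto
qed

definition high :: "real => (real => complex) => real => complex" where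
 "high n h x = of_real (indicator (- {-n..n}) x) * h x"

text \<open>Above frequency \<open>n\<close> one power of the weight is worth a factor
  \<open>1 / n\<close>.\<close>

lemma L2_high:
 assumes h: "hs 1 h" "hsn 1 h <= D" and n: "0 < n"
 shows "L2 (high n h)" "L2_norm (high n h) <= D / n"
proof -
 note [measurable] = hs_measurable[OF h(1)]
 have b: "jp 0 x * cmod (high n h x) <= 1 / n * (jp 1 x * cmod (h x))" for x
 proof (cases "x : {-n..n}")
  case False
  hence "1 <= 1 / n * jp 1 x" using n abs_le_jp_1[of x] by (auto simp: field_simps)
  from mult_right_mono[OF this, of "cmod (h x)"] show ?thesis using False by (simp add: high_def norm_mult)
 qed (use n in \<open>simp add: high_def\<close>)
 have m: "high n h : Borel" unfolding high_def[abs_def] by measurable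
 have "hs 0 (high n h)" "hsn 0 (high n h) <= 1 / n * hsn 1 h" by (rule hs_bound[OF h(1) m b]; use n in simp)+
 thus "L2 (high n h)" "L2_norm (high n h) <= D / n"
  using divide_right_mono[OF h(2), of n] n by (auto simp: hs_0)
qed

text \<open>Below frequency \<open>R\<close> the moment is bounded by a multiple of the L^2 norm;
  above it, by \<open>D\<close> times the L^2 norm of the tail of \<open>jp (-1)\<close>, which is
  small for large \<open>R\<close>. First \<open>R\<close> is fixed by \<open>D\<close>, then
  \<open>\<eta>\<close> by \<open>R\<close>.\<close>

lemma interpolation:
 assumes D: "0 <= D"
 obtains \<eta> where "0 < \<eta>" "!!r. hs 2 r ==> hsn 2 r <= D ==> (L2_norm r)^2 <= \<eta> ==> (moment r) <= 1/2"
proof -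
 let ?j = "%R x. indicator (- {-R..R}) x *\<^sub>R jp (-1) x"
 have "((%R. L2_norm (?j R) * D) \<longlongrightarrow> 0 * D) at_top" by (intro tendsto_intros L2_tail_tendsto_0 L2_jp_minus_1)
 hence "\<forall>\<^sub>F R in at_top. L2_norm (?j R) * D < 1/4" by (rule order_tendstoD) simp
 then obtain R where R: "0 < R" "L2_norm (?j R) * D < 1/4"
  using eventually_happens[OF eventually_conj[OF eventually_gt_at_top[of 0]]] by force
 define k where "k = R * sqrt (2 * R)"
 have k: "0 < k" using R by (simp add: k_def)
 show ?thesis
 proof (rule that)
  show "0 < (1 / (4 * k))^2" using k by simp
  fix r assume r: "hs 2 r" "hsn 2 r <= D" "(L2_norm r)^2 <= (1 / (4 * k))^2"
  have rL: "L2 r" and rn: "L2_norm r <= 1 / (4 * k)" using hs_L2[OF r(1)] power2_le_imp_le[OF r(3)] k by auto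
  note [measurable] = L2_measurable[OF rL]
  let ?i = "%x. cor (indicator {-R..R} x)" and ?h = "%x. of_real (jp 2 x) * r x"
  have jL: "L2 (?j R)" by (rule L2_bound[OF L2_jp_minus_1, where C=1]) (auto simp: indicator_def)
  have hL: "L2 ?h" using r(1) unfolding hs_def .
  note CS1 = L2_Cauchy_Schwarz[OF L2_indicator(1)[OF less_imp_le[OF R(1)]] rL]
  note CS2 = L2_Cauchy_Schwarz[OF jL hL]
  have "(moment r) <= (Lint x. R * (norm (?i x) * norm (r x)) + norm (?j R x) * norm (?h x))"
  proof (rule integral_mono)
   show "L1 (%x. \<bar>x\<bar> * cmod (r x))"
    using integrable_norm[OF hs_integrable_1(1)[OF r(1)]] by (simp add: norm_mult)
   show "L1 (%x. R * (norm (?i x) * norm (r x)) + norm (?j R x) * norm (?h x))" using CS1(1) CS2(1) by simp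
   fix x show "\<bar>x\<bar> * cmod (r x) <= R * (norm (?i x) * norm (r x)) + norm (?j R x) * norm (?h x)"
   proof (cases "x : {-R..R}")
    case True thus ?thesis using mult_right_mono[of "\<bar>x\<bar>" R "cmod (r x)"] by (simp add: abs_le_iff)
   next
    case False
    have "\<bar>x\<bar> * cmod (r x) <= jp (-1 + 2) x * cmod (r x)" using abs_le_jp_1[of x] by (intro mult_right_mono) auto
    also have "... = jp (-1) x * (jp 2 x * cmod (r x))" by (simp only: jp_add mult.assoc)
    finally show ?thesis using False by (simp add: norm_mult)
   qed
  qed
  also have "... = R * (Lint x. norm (?i x) * norm (r x)) + (Lint x. norm (?j R x) * norm (?h x))"
   using CS1(1) CS2(1) by simp
  also have "... <= R * (sqrt (2 * R) * L2_norm r) + L2_norm (?j R) * D"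
  proof (intro add_mono mult_left_mono)
   show "(Lint x. norm (?i x) * norm (r x)) <= sqrt (2 * R) * L2_norm r"
    using CS1(2) L2_indicator(2)[OF less_imp_le[OF R(1)]] by simp
   show "(Lint x. norm (?j R x) * norm (?h x)) <= L2_norm (?j R) * D"
    using CS2(2) mult_left_mono[OF r(2), of "L2_norm (?j R)"] unfolding hsn_def by simp
  qed (use R in simp)
  also have "R * (sqrt (2 * R) * L2_norm r) <= k * (1 / (4 * k))"
   using mult_left_mono[OF rn, of k] k by (simp add: k_def mult.assoc)
  finally show "(moment r) <= 1/2" using R(2) k by simp
 qed
qed

lemma galerkinD:
 assumes "galerkin T n \<mu> a v f" "t : {0..T}"
 shows "flow T v f" "herm (v t)" "L2 (v t)" "!!x. n < \<bar>x\<bar> ==> v t x = 0"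
  "f t x = - \<i> * of_real (\<mu> x) * v t x - of_real (indicator {-n..n} x) * burg (v t) x"
  "v 0 x = of_real (indicator {-n..n} x) * a x"
 using assms unfolding galerkin_def by auto

lemma galerkin_restrict:
 assumes G: "galerkin T n \<mu> a v f" and t: "t : {0..T}" shows "galerkin t n \<mu> a v f"
proof -
 obtain c where "ALL t:{0..T}. L2_norm (v t) <= c" using G unfolding galerkin_def by blast
 hence "ALL r:{0..t}. L2_norm (v r) <= c" using t by simp
 moreover have "flow t v f" using flow_restrict[OF galerkinD(1)[OF G t]] t by simp
 ultimately show ?thesis using G t unfolding galerkin_def by (meson atLeastAtMost_iff order_trans)
qed

lemma galerkin_weight:
 assumes G: "galerkin T n \<mu> a v f" and n: "0 <= n" and \<mu>: "\<mu> : Borel" "!!x. \<bar>\<mu> x\<bar> <= B"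
  and A: "A : Borel" "weight K A" and a: "L1 (%x. A x * (cmod (a x))^2)"
  and M: "!!t. t : {0..T} ==> (moment (v t)) <= M" and t: "t : {0..T}"
 shows "(Lint x. A x * (cmod (v t x))^2) <= 2 * (Lint x. A x * (cmod (a x))^2) * exp (2 * (2 * 2 ^ K * M + 1) * T)"
proof -
 have A0: "0 <= A x" for x using A(2) by (simp add: weight_def)
 note [measurable] = A(1) flow_measurable(1)[OF galerkinD(1)[OF G t]]
 have b: "A x * (cmod (v 0 x))^2 <= A x * (cmod (a x))^2" for x
  using galerkinD(6)[OF G t, of x] A0[of x] by (auto simp: indicator_def)
 have "(Lint x. A x * (cmod (v 0 x))^2) <= (Lint x. A x * (cmod (a x))^2)"
  by (rule integral_mono[OF int_bound[OF a] a b], measurable) (use b A0 in \<open>simp add: abs_mult\<close>)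
 hence "2 * (Lint x. A x * (cmod (v 0 x))^2) * exp (2 * (2 * 2 ^ K * M + 1) * T) <= 2 * (Lint x. A x * (cmod (a x))^2) * exp (2 * (2 * 2 ^ K * M + 1) * T)"
  by simp
 thus ?thesis using galerkin_energy(1)[OF G n \<mu> A M t] by linarith
qed

lemma galerkin_hs:
 assumes G: "galerkin T n \<mu> a v f" and n: "0 <= n" and \<mu>: "\<mu> : Borel" "!!x. \<bar>\<mu> x\<bar> <= B"
  and s: "0 <= s" "2 * s <= real K" and a: "hs s a"
  and M: "!!t. t : {0..T} ==> (moment (v t)) <= M" and t: "t : {0..T}"
 shows "hs s (v t)" "(hsn s (v t))^2 <= 2 * (hsn s a)^2 * exp (2 * (2 * 2 ^ K * M + 1) * T)"
 using L2_support_hs(1)[OF galerkinD(3,4)[OF G t] n s(1)]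
  galerkin_weight[OF G n \<mu> _ weight_jp[OF s] hs_integrable_sq[OF a] M t] by (simp_all add: hsn_sq)

text \<open>Galerkin approximations and Burgers transforms both solve the full equation up to an error \<open>e\<close>.\<close>

lemma approx_solI:
 assumes fl: "flow T g f" and \<mu>: "\<mu> : Borel" "!!x. \<bar>\<mu> x\<bar> <= B"
  and g: "!!t. t : {0..T} ==> herm (g t) & hs 2 (g t) & hsn 2 (g t) <= D"
  and e: "!!t. t : {0..T} ==> L2 (e t) & L2_norm (e t) <= \<epsilon>"
  and f: "!!t x. t : {0..T} ==> f t x = - \<i> * of_real (\<mu> x) * g t x - burg (g t) x + e t x"
 shows "approx_sol T \<mu> g f e" "t : {0..T} ==> L2_norm (g t) <= D" "t : {0..T} ==> L2 (f t) & L2_norm (f t) <= B * D + cb * D^2 + \<epsilon>"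
proof -
 have gL: "L2 (g t)" "L2_norm (g t) <= D" if "t : {0..T}" for t using g[OF that] hs_L2[of 2 "g t"] by auto
 have B: "0 <= B" using \<mu>(2)[of 0] by linarith
 have fL: "L2 (f t) & L2_norm (f t) <= B * D + cb * D^2 + \<epsilon>" if t: "t : {0..T}" for t
 proof -
  note [measurable] = L2_measurable[OF gL(1)[OF t]] \<mu>(1)
  let ?m = "%x. - \<i> * of_real (\<mu> x) * g t x"
  have b: "norm (?m x) <= B * norm (g t x)" for x using mult_right_mono[OF \<mu>(2)] by (simp add: norm_mult)
  have mL: "L2 ?m" by (rule L2_bound[OF gL(1)[OF t] _ b]) simp
  have mn: "L2_norm ?m <= B * D"
  proof -
   have "L2_norm ?m <= L2_norm (%x. of_real B * g t x)" by (rule L2_norm_mono[OF L2_cmult[OF gL(1)[OF t]]]) (use b B in \<open>simp add: norm_mult\<close>)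
   also have "... <= B * D" unfolding L2_norm_cmult using B gL(2)[OF t] by (simp add: mult_left_mono)
   finally show ?thesis .
  qed
  note bb = hs_burg_2(3,4)[of "g t" D]
  have eq: "f t = (%x. (?m x + - burg (g t) x) + e t x)" using f[OF t] by auto
  have L: "L2 (%x. ?m x + - burg (g t) x)" using mL bb(1) g[OF t] by (intro L2_add L2_uminus) auto
  have "L2_norm (f t) <= (L2_norm ?m + L2_norm (%x. - burg (g t) x)) + L2_norm (e t)"
   unfolding eq using L2_norm_triangle[OF L, of "e t"] L2_norm_triangle[OF mL L2_uminus[OF bb(1)]] e[OF t] g[OF t] by linarith
  thus ?thesis using L mn bb(2) g[OF t] e[OF t] unfolding eq L2_norm_uminus by (auto intro!: L2_add)
 qed
 show "approx_sol T \<mu> g f e" unfolding approx_sol_def using fl g e f fL by auto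
 show "t : {0..T} ==> L2_norm (g t) <= D" "t : {0..T} ==> L2 (f t) & L2_norm (f t) <= B * D + cb * D^2 + \<epsilon>"
  using gL fL by auto
qed

lemma galerkin_approx_sol:
 assumes G: "galerkin T n \<mu> a v f" and n: "0 < n" and \<mu>: "\<mu> : Borel" "!!x. \<bar>\<mu> x\<bar> <= B"
  and D: "!!t. t : {0..T} ==> hs 2 (v t) & hsn 2 (v t) <= D"
 shows "t : {0..T} ==> L2 (high n (burg (v t))) & L2_norm (high n (burg (v t))) <= cb * D^2 / n"
  "approx_sol T \<mu> v f (%t. high n (burg (v t)))" "t : {0..T} ==> L2_norm (v t) <= D"
  "t : {0..T} ==> L2 (f t) & L2_norm (f t) <= B * D + cb * D^2 + cb * D^2 / n"
proof -
 have e: "L2 (high n (burg (v t))) & L2_norm (high n (burg (v t))) <= cb * D^2 / n" if t: "t : {0..T}" for t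
  using L2_high[OF hs_burg_2(1,2) n] D[OF t] by auto
 show "t : {0..T} ==> L2 (high n (burg (v t))) & L2_norm (high n (burg (v t))) <= cb * D^2 / n" using e .
 have f: "f t x = - \<i> * of_real (\<mu> x) * v t x - burg (v t) x + high n (burg (v t)) x" if t: "t : {0..T}" for t x
  using galerkinD(5)[OF G t, of x] by (simp add: high_def indicator_def)
 have g: "herm (v t) & hs 2 (v t) & hsn 2 (v t) <= D" if t: "t : {0..T}" for t using D[OF t] galerkinD(2)[OF G t] by simp
 note fl = G[unfolded galerkin_def, THEN conjunct1]
 show "approx_sol T \<mu> v f (%t. high n (burg (v t)))" "t : {0..T} ==> L2_norm (v t) <= D"
  "t : {0..T} ==> L2 (f t) & L2_norm (f t) <= B * D + cb * D^2 + cb * D^2 / n"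
  by (rule approx_solI[OF fl \<mu> g e f]; assumption)+
qed

text \<open>Minkowski's integral inequality in time, proved by Cauchy-Schwarz at each frequency and
  Tonelli.\<close>

lemma flow_Lipschitz:
 assumes fl: "flow T g f" and f: "!!q. q : {r..t} ==> L2 (f q) & L2_norm (f q) <= c" and t: "0 <= r" "r <= t" "t <= T"
 shows "L2 (%x. g t x - g r x)" "L2_norm (%x. g t x - g r x) <= c * (t - r)"
proof -
 have c: "0 <= c"
 proof -
  have "L2_norm (f r) <= c" using f[of r] t by auto
  thus ?thesis using L2_norm_nonneg[of "f r"] by linarith
 qed
 note [measurable] = flowD(2)[OF fl] flow_measurable[OF fl]
 let ?F = "%x. Lint s. indicator {r..t} s * (cmod (f s x))^2"
 have b: "(cmod (g t x - g r x))^2 <= (t - r) * ?F x" and F0: "0 <= ?F x"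
  and F: "ennreal (?F x) = (\<integral>\<^sup>+s. indicator {r..t} s * ennreal ((cmod (f s x))^2) \<partial>lborel)" for x
 proof -
  have cf: "continuous_on {r..t} (%s. f s x)" using continuous_on_subset[OF flowD(4)[OF fl]] t by auto
  have "(Lint s. indicator {r..t} s *\<^sub>R f s x) = g t x - g r x"
   using t by (intro integral_FTC_atLeastAtMost cf has_vector_derivative_within_subset[OF flowD(3)[OF fl]]) auto
  hence "cmod (g t x - g r x) <= (Lint s. norm (indicator {r..t} s *\<^sub>R f s x))"
   using integral_norm_bound[of lborel "%s. indicator {r..t} s *\<^sub>R f s x"] by simp
  also have "... = (Lint s. indicator {r..t} s * (indicator {r..t} s * cmod (f s x)))"
   by (intro int_cong) (auto simp: indicator_def)
  finally have 1: "cmod (g t x - g r x) <= (Lint s. indicator {r..t} s * (indicator {r..t} s * cmod (f s x)))" .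
  have "set_integrable lborel {r..t} (%s. (cmod (f s x))^2)"
   by (intro borel_integrable_atLeastAtMost' continuous_intros cf)
  hence i: "L1 (%s. indicator {r..t} s * (cmod (f s x))^2)" unfolding set_integrable_def by simp
  have sq: "(indicator {r..t} s * y)^2 = indicator {r..t} s * y^2" "(indicator {r..t} s)^2 = (indicator {r..t} s :: real)" for s y :: real
   by (auto simp: indicator_def)
  have "(Lint s. indicator {r..t} s * (indicator {r..t} s * cmod (f s x)))^2 <= (Lint s. (indicator {r..t} s)^2) * (Lint s. (indicator {r..t} s * cmod (f s x))^2)"
   by (rule Cauchy_Schwarz_integral(2)) (use i in \<open>simp_all add: sq integrable_indicator_iff emeasure_lborel_Icc_eq\<close>)
  also have "... = (t - r) * ?F x" unfolding sq using t by simp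
  finally show "(cmod (g t x - g r x))^2 <= (t - r) * ?F x" using order_trans[OF power_mono[OF 1 norm_ge_zero]] by blast
  show "0 <= ?F x" by (intro Bochner_Integration.integral_nonneg) simp
  show "ennreal (?F x) = (\<integral>\<^sup>+s. indicator {r..t} s * ennreal ((cmod (f s x))^2) \<partial>lborel)"
   using nn_integral_eq_integral[OF i] by (simp add: ennreal_mult' ennreal_indicator)
 qed
 have "(\<integral>\<^sup>+x. \<integral>\<^sup>+s. indicator {r..t} s * ennreal ((cmod (f s x))^2) \<partial>lborel \<partial>lborel) = (\<integral>\<^sup>+s. \<integral>\<^sup>+x. indicator {r..t} s * ennreal ((cmod (f s x))^2) \<partial>lborel \<partial>lborel)"
  by (rule lborel_pair.Fubini') measurable
 also have "... <= (\<integral>\<^sup>+s. ennreal (c^2) * indicator {r..t} s \<partial>lborel)"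
 proof (rule nn_integral_mono)
  fix s
  have "(\<integral>\<^sup>+x. ennreal ((cmod (f s x))^2) \<partial>lborel) <= ennreal (c^2)" if "s : {r..t}"
  proof -
   have fs: "L2 (f s)" "L2_norm (f s) <= c" using f[of s] that t by auto
   show ?thesis unfolding nn_integral_sq_eq[OF fs(1)] using fs(2) by (intro ennreal_leI power_mono) simp_all
  qed
  thus "(\<integral>\<^sup>+x. indicator {r..t} s * ennreal ((cmod (f s x))^2) \<partial>lborel) <= ennreal (c^2) * indicator {r..t} s"
   by (simp add: indicator_def)
 qed
 also have "... = ennreal (c^2) * emeasure lborel {r..t}" by (rule nn_integral_cmult_indicator) simp
 also have "... = ennreal (c^2) * ennreal (t - r)" using t by simp
 finally have X: "(\<integral>\<^sup>+x. \<integral>\<^sup>+s. indicator {r..t} s * ennreal ((cmod (f s x))^2) \<partial>lborel \<partial>lborel) <= ennreal (c^2) * ennreal (t - r)" .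
 have "(\<integral>\<^sup>+x. ennreal ((norm (g t x - g r x))^2) \<partial>lborel) <= (\<integral>\<^sup>+x. ennreal (t - r) * ennreal (?F x) \<partial>lborel)"
  using b F0 t by (intro nn_integral_mono) (simp flip: ennreal_mult')
 also have "... = ennreal (t - r) * (\<integral>\<^sup>+x. \<integral>\<^sup>+s. indicator {r..t} s * ennreal ((cmod (f s x))^2) \<partial>lborel \<partial>lborel)"
  unfolding F by (rule nn_integral_cmult) measurable
 also have "... <= ennreal (t - r) * (ennreal (c^2) * ennreal (t - r))" by (rule mult_left_mono[OF X]) simp
 also have "... = ennreal ((c * (t - r))^2)"
 proof -
  have "(c * (t - r))^2 = (t - r) * (c^2 * (t - r))" by (simp add: power2_eq_square)
  thus ?thesis using t by (simp only: ennreal_mult' zero_le_power2 diff_ge_0_iff_ge ennreal_mult)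
 qed
 finally have le: "(\<integral>\<^sup>+x. ennreal ((norm (g t x - g r x))^2) \<partial>lborel) <= ennreal ((c * (t - r))^2)" .
 have m: "(%x. g t x - g r x) : Borel" by measurable
 show "L2 (%x. g t x - g r x)" by (rule L2_of_nn_integral_le(1)[OF m le]) simp
 show "L2_norm (%x. g t x - g r x) <= c * (t - r)"
  by (rule power2_le_imp_le[OF L2_of_nn_integral_le(2)[OF m le]]) (use c t in auto)
qed

text \<open>The continuity argument needs a continuous quantity. On the bounded frequency range the
  moment is Lipschitz in the L^2 norm; the constant depends on \<open>n\<close>, which is harmless
  since only continuity is concluded.\<close>

lemma galerkin_moment_continuous:
 assumes G: "galerkin T n \<mu> a v f" and n: "0 < n" and \<mu>: "\<mu> : Borel" "!!x. \<bar>\<mu> x\<bar> <= B"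
 shows "continuous_on {0..T} (%t. Lint x. \<bar>x\<bar> * cmod (v t x))"
proof (cases "0 <= T")
 case True
 let ?p = "%u. Lint x. \<bar>x\<bar> * cmod (u x)"
 obtain c where c: "!!t. t : {0..T} ==> L2_norm (v t) <= c" using G unfolding galerkin_def by blast
 have hv: "hs 2 (v t) & hsn 2 (v t) <= jp 2 n * c" if t: "t : {0..T}" for t
 proof
  show "hs 2 (v t)" using L2_support_hs(1)[OF galerkinD(3,4)[OF G t] less_imp_le[OF n], of 2] by simp
  have "hsn 2 (v t) <= jp 2 n * L2_norm (v t)" using L2_support_hs(2)[OF galerkinD(3,4)[OF G t] less_imp_le[OF n], of 2] by simp
  also have "... <= jp 2 n * c" by (rule mult_left_mono[OF c[OF t]]) simp
  finally show "hsn 2 (v t) <= jp 2 n * c" .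
 qed
 have fb: "L2 (f t) & L2_norm (f t) <= B * (jp 2 n * c) + cb * (jp 2 n * c)^2 + cb * (jp 2 n * c)^2 / n" if "t : {0..T}" for t
  by (rule galerkin_approx_sol(4)[OF G n \<mu> hv], assumption, rule that)
 define K where "K = B * (jp 2 n * c) + cb * (jp 2 n * c)^2 + cb * (jp 2 n * c)^2 / n"
 have K: "0 <= K"
 proof -
  have "L2_norm (f 0) <= K" using fb[of 0] True unfolding K_def by simp
  thus ?thesis using L2_norm_nonneg[of "f 0"] by linarith
 qed
 have le: "?p (v t) - ?p (v r) <= sqrt (2 * n) * (n * L2_norm (%x. v t x - v r x))" if t: "t : {0..T}" and r: "r : {0..T}" for t r
 proof -
  let ?u = "%x. v t x - v r x"
  have u: "L2 ?u" "!!x. n < \<bar>x\<bar> ==> ?u x = 0"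
   using galerkinD(4)[OF G t] galerkinD(4)[OF G r] L2_diff[OF galerkinD(3)[OF G t] galerkinD(3)[OF G r]] by simp_all
  have xu: "L2 (%x. of_real x * ?u x)" "L2_norm (%x. of_real x * ?u x) <= n * L2_norm ?u"
   using L2_support_weighted[OF u, where p="%x. x" and P=n] n by simp_all
  have i: "L1 (%x. of_real x * ?u x)" "(Lint x. cmod (of_real x * ?u x)) <= sqrt (2 * n) * L2_norm (%x. of_real x * ?u x)"
   by (rule L2_support_integrable[OF xu(1) _ less_imp_le[OF n]], use u(2) in simp)+
  have im: "L1 (%x. \<bar>x\<bar> * cmod (v t x))" if "t : {0..T}" for t
   using integrable_norm[OF hs_integrable_1(1)[OF conjunct1[OF hv[OF that]]]] by (simp add: norm_mult)
  have "?p (v t) - ?p (v r) = (Lint x. \<bar>x\<bar> * cmod (v t x) - \<bar>x\<bar> * cmod (v r x))" using im[OF t] im[OF r] by simp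
  also have "... <= (Lint x. cmod (of_real x * ?u x))"
  proof (rule integral_mono)
   show "L1 (%x. \<bar>x\<bar> * cmod (v t x) - \<bar>x\<bar> * cmod (v r x))" using im[OF t] im[OF r] by simp
   show "\<bar>x\<bar> * cmod (v t x) - \<bar>x\<bar> * cmod (v r x) <= cmod (of_real x * ?u x)" for x
    using mult_left_mono[OF norm_triangle_ineq2[of "v t x" "v r x"], of "\<bar>x\<bar>"] unfolding norm_mult norm_of_real by (simp add: right_diff_distrib)
  qed (rule integrable_norm[OF i(1)])
  also have "... <= sqrt (2 * n) * (n * L2_norm ?u)"
   by (rule order_trans[OF i(2) mult_left_mono[OF xu(2)]]) (use n in simp)
  finally show ?thesis .
 qed
 have lip: "L2_norm (%x. v t x - v r x) <= K * \<bar>t - r\<bar>" if t: "t : {0..T}" and r: "r : {0..T}" for t r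
 proof (cases "r <= t")
  case True
  have "L2_norm (%x. v t x - v r x) <= K * (t - r)"
   by (rule flow_Lipschitz(2)[OF galerkinD(1)[OF G t]]) (use fb True t r in \<open>simp_all add: K_def\<close>)
  thus ?thesis using True by simp
 next
  case False
  have "L2_norm (%x. v r x - v t x) <= K * (r - t)"
   by (rule flow_Lipschitz(2)[OF galerkinD(1)[OF G t]]) (use fb False t r in \<open>simp_all add: K_def\<close>)
  thus ?thesis unfolding L2_norm_minus_commute[of "v r" "v t"] using False by simp
 qed
 have "dist (?p (v t)) (?p (v r)) <= (sqrt (2 * n) * (n * K)) * dist t r" if t: "t : {0..T}" and r: "r : {0..T}" for t r
 proof -
  have "sqrt (2 * n) * (n * L2_norm (%x. v t x - v r x)) <= sqrt (2 * n) * (n * (K * \<bar>t - r\<bar>))"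
   using lip[OF t r] n by (intro mult_left_mono) auto
  thus ?thesis using le[OF t r] le[OF r t] unfolding mult.assoc dist_real_def L2_norm_minus_commute[of "v r" "v t"] by linarith
 qed
 hence "(sqrt (2 * n) * (n * K))-lipschitz_on {0..T} (%t. ?p (v t))"
  by (rule lipschitz_onI) (use K n in simp_all)
 thus ?thesis by (rule lipschitz_on_continuous_on)
qed simp

text \<open>The order of the choices matters: \<open>M\<close> depends on \<open>C\<close>, the H^2
  bound \<open>D\<close> on \<open>M\<close>, the closeness \<open>\<eta>'\<close> on
  \<open>D + C\<close>, and only then come the smallness \<open>\<sigma>\<close> and the truncation
  level \<open>N\<close>. None of them depends on the multiplier or on \<open>n\<close>, which makes
  the estimate uniform.\<close>

lemma galerkin_bootstrap:
 assumes a: "hs 2 a" and T: "0 <= T" and C: "0 <= C" and fl: "flow T w h" and w0: "w 0 = a"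
  and w: "!!t. t : {0..T} ==> herm (w t) & hs 2 (w t) & hsn 2 (w t) <= C" and wf: "!!t x. t : {0..T} ==> h t x = - burg (w t) x"
 obtains M \<eta> N where "0 < \<eta>" "0 < N" "0 <= M"
  "!!\<mu> B n v f t. \<mu> : Borel ==> (!!x. \<bar>\<mu> x\<bar> <= B) ==> galerkin T n \<mu> a v f ==> N <= n ==>
   (!!t. t : {0..T} ==> (L2_norm (%x. of_real (\<mu> x) * w t x))^2 <= \<eta>) ==> t : {0..T} ==> (moment (v t)) <= M"
proof -
 \<comment> \<open>The Burgers solution has moment at most \<open>c1 * C\<close>, which is
   \<open>M - 1/2\<close>. The continuity argument assumes the bound \<open>M + 1/2\<close>, and
   interpolation returns \<open>M\<close>.\<close>
 define M where "M = c1 * C + 1/2"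
 define D where "D = sqrt (2 * (hsn 2 a)^2 * exp (2 * (2 * 2 ^ 4 * (M + 1/2) + 1) * T))"
 define E where "E = exp (2 * (M + 1/2 + 1) * T)"
 have M: "0 <= M" using C by (simp add: M_def)
 have D: "0 <= D" by (simp add: D_def)
 obtain \<eta>' where \<eta>': "0 < \<eta>'" "!!r. hs 2 r ==> hsn 2 r <= D + C ==> (L2_norm r)^2 <= \<eta>' ==> (moment r) <= 1/2"
  using interpolation[of "D + C"] C D by auto
 \<comment> \<open>Solves \<open>2 * (\<sigma>^2 + T * (2 * \<sigma>)^2) * E = \<eta>'\<close>, the
   bound of \<open>stability\<close> for initial error \<open>\<sigma>\<close> and residual
   \<open>2 * \<sigma>\<close>: one \<open>\<sigma>\<close> for the truncation and one for the
   dispersive term.\<close>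
 define \<sigma> where "\<sigma> = sqrt (\<eta>' / (2 * (1 + 4 * T) * E))"
 have E: "0 < E" by (simp add: E_def)
 have \<sigma>: "0 < \<sigma>" using \<eta>' E T by (simp add: \<sigma>_def)
 have \<sigma>2: "2 * (\<sigma>^2 + T * (2 * \<sigma>)^2) * E = \<eta>'"
 proof -
  have "\<sigma>^2 = \<eta>' / (2 * (1 + 4 * T) * E)" unfolding \<sigma>_def using \<eta>' E T by simp
  moreover have "2 * (1 + 4 * T) * E ~= 0" using E T by auto
  ultimately have "\<sigma>^2 * (2 * (1 + 4 * T) * E) = \<eta>'" by simp
  thus ?thesis by (simp add: power_mult_distrib algebra_simps)
 qed
 define N where "N = (cb * D^2 + hsn 2 a + 1) / \<sigma>"
 have N: "0 < N" using \<sigma> by (auto simp: N_def intro!: divide_pos_pos add_nonneg_pos)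
 show ?thesis
 proof (rule that[of "\<sigma>^2" N M])
  fix \<mu> B n v f t
  assume \<mu>: "\<mu> : Borel" "!!x. \<bar>\<mu> x\<bar> <= (B::real)" and G: "galerkin T n \<mu> a v f" and Nn: "N <= n"
   and sm: "!!t. t : {0..T} ==> (L2_norm (%x. of_real (\<mu> x) * w t x))^2 <= \<sigma>^2" and t: "t : {0..T}"
  have n: "0 < n" using N Nn by linarith
  have "cb * D^2 + hsn 2 a + 1 <= n * \<sigma>" using Nn \<sigma> by (simp add: N_def field_simps)
  moreover have "0 <= cb * D^2" "0 <= hsn 2 a" by simp_all
  ultimately have "cb * D^2 <= n * \<sigma>" "hsn 2 a <= n * \<sigma>" by linarith+
  hence small: "cb * D^2 / n <= \<sigma>" "hsn 2 a / n <= \<sigma>" using n by (simp_all add: pos_divide_le_eq mult.commute)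
  have a1: "hs 1 a" "hsn 1 a <= hsn 2 a" using hs_mono[OF a, of 1] by auto
  have wM: "(moment (w t)) <= M - 1/2" if "t : {0..T}" for t
   using hs_integrable_1(2)[of 2 "w t"] w[OF that] mult_left_mono[of "hsn 2 (w t)" C c1] by (simp add: M_def)
  have w0': "(L2_norm (%x. v 0 x - w 0 x))^2 <= \<sigma>^2"
  proof -
   have "(%x. v 0 x - w 0 x) = (%x. - high n a x)"
    using galerkinD(6)[OF G t] by (auto simp: fun_eq_iff w0 high_def indicator_def)
   thus ?thesis using L2_high[OF a1 n] small(2) by (simp add: L2_norm_uminus power_mono)
  qed
  show "(moment (v t)) <= M"
  proof (rule bootstrap[where p="%t. Lint x. \<bar>x\<bar> * cmod (v t x)" and R="M + 1/2", OF galerkin_moment_continuous[OF G n \<mu>] _ _ _ t])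
   have z: "0 : {0..T}" using T by simp
   note im = integrable_norm[OF hs_integrable_1(1)[OF a], simplified]
   have "(moment (v 0)) <= (moment a)"
   proof (rule integral_mono)
    show i: "L1 (%x. \<bar>x\<bar> * cmod (a x))" using im by (simp add: norm_mult)
    show b: "\<bar>x\<bar> * cmod (v 0 x) <= \<bar>x\<bar> * cmod (a x)" for x using galerkinD(6)[OF G z, of x] by (simp add: indicator_def)
    have [measurable]: "v 0 : Borel" using galerkinD(3)[OF G z] by (rule L2_measurable)
    show "L1 (%x. \<bar>x\<bar> * cmod (v 0 x))"
     by (rule int_bound[OF i], measurable) (use b in simp)
   qed
   thus "(moment (v 0)) <= M" using wM[OF z] w0 by simp
   fix t assume t: "t : {0..T}" and pM: "!!r. r : {0..t} ==> (moment (v r)) <= M + 1/2"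
   note Gt = galerkin_restrict[OF G t]
   have T': "r : {0..T}" if "r : {0..t}" for r using t that by auto
   have hv: "hs 2 (v r) & hsn 2 (v r) <= D" if r: "r : {0..t}" for r
   proof -
    have h: "hs 2 (v r)" "(hsn 2 (v r))^2 <= 2 * (hsn 2 a)^2 * exp (2 * (2 * 2 ^ 4 * (M + 1/2) + 1) * t)"
     using galerkin_hs[OF Gt less_imp_le[OF n] \<mu> _ _ a pM r, where K=4] by auto
    have "exp (2 * (2 * 2 ^ 4 * (M + 1/2) + 1) * t) <= exp (2 * (2 * 2 ^ 4 * (M + 1/2) + 1) * T)"
     using M t by (intro iffD2[OF exp_le_cancel_iff] mult_left_mono) auto
    from mult_left_mono[OF this, of "2 * (hsn 2 a)^2"]
    have "(hsn 2 (v r))^2 <= 2 * (hsn 2 a)^2 * exp (2 * (2 * 2 ^ 4 * (M + 1/2) + 1) * T)" using h(2) by simp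
    also have "... = D^2" unfolding D_def by simp
    finally have "(hsn 2 (v r))^2 <= D^2" .
    thus ?thesis using h(1) power2_le_imp_le D by blast
   qed
   have e': "L2 (%x. \<i> * of_real (\<mu> x) * w r x) & L2_norm (%x. \<i> * of_real (\<mu> x) * w r x) <= \<sigma>" if r: "r : {0..t}" for r
   proof -
    have wL: "L2 (w r)" using w[OF T'[OF r]] hs_L2[of 2 "w r"] by simp
    note [measurable] = L2_measurable[OF wL] \<mu>(1)
    have "L2 (%x. \<i> * of_real (\<mu> x) * w r x)"
     by (rule L2_bound[OF wL, where C=B]) (use \<mu>(2) in \<open>auto simp: norm_mult intro: mult_right_mono\<close>)
    moreover have "L2_norm (%x. \<i> * of_real (\<mu> x) * w r x) = L2_norm (%x. of_real (\<mu> x) * w r x)"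
     unfolding L2_norm_def by (simp add: norm_mult)
    ultimately show ?thesis using power2_le_imp_le[OF sm[OF T'[OF r]]] \<sigma> by simp
   qed
   have A: "L2 (high n (burg (v r))) & L2_norm (high n (burg (v r))) <= cb * D^2 / n" "L2_norm (v r) <= D" "L2_norm (f r) <= B * D + cb * D^2 + cb * D^2 / n" if "r : {0..t}" for r
    by (rule galerkin_approx_sol(1,3)[OF Gt n \<mu> hv] galerkin_approx_sol(4)[OF Gt n \<mu> hv, THEN conjunct2], assumption, rule that)+
   have flt: "flow t w h" using flow_restrict[OF fl] t by simp
   have wft: "h r x = - \<i> * of_real (\<mu> x) * w r x - burg (w r) x + \<i> * of_real (\<mu> x) * w r x" if "r : {0..t}" for r x
    using wf[OF T'[OF that]] by simp
   have wt: "herm (w r) & hs 2 (w r) & hsn 2 (w r) <= C" if "r : {0..t}" for r using w[OF T'[OF that]] .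
   have A': "L2_norm (w r) <= C" "L2_norm (h r) <= B * C + cb * C^2 + \<sigma>" if "r : {0..t}" for r
    by (rule approx_solI(2)[OF flt \<mu> wt e' wft] approx_solI(3)[OF flt \<mu> wt e' wft, THEN conjunct2], assumption+, rule that)+
   let ?c = "max D C + (B * D + cb * D^2 + cb * D^2 / n) + (B * C + cb * C^2 + \<sigma>)"
   have B: "0 <= B" using \<mu>(2)[of 0] by linarith
   have nn: "0 <= B * D + cb * D^2 + cb * D^2 / n" "0 <= B * C + cb * C^2 + \<sigma>" using B D C \<sigma> n by auto
   have tt: "t : {0..t}" and t0: "0 <= t" and tT: "t <= T" using t by auto
   have "(L2_norm (%x. v t x - w t x))^2 <= 2 * ((L2_norm (%x. v 0 x - w 0 x))^2 + t * (2 * \<sigma>)^2) * exp (2 * (M + 1/2 + 1) * t)"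
   proof (rule stability[OF galerkin_approx_sol(2)[OF Gt n \<mu> hv] approx_solI(1)[OF flt \<mu> wt e' wft] pM _ _ _ _ _ _ tt, where c = ?c])
    fix r assume r: "r : {0..t}"
    show "(moment (w r)) <= M + 1/2" using wM[OF T'[OF r]] by simp
    show "L2_norm (v r) <= ?c" using A(2)[OF r] nn by linarith
    show "L2_norm (w r) <= ?c" using A'(1)[OF r] nn by linarith
    have "0 <= max D C" using D by simp
    thus "L2_norm (f r) <= ?c" "L2_norm (h r) <= ?c" using A(3)[OF r] A'(2)[OF r] nn by linarith+
    have "L2_norm (%x. high n (burg (v r)) x - \<i> * of_real (\<mu> x) * w r x) <= L2_norm (high n (burg (v r))) + L2_norm (%x. \<i> * of_real (\<mu> x) * w r x)"
     using L2_norm_triangle[of "high n (burg (v r))" "%x. - (\<i> * of_real (\<mu> x) * w r x)"] A(1)[OF r] e'[OF r] L2_uminus[of "%x. \<i> * of_real (\<mu> x) * w r x"]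
     unfolding L2_norm_uminus by simp
    thus "L2_norm (%x. high n (burg (v r)) x - \<i> * of_real (\<mu> x) * w r x) <= 2 * \<sigma>" using A(1)[OF r] e'[OF r] small(1) by linarith
   qed
   also have "... <= 2 * (\<sigma>^2 + T * (2 * \<sigma>)^2) * E"
    unfolding E_def using w0' tT t0 M T by (intro mult_mono add_mono mult_right_mono iffD2[OF exp_le_cancel_iff] mult_left_mono) auto
   finally have d: "(L2_norm (%x. v t x - w t x))^2 <= \<eta>'" unfolding \<sigma>2 .
   have hr: "hs 2 (%x. v t x - w t x)" "hsn 2 (%x. v t x - w t x) <= D + C"
    using hv[OF tt] wt[OF tt] hsn_triangle_diff[of 2 "v t" "w t"] by (auto intro: hs_diff)
   have "(moment (v t)) <= (Lint x. \<bar>x\<bar> * cmod (v t x - w t x) + \<bar>x\<bar> * cmod (w t x))"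
   proof (rule integral_mono)
    have im: "L1 (%x. \<bar>x\<bar> * cmod (u x))" if "hs 2 u" for u
     using integrable_norm[OF hs_integrable_1(1)[OF that]] by (simp add: norm_mult)
    show "L1 (%x. \<bar>x\<bar> * cmod (v t x))" "L1 (%x. \<bar>x\<bar> * cmod (v t x - w t x) + \<bar>x\<bar> * cmod (w t x))"
     using im hr(1) hv[OF tt] wt[OF tt] by (simp_all add: int_add)
    show "\<bar>x\<bar> * cmod (v t x) <= \<bar>x\<bar> * cmod (v t x - w t x) + \<bar>x\<bar> * cmod (w t x)" for x
     using mult_left_mono[OF norm_triangle_ineq[of "v t x - w t x" "w t x"], of "\<bar>x\<bar>"] by (simp add: distrib_left)
   qed
   also have "... = (Lint x. \<bar>x\<bar> * cmod (v t x - w t x)) + (moment (w t))"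
    using integrable_norm[OF hs_integrable_1(1)[OF hr(1)]] integrable_norm[OF hs_integrable_1(1)[of 2 "w t"]] wt[OF tt]
    by (intro lint_add) (simp_all add: norm_mult)
   also have "... <= M" using \<eta>'(2)[OF hr d] wM[OF t] by linarith
   finally show "(moment (v t)) <= M" .
  qed simp
 qed (use \<sigma> N M in auto)
qed

text \<open>The squared H^s weight with a smooth high-frequency cutoff; being a product of
  admissible weights, it is propagated by the Galerkin equation.\<close>

definition tw :: "real => real => real => real" where "tw s R x = (1 + x^2) powr s * (x^2 / (R^2 + x^2))"

lemma tw_measurable[measurable]: "tw s R : Borel" unfolding tw_def[abs_def] by measurable
lemma tw_nonneg[simp]: "0 <= tw s R x" by (simp add: tw_def)

lemma tw_le: assumes "0 < R" shows "\<bar>tw s R x * (cmod z)^2\<bar> <= (1 + x^2) powr s * (cmod z)^2"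
proof -
 have "x^2 / (R^2 + x^2) <= 1" using assms by (simp add: divide_le_eq add_pos_nonneg)
 hence "tw s R x <= (1 + x^2) powr s" unfolding tw_def by (rule mult_left_le) simp
 thus ?thesis by (simp add: abs_mult mult_right_mono)
qed

text \<open>The cutoff factor is at least 1/2 outside \<open>{- R..R}\<close>; inside, the weight is
  at most its value at \<open>R\<close>.\<close>

lemma tail_weight_split:
 assumes R: "0 < R" and s: "0 <= s"
 shows "(1 + x^2) powr s <= (jp s R)^2 + 2 * tw s R x"
proof (cases "\<bar>x\<bar> <= R")
 case True
 hence "x^2 <= R^2" by (simp add: abs_le_square_iff[symmetric] abs_of_pos[OF R])
 hence "(1 + x^2) powr s <= (jp s R)^2" unfolding jp_sq using s by (intro powr_mono2) auto
 thus ?thesis by (simp add: add_increasing2)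
next
 case False
 hence "R^2 <= x^2" using R by (simp add: abs_le_square_iff[symmetric])
 hence "1 <= 2 * (x^2 / (R^2 + x^2))" using R by (simp add: field_simps add_pos_nonneg)
 from mult_left_mono[OF this, of "(1 + x^2) powr s"] show ?thesis by (simp add: tw_def add_increasing mult_ac)
qed

lemma tail_integrable:
 assumes h: "hs s g" and R: "0 < R" shows "L1 (%x. tw s R x * (cmod (g x))^2)"
proof (rule int_bound[OF hs_integrable_sq[OF h]])
 note [measurable] = hs_measurable[OF h]
 show "(%x. tw s R x * (cmod (g x))^2) : borel_measurable lborel" by measurable
qed (use tw_le[OF R] in simp)

text \<open>The last clause is uniform smallness of the high frequencies, which upgrades \<open>L^2\<close> continuity in time to continuity in \<open>H\<^sup>s\<close>.\<close>

definition dispersive_flow :: "real => real => (real => real) => real => (real => real => complex) => (real => real => complex) => bool" where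
 "dispersive_flow s T \<mu> D w h \<longleftrightarrow> flow T w h & (ALL t:{0..T}. herm (w t) & hs s (w t) & hsn s (w t) <= D &
  (ALL x. h t x = - \<i> * of_real (\<mu> x) * w t x - burg (w t) x)) &
 (ALL \<epsilon>>0. EX R>0. ALL t:{0..T}. (Lint x. tw s R x * (cmod (w t x))^2) <= \<epsilon>)"

lemma tail_small:
 assumes h: "hs s a" and e: "0 < \<epsilon>"
 obtains R where "0 < R" "(Lint x. tw s R x * (cmod (a x))^2) <= (\<epsilon>::real)"
proof -
 note [measurable] = hs_measurable[OF h]
 have "((%R. Lint x. tw s R x * (cmod (a x))^2) \<longlongrightarrow> (LINT x::real|lborel. 0)) at_top"
 proof (rule integral_dominated_convergence_at_top[OF _ _ hs_integrable_sq[OF h]])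
  show "\<forall>\<^sub>F R in at_top. AE x in lborel. norm (tw s R x * (cmod (a x))^2) <= (1 + x^2) powr s * (cmod (a x))^2"
   using eventually_gt_at_top[of 0] by eventually_elim (use tw_le in simp)
  show "AE x in lborel. ((%R. tw s R x * (cmod (a x))^2) \<longlongrightarrow> 0) at_top"
  proof (rule AE_I2)
   fix x :: real
   have "((%R. x^2 / (R^2 + x^2)) \<longlongrightarrow> 0) at_top" by real_asymp
   from tendsto_mult[OF tendsto_mult[OF tendsto_const this] tendsto_const]
   show "((%R. tw s R x * (cmod (a x))^2) \<longlongrightarrow> 0) at_top" by (simp add: tw_def)
  qed
 qed auto
 hence "\<forall>\<^sub>F R in at_top. (Lint x. tw s R x * (cmod (a x))^2) < \<epsilon>"
  using e by (intro order_tendstoD) simp_all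
 thus ?thesis using that eventually_happens[OF eventually_conj[OF eventually_gt_at_top[of 0]]] by force
qed

section \<open>Convergence of the Galerkin approximations\<close>

lemma burg_diff_bound:
 assumes "hs 1 a" "hs 1 b" "L2_norm a <= D" "L2_norm b <= D"
 shows "cmod (burg a x - burg b x) <= \<bar>x\<bar> * D * L2_norm (%x. a x - b x)"
proof -
 note ab = hs_add[OF assms(1,2)] hs_diff[OF assms(1,2)]
 have "cmod (prod_ft (%x. a x + b x) (%x. a x - b x) x) <= L2_norm (%x. a x + b x) * L2_norm (%x. a x - b x)"
  using hs_integrable(1) hs_L2(1) ab by (intro prod_ft_bound) auto
 also have "... <= (2 * D) * L2_norm (%x. a x - b x)"
  using L2_norm_triangle[OF hs_L2(1)[OF assms(1)] hs_L2(1)[OF assms(2)]] assms(3,4) by (intro mult_right_mono) auto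
 finally have "\<bar>x\<bar> / 2 * cmod (prod_ft (%x. a x + b x) (%x. a x - b x) x) <= \<bar>x\<bar> / 2 * (2 * D * L2_norm (%x. a x - b x))"
  by (intro mult_left_mono) auto
 thus ?thesis unfolding burg_diff[OF assms(1,2) order_refl] by (simp add: norm_mult)
qed

text \<open>The integrating factor \<open>cis (\<mu> x * t)\<close> removes the linear term. Below
  both truncation levels the initial values agree and only the nonlinearities remain in the
  difference.\<close>

lemma galerkin_pointwise:
 assumes G: "galerkin T n \<mu> a v f" and G': "galerkin T k \<mu> a v' f'" and x: "\<bar>x\<bar> <= n" "\<bar>x\<bar> <= k"
  and c: "!!t. t : {0..T} ==> cmod (burg (v t) x - burg (v' t) x) <= c" and t: "t : {0..T}"
 shows "cmod (v t x - v' t x) <= c * T"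
proof -
 let ?z = "%t. cis (\<mu> x * t) * (v t x - v' t x)"
 have z: "(?z has_vector_derivative - (cis (\<mu> x * r) * (burg (v r) x - burg (v' r) x))) (at r within {0..t})" if r: "r : {0..t}" for r
 proof -
  have rT: "r : {0..T}" using r t by auto
  have dc: "((%t. cis (\<mu> x * t)) has_vector_derivative (\<i> * of_real (\<mu> x)) * cis (\<mu> x * r)) (at r within {0..T})"
   unfolding has_vector_derivative_complex_iff by (auto intro!: derivative_eq_intros)
  have fr: "f r x = - \<i> * of_real (\<mu> x) * v r x - burg (v r) x" "f' r x = - \<i> * of_real (\<mu> x) * v' r x - burg (v' r) x"
   using x galerkinD(5)[OF G rT, of x] galerkinD(5)[OF G' rT, of x] by (simp_all add: indicator_def abs_le_iff)
  have "(?z has_vector_derivative - (cis (\<mu> x * r) * (burg (v r) x - burg (v' r) x))) (at r within {0..T})"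
   by (rule has_vector_derivative_eq_rhs[OF has_vector_derivative_mult[OF dc has_vector_derivative_diff[OF flowD(3)[OF galerkinD(1)[OF G t] rT] flowD(3)[OF galerkinD(1)[OF G' t] rT]]]])
    (simp only: fr, simp add: algebra_simps)
  thus ?thesis by (rule has_vector_derivative_within_subset) (use t in auto)
 qed
 have c0: "0 <= c" using order_trans[OF norm_ge_zero c[OF t]] .
 have "cmod (?z t - ?z 0) <= c * (t - 0)"
  by (rule vector_derivative_bound[OF z]) (use c t in \<open>simp_all add: norm_mult\<close>)
 moreover have "v 0 x = v' 0 x" using galerkinD(6)[OF G t, of x] galerkinD(6)[OF G' t, of x] x by (simp add: indicator_def abs_le_iff)
 moreover have "c * t <= c * T" using t c0 by (intro mult_left_mono) auto
 ultimately show ?thesis by (simp add: norm_mult)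
qed

text \<open>By \<open>stability\<close> the approximations are Cauchy in L^2 with rate
  \<open>1 / n\<close>, uniformly in time. Through \<open>galerkin_pointwise\<close> this gives a
  rate at every single frequency, also for the time derivatives, so the limit is again
  differentiable in time at each frequency. The H^s bound and the uniform tails pass to the limit by
  Fatou's lemma.\<close>

lemma galerkin_limit:
 fixes N :: real
 assumes s: "2 <= s" and T: "0 <= T" and a: "hs s a" and N: "0 < N" and M: "0 <= M"
  and \<mu>: "\<mu> : Borel" "!!x. \<bar>\<mu> x\<bar> <= B"
  and G: "!!n. galerkin T (N + real n) \<mu> a (v n) (f n)"
  and vM: "!!n t. t : {0..T} ==> (Lint x. \<bar>x\<bar> * cmod (v n t x)) <= M"
 obtains D w h where "dispersive_flow s T \<mu> D w h" "w 0 = a"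
proof -
 \<comment> \<open>The summand 2 is the degree of \<open>weight_tail\<close>, whose product with the
   H^s weight must be admissible.\<close>
 define K where "K = nat \<lceil>2 * s\<rceil> + 2"
 define \<kappa> where "\<kappa> = 2 * exp (2 * (2 * 2 ^ K * M + 1) * T)"
 define D where "D = sqrt \<kappa> * hsn s a"
 have \<kappa>: "0 < \<kappa>" by (simp add: \<kappa>_def)
 have D: "0 <= D" and "D^2 = \<kappa> * (hsn s a)^2" using \<kappa> by (simp_all add: D_def power_mult_distrib)
 hence D2: "2 * (hsn s a)^2 * exp (2 * (2 * 2 ^ K * M + 1) * T) = D^2" unfolding \<kappa>_def by simp
 have K: "2 * s <= real K" "2 * s <= real (nat \<lceil>2 * s\<rceil>)" using real_nat_ceiling_ge[of "2 * s"] unfolding K_def by simp_all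
 let ?m = "%n. N + real n"
 have m: "0 < ?m n" for n using N by simp
 have hv: "hs s (v n t)" "hsn s (v n t) <= D" if t: "t : {0..T}" for n t
 proof -
  have s0: "0 <= s" using s by simp
  show "hs s (v n t)" by (rule galerkin_hs(1)[OF G less_imp_le[OF m] \<mu> s0 K(1) a vM t])
  have "(hsn s (v n t))^2 <= 2 * (hsn s a)^2 * exp (2 * (2 * 2 ^ K * M + 1) * T)"
   by (rule galerkin_hs(2)[OF G less_imp_le[OF m] \<mu> s0 K(1) a vM t])
  thus "hsn s (v n t) <= D" unfolding D2 using D by (rule power2_le_imp_le)
 qed
 have hv2: "hs 2 (v n t) & hsn 2 (v n t) <= D" if t: "t : {0..T}" for n t
  using hs_mono[OF hv(1)[OF t] s, of n] hv(2)[OF t, of n] by simp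
 have vL: "L2 (v n t)" "L2_norm (v n t) <= D" and v1: "hs 1 (v n t)" if t: "t : {0..T}" for n t
  using hs_L2[of 2 "v n t"] hs_mono(1)[of 2 "v n t" 1] hv2[OF t, of n] by simp_all
 have a1: "hs 1 a" "hsn 1 a <= hsn s a" using hs_mono[OF a, of 1] s by simp_all
 define \<gamma> where "\<gamma> = hsn s a + cb * D^2"
 have \<gamma>: "0 <= hsn s a" "0 <= cb * D^2" by simp_all
 define Q where "Q = sqrt (2 * (1 + T) * exp (2 * (M + 1) * T)) * \<gamma>"
 have Q0: "0 <= Q" using T \<gamma> by (simp add: Q_def \<gamma>_def)
 let ?r = "%n k. 1 / ?m n + 1 / ?m k"
 have r0: "0 <= ?r n k" for n k using m[of n] m[of k] by simp
 have L2rate: "L2_norm (%x. v n t x - v k t x) <= Q * ?r n k" if t: "t : {0..T}" for n k t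
 proof -
  have e: "L2 (high (?m n) (burg (v n q)))" "L2_norm (high (?m n) (burg (v n q))) <= cb * D^2 / ?m n" if q: "q : {0..T}" for n q
   using hs_burg_2(1,2)[of "v n q" D] hv2[OF q, of n] m by (auto intro!: L2_high)
  have fb: "L2_norm (f n q) <= B * D + cb * D^2 + cb * D^2 / N" if q: "q : {0..T}" for n q
  proof -
   have "L2_norm (f n q) <= B * D + cb * D^2 + cb * D^2 / ?m n"
    by (rule galerkin_approx_sol(4)[OF G m \<mu> hv2, THEN conjunct2], assumption, rule q)
   moreover have "cb * D^2 / ?m n <= cb * D^2 / N" using N by (intro divide_left_mono) auto
   ultimately show ?thesis by simp
  qed
  have B: "0 <= B" using \<mu>(2)[of 0] by linarith
  let ?c = "D + (B * D + cb * D^2 + cb * D^2 / N)"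
  have bb: "0 <= B * D + cb * D^2 + cb * D^2 / N" using B D N by simp
  have "(L2_norm (%x. v n t x - v k t x))^2 <= 2 * ((L2_norm (%x. v n 0 x - v k 0 x))^2 + T * (cb * D^2 * ?r n k)^2) * exp (2 * (M + 1) * T)"
  proof (rule stability[OF galerkin_approx_sol(2)[OF G m \<mu> hv2] galerkin_approx_sol(2)[OF G m \<mu> hv2] vM vM _ _ _ _ _ t, where c = ?c])
   fix q assume q: "q : {0..T}"
   show "L2_norm (v n q) <= ?c" "L2_norm (v k q) <= ?c" "L2_norm (f n q) <= ?c" "L2_norm (f k q) <= ?c"
    using vL(2)[OF q, of n] vL(2)[OF q, of k] fb[OF q, of n] fb[OF q, of k] bb D by linarith+
   have "L2_norm (%x. high (?m n) (burg (v n q)) x - high (?m k) (burg (v k q)) x) <= cb * D^2 / ?m n + cb * D^2 / ?m k"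
    using L2_norm_triangle[OF e(1)[OF q, of n] L2_uminus[OF e(1)[OF q, of k]]] e(2)[OF q, of n] e(2)[OF q, of k] by (simp add: L2_norm_uminus)
   thus "L2_norm (%x. high (?m n) (burg (v n q)) x - high (?m k) (burg (v k q)) x) <= cb * D^2 * ?r n k" by (simp add: distrib_left)
  qed
  also have "... <= 2 * ((\<gamma> * ?r n k)^2 + T * (\<gamma> * ?r n k)^2) * exp (2 * (M + 1) * T)"
  proof -
   have eq: "(%x. v n 0 x - v k 0 x) = (%x. high (?m k) a x + - high (?m n) a x)"
    using galerkinD(6)[OF G[of n] t] galerkinD(6)[OF G[of k] t] by (auto simp: fun_eq_iff high_def indicator_def)
   have "L2_norm (%x. v n 0 x - v k 0 x) <= hsn s a / ?m k + hsn s a / ?m n"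
    unfolding eq using L2_norm_triangle[OF L2_high(1)[OF a1 m] L2_uminus[OF L2_high(1)[OF a1 m]], of k n] L2_high(2)[OF a1 m, of k] L2_high(2)[OF a1 m, of n]
    by (simp add: L2_norm_uminus)
   also have "... = hsn s a * ?r n k" by (simp add: distrib_left)
   also have "... <= \<gamma> * ?r n k" unfolding \<gamma>_def using \<gamma> r0[of n k] by (intro mult_right_mono) auto
   finally have 1: "L2_norm (%x. v n 0 x - v k 0 x) <= \<gamma> * ?r n k" .
   have 2: "cb * D^2 * ?r n k <= \<gamma> * ?r n k" unfolding \<gamma>_def using \<gamma> r0[of n k] by (intro mult_right_mono) auto
   have p: "(L2_norm (%x. v n 0 x - v k 0 x))^2 <= (\<gamma> * ?r n k)^2" "(cb * D^2 * ?r n k)^2 <= (\<gamma> * ?r n k)^2"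
    using power_mono[OF 1, of 2] power_mono[OF 2, of 2] mult_nonneg_nonneg[OF \<gamma>(2) r0[of n k]] by auto
   show ?thesis by (intro mult_right_mono mult_left_mono add_mono p) (use T in auto)
  qed
  also have "... = (Q * ?r n k)^2"
  proof -
   have alg: "2 * (A + T * A) * E = 2 * (1 + T) * E * A" for A E :: real by (simp add: algebra_simps)
   have e1: "(Q * ?r n k)^2 = (sqrt (2 * (1 + T) * exp (2 * (M + 1) * T)))^2 * (\<gamma> * ?r n k)^2" by (simp only: Q_def power_mult_distrib mult.assoc)
   have e2: "(sqrt (2 * (1 + T) * exp (2 * (M + 1) * T)))^2 = 2 * (1 + T) * exp (2 * (M + 1) * T)"
    by (rule real_sqrt_pow2) (use T in simp)
   show ?thesis unfolding e1 e2 by (rule alg)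
  qed
  finally show ?thesis by (rule power2_le_imp_le) (rule mult_nonneg_nonneg[OF Q0 r0])
 qed
 define P where "P = D * Q * T"
 have P0: "0 <= P" using D Q0 T by (simp add: P_def)
 have prate: "cmod (v n t x - v k t x) <= \<bar>x\<bar> * P * ?r n k" if t: "t : {0..T}" and n: "\<bar>x\<bar> <= ?m n" "\<bar>x\<bar> <= ?m k" for n k t x
 proof -
  have "cmod (v n t x - v k t x) <= (\<bar>x\<bar> * D * (Q * ?r n k)) * T"
  proof (rule galerkin_pointwise[OF G G n _ t])
   fix q assume q: "q : {0..T}"
   show "cmod (burg (v n q) x - burg (v k q) x) <= \<bar>x\<bar> * D * (Q * ?r n k)"
    using mult_left_mono[OF L2rate[OF q, of n k], of "\<bar>x\<bar> * D"] D
    by (intro order_trans[OF burg_diff_bound[OF v1[OF q] v1[OF q] vL(2)[OF q] vL(2)[OF q]]]) simp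
  qed
  thus ?thesis by (simp add: P_def mult_ac)
 qed
 have minv: "(%n. C / ?m n) \<longlonglongrightarrow> 0" for C :: real by real_asymp
 have ev: "\<forall>\<^sub>F n in sequentially. \<bar>x\<bar> <= ?m n" for x :: real by real_asymp
 define w where "w = (%t x. lim (%n. v n t x))"
 define h where "h = (%t x. - \<i> * of_real (\<mu> x) * w t x - burg (w t) x)"
 have lim: "(%n. v n t x) \<longlonglongrightarrow> w t x" if t: "t : {0..T}" for t x
 proof -
  have "Cauchy (%n. v n t x)"
  proof (rule metric_CauchyI)
   fix e :: real assume e: "0 < e"
   have "\<forall>\<^sub>F n in sequentially. \<bar>x\<bar> * P / ?m n < e / 2" using e by (intro order_tendstoD[OF minv]) simp
   hence "\<forall>\<^sub>F n in sequentially. \<bar>x\<bar> * P / ?m n < e / 2 & \<bar>x\<bar> <= ?m n" using ev by (rule eventually_conj)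
   then obtain n0 where n0: "!!n. n0 <= n ==> \<bar>x\<bar> * P / ?m n < e / 2 & \<bar>x\<bar> <= ?m n"
    unfolding eventually_sequentially by blast
   have "dist (v n t x) (v k t x) < e" if nk: "n0 <= n" "n0 <= k" for n k
   proof -
    have "\<bar>x\<bar> * P * ?r n k = \<bar>x\<bar> * P / ?m n + \<bar>x\<bar> * P / ?m k" by (simp add: distrib_left)
    thus ?thesis unfolding dist_norm using prate[OF t, of x n k] n0[OF nk(1)] n0[OF nk(2)] by linarith
   qed
   thus "EX M. ALL m>=M. ALL n>=M. dist (v m t x) (v n t x) < e" by blast
  qed
  thus ?thesis unfolding w_def by (simp add: Cauchy_convergent_iff convergent_LIMSEQ_iff)
 qed
 have vm: "(%(t, x). v n t x) : Borel2" for n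
  by (rule flowD(1)[OF galerkinD(1)[OF G, of 0]]) (use T in simp)
 have wm: "(%(t, x). w t x) : Borel2"
  unfolding w_def case_prod_beta' by (rule borel_measurable_lim_metric) (use vm in \<open>simp add: case_prod_beta'\<close>)
 have wt[measurable]: "w t : Borel" for t using measurable_Pair2[OF wm, of t] by simp
 have W: "hs s (w t)" "hsn s (w t) <= D" if t: "t : {0..T}" for t
 proof -
  have L: "L2 (%x. of_real (jp s x) * v n t x)" for n using hv(1)[OF t] unfolding hs_def .
  have l: "AE x in lborel. (%n. of_real (jp s x) * v n t x) \<longlonglongrightarrow> of_real (jp s x) * w t x" by (intro AE_I2 tendsto_intros lim[OF t])
  have b: "(L2_norm (%x. of_real (jp s x) * v n t x))^2 <= D^2" for n using hv(2)[OF t, of n] unfolding hsn_def by (intro power_mono) auto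
  have "(%x. of_real (jp s x) * w t x) : Borel" by measurable
  note F = L2_Fatou[OF L this l b]
  show "hs s (w t)" unfolding hs_def by (rule F(1))
  show "hsn s (w t) <= D" unfolding hsn_def by (rule power2_le_imp_le[OF F(2) D])
 qed
 have W1: "hs 1 (w t)" if t: "t : {0..T}" for t using hs_mono(1)[OF W(1)[OF t], of 1] s by simp
 have WD: "L2_norm (w t) <= D" if t: "t : {0..T}" for t using hs_L2(2)[OF W(1)[OF t]] W(2)[OF t] s by simp
 have wrate: "L2_norm (%x. v n t x - w t x) <= 2 * Q / ?m n" if t: "t : {0..T}" for n t
 proof -
  have L: "L2 (%x. v n t x - v (k + n) t x)" for k using vL(1)[OF t] by (intro L2_diff)
  have l: "AE x in lborel. (%k. v n t x - v (k + n) t x) \<longlonglongrightarrow> v n t x - w t x"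
   by (intro AE_I2 tendsto_intros LIMSEQ_ignore_initial_segment lim[OF t])
  have b: "(L2_norm (%x. v n t x - v (k + n) t x))^2 <= (2 * Q / ?m n)^2" for k
  proof (rule power_mono)
   have "1 / ?m (k + n) <= 1 / ?m n" using m[of n] by (intro divide_left_mono mult_pos_pos) auto
   hence "Q * ?r n (k + n) <= Q * (2 / ?m n)" using Q0 by (intro mult_left_mono) auto
   thus "L2_norm (%x. v n t x - v (k + n) t x) <= 2 * Q / ?m n" using L2rate[OF t, of n "k + n"] by (simp add: mult_ac)
  qed simp
  have "(%x. v n t x - w t x) : Borel" using L2_measurable[OF vL(1)[OF t, of n]] by measurable
  from L2_Fatou(2)[OF L this l b] show ?thesis by (rule power2_le_imp_le) (use Q0 m[of n] in \<open>simp add: less_imp_le\<close>)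
 qed
 have wprate: "cmod (v n t x - w t x) <= 2 * \<bar>x\<bar> * P / ?m n" if t: "t : {0..T}" and n: "\<bar>x\<bar> <= ?m n" for n t x
 proof (rule LIMSEQ_le_const2)
  show "(%k. cmod (v n t x - v k t x)) \<longlonglongrightarrow> cmod (v n t x - w t x)" by (intro tendsto_intros lim[OF t])
  have "cmod (v n t x - v k t x) <= 2 * \<bar>x\<bar> * P / ?m n" if k: "n <= k" for k
  proof -
   have "1 / ?m k <= 1 / ?m n" using m[of n] k by (intro divide_left_mono mult_pos_pos) auto
   hence "\<bar>x\<bar> * P * ?r n k <= \<bar>x\<bar> * P * (2 / ?m n)" using P0 by (intro mult_left_mono) auto
   thus ?thesis using prate[OF t n, of k] n k by (simp add: mult_ac)
  qed
  thus "EX N. ALL k>=N. cmod (v n t x - v k t x) <= 2 * \<bar>x\<bar> * P / ?m n" by blast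
 qed
 define c where "c = (%x. B * (2 * \<bar>x\<bar> * P) + \<bar>x\<bar> * D * (2 * Q))"
 have frate: "cmod (f n t x - h t x) <= c x / ?m n" if t: "t : {0..T}" and n: "\<bar>x\<bar> <= ?m n" for n t x
 proof -
  have "f n t x = - \<i> * of_real (\<mu> x) * v n t x - burg (v n t) x"
   using galerkinD(5)[OF G[of n] t, of x] n by (simp add: indicator_def abs_le_iff)
  hence "f n t x - h t x = - \<i> * of_real (\<mu> x) * (v n t x - w t x) - (burg (v n t) x - burg (w t) x)"
   unfolding h_def by (simp only:) (simp add: algebra_simps)
  hence "cmod (f n t x - h t x) <= \<bar>\<mu> x\<bar> * cmod (v n t x - w t x) + cmod (burg (v n t) x - burg (w t) x)"
   using norm_triangle_ineq4[of "- \<i> * of_real (\<mu> x) * (v n t x - w t x)" "burg (v n t) x - burg (w t) x"] by (simp add: norm_mult)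
  also have "... <= B * (2 * \<bar>x\<bar> * P / ?m n) + \<bar>x\<bar> * D * (2 * Q / ?m n)"
  proof (intro add_mono)
   show "\<bar>\<mu> x\<bar> * cmod (v n t x - w t x) <= B * (2 * \<bar>x\<bar> * P / ?m n)"
    using \<mu>(2)[of x] by (intro mult_mono wprate t n) auto
   show "cmod (burg (v n t) x - burg (w t) x) <= \<bar>x\<bar> * D * (2 * Q / ?m n)"
    using mult_left_mono[OF wrate[OF t, of n], of "\<bar>x\<bar> * D"] D
    by (intro order_trans[OF burg_diff_bound[OF v1[OF t] W1[OF t] vL(2)[OF t] WD[OF t]]]) simp
  qed
  also have "... = c x / ?m n" by (simp add: c_def add_divide_distrib)
  finally show ?thesis .
 qed
 \<comment> \<open>Uniformity in time at a fixed frequency is what differentiating the limit of the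
   \<open>v n\<close> requires.\<close>
 have unif: "\<forall>\<^sub>F n in sequentially. ALL t:{0..T}. cmod (f n t x - h t x) < e" if e: "0 < e" for e x
 proof -
  have "\<forall>\<^sub>F n in sequentially. c x / ?m n < e" using e by (intro order_tendstoD[OF minv])
  thus ?thesis using ev[of x] by eventually_elim (use frate order_le_less_trans in blast)
 qed
 have hc: "continuous_on {0..T} (%t. h t x)" for x
 proof (rule uniform_limit_theorem)
  show "\<forall>\<^sub>F n in sequentially. continuous_on {0..T} (%t. f n t x)" using flowD(4)[OF galerkinD(1)[OF G]] T by (intro always_eventually) auto
  show "uniform_limit {0..T} (%n t. f n t x) (%t. h t x) sequentially" unfolding uniform_limit_iff dist_norm using unif by blast
 qed simp
 have hd: "((%t. w t x) has_vector_derivative h t x) (at t within {0..T})" if t: "t : {0..T}" for t x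
 proof -
  have "EX g. ALL t:{0..T}. (%n. v n t x) \<longlonglongrightarrow> g t & (g has_derivative (%y. y *\<^sub>R h t x)) (at t within {0..T})"
  proof (rule has_derivative_sequence[where f'="%n t y. y *\<^sub>R f n t x"])
   show "((%t. v n t x) has_derivative (%y. y *\<^sub>R f n q x)) (at q within {0..T})" if q: "q : {0..T}" for n q
    using flowD(3)[OF galerkinD(1)[OF G q] q] unfolding has_vector_derivative_def .
   show "\<forall>\<^sub>F n in sequentially. ALL q:{0..T}. ALL y. norm (y *\<^sub>R f n q x - y *\<^sub>R h q x) <= e * norm y" if e: "0 < e" for e
    using unif[OF e, of x]
   proof eventually_elim
    case (elim n)
    show ?case
    proof (intro ballI allI)
     fix q y assume "q : {0..T}"
     thus "norm (y *\<^sub>R f n q x - y *\<^sub>R h q x) <= e * norm y"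
      using elim mult_left_mono[of "cmod (f n q x - h q x)" e "\<bar>y\<bar>"] by (simp add: mult.commute less_imp_le flip: scaleR_diff_right)
    qed
   qed
  qed (use t lim[OF t] in auto)
  then obtain g where g: "!!t. t : {0..T} ==> (%n. v n t x) \<longlonglongrightarrow> g t" "(g has_vector_derivative h t x) (at t within {0..T})"
   using t unfolding has_vector_derivative_def by blast
  show ?thesis by (rule has_vector_derivative_transform[OF t _ g(2)]) (use g(1) lim LIMSEQ_unique in blast)
 qed
 show ?thesis
 proof (rule that)
  have hm: "(%(t, x). h t x) : Borel2"
   using wm burg_measurable_param[OF wm] \<mu>(1) unfolding h_def case_prod_beta' by measurable
  have fl: "flow T w h" unfolding flow_def using wm hm hd hc by blast
  have hw: "herm (w t)" if t: "t : {0..T}" for t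
   unfolding herm_def
  proof
   fix x
   have "(%n. v n t (- x)) \<longlonglongrightarrow> cnj (w t x)"
    using tendsto_cnj[OF lim[OF t, of x]] galerkinD(2)[OF G t] unfolding herm_def by simp
   thus "w t (- x) = cnj (w t x)" using lim[OF t, of "- x"] LIMSEQ_unique by blast
  qed
  have tail: "EX R>0. ALL t:{0..T}. (Lint x. tw s R x * (cmod (w t x))^2) <= \<epsilon>" if \<epsilon>: "0 < \<epsilon>" for \<epsilon>
  proof -
   obtain R where R: "0 < R" "(Lint x. tw s R x * (cmod (a x))^2) <= \<epsilon> / \<kappa>"
    using tail_small[OF a, of "\<epsilon> / \<kappa>"] \<epsilon> \<kappa> by auto
   have sq: "(norm (of_real (sqrt (tw s R x)) * z))^2 = tw s R x * (cmod z)^2" for x z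
    by (simp add: norm_mult power_mult_distrib)
   have "(Lint x. tw s R x * (cmod (w t x))^2) <= \<epsilon>" if t: "t : {0..T}" for t
   proof -
    have L: "L2 (%x. of_real (sqrt (tw s R x)) * v n t x)" for n
     using tail_integrable[OF hv(1)[OF t] R(1)] L2_measurable[OF vL(1)[OF t, of n]] by (intro L2I) (simp_all add: sq)
    have l: "AE x in lborel. (%n. of_real (sqrt (tw s R x)) * v n t x) \<longlonglongrightarrow> of_real (sqrt (tw s R x)) * w t x" by (intro AE_I2 tendsto_intros lim[OF t])
    have wgt: "weight K (tw s R)"
     using weight_mult[OF weight_jp[OF _ K(2)] weight_tail[OF R(1)]] s unfolding tw_def[abs_def] K_def by simp
    have b: "(L2_norm (%x. of_real (sqrt (tw s R x)) * v n t x))^2 <= \<epsilon>" for n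
    proof -
     have "(Lint x. tw s R x * (cmod (v n t x))^2) <= 2 * (Lint x. tw s R x * (cmod (a x))^2) * exp (2 * (2 * 2 ^ K * M + 1) * T)"
      by (rule galerkin_weight[OF G less_imp_le[OF m] \<mu> tw_measurable wgt tail_integrable[OF a R(1)] vM t])
     also have "... = \<kappa> * (Lint x. tw s R x * (cmod (a x))^2)" by (simp add: \<kappa>_def)
     also have "... <= \<epsilon>" using mult_left_mono[OF R(2), of \<kappa>] \<kappa> by simp
     finally show ?thesis unfolding L2_norm_sq sq .
    qed
    have "(%x. of_real (sqrt (tw s R x)) * w t x) : Borel" by measurable
    from L2_Fatou(2)[OF L this l b] show ?thesis unfolding L2_norm_sq sq .
   qed
   thus ?thesis using R(1) by blast
  qed
  show "dispersive_flow s T \<mu> D w h"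
   unfolding dispersive_flow_def using fl hw W tail by (auto simp: h_def)
  have z: "0 : {0..T}" using T by simp
  show "w 0 = a"
  proof
   fix x
   have "\<forall>\<^sub>F n in sequentially. v n 0 x = a x"
    using ev[of x] by eventually_elim (use galerkinD(6)[OF G z] in \<open>auto simp: indicator_def abs_le_iff\<close>)
   hence "(%n. v n 0 x) \<longlonglongrightarrow> a x" by (rule tendsto_eventually)
   thus "w 0 x = a x" using lim[OF z, of x] LIMSEQ_unique by blast
  qed
 qed
qed

lemma burg_diff_hs:
 assumes a: "hs s a" "hsn s a <= D" and b: "hs s b" "hsn s b <= D" and s: "1 <= s"
 shows "hs (s - 1) (%x. burg a x - burg b x)" "hsn (s - 1) (%x. burg a x - burg b x) <= (2 * 2 powr s * c1) * D * hsn s (%x. a x - b x)"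
proof -
 note ab = hs_add[OF a(1) b(1)] hs_diff[OF a(1) b(1)]
 note P = hs_prod_ft[OF ab s]
 note S = hs_shift[OF hs_cmult[OF P(1), of "\<i> / 2"]]
 have e: "(%x. burg a x - burg b x) = (%x. of_real x * (\<i> / 2 * prod_ft (%x. a x + b x) (%x. a x - b x) x))"
  using burg_diff[OF a(1) b(1) s] by (auto simp: fun_eq_iff)
 show "hs (s - 1) (%x. burg a x - burg b x)" unfolding e by (rule S(1))
 have "hsn s (%x. a x + b x) <= 2 * D" using hsn_triangle[OF a(1) b(1)] a(2) b(2) by linarith
 hence "hsn s (%x. a x + b x) * hsn s (%x. a x - b x) <= (2 * D) * hsn s (%x. a x - b x)" by (rule mult_right_mono) simp
 hence "(2 * 2 powr s * c1) * (hsn s (%x. a x + b x) * hsn s (%x. a x - b x)) <= (2 * 2 powr s * c1) * ((2 * D) * hsn s (%x. a x - b x))"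
  by (rule mult_left_mono) simp
 hence "hsn s (prod_ft (%x. a x + b x) (%x. a x - b x)) <= 2 * ((2 * 2 powr s * c1) * D * hsn s (%x. a x - b x))"
  using P(2) by (simp add: mult_ac)
 thus "hsn (s - 1) (%x. burg a x - burg b x) <= (2 * 2 powr s * c1) * D * hsn s (%x. a x - b x)"
  using S(2) unfolding e hsn_cmult by (simp add: norm_divide)
qed

lemma multiplier_hs:
 assumes g: "hs s g" and \<mu>: "\<mu> : Borel" "!!x. \<bar>\<mu> x\<bar> <= B"
 shows "hs s (%x. - \<i> * of_real (\<mu> x) * g x)" "hsn s (%x. - \<i> * of_real (\<mu> x) * g x) <= B * hsn s g"
proof -
 note [measurable] = hs_measurable[OF g] \<mu>(1)
 have m: "(%x. - \<i> * of_real (\<mu> x) * g x) : Borel" by measurable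
 have b: "jp s x * cmod (- \<i> * of_real (\<mu> x) * g x) <= B * (jp s x * cmod (g x))" for x
  using mult_right_mono[OF \<mu>(2)[of x], of "jp s x * cmod (g x)"] by (simp add: norm_mult mult_ac)
 have B: "0 <= B" using \<mu>(2)[of 0] by linarith
 show "hs s (%x. - \<i> * of_real (\<mu> x) * g x)" "hsn s (%x. - \<i> * of_real (\<mu> x) * g x) <= B * hsn s g"
  by (rule hs_bound[OF g m b B])+
qed

lemma disp_measurable[measurable]: "disp B b : Borel"
 unfolding disp_def[abs_def] by measurable

lemma disp_bound: assumes "0 < b" "0 < B" shows "\<bar>disp B b x\<bar> <= B"
proof -
 have "2 * (b * \<bar>x\<bar>) <= b^2 + x^2" using sum_squares_bound[of b "\<bar>x\<bar>"] by simp
 from mult_left_mono[OF this, of B] show ?thesis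
  unfolding disp_def using assms by (simp add: abs_mult divide_le_eq add_pos_nonneg mult_ac)
qed

lemma burg_rep:
 assumes r: "rep s f g" and s: "2 <= s"
 shows "ift (burg g) x = of_real (f x * deriv f x)" "L1 (burg g)"
proof -
 have s': "1 <= s" "1 <= s - 1" using s by auto
 let ?p = "prod_ft g g"
 have rp: "rep s (%x. f x * f x) ?p"
  unfolding rep_def using hs_prod_ft(1)[OF repD(1)[OF r] repD(1)[OF r] s'(1)] prod_ft_hermitian[of g] repD(2)[OF r] rep_mult[OF r r s'(1)] by (simp add: herm_def)
 have dq: "deriv (%x. f x * f x) x = 2 * (f x * deriv f x)"
  by (rule DERIV_imp_deriv, rule DERIV_cong[OF DERIV_mult[OF rep_deriv(1)[OF r s] rep_deriv(1)[OF r s]]]) simp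
 have Q: "of_real (2 * (f x * deriv f x)) = ift (%x. \<i> * (of_real x * ?p x)) x" using repD(3)[OF rep_deriv(2)[OF rp s], of x] unfolding dq .
 have e: "burg g = (%x. (1 / 2) * (\<i> * (of_real x * ?p x)))" by (auto simp: burg_def)
 have "ift (burg g) x = (1 / 2) * ift (%x. \<i> * (of_real x * ?p x)) x" unfolding e by (rule ift_cmult)
 thus "ift (burg g) x = of_real (f x * deriv f x)" unfolding Q[symmetric] by simp
 show "L1 (burg g)" by (rule hs_integrable(1)[OF hs_burg(1)[OF repD(1)[OF r] s'(1)] s'(2)])
qed

lemma disp_rep:
 assumes r: "rep s f g" and s: "2 <= s" and b: "0 < b" "0 < B"
 shows "of_real (Lint y. B * exp (- b * \<bar>x - y\<bar>) * deriv f y) = ift (%x. \<i> * of_real (disp B b x) * g x) x"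
  "L1 (%x. \<i> * of_real (disp B b x) * g x)"
proof -
 show "of_real (Lint y. B * exp (- b * \<bar>x - y\<bar>) * deriv f y) = ift (%x. \<i> * of_real (disp B b x) * g x) x"
  by (rule dispersive_operator[OF b(1) hs_integrable_1(1)[OF repD(1)[OF r] s] repD(3)[OF rep_deriv(2)[OF r s]]])
 have "L1 (%x. - \<i> * of_real (disp B b x) * g x)"
  by (rule hs_integrable(1)[OF multiplier_hs(1)[OF repD(1)[OF r] disp_measurable disp_bound[OF b]]]) (use s in simp)
 from integrable_minus[OF this] show "L1 (%x. \<i> * of_real (disp B b x) * g x)" by simp
qed

section \<open>Continuity and differentiability in Sobolev norms\<close>

locale dispersive_solution =
 fixes s T B b D :: real and w h :: "real => real => complex"
 assumes s: "3 <= s" and T: "0 <= T" and b: "0 < b" and B: "0 < B" and F: "dispersive_flow s T (disp B b) D w h"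
begin

lemma fl: "flow T w h" using F unfolding dispersive_flow_def by blast

lemma W: assumes "t : {0..T}"
 shows "herm (w t)" "hs s (w t)" "hsn s (w t) <= D" "h t = (%x. - \<i> * of_real (disp B b x) * w t x - burg (w t) x)"
 using F assms unfolding dispersive_flow_def by auto

lemma D: "0 <= D" using W(3)[of 0] T order_trans[OF hsn_nonneg] by simp

lemmas disp_bound = disp_bound[OF b B]

lemma h_diff:
 assumes t: "t : {0..T}" "r : {0..T}"
 shows "hs (s - 1) (%x. h r x - h t x)" "hsn (s - 1) (%x. h r x - h t x) <= (B + 2 * 2 powr s * c1 * D) * hsn s (%x. w r x - w t x)"
proof -
 let ?d = "%x. w r x - w t x"
 have d: "hs s ?d" using W(2)[OF t(1)] W(2)[OF t(2)] by (intro hs_diff)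
 note d1 = hs_mono[OF d, of "s - 1", simplified]
 note m = multiplier_hs[OF d1(1) disp_measurable disp_bound]
 have s1: "1 <= s" using s by simp
 note q = burg_diff_hs[OF W(2,3)[OF t(2)] W(2,3)[OF t(1)] s1]
 have e: "(%x. h r x - h t x) = (%x. - \<i> * of_real (disp B b x) * ?d x - (burg (w r) x - burg (w t) x))"
  unfolding W(4)[OF t(1)] W(4)[OF t(2)] by (auto simp: algebra_simps)
 show "hs (s - 1) (%x. h r x - h t x)" unfolding e by (rule hs_diff[OF m(1) q(1)])
 have "B * hsn (s - 1) ?d <= B * hsn s ?d" using d1(2) B by (intro mult_left_mono) auto
 thus "hsn (s - 1) (%x. h r x - h t x) <= (B + 2 * 2 powr s * c1 * D) * hsn s ?d"
  unfolding e distrib_right using hsn_triangle_diff[OF m(1) q(1)] m(2) q(2) by linarith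
qed

lemma h_L2: assumes t: "t : {0..T}" shows "L2 (h t) & L2_norm (h t) <= B * D + cb * D^2 + 0"
proof (rule approx_solI(3)[OF fl disp_measurable disp_bound _ _ _ t, where e="%t x. 0"])
 fix t assume t: "t : {0..T}"
 show "herm (w t) & hs 2 (w t) & hsn 2 (w t) <= D" using W[OF t] hs_mono[OF W(2)[OF t], of 2] s by simp
 show "L2 (%x::real. 0::complex) & L2_norm (%x::real. 0::complex) <= 0" by (simp add: L2_def L2_norm_def)
qed (simp add: W(4))

lemma w_Lipschitz:
 assumes t: "t : {0..T}" "r : {0..T}"
 shows "L2_norm (%x. w r x - w t x) <= (B * D + cb * D^2) * \<bar>r - t\<bar>"
proof -
 have L: "L2_norm (%x. w r x - w t x) <= (B * D + cb * D^2 + 0) * (r - t)" if "0 <= t" "t <= r" "r <= T" for r t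
  by (rule flow_Lipschitz(2)[OF fl h_L2 that]) (use that in simp)
 show ?thesis
 proof (cases "t <= r")
  case True thus ?thesis using L[of t r] t by simp
 next
  case False thus ?thesis unfolding L2_norm_minus_commute[of "w r" "w t"] using L[of r t] t by simp
 qed
qed

text \<open>Low frequencies are controlled by the Lipschitz bound in L^2, high frequencies by the
  uniform tails. Tails of at most \<open>e^2 / 32\<close> at both times give at most
  \<open>e^2 / 8\<close> for the difference; this enters with factor 2, and together with
  \<open>(e / 2)^2\<close> for the low part the total is \<open>e^2 / 2\<close>.\<close>

lemma w_continuous:
 assumes t: "t : {0..T}" shows "((%r. hsn s (%x. w r x - w t x)) \<longlongrightarrow> 0) (at t within {0..T})"
 unfolding tendsto_iff eventually_at
proof (intro allI impI)
 fix e :: real assume e: "0 < e"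
 obtain R where R: "0 < R" "!!t. t : {0..T} ==> (Lint x. tw s R x * (cmod (w t x))^2) <= e^2 / 32"
  using F e unfolding dispersive_flow_def by (metis zero_less_divide_iff zero_less_numeral zero_less_power)
 define c where "c = jp s R * (B * D + cb * D^2) + 1"
 have c: "0 < c" using B D by (simp add: c_def add_nonneg_pos)
 have "dist (hsn s (%x. w r x - w t x)) 0 < e" if r: "r : {0..T}" "r ~= t & dist r t < e / (2 * c)" for r
 proof -
  let ?d = "%x. w r x - w t x"
  have d: "hs s ?d" using W(2)[OF t] W(2)[OF r(1)] by (intro hs_diff)
  have dL: "L2 ?d" using hs_L2[OF d] s by simp
  note it = tail_integrable[OF _ R(1)]
  have "(Lint x. tw s R x * (cmod (?d x))^2) <= (Lint x. 2 * (tw s R x * (cmod (w r x))^2) + 2 * (tw s R x * (cmod (w t x))^2))"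
  proof (rule integral_mono[OF it[OF d]])
   show "L1 (%x. 2 * (tw s R x * (cmod (w r x))^2) + 2 * (tw s R x * (cmod (w t x))^2))"
    using it[OF W(2)[OF t]] it[OF W(2)[OF r(1)]] by simp
   show "tw s R x * (cmod (?d x))^2 <= 2 * (tw s R x * (cmod (w r x))^2) + 2 * (tw s R x * (cmod (w t x))^2)" for x
    using mult_left_mono[OF norm_diff_sq_le[of "w r x" "w t x"] tw_nonneg[of s R x]] by (simp add: distrib_left mult_ac)
  qed
  also have "... = 2 * (Lint x. tw s R x * (cmod (w r x))^2) + 2 * (Lint x. tw s R x * (cmod (w t x))^2)"
   using it[OF W(2)[OF t]] it[OF W(2)[OF r(1)]] by simp
  also have "... <= e^2 / 8" using R(2)[OF t] R(2)[OF r(1)] by simp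
  finally have tail: "(Lint x. tw s R x * (cmod (?d x))^2) <= e^2 / 8" .
  have "(hsn s ?d)^2 <= (Lint x. (jp s R)^2 * (norm (?d x))^2 + 2 * (tw s R x * (cmod (?d x))^2))"
   unfolding hsn_sq
  proof (rule integral_mono[OF hs_integrable_sq[OF d]])
   show "L1 (%x. (jp s R)^2 * (norm (?d x))^2 + 2 * (tw s R x * (cmod (?d x))^2))"
    using it[OF d] L2_integrable[OF dL] by simp
   have s0: "0 <= s" using s by simp
   show "(1 + x^2) powr s * (cmod (?d x))^2 <= (jp s R)^2 * (norm (?d x))^2 + 2 * (tw s R x * (cmod (?d x))^2)" for x
    using mult_right_mono[OF tail_weight_split[OF R(1) s0, of x], of "(cmod (?d x))^2"] unfolding distrib_right mult.assoc by simp
  qed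
  also have "... = (jp s R * L2_norm ?d)^2 + 2 * (Lint x. tw s R x * (cmod (?d x))^2)"
   using it[OF d] L2_integrable[OF dL] by (simp add: power_mult_distrib L2_norm_sq)
  also have "(jp s R * L2_norm ?d)^2 <= (e / 2)^2"
  proof (rule power_mono)
   have "jp s R * L2_norm ?d <= jp s R * ((B * D + cb * D^2) * \<bar>r - t\<bar>)" by (rule mult_left_mono[OF w_Lipschitz[OF t r(1)]]) simp
   also have "... <= c * \<bar>r - t\<bar>" unfolding c_def mult.assoc[symmetric] by (rule mult_right_mono) auto
   also have "... <= e / 2" using r(2) c by (simp add: dist_real_def field_simps)
   finally show "jp s R * L2_norm ?d <= e / 2" .
  qed simp
  finally have "(hsn s ?d)^2 <= e^2 / 2" using tail by (simp add: power_divide)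
  also have "... < e^2" using e by simp
  finally show ?thesis using power_less_imp_less_base[of _ 2 e] e by simp
 qed
 thus "EX d>0. ALL r:{0..T}. r ~= t & dist r t < d --> dist (hsn s (%x. w r x - w t x)) 0 < e"
  using e c by (intro exI[of _ "e / (2 * c)"]) auto
qed

lemma h_continuous:
 assumes t: "t : {0..T}" shows "((%r. hsn (s - 1) (%x. h r x - h t x)) \<longlongrightarrow> 0) (at t within {0..T})"
proof (rule tendsto_sandwich[OF always_eventually _ tendsto_const])
 show "((%r. (B + 2 * 2 powr s * c1 * D) * hsn s (%x. w r x - w t x)) \<longlongrightarrow> 0) (at t within {0..T})"
  using tendsto_mult_left[OF w_continuous[OF t]] by fastforce
 show "\<forall>\<^sub>F r in at t within {0..T}. hsn (s - 1) (%x. h r x - h t x) <= (B + 2 * 2 powr s * c1 * D) * hsn s (%x. w r x - w t x)"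
  using h_diff(2)[OF t] by (auto simp: eventually_at_filter)
qed simp

lemma w_derivative:
 assumes t: "t : {0..T}"
 shows "((%r. hsn (s - 1) (%x. of_real (1 / (r - t)) * (w r x - w t x) - h t x)) \<longlongrightarrow> 0) (at t within {0..T})"
 unfolding tendsto_iff eventually_at
proof (intro allI impI)
 fix e :: real assume e: "0 < e"
 obtain d where d: "0 < d" "!!r. r : {0..T} ==> \<bar>r - t\<bar> < d ==> hsn (s - 1) (%x. h r x - h t x) <= e / 2"
 proof -
  obtain d where d: "0 < d" "ALL r:{0..T}. r ~= t & dist r t < d --> dist (hsn (s - 1) (%x. h r x - h t x)) 0 < e / 2"
   using h_continuous[OF t, unfolded tendsto_iff eventually_at] half_gt_zero[OF e] by blast
  have "hsn (s - 1) (%x. h r x - h t x) <= e / 2" if "r : {0..T}" "\<bar>r - t\<bar> < d" for r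
  proof (cases "r = t")
   case True thus ?thesis using e by (simp add: hsn_def L2_norm_def)
  next
   case False thus ?thesis using d(2)[rule_format, of r] that by (simp add: dist_real_def)
  qed
  thus ?thesis using that d(1) by blast
 qed
 \<comment> \<open>Subtracting the linear motion with velocity \<open>h t\<close> leaves a curve
   with velocity \<open>h r - h t\<close>, which is small near \<open>t\<close> in the weighted
   norm. The Lipschitz bound for this curve is the claimed differentiability.\<close>
 let ?G = "%r x. of_real (jp (s - 1) x) * (w r x - of_real r * h t x)" and ?H = "%r x. of_real (jp (s - 1) x) * (h r x - h t x)"
 have ht[measurable]: "h t : Borel" by (rule flow_measurable(2)[OF fl])
 have G: "flow T ?G ?H"
  unfolding flow_def
 proof (intro conjI allI ballI)
  note [measurable] = flowD(1,2)[OF fl]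
  show "(%(r, x). ?G r x) : Borel2" unfolding case_prod_beta' by measurable
  show "(%(r, x). ?H r x) : Borel2" unfolding case_prod_beta' by measurable
  fix x
  show "continuous_on {0..T} (%r. ?H r x)" using flowD(4)[OF fl] by (intro continuous_intros)
  fix r assume r: "r : {0..T}"
  have "((%r. of_real r * h t x) has_vector_derivative of_real 1 * h t x) (at r within {0..T})"
   by (intro has_vector_derivative_mult_left has_vector_derivative_of_real) (auto intro!: derivative_eq_intros)
  thus "((%r. ?G r x) has_vector_derivative ?H r x) (at r within {0..T})"
   by (intro has_vector_derivative_mult_right has_vector_derivative_diff flowD(3)[OF fl r]) simp
 qed
 have Hb: "L2 (?H r) & L2_norm (?H r) <= e / 2" if "r : {0..T}" "\<bar>r - t\<bar> < d" for r
  using h_diff(1)[OF t that(1)] d(2)[OF that] unfolding hs_def hsn_def by simp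
 have K: "L2_norm (%x. ?G r x - ?G t x) <= e / 2 * \<bar>r - t\<bar>" if r: "r : {0..T}" "\<bar>r - t\<bar> < d" for r
 proof (cases "t <= r")
  case True
  have "L2_norm (%x. ?G r x - ?G t x) <= e / 2 * (r - t)" by (rule flow_Lipschitz(2)[OF G Hb]) (use True r t in auto)
  thus ?thesis using True by simp
 next
  case False
  have "L2_norm (%x. ?G t x - ?G r x) <= e / 2 * (t - r)" by (rule flow_Lipschitz(2)[OF G Hb]) (use False r t in auto)
  thus ?thesis unfolding L2_norm_minus_commute[of "?G r" "?G t"] using False by simp
 qed
 have "dist (hsn (s - 1) (%x. of_real (1 / (r - t)) * (w r x - w t x) - h t x)) 0 < e" if r: "r : {0..T}" "r ~= t" "dist r t < d" for r
 proof -
  have eq: "(%x. ?G r x - ?G t x) = (%x. of_real (r - t) * (of_real (jp (s - 1) x) * (of_real (1 / (r - t)) * (w r x - w t x) - h t x)))"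
  proof
   fix x
   have "of_real (r - t) * (of_real (1 / (r - t)) * (w r x - w t x)) = w r x - w t x" using r(2) by (simp flip: of_real_mult mult.assoc)
   hence "of_real (r - t) * (of_real (1 / (r - t)) * (w r x - w t x) - h t x) = w r x - w t x - of_real (r - t) * h t x" by (simp only: right_diff_distrib)
   thus "?G r x - ?G t x = of_real (r - t) * (of_real (jp (s - 1) x) * (of_real (1 / (r - t)) * (w r x - w t x) - h t x))"
    unfolding mult.left_commute[of "of_real (r - t)"] by (simp only:) (simp add: algebra_simps)
  qed
  have "\<bar>r - t\<bar> * hsn (s - 1) (%x. of_real (1 / (r - t)) * (w r x - w t x) - h t x) <= \<bar>r - t\<bar> * (e / 2)"
   using K[OF r(1)] r(3) unfolding eq L2_norm_cmult hsn_def norm_of_real dist_real_def by (simp add: mult.commute)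
  hence "hsn (s - 1) (%x. of_real (1 / (r - t)) * (w r x - w t x) - h t x) <= e / 2" using r(2) by (simp only: mult_le_cancel_left)
  thus ?thesis using e by simp
 qed
 thus "EX d>0. ALL r:{0..T}. r ~= t & dist r t < d --> dist (hsn (s - 1) (%x. of_real (1 / (r - t)) * (w r x - w t x) - h t x)) 0 < e"
  using d(1) by blast
qed

definition u where "u t x = Re (ift (w t) x)"
definition ut where "ut t x = Re (ift (h t) x)"

lemma reps: assumes t: "t : {0..T}" shows "rep s (u t) (w t)" "rep (s - 1) (ut t) (h t)"
proof -
 note W = W[OF t]
 show "rep s (u t) (w t)" unfolding u_def by (rule repI[OF W(2,1)])
 have o: "herm (%x. \<i> * of_real (disp B b x) * w t x)" by (rule herm_odd[OF W(1)]) (simp add: disp_def)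
 have "hs (s - 1) (%x. - \<i> * of_real (disp B b x) * w t x - burg (w t) x)"
  using hs_mono(1)[OF multiplier_hs(1)[OF W(2) disp_measurable disp_bound], of "s - 1"] hs_burg(1)[OF W(2)] s by (intro hs_diff) auto
 moreover have "herm (%x. - \<i> * of_real (disp B b x) * w t x - burg (w t) x)"
  using herm_diff[OF herm_uminus[OF o] burg_herm[OF W(1)]] by simp
 ultimately show "rep (s - 1) (ut t) (h t)" unfolding ut_def[abs_def] by (intro repI) (simp_all only: W(4))
qed

lemma equation: assumes t: "t : {0..T}"
 shows "ut t x + u t x * deriv (u t) x + (Lint y. B * exp (- b * \<bar>x - y\<bar>) * deriv (u t) y) = 0"
proof -
 note r = reps[OF t]
 have s': "2 <= s" using s by auto
 note bw = burg_rep[OF r(1) s'] and L = disp_rep[OF r(1) s' b B]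
 have "of_real (ut t x) = ift (%x. - (\<i> * of_real (disp B b x) * w t x) - burg (w t) x) x" using repD(3)[OF r(2), of x] unfolding W(4)[OF t] by simp
 also have "... = - ift (%x. \<i> * of_real (disp B b x) * w t x) x - ift (burg (w t)) x"
  using ift_diff[OF integrable_minus[OF L(2)] bw(2)] by (simp add: ift_uminus)
 finally have "cor (ut t x) = of_real (- (Lint y. B * exp (- b * \<bar>x - y\<bar>) * deriv (u t) y) - u t x * deriv (u t) x)"
  unfolding L(1)[symmetric] bw(1) by simp
 thus ?thesis unfolding of_real_eq_iff by simp
qed

lemma solution: assumes u0: "!!x. of_real (u0 x) = ift (w 0) x" shows "is_solution s B b u0 (ereal T) u"
proof -
 let ?I = "time_interval (ereal T)"
 have I: "?I \<subseteq> {0..T}" by (auto simp: time_interval_def)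
 have s1: "1 <= s - 1" using s by simp
 have "\<forall>\<^sub>F r in at t within ?I. r : ?I & r ~= t" for t by (simp add: eventually_at_filter)
 hence ev: "\<forall>\<^sub>F r in at t within ?I. r : {0..T} & r ~= t" for t by (rule eventually_mono) (use I in blast)
 have within: "(f \<longlongrightarrow> 0) (at t within ?I)" if "(g \<longlongrightarrow> 0) (at t within {0..T})" "!!r. r : {0..T} ==> r ~= t ==> f r = g r" for f g :: "real => real" and t
 proof (rule Lim_transform_eventually[OF tendsto_within_subset[OF that(1) I]])
  show "\<forall>\<^sub>F r in at t within ?I. g r = f r" using ev by eventually_elim (use that(2) in auto)
 qed
 have 1: "continuous_into_sobolev s ?I u"
  unfolding continuous_into_sobolev_def
 proof (intro conjI ballI)
  fix t assume "t : ?I"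
  hence t: "t : {0..T}" using I by blast
  show "u t : sobolev s" using rep_sobolev(1)[OF reps(1)[OF t]] s by simp
  show "((%r. sobolev_norm s (%x. u r x - u t x)) \<longlongrightarrow> 0) (at t within ?I)"
   by (rule within[OF w_continuous[OF t]], rule rep_sobolev(2)[OF rep_diff[OF reps(1) reps(1)[OF t]]]) (use s in auto)
 qed
 have 2: "continuous_into_sobolev (s - 1) ?I ut"
  unfolding continuous_into_sobolev_def
 proof (intro conjI ballI)
  fix t assume "t : ?I"
  hence t: "t : {0..T}" using I by blast
  show "ut t : sobolev (s - 1)" using rep_sobolev(1)[OF reps(2)[OF t] s1] by simp
  show "((%r. sobolev_norm (s - 1) (%x. ut r x - ut t x)) \<longlongrightarrow> 0) (at t within ?I)"
   by (rule within[OF h_continuous[OF t]], rule rep_sobolev(2)[OF rep_diff[OF reps(2) reps(2)[OF t] s1] s1]) auto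
 qed
 have 3: "has_sobolev_time_derivative (s - 1) ?I u ut"
  unfolding has_sobolev_time_derivative_def
 proof
  fix t assume "t : ?I"
  hence t: "t : {0..T}" using I by blast
  show "((%r. sobolev_norm (s - 1) (%x. (u r x - u t x) / (r - t) - ut t x)) \<longlongrightarrow> 0) (at t within ?I)"
  proof (rule within[OF w_derivative[OF t]])
   fix r assume r: "r : {0..T}" "r ~= t"
   have m: "rep (s - 1) (u q) (w q)" if "q : {0..T}" for q using rep_mono[OF reps(1)[OF that]] by simp
   show "sobolev_norm (s - 1) (%x. (u r x - u t x) / (r - t) - ut t x) = hsn (s - 1) (%x. of_real (1 / (r - t)) * (w r x - w t x) - h t x)"
    using rep_sobolev(2)[OF rep_diff[OF rep_scale[OF rep_diff[OF m[OF r(1)] m[OF t] s1], of "1 / (r - t)"] reps(2)[OF t] s1] s1 order_refl] by simp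
  qed
 qed
 have "u 0 x = u0 x" for x unfolding u_def u0[symmetric] by simp
 moreover have "ALL t x. 0 < t & ereal t < ereal T --> ut t x + u t x * deriv (u t) x + (Lint y. B * exp (- b * \<bar>x - y\<bar>) * deriv (u t) y) = 0"
  using equation by simp
 ultimately show ?thesis unfolding is_solution_def using 1 2 3 by blast
qed

end

text \<open>The smallness condition involves only the multiplier and the Burgers transform
  \<open>g\<close>, which is independent of \<open>B\<close> and \<open>b\<close>. The two limits of
  the theorem therefore differ, for the lower bound, only in how that condition is verified.\<close>

lemma existence_before_breaking:
 assumes s: "3 <= s" and u0: "rep s u0 a" and T: "0 <= T" and \<delta>: "0 < \<delta>" "!!x. \<delta> <= 1 + T * deriv u0 x"
 obtains C \<eta> g where "0 < \<eta>" "0 <= C" "!!t. t : {0..T} ==> hs 2 (g t) & hsn 2 (g t) <= C" "!!t x. t : {0..T} ==> cmod (g t x) <= cmod (a x) + C * \<bar>x\<bar>"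
  "!!B b. 0 < B ==> 0 < b ==> (!!t. t : {0..T} ==> (L2_norm (%x. of_real (disp B b x) * g t x))^2 <= \<eta>) ==> EX u. is_solution s B b u0 (ereal T) u"
proof -
 note r1 = rep_deriv[OF u0] and r2 = rep_deriv[OF rep_deriv(2)[OF u0]]
 \<comment> \<open>The last inequality is one place where \<open>s >= 3\<close> enters: it makes the
   second derivative of \<open>u0\<close> continuous.\<close>
 have s2: "2 <= s" "2 <= s - 1" "1 <= s" "1 <= s - 1" "1 <= s - 1 - 1" using s by auto
 note r3 = r2(2)[OF s2(1,2)]
 obtain M where M: "!!x. \<bar>u0 x\<bar> <= M" "!!x. \<bar>deriv u0 x\<bar> <= M"
 proof
  fix x
  have b: "\<bar>f x\<bar> <= c1 * hsn q k" if "rep q f k" "1 <= q" for f q k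
   using norm_ift_hs[OF repD(1)[OF that(1)] that(2), of x] repD(3)[OF that(1), of x, symmetric] by simp
  let ?k = "%\<xi>. \<i> * (of_real \<xi> * a \<xi>)"
  have "0 <= c1 * hsn s a" "0 <= c1 * hsn (s - 1) ?k" by simp_all
  thus "\<bar>u0 x\<bar> <= c1 * hsn s a + c1 * hsn (s - 1) ?k" "\<bar>deriv u0 x\<bar> <= c1 * hsn s a + c1 * hsn (s - 1) ?k"
   using b[OF u0 s2(3)] b[OF r1(2)[OF s2(1)] s2(4)] by linarith+
 qed
 have c: "continuous_on UNIV (deriv (deriv u0))"
  using rep_sobolev(1)[OF r3 s2(5) order_refl] unfolding sobolev_def by simp
 obtain g f C where G: "flow T g f" "g 0 = a" "0 <= C" "!!t. t : {0..T} ==> herm (g t) & hs 2 (g t) & hsn 2 (g t) <= C"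
  "!!t \<xi>. t : {0..T} ==> f t \<xi> = - burg (g t) \<xi>" "!!t \<xi>. t : {0..T} ==> cmod (g t \<xi>) <= cmod (a \<xi>) + C * \<bar>\<xi>\<bar>"
  using burgers_flow[OF r1(1)[OF s2(1)] r2(1)[OF s2(1,2)] c rep_fourier(1)[OF u0 s2(3)] rep_fourier(1)[OF r1(2)[OF s2(1)] s2(4)]
   rep_fourier(1)[OF r3 s2(5)] M T \<delta> rep_fourier(2)[OF u0 s2(3)] repD(2)[OF u0]] by metis
 have a2: "hs 2 a" by (rule hs_mono(1)[OF repD(1)[OF u0] s2(1)])
 obtain M \<eta> N where N: "0 < \<eta>" "0 < N" "0 <= M"
  "!!\<mu> B n v f t. \<mu> : Borel ==> (!!x. \<bar>\<mu> x\<bar> <= B) ==> galerkin T n \<mu> a v f ==> N <= n ==>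
   (!!t. t : {0..T} ==> (L2_norm (%x. of_real (\<mu> x) * g t x))^2 <= \<eta>) ==> t : {0..T} ==> (moment (v t)) <= M"
  by (rule galerkin_bootstrap[OF a2 T G(3,1,2,4,5)]) blast+
 show ?thesis
 proof (rule that[OF N(1) G(3) _ G(6)])
  show "hs 2 (g t) & hsn 2 (g t) <= C" if "t : {0..T}" for t using G(4)[OF that] by simp
  fix B b :: real assume B: "0 < B" and b: "0 < b"
   and small: "!!t. t : {0..T} ==> (L2_norm (%x. of_real (disp B b x) * g t x))^2 <= \<eta>"
  note db = disp_bound[OF b B]
  have nz: "b^2 + x^2 ~= 0" for x :: real using b by (simp add: add_pos_nonneg less_imp_neq[symmetric])
  have dc: "continuous_on UNIV (disp B b)" unfolding disp_def[abs_def] using nz by (intro continuous_intros) simp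
  note dm = disp_measurable[of B b]
  have "EX v f. galerkin T (N + real n) (disp B b) a v f" for n
  proof -
   have N0: "0 <= N + real n" using N(2) by simp
   have od: "disp B b (- x) = - disp B b x" for x by (simp add: disp_def)
   show ?thesis by (rule galerkin_exists[OF N0 T dc db od hs_L2(1)[OF a2 zero_le_numeral] repD(2)[OF u0]]) blast
  qed
  then obtain v f where v: "!!n. galerkin T (N + real n) (disp B b) a (v n) (f n)" by metis
  have "(Lint x. \<bar>x\<bar> * cmod (v n t x)) <= M" if "t : {0..T}" for n t
   by (rule N(4)[OF dm db v _ small that]) simp_all
  then obtain D w h where w: "dispersive_flow s T (disp B b) D w h" "w 0 = a"
   by (rule galerkin_limit[OF s2(1) T repD(1)[OF u0] N(2,3) dm db v]) blast+
  interpret dispersive_solution s T B b D w h by unfold_locales (use s T b B w in auto)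
  show "EX u. is_solution s B b u0 (ereal T) u" using solution repD(3)[OF u0] w(2) by blast
 qed
qed

section \<open>Breakdown shortly after the Burgers breaking time\<close>

text \<open>The symmetrized multiplier of the constant weight is identically 0, so the trilinear
  bound holds with \<open>K = 0\<close>.\<close>

lemma burg_energy:
 assumes g: "hs 2 g" "herm g"
 shows "(Lint x. cnj (g x) * burg g x) = 0"
proof -
 note L = hs_L2(1)[OF g(1) zero_le_numeral] and I = hs_integrable(1)[OF g(1)] and X = hs_integrable_1(1)[OF g(1) order_refl]
 have I: "L1 g" using I by simp
 note [measurable] = L2_measurable[OF L] prod_ft_measurable[OF I L I L]
 have LA: "L2 (%x. of_real (1 * x) * g x)" using hs_L2(1)[OF hs_shift(1)[OF g(1)]] by simp
 have "cmod (Lint x. cnj (g x) * (\<i> * of_real (1 * x) * cnv g g x)) <= 0 * (moment g) * (L2_norm (%x. of_real (sqrt 1) * g x))^2"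
  by (rule symmetrized_trilinear_bound[OF g(2) I L, where A="%x. 1"]) (use LA L X in simp_all)
 hence z: "(Lint x. cnj (g x) * (\<i> * of_real (1 * x) * cnv g g x)) = 0" by simp
 have "(Lint x. cnj (g x) * burg g x) = (Lint x. of_real (1 / sqrt (2 * pi) / 2) * (cnj (g x) * (\<i> * of_real (1 * x) * cnv g g x)))"
  by (rule integral_cong_AE, simp add: burg_def[abs_def], simp)
   (use prod_ft_eq_cnv[OF I L I L] in \<open>eventually_elim, simp add: burg_def\<close>)
 thus ?thesis using z by simp
qed

text \<open>Substituting \<open>b * x\<close> for \<open>x\<close> removes \<open>b\<close> from the
  multiplier, and the Jacobian leaves a factor \<open>sqrt b\<close>. Hence
  \<open>B * sqrt b\<close> governs the upper bound in both limits.\<close>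

lemma disp_L2:
 assumes b: "0 < b" "0 < B"
 shows "L2 (disp B b)" "L2_norm (disp B b) <= 2 * B * sqrt b * c1"
proof -
 have p: "(disp B b (0 + b * x))^2 <= (2 * B * jp (-1) x)^2" for x
 proof -
  have n: "b^2 ~= 0" using b by simp
  have "disp B b (0 + b * x) = (b^2 * (2 * B * x)) / (b^2 * (1 + x^2))"
   unfolding disp_def by (simp add: power_mult_distrib distrib_left power2_eq_square mult_ac)
  hence e: "disp B b (0 + b * x) = 2 * B * (x / (1 + x^2))" unfolding nonzero_mult_divide_mult_cancel_left[OF n] by simp
  have m: "jp (-2) x = 1 / (1 + x^2)" unfolding jp_def using powr_minus_divide[of "1 + x^2" 1] by simp
  have "\<bar>x / (1 + x^2)\<bar> = \<bar>x\<bar> * jp (-2) x" unfolding m by (simp add: abs_mult)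
  also have "... <= jp 1 x * jp (-2) x" by (intro mult_right_mono abs_le_jp_1) simp
  also have "... = jp (-1) x" by (simp flip: jp_add)
  finally have "2 * B * \<bar>x / (1 + x^2)\<bar> <= 2 * B * jp (-1) x" using b by (intro mult_left_mono) auto
  hence "\<bar>2 * B * (x / (1 + x^2))\<bar> <= \<bar>2 * B * jp (-1) x\<bar>" using b by (simp only: abs_mult) simp
  thus ?thesis unfolding e by (rule abs_le_square_iff[THEN iffD1])
 qed
 have J: "L1 (%x. (2 * B * jp (-1) x)^2)" using L2_integrable[OF L2_jp_minus_1] by (simp add: power_mult_distrib)
 have i: "L1 (%x. (disp B b (0 + b * x))^2)"
  by (rule int_bound[OF J], measurable) (use p in simp)
 have "L1 (%x. (disp B b x)^2)" using i lborel_integrable_real_affine_iff[of b "%x. (disp B b x)^2" 0] b by simp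
 thus "L2 (disp B b)" by (intro L2I) simp_all
 have "(Lint x. (disp B b x)^2) = b * (Lint x. (disp B b (0 + b * x))^2)"
  using lborel_integral_real_affine[of b "%x. (disp B b x)^2" 0] b by simp
 also have "... <= b * (Lint x. (2 * B * jp (-1) x)^2)" using b by (intro mult_left_mono integral_mono[OF i J] p) auto
 also have "... = (2 * B * sqrt b * c1)^2"
  unfolding c1_def power_mult_distrib L2_norm_sq using b by (simp add: power_mult_distrib)
 finally have "(L2_norm (disp B b))^2 <= (2 * B * sqrt b * c1)^2" unfolding L2_norm_sq by simp
 thus "L2_norm (disp B b) <= 2 * B * sqrt b * c1" by (rule power2_le_imp_le) (use b in simp)
qed

text \<open>Time runs over the closed interval \<open>{0..T}\<close>, on which norms are bounded by
  compactness; a solution that lives beyond \<open>T\<close> restricts to this setting.\<close>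

locale classical_solution =
 fixes s B b T :: real and u ut :: "real => real => real" and g k :: "real => real => complex"
 assumes s: "3 <= s" and b: "0 < b" "0 < B" and T: "0 < T"
  and g: "!!t. t : {0..T} ==> rep s (u t) (g t)" and k: "!!t. t : {0..T} ==> rep (s - 1) (ut t) (k t)"
  and gc: "!!t. t : {0..T} ==> ((%r. hsn s (%x. g r x - g t x)) \<longlongrightarrow> 0) (at t within {0..T})"
  and gd: "!!t. t : {0..T} ==> ((%r. hsn (s - 1) (%x. of_real (1 / (r - t)) * (g r x - g t x) - k t x)) \<longlongrightarrow> 0) (at t within {0..T})"
  and pde: "!!t x. 0 < t ==> t <= T ==> ut t x + u t x * deriv (u t) x + (Lint y. B * exp (- b * \<bar>x - y\<bar>) * deriv (u t) y) = 0"
begin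

lemma s': "1 <= s" "2 <= s" "1 <= s - 1" "2 <= s - 1" "0 <= s" "0 <= s - 1" using s by auto

lemma gL: assumes "t : {0..T}" shows "L2 (g t)" "L2 (k t)"
 using hs_L2(1)[OF repD(1)[OF g[OF assms]] s'(5)] hs_L2(1)[OF repD(1)[OF k[OF assms]] s'(6)] by auto

text \<open>The equation is given pointwise in \<open>x\<close>; injectivity of the inverse
  transform moves it to the frequency side.\<close>

lemma k_AE: assumes t: "0 < t" "t <= T" shows "AE x in lborel. k t x = - (\<i> * of_real (disp B b x) * g t x) - burg (g t) x"
proof -
 have tT: "t : {0..T}" using t by simp
 note L = disp_rep[OF g[OF tT] s'(2) b] and Q = burg_rep[OF g[OF tT] s'(2)]
 have ki: "L1 (k t)" by (rule hs_integrable(1)[OF repD(1)[OF k[OF tT]] s'(3)])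
 note i = int_add[OF ki int_add[OF L(2) Q(2)]]
 have "ift (%x. k t x + (\<i> * of_real (disp B b x) * g t x + burg (g t) x)) x = 0" for x
 proof -
  have "ift (%x. k t x + (\<i> * of_real (disp B b x) * g t x + burg (g t) x)) x
   = of_real (ut t x + u t x * deriv (u t) x + (Lint y. B * exp (- b * \<bar>x - y\<bar>) * deriv (u t) y))"
   unfolding ift_add[OF ki int_add[OF L(2) Q(2)]] ift_add[OF L(2) Q(2)] L(1)[symmetric] Q(1) repD(3)[OF k[OF tT], symmetric] by simp
  thus ?thesis unfolding pde[OF t] by simp
 qed
 from ift_injective[OF i this] show ?thesis by eventually_elim (simp add: algebra_simps eq_neg_iff_add_eq_0)
qed

text \<open>Here differentiability in time is given in the norm of H^(s-1) and not frequency by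
  frequency; expanding the square around \<open>g t\<close> leaves terms that this norm
  controls.\<close>

lemma energy_derivative:
 assumes t: "t : {0..T}"
 shows "((%t. (L2_norm (g t))^2) has_real_derivative (Lint x. 2 * Re (cnj (g t x) * k t x))) (at t within {0..T})"
 unfolding has_field_derivative_iff
proof (rule LIM_zero_cancel, rule Lim_null_comparison)
 let ?q = "%r x. of_real (1 / (r - t)) * (g r x - g t x)" and ?d = "%r x. g r x - g t x"
 let ?c = "%r. 2 * (L2_norm (g t) * hsn (s - 1) (%x. ?q r x - k t x)) + hsn s (?d r) * (hsn (s - 1) (%x. ?q r x - k t x) + L2_norm (k t))"
 have "(?c \<longlongrightarrow> 2 * (L2_norm (g t) * 0) + 0 * (0 + L2_norm (k t))) (at t within {0..T})"
  by (intro tendsto_intros gc[OF t] gd[OF t])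
 thus "(?c \<longlongrightarrow> 0) (at t within {0..T})" by simp
 have "norm (((L2_norm (g r))^2 - (L2_norm (g t))^2) / (r - t) - (Lint x. 2 * Re (cnj (g t x) * k t x))) <= ?c r"
  if r: "r : {0..T}" "r ~= t" for r
 proof -
  have m: "rep (s - 1) (u q) (g q)" if "q : {0..T}" for q using rep_mono[OF g[OF that]] by simp
  have d: "hs s (?d r)" using repD(1)[OF g[OF r(1)]] repD(1)[OF g[OF t]] by (intro hs_diff)
  have qk: "hs (s - 1) (%x. ?q r x - k t x)" using hs_cmult[OF hs_diff[OF repD(1)[OF m[OF r(1)]] repD(1)[OF m[OF t]]]] repD(1)[OF k[OF t]] by (intro hs_diff)
  note dL = hs_L2[OF d s'(5)] and qL = hs_L2[OF qk s'(6)]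
  have q: "L2 (?q r)" by (rule L2_cmult[OF dL(1)])
  have cn: "L2 (%x. cnj (f x)) & L2_norm (%x. cnj (f x)) = L2_norm f" if f: "L2 f" for f :: "real => complex"
   using f unfolding L2_def L2_norm_def by auto
  note P1 = L2_mult_integrable[OF conjunct1[OF cn[OF gL(1)[OF t]]] qL(1)] and P2 = L2_mult_integrable[OF conjunct1[OF cn[OF dL(1)]] q]
   and P3 = L2_mult_integrable[OF conjunct1[OF cn[OF gL(1)[OF t]]] gL(2)[OF t]]
  have pt: "((norm (g r x))^2 - (norm (g t x))^2) / (r - t) = 2 * Re (cnj (g t x) * k t x) + (2 * Re (cnj (g t x) * (?q r x - k t x)) + 1 * Re (cnj (?d r x) * ?q r x))" for x
  proof -
   have e1: "(norm (g r x))^2 - (norm (g t x))^2 = 2 * Re (cnj (g t x) * ?d r x) + Re (cnj (?d r x) * ?d r x)"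
    unfolding cmod_power2 by (simp add: power2_eq_square algebra_simps)
   have e2: "Re (z * ?q r x) = Re (z * ?d r x) / (r - t)" for z
    unfolding mult.left_commute[of z "of_real (1 / (r - t))"] Re_complex_of_real_mult by simp
   have e3: "Re (z * (v - w)) = Re (z * v) - Re (z * w)" for z v w by (simp only: right_diff_distrib minus_complex.sel)
   have alg: "(2 * A + C) / p = 2 * K + (2 * (A / p - K) + 1 * (C / p))" for A C K p :: real by (simp add: add_divide_distrib)
   show ?thesis unfolding e1 e3[of "cnj (g t x)" "?q r x" "k t x"] e2 by (rule alg)
  qed
  have "((L2_norm (g r))^2 - (L2_norm (g t))^2) / (r - t) = (Lint x. ((norm (g r x))^2 - (norm (g t x))^2) / (r - t))"
   unfolding L2_norm_sq using L2_integrable[OF gL(1)[OF t]] L2_integrable[OF gL(1)[OF r(1)]] by simp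
  also have "... = (Lint x. 2 * Re (cnj (g t x) * k t x)) + (2 * Re (Lint x. cnj (g t x) * (?q r x - k t x)) + 1 * Re (Lint x. cnj (?d r x) * ?q r x))"
   unfolding pt integral_Re_lincomb[OF P1(1) P2(1), symmetric] using P1(1) P2(1) P3(1)
   by (intro lint_add int_add integrable_mult_right integrable_Re)
  finally have e: "((L2_norm (g r))^2 - (L2_norm (g t))^2) / (r - t) - (Lint x. 2 * Re (cnj (g t x) * k t x)) = 2 * Re (Lint x. cnj (g t x) * (?q r x - k t x)) + Re (Lint x. cnj (?d r x) * ?q r x)" by simp
  have 1: "cmod (Lint x. cnj (g t x) * (?q r x - k t x)) <= L2_norm (g t) * hsn (s - 1) (%x. ?q r x - k t x)"
   using P1(2) mult_left_mono[OF qL(2), of "L2_norm (g t)"] cn[OF gL(1)[OF t]] by simp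
  have "L2_norm (?q r) <= L2_norm (%x. ?q r x - k t x) + L2_norm (k t)"
   using L2_norm_triangle[OF qL(1) gL(2)[OF t]] by simp
  hence "L2_norm (?d r) * L2_norm (?q r) <= hsn s (?d r) * (hsn (s - 1) (%x. ?q r x - k t x) + L2_norm (k t))"
   using dL(2) qL(2) by (intro mult_mono) auto
  hence 2: "cmod (Lint x. cnj (?d r x) * ?q r x) <= hsn s (?d r) * (hsn (s - 1) (%x. ?q r x - k t x) + L2_norm (k t))"
   using P2(2) cn[OF dL(1)] by simp
  show ?thesis unfolding real_norm_def e
   using 1 2 abs_Re_le_cmod[of "Lint x. cnj (g t x) * (?q r x - k t x)"] abs_Re_le_cmod[of "Lint x. cnj (?d r x) * ?q r x"] by linarith
 qed
 thus "\<forall>\<^sub>F r in at t within {0..T}. norm (((L2_norm (g r))^2 - (L2_norm (g t))^2) / (r - t) - (Lint x. 2 * Re (cnj (g t x) * k t x))) <= ?c r"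
  by (simp add: eventually_at_filter)
qed

lemma energy: assumes t: "t : {0..T}" shows "L2_norm (g t) = L2_norm (g 0)"
proof (cases "t = 0")
 case False
 have "(L2_norm (g t))^2 = (L2_norm (g 0))^2"
 proof (rule DERIV_isconst_end[where f="%t. (L2_norm (g t))^2" and a=0 and b=t])
  show "0 < t" using False t by simp
  show "continuous_on {0..t} (%t. (L2_norm (g t))^2)"
   by (rule continuous_on_subset[of "{0..T}"], rule DERIV_continuous_on[OF energy_derivative]) (use t in auto)
  fix r assume r: "0 < r" "r < t"
  hence rT: "r : {0..T}" "r : {0<..<T}" "r <= T" using t by auto
  have H: "hs 2 (g r)" "herm (g r)" using hs_mono(1)[OF repD(1)[OF g[OF rT(1)]] s'(2)] repD(2)[OF g[OF rT(1)]] by auto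
  note [measurable] = L2_measurable[OF gL(1)[OF rT(1)]] L2_measurable[OF gL(2)[OF rT(1)]] hs_measurable[OF hs_burg(1)[OF H(1)]]
  have ib: "L1 (%x. cnj (g r x) * burg (g r) x)"
   using gL(1)[OF rT(1)] hs_burg_2(3)[OF H(1) order_refl] by (intro L2_mult_integrable) (auto simp: L2_def)
  have "(Lint x. 2 * Re (cnj (g r x) * k r x)) = (Lint x. - 2 * Re (cnj (g r x) * burg (g r) x))"
  proof (rule integral_cong_AE)
   show "AE x in lborel. 2 * Re (cnj (g r x) * k r x) = - 2 * Re (cnj (g r x) * burg (g r) x)"
    using k_AE[OF r(1) rT(3)]
   proof eventually_elim
    case (elim x) show ?case unfolding elim by (simp add: algebra_simps)
   qed
  qed simp_all
  also have "... = 0" unfolding integral_mult_right_zero integral_Re[OF ib] burg_energy[OF H] by simp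
  finally show "((%t. (L2_norm (g t))^2) has_real_derivative 0) (at r)"
   using energy_derivative[OF rT(1)] at_within_Icc_at[of 0 r T] rT(2) by simp
 qed
 thus ?thesis by (simp add: power2_eq_iff_nonneg)
qed simp

text \<open>A bound for the acceleration along characteristics, see \<open>dispersion_small\<close>:
  the bound for the L^2 norm of the multiplier times the conserved norm of the solution.\<close>

definition \<epsilon> where "\<epsilon> = 2 * B * sqrt b * c1 * L2_norm (g 0)"

lemma \<epsilon>_nonneg: "0 <= \<epsilon>" using b by (simp add: \<epsilon>_def)

lemma dispersion_small: assumes t: "t : {0..T}" shows "\<bar>Lint y. B * exp (- b * \<bar>x - y\<bar>) * deriv (u t) y\<bar> <= \<epsilon>"
proof -
 note L = disp_rep[OF g[OF t] s'(2) b] and D = disp_L2[OF b] and CS = L2_Cauchy_Schwarz[OF disp_L2(1)[OF b] gL(1)[OF t]]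
 have "\<bar>Lint y. B * exp (- b * \<bar>x - y\<bar>) * deriv (u t) y\<bar> = cmod (ift (%x. \<i> * of_real (disp B b x) * g t x) x)"
  unfolding L(1)[symmetric] by simp
 also have "... <= 1 / sqrt (2 * pi) * (Lint x. cmod (\<i> * of_real (disp B b x) * g t x))" by (rule norm_ift_le)
 also have "... <= 1 * (Lint x. cmod (\<i> * of_real (disp B b x) * g t x))"
  using pi_gt3 by (intro mult_right_mono Bochner_Integration.integral_nonneg) (auto simp: real_le_rsqrt)
 also have "... <= L2_norm (disp B b) * L2_norm (g t)" using CS(2) by (simp add: norm_mult)
 also have "... <= \<epsilon>" unfolding \<epsilon>_def energy[OF t] by (intro mult_right_mono D(2)) simp
 finally show ?thesis .
qed

lemma hsn_continuous: assumes h: "hs s h" shows "continuous_on {0..T} (%t. hsn s (%x. g t x - h x))"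
 unfolding continuous_on_def
proof
 fix t assume t: "t : {0..T}"
 have "((%r. hsn s (%x. g r x - h x) - hsn s (%x. g t x - h x)) \<longlongrightarrow> 0) (at t within {0..T})"
 proof (rule Lim_null_comparison[OF _ gc[OF t]])
  show "\<forall>\<^sub>F r in at t within {0..T}. norm (hsn s (%x. g r x - h x) - hsn s (%x. g t x - h x)) <= hsn s (%x. g r x - g t x)"
   using hsn_diff_abs[OF hs_diff[OF repD(1)[OF g] h] hs_diff[OF repD(1)[OF g[OF t]] h]] by (simp add: eventually_at_filter)
 qed
 thus "((%t. hsn s (%x. g t x - h x)) \<longlongrightarrow> hsn s (%x. g t x - h x)) (at t within {0..T})" by (rule LIM_zero_cancel)
qed

lemma uniform_bound: obtains M where "0 <= M" "!!t x. t : {0..T} ==> \<bar>deriv (u t) x\<bar> <= M"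
proof -
 have "continuous_on {0..T} (%t. hsn s (g t))" using hsn_continuous[of "%x. 0"] by (simp add: hs_def L2_def)
 hence "bounded ((%t. hsn s (g t)) ` {0..T})" by (intro compact_imp_bounded compact_continuous_image) auto
 then obtain C where C: "!!t. t : {0..T} ==> hsn s (g t) <= C" unfolding bounded_real by force
 show ?thesis
 proof (rule that[of "c1 * C"])
  show "0 <= c1 * C" using order_trans[OF hsn_nonneg C[of 0]] T by simp
  fix t x assume t: "t : {0..T}"
  note d = rep_deriv(2)[OF g[OF t] s'(2)]
  have "\<bar>deriv (u t) x\<bar> = cmod (ift (%x. \<i> * (of_real x * g t x)) x)" unfolding repD(3)[OF d, symmetric] norm_of_real ..
  also have "... <= c1 * hsn (s - 1) (%x. \<i> * (of_real x * g t x))" by (rule norm_ift_hs[OF repD(1)[OF d] s'(3)])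
  also have "hsn (s - 1) (%x. \<i> * (of_real x * g t x)) <= C"
   unfolding hsn_cmult using order_trans[OF hs_shift(2)[OF repD(1)[OF g[OF t]]] C[OF t]] by simp
  finally show "\<bar>deriv (u t) x\<bar> <= c1 * C" by (simp add: mult_left_mono)
 qed
qed

text \<open>The derivative of \<open>u t\<close> is bounded uniformly on \<open>{0..T}\<close>, so
  the velocity field is Lipschitz in \<open>x\<close> and characteristics exist up to
  \<open>T\<close>. Along them the velocity changes at the rate of the dispersive term alone, at
  most \<open>\<epsilon>\<close>.\<close>

lemma characteristic:
 obtains y where "y 0 = a" "!!t. t : {0..T} ==> (y has_real_derivative u t (y t)) (at t within {0..T})"
  "!!t. t : {0..T} ==> \<bar>u t (y t) - u 0 a\<bar> <= \<epsilon> * T"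
proof -
 obtain M where M: "0 <= M" "!!t x. t : {0..T} ==> \<bar>deriv (u t) x\<bar> <= M" by (rule uniform_bound) blast
 have lip: "norm (u t x - u t y) <= M * norm (x - y)" if t: "t : {0..T}" for t x y
  by (rule field_differentiable_bound[of UNIV "u t" "deriv (u t)"]) (use rep_deriv(1)[OF g[OF t] s'(2)] M(2)[OF t] in simp_all)
 have sup: "\<bar>u r x - u t x\<bar> <= c1 * hsn s (%x. g r x - g t x)" if t: "t : {0..T}" "r : {0..T}" for r t x
 proof -
  note R = rep_diff[OF g[OF t(2)] g[OF t(1)] s'(1)]
  have "\<bar>u r x - u t x\<bar> = cmod (ift (%x. g r x - g t x) x)" unfolding repD(3)[OF R, symmetric] norm_of_real ..
  thus ?thesis using norm_ift_hs[OF repD(1)[OF R] s'(1)] by simp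
 qed
 have cont: "continuous_on ({0..T} \<times> UNIV) (%(t, x). u t x)"
  unfolding continuous_on_def
 proof (clarify)
  fix t x :: real assume t: "t : {0..T}"
  let ?F = "at (t, x) within ({0..T} \<times> UNIV)"
  have l1: "((%p. c1 * hsn s (%x. g (fst p) x - g t x)) \<longlongrightarrow> c1 * 0) ?F"
  proof (intro tendsto_mult tendsto_const)
   note c = hsn_continuous[OF repD(1)[OF g[OF t]]]
   have z: "hsn s (%x. g t x - g t x) = 0" by (simp add: hsn_def L2_norm_def)
   have "continuous_on ({0..T} \<times> UNIV) (%p. hsn s (%x. g (fst p) x - g t x))"
    by (rule continuous_on_compose2[OF c]) (auto intro!: continuous_intros)
   thus "((%p. hsn s (%x. g (fst p) x - g t x)) \<longlongrightarrow> 0) ?F" unfolding continuous_on_def using t z by force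
  qed
  have l2: "((%p. M * norm (snd p - x)) \<longlongrightarrow> M * norm (snd (t, x) - x)) ?F" by (intro tendsto_intros)
  have "((%p. (case p of (t, x) => u t x) - u t x) \<longlongrightarrow> 0) ?F"
  proof (rule Lim_null_comparison)
   show "((%p. c1 * hsn s (%x. g (fst p) x - g t x) + M * norm (snd p - x)) \<longlongrightarrow> 0) ?F" using tendsto_add[OF l1 l2] by simp
   have H: "norm (u r y - u t x) <= c1 * hsn s (%x. g r x - g t x) + M * norm (y - x)" if "r : {0..T}" for r y
    using sup[OF t that, of y] lip[OF t, of y x] unfolding real_norm_def by linarith
   show "\<forall>\<^sub>F p in ?F. norm ((case p of (t, x) => u t x) - u t x) <= c1 * hsn s (%x. g (fst p) x - g t x) + M * norm (snd p - x)"
    unfolding eventually_at_filter case_prod_beta' by (intro always_eventually allI impI H) (simp add: mem_Times_iff)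
  qed
  thus "((%(t, x). u t x) \<longlongrightarrow> u t x) ?F" by (rule LIM_zero_cancel)
 qed
 obtain y where y: "y 0 = a" "!!t. t : {0..T} ==> (y has_vector_derivative u t (y t)) (at t within {0..T})"
  using Picard_global[OF less_imp_le[OF T] M(1) cont lip] by metis
 note yd = y(2)[folded has_real_derivative_iff_has_vector_derivative]
 let ?U = "%t. u t (y t)"
 have U: "(?U has_real_derivative ut t (y t) + deriv (u t) (y t) * u t (y t)) (at t within {0..T})" if t: "t : {0..T}" for t
 proof -
  \<comment> \<open>The velocity is split at the fixed time \<open>t\<close>. In this first part
    only time varies, but at a moving point, so the difference quotients must converge uniformly in
    \<open>x\<close>; the embedding with constant \<open>c1\<close> provides this.\<close>
  have "((%r. u r (y r) - u t (y r)) has_real_derivative ut t (y t)) (at t within {0..T})"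
   unfolding has_field_derivative_iff
  proof (rule Lim_transform2)
   show "((%r. ut t (y r)) \<longlongrightarrow> ut t (y t)) (at t within {0..T})"
    by (rule isCont_tendsto_compose[OF DERIV_isCont[OF rep_deriv(1)[OF k[OF t] s'(4)]] DERIV_continuous[OF yd[OF t], unfolded continuous_within]])
   have l: "((%r. c1 * hsn (s - 1) (%x. of_real (1 / (r - t)) * (g r x - g t x) - k t x)) \<longlongrightarrow> 0) (at t within {0..T})"
    using tendsto_mult_left[OF gd[OF t], of c1] by simp
   show "((%r. ut t (y r) - (u r (y r) - u t (y r) - (u t (y t) - u t (y t))) / (r - t)) \<longlongrightarrow> 0) (at t within {0..T})"
   proof (rule Lim_null_comparison[OF _ l])
    have "norm (ut t (y r) - (u r (y r) - u t (y r) - (u t (y t) - u t (y t))) / (r - t)) <= c1 * hsn (s - 1) (%x. of_real (1 / (r - t)) * (g r x - g t x) - k t x)"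
     if r: "r : {0..T}" for r
    proof -
     have m: "rep (s - 1) (u q) (g q)" if "q : {0..T}" for q using rep_mono[OF g[OF that]] by simp
     note R = rep_diff[OF rep_scale[OF rep_diff[OF m[OF r] m[OF t] s'(3)], of "1 / (r - t)"] k[OF t] s'(3)]
     have "norm (ut t (y r) - (u r (y r) - u t (y r) - (u t (y t) - u t (y t))) / (r - t)) = \<bar>1 / (r - t) * (u r (y r) - u t (y r)) - ut t (y r)\<bar>"
      unfolding diff_self diff_zero real_norm_def by (subst abs_minus_commute) simp
     also have "... = cmod (ift (%x. of_real (1 / (r - t)) * (g r x - g t x) - k t x) (y r))" unfolding repD(3)[OF R, symmetric] norm_of_real ..
     also have "... <= c1 * hsn (s - 1) (%x. of_real (1 / (r - t)) * (g r x - g t x) - k t x)" by (rule norm_ift_hs[OF repD(1)[OF R] s'(3)])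
     finally show ?thesis .
    qed
    thus "\<forall>\<^sub>F r in at t within {0..T}. norm (ut t (y r) - (u r (y r) - u t (y r) - (u t (y t) - u t (y t))) / (r - t)) <= c1 * hsn (s - 1) (%x. of_real (1 / (r - t)) * (g r x - g t x) - k t x)"
     by (simp add: eventually_at_filter)
   qed
  qed
  from DERIV_add[OF this DERIV_chain2[OF rep_deriv(1)[OF g[OF t] s'(2)] yd[OF t]]] show ?thesis by simp
 qed
 show ?thesis
 proof (rule that[OF y(1) yd])
  fix t assume t: "t : {0..T}"
  show "\<bar>u t (y t) - u 0 a\<bar> <= \<epsilon> * T"
  proof (cases "t = 0")
   case True thus ?thesis using y(1) \<epsilon>_nonneg T by simp
  next
   case False
   have at: "at r within {0..T} = at r" if "0 < r" "r < t" for r using that t by (intro at_within_Icc_at) auto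
   have "EX l z. 0 < z & z < t & DERIV ?U z :> l & ?U t - ?U 0 = (t - 0) * l"
   proof (rule MVT)
    show "0 < t" using t False by simp
    show "continuous_on {0..t} ?U" by (rule continuous_on_subset[OF DERIV_continuous_on[OF U]]) (use t in auto)
    fix r assume r: "0 < r" "r < t"
    hence "r : {0..T}" using t by auto
    from U[OF this] show "?U differentiable at r" unfolding at[OF r] real_differentiable_def by blast
   qed
   then obtain l z where z: "0 < z" "z < t" "DERIV ?U z :> l" "?U t - ?U 0 = (t - 0) * l" by blast
   have zT: "z : {0..T}" "z <= T" using z t by auto
   have "l = ut z (y z) + deriv (u z) (y z) * u z (y z)" using U[OF zT(1)] z(3) unfolding at[OF z(1,2)] by (rule DERIV_unique[rotated])
   hence l: "\<bar>l\<bar> <= \<epsilon>"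
    using pde[OF z(1) zT(2), of "y z"] dispersion_small[OF zT(1), of "y z"] mult.commute[of "u z (y z)" "deriv (u z) (y z)"] by linarith
   have "\<bar>t * l\<bar> <= T * \<epsilon>" unfolding abs_mult by (rule mult_mono) (use t l T in simp_all)
   thus ?thesis using z(4) unfolding y(1) by (simp add: mult.commute)
  qed
 qed
qed

text \<open>Characteristics of a velocity field that is Lipschitz in \<open>x\<close> keep their
  order. Each end point differs from that of the straight line by at most
  \<open>\<epsilon> * T * T\<close>, so the straight lines cannot have crossed by more than twice
  this.\<close>

lemma characteristics_do_not_cross:
 assumes a: "a\<^sub>1 < a\<^sub>2" shows "0 <= (a\<^sub>2 - a\<^sub>1) + T * (u 0 a\<^sub>2 - u 0 a\<^sub>1) + 2 * \<epsilon> * T^2"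
proof -
 obtain M where M: "0 <= M" "!!t x. t : {0..T} ==> \<bar>deriv (u t) x\<bar> <= M" by (rule uniform_bound) blast
 obtain y where y: "y 0 = a\<^sub>1" "!!t. t : {0..T} ==> (y has_real_derivative u t (y t)) (at t within {0..T})" "!!t. t : {0..T} ==> \<bar>u t (y t) - u 0 a\<^sub>1\<bar> <= \<epsilon> * T"
  by (rule characteristic[of a\<^sub>1]) blast
 obtain z where z: "z 0 = a\<^sub>2" "!!t. t : {0..T} ==> (z has_real_derivative u t (z t)) (at t within {0..T})" "!!t. t : {0..T} ==> \<bar>u t (z t) - u 0 a\<^sub>2\<bar> <= \<epsilon> * T"
  by (rule characteristic[of a\<^sub>2]) blast
 have lin: "\<bar>q T - q 0 - T * v\<bar> <= \<epsilon> * T * T" if "!!t. t : {0..T} ==> (q has_real_derivative u t (q t)) (at t within {0..T})" "!!t. t : {0..T} ==> \<bar>u t (q t) - v\<bar> <= \<epsilon> * T" for q v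
 proof -
  have "((%t. q t - t * v) has_vector_derivative u t (q t) - v) (at t within {0..T})" if "t : {0..T}" for t
   unfolding has_real_derivative_iff_has_vector_derivative[symmetric] using that \<open>!!t. t : {0..T} ==> (q has_real_derivative u t (q t)) (at t within {0..T})\<close>
   by (auto intro!: derivative_eq_intros)
  from vector_derivative_bound[OF this, of "\<epsilon> * T"] that(2) T have "norm (q T - T * v - (q 0 - 0 * v)) <= \<epsilon> * T * (T - 0)" by simp
  thus ?thesis by (simp add: algebra_simps)
 qed
 \<comment> \<open>With \<open>M\<close> a Lipschitz constant of the velocity, the factor
   \<open>exp (2 * M * t)\<close> makes the squared distance nondecreasing, so it stays
   positive.\<close>
 let ?d = "%t. z t - y t" and ?e = "%t. (z t - y t)^2 * exp (2 * M * t)"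
 have dd: "(?d has_real_derivative u t (z t) - u t (y t)) (at t within {0..T})" if "t : {0..T}" for t
  using that by (intro DERIV_diff y z)
 have nz: "?d t ~= 0" if t: "t : {0..T}" for t
 proof -
  have "?e 0 <= ?e t"
  proof (rule DERIV_nonneg_imp_increasing_open[where f="?e" and a=0 and b=t])
   show "0 <= t" using t by simp
   show "continuous_on {0..t} ?e" by (intro continuous_intros continuous_on_subset[OF DERIV_continuous_on[OF y(2)]] continuous_on_subset[OF DERIV_continuous_on[OF z(2)]]) (use t in auto)
   fix r assume r: "0 < r" "r < t"
   hence rT: "r : {0..T}" using t by auto
   have at: "at r within {0..T} = at r" using r t by (intro at_within_Icc_at) auto
   have d: "(?e has_real_derivative 2 * (?d r * (u r (z r) - u r (y r))) * exp (2 * M * r) + (?d r)^2 * (exp (2 * M * r) * (2 * M))) (at r)"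
   proof -
    have ex: "((%t. exp (2 * M * t)) has_real_derivative exp (2 * M * r) * (2 * M)) (at r)" by (auto intro!: derivative_eq_intros)
    show ?thesis by (rule DERIV_cong[OF DERIV_mult[OF DERIV_power[OF dd[OF rT, unfolded at], of 2] ex]]) (simp add: algebra_simps)
   qed
   have "\<bar>u r (z r) - u r (y r)\<bar> <= M * \<bar>z r - y r\<bar>"
    using field_differentiable_bound[of UNIV "u r" "deriv (u r)" M "z r" "y r"] rep_deriv(1)[OF g[OF rT] s'(2)] M(2)[OF rT] by simp
   hence "\<bar>?d r * (u r (z r) - u r (y r))\<bar> <= \<bar>?d r\<bar> * (M * \<bar>?d r\<bar>)" unfolding abs_mult by (intro mult_left_mono) auto
   also have "... = M * (?d r)^2" by (simp add: power2_eq_square)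
   finally have "0 <= ?d r * (u r (z r) - u r (y r)) + M * (?d r)^2" by linarith
   from mult_nonneg_nonneg[OF this, of "2 * exp (2 * M * r)"]
   have "0 <= 2 * (?d r * (u r (z r) - u r (y r))) * exp (2 * M * r) + (?d r)^2 * (exp (2 * M * r) * (2 * M))" by (simp add: algebra_simps)
   thus "EX y. DERIV ?e r :> y & 0 <= y" using d by blast
  qed
  moreover have "0 < ?e 0" using a y(1) z(1) by simp
  ultimately show ?thesis by auto
 qed
 have "0 <= ?d T"
 proof (rule ccontr)
  assume "~  0 <= ?d T"
  hence "EX t>=0. t <= T & ?d t = 0"
   using a y(1) z(1) T DERIV_continuous_on[OF dd] by (intro IVT2') auto
  thus False using nz by auto
 qed
 moreover have "\<bar>y T - a\<^sub>1 - T * u 0 a\<^sub>1\<bar> <= \<epsilon> * T * T" "\<bar>z T - a\<^sub>2 - T * u 0 a\<^sub>2\<bar> <= \<epsilon> * T * T"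
  using lin[OF y(2,3)] lin[OF z(2,3)] y(1) z(1) by auto
 ultimately have "0 <= (a\<^sub>2 - a\<^sub>1) + (T * u 0 a\<^sub>2 - T * u 0 a\<^sub>1) + 2 * (\<epsilon> * T * T)" by linarith
 thus ?thesis by (simp add: right_diff_distrib power2_eq_square mult.assoc)
qed

end

text \<open>Each \<open>u t\<close> has a transform by \<open>sobolev_rep\<close>. These are chosen
  separately at each time, which is harmless because the limits are stated in norms and norms ignore
  null sets.\<close>

lemma is_solution_classical:
 assumes s: "3 <= s" and b: "0 < b" "0 < B" and T: "0 < T" "ereal T < T'" and sol: "is_solution s B b u0 T' u"
 obtains ut g k where "classical_solution s B b T u ut g k" "u 0 = u0"
proof -
 let ?I = "time_interval T'"
 have s1: "1 <= s" "1 <= s - 1" using s by auto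
 note S = sol[unfolded is_solution_def]
 obtain ut where U: "continuous_into_sobolev (s - 1) ?I ut" "has_sobolev_time_derivative (s - 1) ?I u ut"
  "ALL t x. 0 < t & ereal t < T' --> ut t x + u t x * deriv (u t) x + (Lint y. B * exp (- b * \<bar>x - y\<bar>) * deriv (u t) y) = 0"
  using S by blast
 note U1 = S[THEN conjunct1]
 have U0: "u 0 = u0" by (rule ext) (rule S[THEN conjunct2, THEN conjunct2, rule_format])
 have lt: "ereal t < T'" if "t <= T" for t using T(2) that by (meson ereal_less_eq(3) order_le_less_trans)
 have I: "{0..T} \<subseteq> ?I" using lt by (auto simp: time_interval_def)
 have "EX h. rep s (u t) h" if "t : {0..T}" for t
 proof -
  have "u t : sobolev s" using U1 I that unfolding continuous_into_sobolev_def by blast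
  thus ?thesis using sobolev_rep s1(1) by blast
 qed
 then obtain g where g: "!!t. t : {0..T} ==> rep s (u t) (g t)" by metis
 have "EX h. rep (s - 1) (ut t) h" if "t : {0..T}" for t
 proof -
  have "ut t : sobolev (s - 1)" using U(1) I that unfolding continuous_into_sobolev_def by blast
  thus ?thesis using sobolev_rep s1(2) by blast
 qed
 then obtain k where k: "!!t. t : {0..T} ==> rep (s - 1) (ut t) (k t)" by metis
 have within: "(f \<longlongrightarrow> 0) (at t within {0..T})" if "(h \<longlongrightarrow> 0) (at t within ?I)" "!!r. r : {0..T} ==> h r = f r" for f h :: "real => real" and t
  by (rule Lim_transform_eventually[OF tendsto_within_subset[OF that(1) I]]) (use that(2) in \<open>simp add: eventually_at_filter\<close>)
 have m: "rep (s - 1) (u q) (g q)" if "q : {0..T}" for q using rep_mono[OF g[OF that]] by simp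
 have "classical_solution s B b T u ut g k"
 proof
  fix t assume t: "t : {0..T}"
  hence tI: "t : ?I" using I by blast
  show "((%r. hsn s (%x. g r x - g t x)) \<longlongrightarrow> 0) (at t within {0..T})"
   by (rule within[where h="%r. sobolev_norm s (%x. u r x - u t x)"], use U1 tI in \<open>simp add: continuous_into_sobolev_def\<close>)
    (rule rep_sobolev(2)[OF rep_diff[OF g g[OF t]]], use s1 in simp_all)
  show "((%r. hsn (s - 1) (%x. of_real (1 / (r - t)) * (g r x - g t x) - k t x)) \<longlongrightarrow> 0) (at t within {0..T})"
  proof (rule within[where h="%r. sobolev_norm (s - 1) (%x. (u r x - u t x) / (r - t) - ut t x)"])
   show "((%r. sobolev_norm (s - 1) (%x. (u r x - u t x) / (r - t) - ut t x)) \<longlongrightarrow> 0) (at t within ?I)"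
    using U(2) tI by (simp add: has_sobolev_time_derivative_def)
   fix r assume r: "r : {0..T}"
   show "sobolev_norm (s - 1) (%x. (u r x - u t x) / (r - t) - ut t x) = hsn (s - 1) (%x. of_real (1 / (r - t)) * (g r x - g t x) - k t x)"
    using rep_sobolev(2)[OF rep_diff[OF rep_scale[OF rep_diff[OF m[OF r] m[OF t] s1(2)], of "1 / (r - t)"] k[OF t] s1(2)] s1(2) order_refl] by simp
  qed
 next
  show "ut t x + u t x * deriv (u t) x + (Lint y. B * exp (- b * \<bar>x - y\<bar>) * deriv (u t) y) = 0" if "0 < t" "t <= T" for t x
   using U(3) that(1) lt[OF that(2)] by blast
 qed (fact s b T(1) | rule g k; assumption)+
 thus ?thesis using that U0 by blast
qed

lemma breakdown:
 assumes s: "3 <= s" and u0: "rep s u0 a" and T: "0 < T" and x\<^sub>0: "deriv u0 x\<^sub>0 < - 1 / T"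
 obtains \<eta> where "0 < \<eta>" "!!B b T' u. 0 < B ==> 0 < b ==> B * sqrt b <= \<eta> ==> is_solution s B b u0 T' u ==> T' <= ereal T"
proof -
 have s2: "2 <= s" "1 <= s" using s by auto
 have "((%x. (u0 x - u0 x\<^sub>0) / (x - x\<^sub>0)) \<longlongrightarrow> deriv u0 x\<^sub>0) (at x\<^sub>0)"
  using rep_deriv(1)[OF u0 s2(1), of x\<^sub>0] unfolding has_field_derivative_iff .
 from order_tendstoD(2)[OF this x\<^sub>0] obtain d where d: "0 < d" "!!x. x ~= x\<^sub>0 ==> dist x x\<^sub>0 < d ==> (u0 x - u0 x\<^sub>0) / (x - x\<^sub>0) < - 1 / T"
  unfolding eventually_at by auto
 define x1 where "x1 = x\<^sub>0 + d / 2"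
 have x1: "x\<^sub>0 < x1" "(u0 x1 - u0 x\<^sub>0) / (x1 - x\<^sub>0) < - 1 / T" using d(1) d(2)[of x1] by (auto simp: x1_def dist_real_def)
 \<comment> \<open>The amount by which the straight characteristics from \<open>x\<^sub>0\<close>
   and \<open>x1\<close> have crossed at time \<open>T\<close>.\<close>
 define \<kappa> where "\<kappa> = - ((x1 - x\<^sub>0) + T * (u0 x1 - u0 x\<^sub>0))"
 have "u0 x1 - u0 x\<^sub>0 < (- 1 / T) * (x1 - x\<^sub>0)" using x1 by (simp only: pos_divide_less_eq diff_gt_0_iff_gt)
 from mult_strict_left_mono[OF this T] have \<kappa>: "0 < \<kappa>" using T by (simp add: \<kappa>_def)
 define n where "n = c1 * L2_norm a"
 have n: "0 <= n" by (simp add: n_def)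
 \<comment> \<open>Chosen such that \<open>2 * \<epsilon> * T^2 <= \<kappa> / 2\<close>; the 1 added
   to \<open>n\<close> keeps the denominator positive.\<close>
 define \<eta> where "\<eta> = \<kappa> / (8 * T^2 * (n + 1))"
 have \<eta>: "0 < \<eta>" using \<kappa> T n by (simp add: \<eta>_def)
 show ?thesis
 proof (rule that[OF \<eta>])
  fix B b :: real and T' u assume b: "0 < B" "0 < b" and small: "B * sqrt b <= \<eta>" and sol: "is_solution s B b u0 T' u"
  show "T' <= ereal T"
  proof (rule ccontr)
   assume "~  T' <= ereal T"
   hence T': "ereal T < T'" by simp
   obtain ut g k where cs: "classical_solution s B b T u ut g k" and u: "u 0 = u0"
    by (rule is_solution_classical[OF s b(2,1) T T' sol]) blast
   interpret classical_solution s B b T u ut g k by (rule cs)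
   have "L2_norm (g 0) = L2_norm a"
   proof (rule L2_norm_cong_AE)
    have r0: "rep s u0 (g 0)" using g[of 0] T u by simp
    show "g 0 : Borel" "a : Borel" using hs_measurable repD(1) r0 u0 by blast+
    show "AE x in lborel. g 0 x = a x" by (rule rep_unique[OF r0 u0 s2(2)])
   qed
   hence "\<epsilon> = 2 * (B * sqrt b) * n" by (simp add: \<epsilon>_def n_def)
   also have "... <= 2 * \<eta> * (n + 1)" using small n b \<eta> by (intro mult_mono) auto
   finally have "2 * \<epsilon> * T^2 <= 2 * (2 * \<eta> * (n + 1)) * T^2" by (simp add: mult_right_mono)
   also have "... = \<eta> * (8 * T^2 * (n + 1)) / 2" by (simp add: mult_ac)
   also have "... = \<kappa> / 2" using T n by (simp add: \<eta>_def)
   finally have "2 * \<epsilon> * T^2 <= \<kappa> / 2" .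
   moreover have "0 <= - \<kappa> + 2 * \<epsilon> * T^2" using characteristics_do_not_cross[OF x1(1)] unfolding u \<kappa>_def minus_minus .
   ultimately show False using \<kappa> by linarith
  qed
 qed
qed

text \<open>Otherwise \<open>u0\<close> is nondecreasing. Far to the left and to the right there are
  points where the square integrable \<open>u0\<close> is arbitrarily small, and its values there
  enclose \<open>u0 y\<close>.\<close>

lemma exists_negative_slope:
 assumes u0: "rep s u0 a" and s: "2 <= s" and nz: "u0 y ~= 0"
 shows "EX x. deriv u0 x < 0"
proof (rule ccontr)
 assume "~  (EX x. deriv u0 x < 0)"
 hence mono: "x <= z ==> u0 x <= u0 z" for x z
  using rep_deriv(1)[OF u0 s] by (intro DERIV_nonneg_imp_nondecreasing[of x z u0]) (auto simp: not_less)
 have L: "L2 u0" using rep_fourier(1)[OF u0] s by simp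
 have "L1 (%x. (u0 x)^2 + (u0 (- x))^2)"
  using L2_integrable[OF L] lborel_integrable_reflect[of "%x. (u0 x)^2"] by simp
 then obtain R where R: "!!n. real n <= R n" "!!n. (u0 (R n))^2 + (u0 (- R n))^2 < 1 / real (Suc n)"
  using integrable_small_values[of "%x. (u0 x)^2 + (u0 (- x))^2"] by auto
 obtain n1 where n1: "\<bar>y\<bar> <= real n1" using real_arch_simple by blast
 obtain n2 where n2: "1 / real (Suc n2) < (u0 y)^2"
  using reals_Archimedean[of "(u0 y)^2"] nz by (auto simp: inverse_eq_divide)
 define n where "n = max n1 n2"
 have "\<bar>y\<bar> <= R n" using n1 R(1)[of n] by (simp add: n_def)
 hence b: "u0 (- R n) <= u0 y" "u0 y <= u0 (R n)" by (auto intro: mono)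
 have "(u0 y)^2 <= (u0 (R n))^2 + (u0 (- R n))^2"
 proof (cases "0 <= u0 y")
  case True
  hence "(u0 y)^2 <= (u0 (R n))^2" using b by (intro power_mono) auto
  thus ?thesis by (simp add: add_increasing2)
 next
  case False
  hence "(- u0 y)^2 <= (- u0 (- R n))^2" using b by (intro power_mono) auto
  thus ?thesis by (simp add: add_increasing)
 qed
 also have "... < 1 / real (Suc n)" by (rule R(2))
 also have "... <= 1 / real (Suc n2)" by (simp add: n_def field_simps)
 finally show False using n2 by simp
qed

text \<open>Both limits of the theorem are instances of this statement, for a filter along which
  \<open>B * sqrt b\<close> tends to 0. The hypothesis \<open>error\<close> is the smallness of the
  dispersive term on Burgers transforms, uniformly in time.\<close>

lemma max_existence_time_tendsto:
 fixes F :: "real filter" and B b :: "real => real"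
 assumes s: "3 <= s" and u0: "rep s u0 a"
  and pos: "\<forall>\<^sub>F p in F. 0 < B p & 0 < b p" and small: "((%p. B p * sqrt (b p)) \<longlongrightarrow> 0) F"
  and error: "!!(T::real) C g \<eta>. 0 <= C ==> 0 < \<eta> ==> (!!t. t : {0..T} ==> hs 2 (g t) & hsn 2 (g t) <= C) ==>
   (!!t x. t : {0..T} ==> cmod (g t x) <= cmod (a x) + C * \<bar>x\<bar>) ==>
   \<forall>\<^sub>F p in F. ALL t:{0..T}. (L2_norm (%x. of_real (disp (B p) (b p) x) * g t x))^2 <= \<eta>"
 shows "((%p. max_existence_time s (B p) (b p) u0) \<longlongrightarrow> burgers_breaking_time u0) F"
proof -
 have s2: "2 <= s" "1 <= s" "1 <= s - 1" using s by auto
 define m where "m = (INF x. deriv u0 x)"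
 have "\<bar>deriv u0 x\<bar> <= c1 * hsn (s - 1) (%\<xi>. \<i> * (of_real \<xi> * a \<xi>))" for x
  using norm_ift_hs[OF repD(1)[OF rep_deriv(2)[OF u0 s2(1)]] s2(3), of x] unfolding repD(3)[OF rep_deriv(2)[OF u0 s2(1)], symmetric] norm_of_real .
 hence bdd: "bdd_below (range (deriv u0))" by (auto simp: bdd_below_def abs_le_iff intro!: exI[of _ "- (c1 * hsn (s - 1) (%\<xi>. \<i> * (of_real \<xi> * a \<xi>)))"] simp: minus_le_iff)
 have m: "m <= deriv u0 x" for x unfolding m_def by (rule cINF_lower[OF bdd]) simp
 have lower: "\<forall>\<^sub>F p in F. ereal T <= max_existence_time s (B p) (b p) u0" if T: "0 < T" "ereal T < burgers_breaking_time u0" for T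
 proof -
  obtain \<delta> where \<delta>: "0 < \<delta>" "!!x. \<delta> <= 1 + T * deriv u0 x"
  proof (cases "ALL x. u0 x = 0")
   case True
   hence "u0 = (%x. 0)" by auto
   thus ?thesis using that[of 1] by simp
  next
   case False
   then obtain y where "u0 y ~= 0" by blast
   then obtain x where x: "deriv u0 x < 0" using exists_negative_slope[OF u0 s2(1)] by blast
   have m0: "m < 0" using m[of x] x by linarith
   have "T < - 1 / m" using T(2) False unfolding burgers_breaking_time_def m_def by (auto split: if_splits)
   hence "- 1 < T * m" using m0 by (simp only: neg_less_divide_eq)
   thus ?thesis using that[of "1 + T * m"] m T(1) by (simp add: mult_left_mono)
  qed
  obtain C \<eta> g where E: "0 < \<eta>" "0 <= C" "!!t. t : {0..T} ==> hs 2 (g t) & hsn 2 (g t) <= C" "!!t x. t : {0..T} ==> cmod (g t x) <= cmod (a x) + C * \<bar>x\<bar>"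
   "!!B b. 0 < B ==> 0 < b ==> (!!t. t : {0..T} ==> (L2_norm (%x. of_real (disp B b x) * g t x))^2 <= \<eta>) ==> EX u. is_solution s B b u0 (ereal T) u"
   by (rule existence_before_breaking[OF s u0 less_imp_le[OF T(1)] \<delta>]) blast
  have "\<forall>\<^sub>F p in F. ALL t:{0..T}. (L2_norm (%x. of_real (disp (B p) (b p) x) * g t x))^2 <= \<eta>"
   by (rule error[where g=g, OF E(2,1,3,4)])
  with pos show ?thesis
  proof eventually_elim
   case (elim p)
   hence "EX u. is_solution s (B p) (b p) u0 (ereal T) u" using E(5)[of "B p" "b p"] by blast
   thus ?case unfolding max_existence_time_def using T(1) by (intro Sup_upper) simp
  qed
 qed
 have upper: "\<forall>\<^sub>F p in F. max_existence_time s (B p) (b p) u0 <= ereal T" if T: "0 < T" "burgers_breaking_time u0 < ereal T" for T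
 proof -
  have "EX x. u0 x ~= 0" using T(2) by (auto simp: burgers_breaking_time_def split: if_splits)
  hence e: "burgers_breaking_time u0 = ereal (- 1 / m)" by (auto simp: burgers_breaking_time_def m_def)
  obtain x where x: "deriv u0 x < 0" using exists_negative_slope[OF u0 s2(1)] \<open>EX x. u0 x ~= 0\<close> by blast
  have m0: "m < 0" using m[of x] x by linarith
  have "- 1 / m < T" using T(2) unfolding e by simp
  hence "T * m < - 1" using m0 by (simp only: neg_divide_less_eq)
  hence "m < - 1 / T" unfolding pos_less_divide_eq[OF T(1)] by (simp add: mult.commute)
  then obtain x0 where x0: "deriv u0 x0 < - 1 / T" unfolding m_def using cINF_less_iff[OF _ bdd, of "- 1 / T"] by auto
  obtain \<eta> where \<eta>: "0 < \<eta>" "!!B b T' u. 0 < B ==> 0 < b ==> B * sqrt b <= \<eta> ==> is_solution s B b u0 T' u ==> T' <= ereal T"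
   by (rule breakdown[OF s u0 T(1) x0]) blast
  have "\<forall>\<^sub>F p in F. B p * sqrt (b p) < \<eta>" by (rule order_tendstoD(2)[OF small \<eta>(1)])
  with pos show ?thesis
  proof eventually_elim
   case (elim p) show ?case unfolding max_existence_time_def by (rule Sup_least) (use \<eta>(2)[of "B p" "b p"] elim in auto)
  qed
 qed
 have bt: "0 <= burgers_breaking_time u0"
 proof (cases "ALL x. u0 x = 0")
  case False
  then obtain x where x: "deriv u0 x < 0" using exists_negative_slope[OF u0 s2(1)] by blast
  have "m < 0" using m[of x] x by linarith
  thus ?thesis using False by (simp add: burgers_breaking_time_def m_def[symmetric] divide_nonpos_neg)
 qed (simp add: burgers_breaking_time_def)
 show ?thesis
 proof (rule order_tendstoI)
  fix c assume c: "c < burgers_breaking_time u0"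
  show "\<forall>\<^sub>F p in F. c < max_existence_time s (B p) (b p) u0"
  proof (cases "0 < burgers_breaking_time u0")
   case True
   then obtain T where T: "max c 0 < ereal T" "ereal T < burgers_breaking_time u0" using ereal_dense2[of "max c 0" "burgers_breaking_time u0"] c by auto
   hence T0: "0 < T" by (simp add: less_ereal.simps)
   from lower[OF T0 T(2)] show ?thesis by eventually_elim (use T(1) in auto)
  next
   case False
   \<comment> \<open>This case is contradictory: the breaking time is infinite for the zero datum,
     and otherwise positive because the infimum of the slope is negative.\<close>
   have "burgers_breaking_time u0 = ereal (- 1 / m)" "EX x. u0 x ~= 0" using False by (auto simp: burgers_breaking_time_def m_def split: if_splits)
   moreover from this obtain x where x: "deriv u0 x < 0" using exists_negative_slope[OF u0 s2(1)] by blast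
   moreover have "m < 0" using m[of x] x by linarith
   ultimately show ?thesis using False by (simp add: divide_pos_neg)
  qed
 next
  fix c assume c: "burgers_breaking_time u0 < c"
  then obtain T where T: "burgers_breaking_time u0 < ereal T" "ereal T < c" using ereal_dense2 by blast
  hence T0: "0 < T" using bt by (metis ereal_less(2) order_le_less_trans)
  from upper[OF T0 T(1)] show "\<forall>\<^sub>F p in F. max_existence_time s (B p) (b p) u0 < c" by eventually_elim (use T(2) in auto)
 qed
qed

text \<open>The first bound serves \<open>B\<close> tending to 0, the second \<open>b\<close>
  tending to 0. In the second, \<open>disp B b x * x\<close> is at most \<open>2 * b * B\<close> in
  size; this handles frequencies above 1 directly and, below 1, the part
  \<open>C * \<bar>x\<bar>\<close> of the bound on \<open>g\<close>. Only the initial transform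
  \<open>a\<close> meets the multiplier near frequency 0, and it does not depend on time.\<close>

lemma disp_error_bound:
 assumes b: "0 < b" "0 < B" and C: "0 <= C" and a: "L2 a" and g: "hs 2 g" "hsn 2 g <= C" "!!x. cmod (g x) <= cmod (a x) + C * \<bar>x\<bar>"
 shows "(L2_norm (%x. of_real (disp B b x) * g x))^2 <= (B * C)^2"
  "(L2_norm (%x. of_real (disp B b x) * g x))^2 <= 2 * (Lint x. (disp B b x)^2 * (cmod (a x))^2) + 20 * (b * B * C)^2"
proof -
 have gL: "L2 g" "L2_norm g <= C" using hs_L2[OF g(1)] g(2) by auto
 note [measurable] = L2_measurable[OF gL(1)] L2_measurable[OF a]
 have d2: "(disp B b x)^2 <= B^2" for x using disp_bound[OF b, of x] by (simp add: abs_le_square_iff[symmetric] b(2) less_imp_le abs_of_pos)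
 have i: "L1 (%x. (disp B b x)^2 * (cmod (f x))^2)" if f: "L2 f" for f :: "real => complex"
 proof -
  note [measurable] = L2_measurable[OF f]
  show ?thesis by (rule int_bound[OF integrable_mult_right[OF L2_integrable[OF f], of "B^2"]], measurable)
   (use d2 in \<open>simp add: abs_mult mult_right_mono\<close>)
 qed
 have e: "(L2_norm (%x. of_real (disp B b x) * g x))^2 = (Lint x. (disp B b x)^2 * (cmod (g x))^2)"
  unfolding L2_norm_sq by (simp add: norm_mult power_mult_distrib)
 have sq: "(Lint x. (norm (g x))^2) <= C^2" unfolding L2_norm_sq[symmetric] using gL(2) by (intro power_mono) auto
 have "(Lint x. (disp B b x)^2 * (cmod (g x))^2) <= (Lint x. B^2 * (norm (g x))^2)"
  by (rule integral_mono[OF i[OF gL(1)]]) (use L2_integrable[OF gL(1)] d2 in \<open>auto intro: mult_right_mono\<close>)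
 thus "(L2_norm (%x. of_real (disp B b x) * g x))^2 <= (B * C)^2"
  unfolding e using mult_left_mono[OF sq, of "B^2"] by (simp add: power_mult_distrib)
 have dx: "(disp B b x)^2 * x^2 <= (2 * b * B)^2" for x
 proof -
  have "\<bar>disp B b x * x\<bar> <= \<bar>2 * b * B\<bar>"
  proof -
   have "x^2 / (b^2 + x^2) <= 1" using b by (simp add: divide_le_eq add_pos_nonneg)
   from mult_left_mono[OF this, of "2 * b * B"] show ?thesis unfolding disp_def using b by (simp add: abs_mult power2_eq_square mult_ac)
  qed
  thus ?thesis by (simp only: abs_le_square_iff power_mult_distrib)
 qed
 \<comment> \<open>The final constant 20 is 16 + 4: the interval \<open>{-1..1}\<close> has length 2
   and contributes \<open>2 * 4 * 2\<close>, the last term contributes 4.\<close>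
 have pt: "(disp B b x)^2 * (cmod (g x))^2 <= 2 * ((disp B b x)^2 * (cmod (a x))^2) + 2 * C^2 * (2 * b * B)^2 * indicator {-1..1} x + (2 * b * B)^2 * (norm (g x))^2" for x
 proof (cases "x : {-1..1}")
  case True
  have "(cmod (g x))^2 <= (cmod (a x) + C * \<bar>x\<bar>)^2" by (intro power_mono g(3)) simp
  also have "... <= 2 * (cmod (a x))^2 + 2 * (C * \<bar>x\<bar>)^2" using norm_add_sq_le[of "cmod (a x)" "C * \<bar>x\<bar>"] by simp
  also have "... = 2 * (cmod (a x))^2 + 2 * C^2 * x^2" by (simp add: power_mult_distrib)
  finally have "(disp B b x)^2 * (cmod (g x))^2 <= (disp B b x)^2 * (2 * (cmod (a x))^2 + 2 * C^2 * x^2)" by (rule mult_left_mono) simp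
  also have "... = 2 * ((disp B b x)^2 * (cmod (a x))^2) + 2 * C^2 * ((disp B b x)^2 * x^2)" by (simp add: algebra_simps)
  also have "... <= 2 * ((disp B b x)^2 * (cmod (a x))^2) + 2 * C^2 * (2 * b * B)^2" by (intro add_left_mono mult_left_mono dx) simp
  finally show ?thesis using True by (simp add: add_increasing2)
 next
  case False
  hence "1 <= \<bar>x\<bar>" by auto
  hence "1 <= x^2" using abs_le_square_iff[of 1 x] by simp
  from mult_left_mono[OF this, of "(disp B b x)^2"] have "(disp B b x)^2 <= (2 * b * B)^2" using dx[of x] by simp
  from mult_right_mono[OF this, of "(norm (g x))^2"] show ?thesis using False by (simp add: add_increasing)
 qed
 have ind: "L1 (indicator {-1..1} :: real => real)" by (simp add: integrable_indicator_iff emeasure_lborel_Icc_eq)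
 hence ii: "L1 (%x. 2 * C^2 * (2 * b * B)^2 * indicator {-1..1::real} x)" by (rule integrable_mult_right)
 have "(Lint x. (disp B b x)^2 * (cmod (g x))^2) <= (Lint x. 2 * ((disp B b x)^2 * (cmod (a x))^2) + 2 * C^2 * (2 * b * B)^2 * indicator {-1..1} x + (2 * b * B)^2 * (norm (g x))^2)"
  using i[OF a] ind L2_integrable[OF gL(1)] by (intro integral_mono[OF i[OF gL(1)] _ pt] int_add integrable_mult_right)
 also have "... = 2 * (Lint x. (disp B b x)^2 * (cmod (a x))^2) + 2 * C^2 * (2 * b * B)^2 * 2 + (2 * b * B)^2 * (Lint x. (norm (g x))^2)"
  using i[OF a] ii L2_integrable[OF gL(1)] by simp
 also have "... <= 2 * (Lint x. (disp B b x)^2 * (cmod (a x))^2) + 2 * C^2 * (2 * b * B)^2 * 2 + (2 * b * B)^2 * C^2"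
  by (intro add_left_mono mult_left_mono sq) simp
 also have "... = 2 * (Lint x. (disp B b x)^2 * (cmod (a x))^2) + 20 * (b * B * C)^2" by (simp add: power_mult_distrib)
 finally show "(L2_norm (%x. of_real (disp B b x) * g x))^2 <= 2 * (Lint x. (disp B b x)^2 * (cmod (a x))^2) + 20 * (b * B * C)^2" unfolding e .
qed

text \<open>The multiplier tends to 0 at every frequency and is bounded by \<open>B\<close>, so
  dominated convergence applies although its supremum stays \<open>B\<close>.\<close>

lemma disp_tendsto:
 fixes a :: "real => complex"
 assumes a: "L2 a" and B: "0 < B"
 shows "((%b. Lint x. (disp B b x)^2 * (norm (a x))^2) \<longlongrightarrow> 0) (at_right 0)"
proof (rule tendsto_at_right_sequentially[OF zero_less_one])
 fix S :: "nat => real" assume S: "!!n. 0 < S n" "S \<longlonglongrightarrow> 0"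
 note [measurable] = L2_measurable[OF a]
 have "(%n. Lint x. (disp B (S n) x)^2 * (norm (a x))^2) \<longlonglongrightarrow> (LINT x::real|lborel. 0)"
 proof (rule integral_dominated_convergence[where w="%x. B^2 * (norm (a x))^2"])
  show "L1 (%x. B^2 * (norm (a x))^2)" using L2_integrable[OF a] by simp
  show "AE x in lborel. (%n. (disp B (S n) x)^2 * (norm (a x))^2) \<longlonglongrightarrow> 0"
  proof (rule AE_I2)
   fix x :: real
   have "(%n. disp B (S n) x) \<longlonglongrightarrow> 0"
   proof (cases "x = 0")
    case False
    hence "(%n. 2 * S n * B * x / ((S n)^2 + x^2)) \<longlonglongrightarrow> 2 * 0 * B * x / (0^2 + x^2)" by (intro tendsto_intros S(2)) simp
    thus ?thesis by (simp add: disp_def)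
   qed (simp add: disp_def)
   from tendsto_mult[OF tendsto_power[OF this, of 2] tendsto_const] show "(%n. (disp B (S n) x)^2 * (norm (a x))^2) \<longlonglongrightarrow> 0" by simp
  qed
  have "(disp B (S n) x)^2 <= B^2" for n x using disp_bound[OF S(1) B, of n x] by (simp add: abs_le_square_iff[symmetric] B less_imp_le abs_of_pos)
  thus "AE x in lborel. norm ((disp B (S n) x)^2 * (norm (a x))^2) <= B^2 * (norm (a x))^2" for n by (simp add: abs_mult mult_right_mono)
 qed simp_all
 thus "(%n. Lint x. (disp B (S n) x)^2 * (norm (a x))^2) \<longlonglongrightarrow> 0" by simp
qed

theorem theorem1p2:
  fixes s :: real and u0 :: "real \<Rightarrow> real"
  assumes "s \<ge> 3" and "u0 \<in> sobolev s"
  shows "(\<forall>b>0. ((\<lambda>B. max_existence_time s B b u0) \<longlongrightarrow> burgers_breaking_time u0) (at_right 0)) \<and>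
         (\<forall>B>0. ((\<lambda>b. max_existence_time s B b u0) \<longlongrightarrow> burgers_breaking_time u0) (at_right 0))"
proof -
 have s1: "1 <= s" using assms(1) by simp
 obtain a where u0: "rep s u0 a" by (rule sobolev_rep[OF assms(2) s1])
 have aL: "L2 a" using hs_L2(1)[OF repD(1)[OF u0]] s1 by simp
 have pos: "\<forall>\<^sub>F p in at_right (0::real). 0 < p" by (simp add: eventually_at_filter)
 show ?thesis
 proof (intro conjI allI impI)
  fix b :: real assume b: "0 < b"
  show "((%B. max_existence_time s B b u0) \<longlongrightarrow> burgers_breaking_time u0) (at_right 0)"
  proof (rule max_existence_time_tendsto[OF assms(1) u0])
   show "\<forall>\<^sub>F p in at_right (0::real). 0 < p & 0 < b" using pos b by simp
   have "((%p. p * sqrt b) \<longlongrightarrow> 0 * sqrt b) (at_right 0)" by (intro tendsto_intros)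
   thus "((%p. p * sqrt b) \<longlongrightarrow> 0) (at_right 0)" by simp
   fix T C \<eta> :: real and g :: "real => real => complex"
   assume C: "0 <= C" and \<eta>: "0 < \<eta>" and g: "!!t. t : {0..T} ==> hs 2 (g t) & hsn 2 (g t) <= C"
    "!!t x. t : {0..T} ==> cmod (g t x) <= cmod (a x) + C * \<bar>x\<bar>"
   have "((%p. (p * C)^2) \<longlongrightarrow> (0 * C)^2) (at_right 0)" by (intro tendsto_intros)
   hence "\<forall>\<^sub>F p in at_right 0. (p * C)^2 < \<eta>" using \<eta> by (intro order_tendstoD) simp_all
   with pos show "\<forall>\<^sub>F p in at_right 0. ALL t:{0..T}. (L2_norm (%x. of_real (disp p b x) * g t x))^2 <= \<eta>"
   proof eventually_elim
    case (elim p)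
    show ?case
    proof
     fix t assume t: "t : {0..T}"
     show "(L2_norm (%x. of_real (disp p b x) * g t x))^2 <= \<eta>"
      using disp_error_bound(1)[OF b elim(1) C aL _ _ g(2)[OF t]] g(1)[OF t] elim(2) by simp
    qed
   qed
  qed
 next
  fix B :: real assume B: "0 < B"
  show "((%b. max_existence_time s B b u0) \<longlongrightarrow> burgers_breaking_time u0) (at_right 0)"
  proof (rule max_existence_time_tendsto[OF assms(1) u0])
   show "\<forall>\<^sub>F p in at_right (0::real). 0 < B & 0 < p" using pos B by simp
   have "((%p. B * sqrt p) \<longlongrightarrow> B * sqrt 0) (at_right 0)" by (intro tendsto_intros)
   thus "((%p. B * sqrt p) \<longlongrightarrow> 0) (at_right 0)" by simp
   fix T C \<eta> :: real and g :: "real => real => complex"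
   assume C: "0 <= C" and \<eta>: "0 < \<eta>" and g: "!!t. t : {0..T} ==> hs 2 (g t) & hsn 2 (g t) <= C"
    "!!t x. t : {0..T} ==> cmod (g t x) <= cmod (a x) + C * \<bar>x\<bar>"
   \<comment> \<open>With \<open>B\<close> fixed the bound \<open>(B * C)^2\<close> does not tend to
     0, so the second bound of \<open>disp_error_bound\<close> is used here.\<close>
   have "((%p. 2 * (Lint x. (disp B p x)^2 * (cmod (a x))^2) + 20 * (p * B * C)^2) \<longlongrightarrow> 2 * 0 + 20 * (0 * B * C)^2) (at_right 0)"
    by (intro tendsto_intros disp_tendsto aL B)
   hence "\<forall>\<^sub>F p in at_right 0. 2 * (Lint x. (disp B p x)^2 * (cmod (a x))^2) + 20 * (p * B * C)^2 < \<eta>"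
    using \<eta> by (intro order_tendstoD) simp_all
   with pos show "\<forall>\<^sub>F p in at_right 0. ALL t:{0..T}. (L2_norm (%x. of_real (disp B p x) * g t x))^2 <= \<eta>"
   proof eventually_elim
    case (elim p)
    show ?case
    proof
     fix t assume t: "t : {0..T}"
     show "(L2_norm (%x. of_real (disp B p x) * g t x))^2 <= \<eta>"
      using disp_error_bound(2)[OF elim(1) B C aL _ _ g(2)[OF t]] g(1)[OF t] elim(2) by linarith
    qed
   qed
  qed
 qed
qed


end
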